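(* Let $p>5$ be a prime with $p\equiv 1\pmod 4$, let $\chi=\left(\frac{\cdot}{p}\right)$ be the Legendre character modulo $p$, and let $K=\mathbb{Q}(\sqrt{p})$, with class number $h_K$ and fundamental unit $\varepsilon_K>1$. For each $n\in\mathbb{Z}_{\geq 0}$ let $p_+(n)$ (resp. $p_-(n)$) denote the number of partitions $n=\lambda_1+\dots+\lambda_r$ with parts $\lambda_i\in\mathbb{Z}_{>0}$, $\lambda_1\leq\lambda_2\leq\dots\leq\lambda_r$, such that $\chi(\lambda_i)=+1$ (resp. $\chi(\lambda_i)=-1$) for all $i=1,\dots,r$ (with $p_\pm(0)=1$). Then \[ \lim_{\nu\to\infty}\frac{\sum_{n=0}^{\nu}p_+(n)}{\sum_{n=0}^{\nu}p_-(n)}=\varepsilon_K^{h_K}. \]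
   Context: $K=\mathbb{Q}(\sqrt{p})$ is the real quadratic field of (prime) discriminant $p$; $h_K$ is its class number and $\varepsilon_K>1$ its fundamental unit. *)

theory Defs
  imports Complex_Main "HOL-Computational_Algebra.Polynomial" "HOL-Number_Theory.Number_Theory" "HOL-Algebra.Ideal" "HOL-Algebra.Coset"
begin

text \<open>
  For \<open>d \<ge> 0\<close>, the field \<open>\<rat>(\<surd>d)\<close> is taken inside the reals, \<open>\<surd>d\<close> being the
  nonnegative root; this embedding is the one for which the condition \<open>\<epsilon> > 1\<close> on the
  fundamental unit is meant.
\<close>

definition quadratic_field :: "nat \<Rightarrow> real set" where
  "quadratic_field d = {a + b * sqrt (real d) | a b. a \<in> \<rat> \<and> b \<in> \<rat>}"

definition ring_of_integers :: "real set \<Rightarrow> real ring" where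
  "ring_of_integers K =
     \<lparr>carrier = {x \<in> K. algebraic_int x}, monoid.mult = (*), monoid.one = 1, ring.zero = 0, ring.add = (+)\<rparr>"

definition nonzero_ideals :: "('a, 'b) ring_scheme \<Rightarrow> 'a set set" where
  "nonzero_ideals R = {I. ideal I R \<and> I \<noteq> {\<zero>\<^bsub>R\<^esub>}}"

text \<open>
  In an integral domain, \<open>aI = bJ\<close> for some nonzero ring elements \<open>a\<close>, \<open>b\<close> says that \<open>I\<close> and
  \<open>J\<close> differ by a principal fractional ideal.
\<close>

definition ideal_class_rel :: "('a, 'b) ring_scheme \<Rightarrow> ('a set \<times> 'a set) set" where
  "ideal_class_rel R =
     {(I, J). I \<in> nonzero_ideals R \<and> J \<in> nonzero_ideals R \<and>
        (\<exists>a \<in> carrier R - {\<zero>\<^bsub>R\<^esub>}. \<exists>b \<in> carrier R - {\<zero>\<^bsub>R\<^esub>}.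
           a <#\<^bsub>R\<^esub> I = b <#\<^bsub>R\<^esub> J)}"

definition class_number :: "real set \<Rightarrow> nat" where
  "class_number K =
     card (nonzero_ideals (ring_of_integers K) // ideal_class_rel (ring_of_integers K))"

definition fundamental_unit :: "real set \<Rightarrow> real" where
  "fundamental_unit K =
     (THE \<epsilon>. \<epsilon> \<in> Units (ring_of_integers K) \<and> \<epsilon> > 1 \<and>
        (\<forall>u \<in> Units (ring_of_integers K). \<exists>k::int. u = \<epsilon> powi k \<or> u = - (\<epsilon> powi k)))"

text \<open>
  A partition is encoded as the nondecreasing list of its parts; the empty list is the
  unique partition of \<open>0\<close>.
\<close>

definition legendre_partitions :: "nat \<Rightarrow> int \<Rightarrow> nat \<Rightarrow> nat list set" where
  "legendre_partitions p s n =
     {xs. sorted xs \<and> sum_list xs = n \<and> (\<forall>x \<in> set xs. x > 0 \<and> Legendre (int x) (int p) = s)}"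

definition p_plus :: "nat \<Rightarrow> nat \<Rightarrow> nat" where
  "p_plus p n = card (legendre_partitions p 1 n)"

definition p_minus :: "nat \<Rightarrow> nat \<Rightarrow> nat" where
  "p_minus p n = card (legendre_partitions p (-1) n)"

end

theory Submission
  imports Defs "HOL-Real_Asymp.Real_Asymp" "HOL-Probability.Sinc_Integral"
begin

text \<open>
  Let \<open>F(s) = \<Sum>_m \<chi>(m) log_factor(m s)\<close> be the logarithm of the quotient of the generating functions of \<open>p_+\<close>
  and \<open>p_-\<close>. The coefficients of both generating functions (divided by \<open>1 - e^{-s}\<close>, which turns them
  into partial sums) are evaluated by a saddle point argument. To leading order the saddle points and
  the widths depend only on the number of residue classes modulo \<open>p\<close> that are allowed as parts, which
  is \<open>(p - 1) / 2\<close> in both cases; hence the ratio tends to \<open>exp (lim_{s \<rightarrow> 0} F(s))\<close>. The limit is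
  \<open>- \<Sum>_j \<Sum>_a \<chi>(a) ln (j p + a)\<close>. The reflection formula turns it into \<open>- \<Sum>_a \<chi>(a) ln (sin (\<pi> a / p)) / 2\<close>,
  and the Fourier expansion of the logarithm of the sine, together with the Gauss sum, into \<open>\<surd>p L(1, \<chi>) / 2\<close>.

  The class number formula \<open>2 h ln \<epsilon> = \<surd>p L(1, \<chi>)\<close> comes from counting the nonzero ideals of norm
  at most \<open>N\<close> twice: all of them through the roots of \<open>b\<^sup>2 + b - (p - 1) / 4\<close> modulo \<open>a\<close>, and the members
  of one ideal class as lattice points in a region \<open>|X Y| \<le> t\<close>, \<open>|Y| \<le> X < \<epsilon>\<^sup>2 |Y|\<close>. The second count,
  applied with any bound in place of \<open>\<epsilon>\<^sup>2\<close>, also shows that units \<open>> 1\<close> exist and that the class number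
  is finite.
\<close>

section \<open>Gauss sums\<close>

text \<open>The sign of the Gauss sum is decisive. Its square leaves \<open>sqrt p\<close> and
  \<open>- sqrt p\<close>, and the second value would turn the limit into its inverse. The two
  candidates are far apart, so a crude lower bound for the real part settles the matter. The
  obstacle on the analytic side is that the saddle points of the two generating functions agree only
  to leading order. One common point \<open>x = sqrt (\<kappa>1 / n)\<close> is used for both. It
  misses each saddle equation by a bounded amount, while the relevant angles \<open>y\<close> have
  \<open>y / x\<close> of order \<open>sqrt x\<close>, so the linear term of the exponent still
  disappears in the limit. The values of the generating functions at \<open>x\<close> are never
  expanded; only their quotient is evaluated, so no error term has to be controlled inside an
  exponential. The limit of the normalised integrals comes from dominated convergence. On the
  algebraic side the condition \<open>p \<equiv> 1\<close> modulo 4 acts throughout: the character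
  is even, reciprocity has no sign, and the ring of integers is generated by
  \<open>(1 + sqrt p) / 2\<close>.\<close>

lemma abel_telescoping_bound:
  fixes c B :: "nat \<Rightarrow> real"
  assumes "u \<le> v" and dec: "\<And>m. u \<le> m \<Longrightarrow> m < v \<Longrightarrow> c (Suc m) \<le> c m"
    and B: "\<And>m. \<bar>B m\<bar> \<le> 1" and nn: "\<And>m. u \<le> m \<Longrightarrow> m \<le> v \<Longrightarrow> 0 \<le> c m"
  shows "\<bar>\<Sum>m=u..v. c m * (B (Suc m) - B m)\<bar> \<le> 2 * c u"
proof -
  \<comment> \<open>The induction keeps the boundary term of partial summation: once
    \<open>c w * B (Suc w)\<close> is split off, each step adds at most
    \<open>c w - c (Suc w)\<close>, and the bounds telescope.\<close>
  have "w \<le> v \<Longrightarrow> \<bar>(\<Sum>m=u..w. c m * (B (Suc m) - B m)) - c w * B (Suc w)\<bar> \<le> 2 * c u - c w" if "u \<le> w" for w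
    using that
  proof (induction w rule: nat_induct_at_least)
    case base
    have "\<bar>c u * B u\<bar> \<le> c u" using B[of u] nn[of u] base by (simp add: abs_mult mult_left_le)
    thus ?case by (simp add: algebra_simps)
  next
    case (Suc w)
    define S where "S = (\<Sum>m=u..w. c m * (B (Suc m) - B m))"
    have IH: "\<bar>S - c w * B (Suc w)\<bar> \<le> 2 * c u - c w" using Suc unfolding S_def by simp
    have "\<bar>(c w - c (Suc w)) * B (Suc w)\<bar> \<le> c w - c (Suc w)"
      using B[of "Suc w"] dec[of w] Suc by (simp add: abs_mult mult_left_le)
    moreover have "(\<Sum>m=u..Suc w. c m * (B (Suc m) - B m)) - c (Suc w) * B (Suc (Suc w)) =
      (S - c w * B (Suc w)) + (c w - c (Suc w)) * B (Suc w)"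
      using Suc unfolding S_def by (simp add: algebra_simps)
    ultimately show ?case using IH by linarith
  qed
  from this[of v] have S: "\<bar>(\<Sum>m=u..v. c m * (B (Suc m) - B m)) - c v * B (Suc v)\<bar> \<le> 2 * c u - c v"
    using assms(1) by simp
  have "\<bar>c v * B (Suc v)\<bar> \<le> c v" using B[of "Suc v"] nn[of v] assms(1) by (simp add: abs_mult mult_left_le)
  thus ?thesis using S by linarith
qed

section \<open>Lower bounds for sums of cosines and sines at squares\<close>

lemma sin_ge_chord:
  assumes "0 \<le> x" "x \<le> pi / 2" shows "2 * x / pi \<le> sin x"
proof -
  have cv: "concave_on {0..pi/2} sin"
  proof (rule f''_le0_imp_concave)
    show "(sin has_real_derivative cos x) (at x)" for x :: real by (rule DERIV_sin)
    show "(cos has_real_derivative - sin x) (at x)" for x :: real by (rule DERIV_cos)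
    show "- sin x \<le> 0" if "x \<in> {0..pi/2}" for x :: real
      using that sin_ge_zero[of x] by auto
  qed auto
  have "sin ((1 - 2*x/pi) *\<^sub>R 0 + (2*x/pi) *\<^sub>R (pi/2)) \<ge> (1 - 2*x/pi) * sin 0 + (2*x/pi) * sin (pi/2)"
    using assms by (intro concave_onD[OF cv]) (auto simp: field_simps)
  thus ?thesis by simp
qed

lemma cos_ge_chord:
  assumes "0 \<le> x" "x \<le> pi / 2" shows "1 - 2 * x / pi \<le> cos x"
proof -
  have "2 * (pi/2 - x) / pi \<le> sin (pi/2 - x)" using assms by (intro sin_ge_chord) auto
  thus ?thesis unfolding cos_sin_eq by (simp add: diff_divide_distrib right_diff_distrib)
qed

lemma sum_squares_real: "(\<Sum>m=1..n. real m ^ 2) = real n * (real n + 1) * (2 * real n + 1) / 6"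
  by (induction n) (auto simp: field_simps power2_eq_square)

lemma sum_odd_squares_real: "(\<Sum>j<k. (2 * real j + 1) ^ 2) = real k * (4 * real k ^ 2 - 1) / 3"
  by (induction k) (auto simp: field_simps power2_eq_square)

text \<open>Below \<open>u\<close>, about \<open>s / 2\<close>, the angles stay within a quarter
  turn and the chord of the cosine bounds each term. From \<open>u\<close> on, multiplication by
  \<open>2 * sin (2 * pi * m / P)\<close> turns the cosines into differences of \<open>B m\<close>,
  so partial summation bounds the whole tail by \<open>1 / sin (2 * pi * u / P)\<close>, which is at
  most \<open>s / 2\<close>. The condition \<open>4 * n < P\<close> makes that sine increasing in
  \<open>m\<close>.\<close>

lemma cos_square_sum_lower:
  fixes P :: nat and n :: nat
  assumes n: "4 * n < P" and P: "P \<ge> 13"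
  defines "s \<equiv> sqrt (real P)"
  assumes large: "s / 2 \<le> real n"
  shows "1 + 2 * (\<Sum>m=1..n. cos (2 * pi * real m ^ 2 / P)) \<ge> - s / 3 - 1 / s - 1 / (3 * s^2)"
proof -
  have s: "s > 0" "s^2 = P" "s \<ge> 3" unfolding s_def using P by (auto simp: real_le_rsqrt)
  define u where "u = nat \<lceil>s / 2\<rceil>"
  have u1: "u \<ge> 1" and u2: "s/2 \<le> u" "u < s/2 + 1" unfolding u_def using s by linarith+
  have un: "u \<le> n" using large unfolding u_def by (simp add: ceiling_le_iff)
  have split: "{1..n} = {1..u-1} \<union> {u..n}" using u1 un by auto
  have "(\<Sum>m=1..n. cos (2 * pi * real m ^ 2 / P)) =
      (\<Sum>m=1..u-1. cos (2 * pi * real m ^ 2 / P)) + (\<Sum>m=u..n. cos (2 * pi * real m ^ 2 / P))"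
    unfolding split by (intro sum.union_disjoint) auto
  moreover have "\<bar>\<Sum>m=u..n. cos (2 * pi * real m ^ 2 / P)\<bar> \<le> s / 2"
  proof -
    define c where "c = (\<lambda>m::nat. 1 / (2 * sin (2 * pi * m / P)))"
    define B where "B = (\<lambda>m::nat. sin (2 * pi * real m * (real m - 1) / P))"
    have ang: "0 < 2 * pi * m / P" "2 * pi * m / P \<le> pi / 2" if "u \<le> m" "m \<le> n" for m :: nat
    proof -
      have "4 * real m \<le> P" "real m > 0" using that n u1 by linarith+
      thus "0 < 2 * pi * m / P" "2 * pi * m / P \<le> pi / 2" using s(1,2) P by (auto simp: field_simps)
    qed
    have pos: "sin (2 * pi * m / P) > 0" if "u \<le> m" "m \<le> n" for m :: nat
      using ang[OF that] pi_gt_zero by (intro sin_gt_zero) linarith+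
    have eq: "cos (2 * pi * real m ^ 2 / P) = c m * (B (Suc m) - B m)" if "u \<le> m" "m \<le> n" for m
    proof -
      define a b where "a = 2 * pi * real m ^ 2 / P" and "b = 2 * pi * m / P"
      have 1: "2 * pi * real (Suc m) * (real (Suc m) - 1) / P = a + b"
        unfolding a_def b_def add_divide_distrib[symmetric] by (simp add: algebra_simps power2_eq_square)
      have 2: "2 * pi * real m * (real m - 1) / P = a - b"
        unfolding a_def b_def diff_divide_distrib[symmetric] by (simp add: algebra_simps power2_eq_square)
      have "B (Suc m) - B m = sin (a + b) - sin (a - b)" unfolding B_def 1 2 ..
      also have "\<dots> = 2 * sin b * cos a" by (simp add: sin_add sin_diff)
      finally show ?thesis using pos[OF that] unfolding c_def a_def b_def by simp
    qed
    have "\<bar>\<Sum>m=u..n. cos (2 * pi * real m ^ 2 / P)\<bar> = \<bar>\<Sum>m=u..n. c m * (B (Suc m) - B m)\<bar>"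
      using eq by (intro arg_cong[where f = abs] sum.cong) auto
    also have "\<dots> \<le> 2 * c u"
    proof (rule abel_telescoping_bound[OF un])
      show "\<bar>B m\<bar> \<le> 1" for m unfolding B_def by simp
      show "c m \<ge> 0" if "u \<le> m" "m \<le> n" for m using pos[OF that] unfolding c_def by simp
      show "c (Suc m) \<le> c m" if "u \<le> m" "m < n" for m
      proof -
        have "sin (2 * pi * m / P) \<le> sin (2 * pi * Suc m / P)"
          using ang[of m] ang[of "Suc m"] that pi_gt_zero
          by (intro sin_monotone_2pi_le) (linarith, simp add: divide_right_mono, simp)
        thus ?thesis using pos[of m] that unfolding c_def by (intro divide_left_mono) auto
      qed
    qed
    also have "\<dots> = 1 / sin (2 * pi * u / P)" by (simp add: c_def)
    also have "\<dots> \<le> 1 / (2 * (2 * pi * u / P) / pi)"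
      using ang[of u] un u1 P by (intro divide_left_mono sin_ge_chord mult_pos_pos pos) (auto intro: less_imp_le)
    also have "\<dots> = s^2 / (4 * u)" using s by (simp add: field_simps)
    also have "\<dots> \<le> s^2 / (4 * (s / 2))" using u2 s by (intro divide_left_mono) auto
    also have "\<dots> = s / 2" using s(1) by (simp add: power2_eq_square)
    finally show ?thesis .
  qed
  moreover have "2 * (\<Sum>m=1..u-1. cos (2 * pi * real m ^ 2 / P)) \<ge> 2 * s / 3 - 1 - 1 / s - 1 / (3 * s^2)"
  proof -
    have "(\<Sum>m=1..u-1. cos (2 * pi * real m ^ 2 / P)) \<ge> (\<Sum>m=1..u-1. 1 - 4 / s^2 * real m ^ 2)"
    proof (intro sum_mono)
      fix m assume m: "m \<in> {1..u-1}"
      have "real m \<le> real u - 1" using m u1 by auto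
      hence "real m \<le> s / 2" using u2 by linarith
      hence "real m ^ 2 \<le> (s/2)^2" by (intro power_mono) auto
      hence "4 * real m ^ 2 \<le> P" using s by (simp add: power_divide)
      hence "2 * pi * real m ^ 2 / P \<le> pi / 2" using P by (simp add: field_simps)
      hence "1 - 2 * (2 * pi * real m ^ 2 / P) / pi \<le> cos (2 * pi * real m ^ 2 / P)"
        by (intro cos_ge_chord) auto
      thus "1 - 4 / s^2 * real m ^ 2 \<le> cos (2 * pi * real m ^ 2 / P)" using s(2) by simp
    qed
    also have "(\<Sum>m=1..u-1. 1 - 4 / s^2 * real m ^ 2) = real (u - 1) - 4 / s^2 * (\<Sum>m=1..u-1. real m ^ 2)"
      by (simp add: sum_subtractf sum_distrib_left)
    also have "\<dots> = (real u - 1) - 4 / s^2 * ((real u - 1) * real u * (2 * real u - 1) / 6)"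
      unfolding sum_squares_real using u1 by (simp add: of_nat_diff)
    finally have "2 * ((real u - 1) - 4 / s^2 * ((real u - 1) * real u * (2 * real u - 1) / 6))
        \<le> 2 * (\<Sum>m=1..u-1. cos (2 * pi * real m ^ 2 / P))" by simp
    also have "2 * ((real u - 1) - 4 / s^2 * ((real u - 1) * real u * (2 * real u - 1) / 6)) =
        2 * (real u - 1) - 4 / s^2 * ((real u - 1) * real u * (2 * real u - 1) / 3)"
    proof -
      have "2 * (a - b * (k / 6)) = 2 * a - b * (k / 3)" for a b k :: real by (simp add: field_simps)
      thus ?thesis .
    qed
    finally have "2 * (real u - 1) - 4 / s^2 * ((real u - 1) * real u * (2 * real u - 1) / 3)
        \<le> 2 * (\<Sum>m=1..u-1. cos (2 * pi * real m ^ 2 / P))" .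
    moreover define w where "w = 2 * real u - 1"
    have "2 * (real u - 1) - 4 / s^2 * ((real u - 1) * real u * (2 * real u - 1) / 3) = w - 1 - (w^2 - 1) * w / (3 * s^2)"
      unfolding w_def using s by (simp add: field_simps power2_eq_square)
    moreover have "w - 1 - (w^2 - 1) * w / (3 * s^2) \<ge> 2 * s / 3 - 1 - 1 / s - 1 / (3 * s^2)"
    proof -
      \<comment> \<open>With \<open>w = s + d\<close> and \<open>\<bar>d\<bar> \<le> 1\<close>, the
        difference of the two sides times \<open>3 * s^2\<close> is a sum of three nonnegative
        terms.\<close>
      define d where "d = w - s"
      have d: "\<bar>d\<bar> \<le> 1" using u2 unfolding d_def w_def by linarith
      hence d2: "d^2 \<le> 1" by (simp add: abs_square_le_1)
      have "3 * s^2 * ((w - 1 - (w^2 - 1) * w / (3 * s^2)) - (2 * s / 3 - 1 - 1 / s - 1 / (3 * s^2)))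
          = 3 * s * (1 - d^2) + (1 - d^3) + w"
        unfolding d_def using s(1) by (simp add: field_simps power2_eq_square power3_eq_cube)
      also have "\<dots> \<ge> 0"
      proof -
        have "d^3 \<le> 1" using d by (metis abs_le_D1 abs_le_square_iff abs_of_nonneg d power_le_one_iff power_abs abs_ge_self order_trans power_one abs_ge_zero)
        thus ?thesis using d2 s u1 unfolding w_def by (simp add: mult_nonneg_nonneg)
      qed
      finally have "0 \<le> (w - 1 - (w^2 - 1) * w / (3 * s^2)) - (2 * s / 3 - 1 - 1 / s - 1 / (3 * s^2))"
        using s(1) by (subst (asm) zero_le_mult_iff) (auto simp del: diff_ge_0_iff_ge)
      thus ?thesis by simp
    qed
    ultimately show ?thesis by linarith
  qed
  ultimately show ?thesis by linarith
qed

text \<open>Three ranges of odd numbers \<open>2 * j + 1\<close>. Up to \<open>s\<close> the angle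
  is at most \<open>pi / 2\<close> and the chord of the sine applies; up to
  \<open>sqrt 2 * s\<close> it is at most \<open>pi\<close> and the terms are nonnegative; beyond
  that, partial summation works as for the cosines. The case distinction is whether the third range
  is reached.\<close>

lemma sin_odd_square_sum_lower:
  fixes P :: nat and n :: nat
  assumes n: "4 * n < P" and P: "P \<ge> 13"
  defines "s \<equiv> sqrt (real P)"
  shows "(sqrt 2 * s \<ge> 2 * real n - 1 \<longrightarrow> 2 * (\<Sum>j<n. sin (pi * (2 * real j + 1) ^ 2 / (2 * P))) \<ge> 0) \<and>
         (sqrt 2 * s \<le> 2 * real n - 1 \<longrightarrow> 2 * (\<Sum>j<n. sin (pi * (2 * real j + 1) ^ 2 / (2 * P))) \<ge> s / 3 - 1 + 2 / (3 * s) - s / sqrt 2)"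
proof -
  have s: "s > 0" "s^2 = P" "s \<ge> 3" unfolding s_def using P by (auto simp: real_le_rsqrt)
  have nonneg: "sin (pi * (2 * real j + 1) ^ 2 / (2 * P)) \<ge> 0" if "2 * real j + 1 \<le> sqrt 2 * s" for j
  proof -
    have "(2 * real j + 1)^2 \<le> (sqrt 2 * s)^2" using that by (intro power_mono) auto
    hence "(2 * real j + 1)^2 \<le> 2 * real P" using s by (simp add: power_mult_distrib)
    hence "pi * (2 * real j + 1) ^ 2 / (2 * P) \<le> pi" using P by (simp add: field_simps)
    thus ?thesis by (intro sin_ge_zero) auto
  qed
  show ?thesis
  proof (intro conjI impI)
    assume "sqrt 2 * s \<ge> 2 * real n - 1"
    thus "2 * (\<Sum>j<n. sin (pi * (2 * real j + 1) ^ 2 / (2 * P))) \<ge> 0"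
      by (intro mult_nonneg_nonneg sum_nonneg nonneg) auto
  next
    assume big: "sqrt 2 * s \<le> 2 * real n - 1"
    \<comment> \<open>\<open>u\<close> is the first index with
      \<open>2 * u + 1 \<ge> sqrt 2 * s\<close>; the \<open>k\<close> chosen below is the number of
      odd positive integers up to \<open>s\<close>.\<close>
    define u where "u = nat \<lceil>(sqrt 2 * s - 1) / 2\<rceil>"
    have "sqrt 2 * s \<ge> 1 * 3" using s by (intro mult_mono) auto
    hence "sqrt 2 * s \<ge> 3" by linarith
    moreover have "1 \<le> nat \<lceil>(y - 1) / 2\<rceil>" "y \<le> 2 * real (nat \<lceil>(y - 1) / 2\<rceil>) + 1"
      "2 * real (nat \<lceil>(y - 1) / 2\<rceil>) + 1 < y + 2" if "y \<ge> 3" for y :: real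
    proof -
      have "\<lceil>(y - 1) / 2\<rceil> \<ge> 1" using that by (simp add: le_ceiling_iff)
      hence eq: "real (nat \<lceil>(y - 1) / 2\<rceil>) = real_of_int \<lceil>(y - 1) / 2\<rceil>" by simp
      show "1 \<le> nat \<lceil>(y - 1) / 2\<rceil>" using \<open>\<lceil>(y - 1) / 2\<rceil> \<ge> 1\<close> by linarith
      show "y \<le> 2 * real (nat \<lceil>(y - 1) / 2\<rceil>) + 1"
        "2 * real (nat \<lceil>(y - 1) / 2\<rceil>) + 1 < y + 2"
      proof -
        define c where "c = real_of_int \<lceil>(y - 1) / 2\<rceil>"
        have "c - 1 < (y - 1) / 2" "(y - 1) / 2 \<le> c"
          using ceiling_correct[of "(y - 1) / 2"] unfolding c_def by blast+
        thus "y \<le> 2 * real (nat \<lceil>(y - 1) / 2\<rceil>) + 1" "2 * real (nat \<lceil>(y - 1) / 2\<rceil>) + 1 < y + 2"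
          unfolding eq c_def[symmetric] by (simp_all add: field_simps)
      qed
    qed
    ultimately have u1: "u \<ge> 1" and u2: "sqrt 2 * s \<le> 2 * real u + 1" "2 * real u + 1 < sqrt 2 * s + 2"
      unfolding u_def by blast+
    have un: "u \<le> n - 1"
    proof -
      have "real u < real n" using big u2 by linarith
      thus ?thesis by simp
    qed
    have n1: "n \<ge> 1" using un u1 by linarith
    define k where "k = nat \<lfloor>(s + 1) / 2\<rfloor>"
    have k: "2 * real k - 1 \<le> s" "s < 2 * real k + 1" 
    proof -
      have "\<lfloor>(s + 1) / 2\<rfloor> \<ge> 0" using s by simp
      hence eq: "real k = real_of_int \<lfloor>(s + 1) / 2\<rfloor>" unfolding k_def by simp
      define c where "c = real_of_int \<lfloor>(s + 1) / 2\<rfloor>"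
      have "c \<le> (s + 1) / 2" "(s + 1) / 2 < c + 1"
        using floor_correct[of "(s + 1) / 2"] unfolding c_def by simp_all
      thus "2 * real k - 1 \<le> s" "s < 2 * real k + 1"
        unfolding eq c_def[symmetric] by (simp_all add: field_simps)
    qed
    have "s < sqrt 2 * s" using s by simp
    hence "real k < real (u + 1)" using k u2 by simp
    hence "k < u + 1" by (simp only: of_nat_less_iff)
    hence ku: "k \<le> u" by simp
    have split: "{..<n} = {..<k} \<union> ({k..<u} \<union> {u..n-1})" using ku un n1 by auto
    let ?f = "\<lambda>j::nat. sin (pi * (2 * real j + 1) ^ 2 / (2 * P))"
    have "(\<Sum>j<n. ?f j) = (\<Sum>j<k. ?f j) + ((\<Sum>j=k..<u. ?f j) + (\<Sum>j=u..n-1. ?f j))"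
      unfolding split using ku by (subst sum.union_disjoint; (subst sum.union_disjoint)?) auto
    moreover have "(\<Sum>j=k..<u. ?f j) \<ge> 0"
    proof (intro sum_nonneg nonneg)
      fix j assume "j \<in> {k..<u}"
      hence "real j \<le> real u - 1" by auto
      thus "2 * real j + 1 \<le> sqrt 2 * s" using u2 by linarith
    qed
    moreover have "\<bar>\<Sum>j=u..n-1. ?f j\<bar> \<le> s / (2 * sqrt 2)"
    proof -
      define c where "c = (\<lambda>j::nat. 1 / (2 * sin (pi * (2 * real j + 1) / P)))"
      define B where "B = (\<lambda>j::nat. - cos (pi * (2 * real j + 1) * (2 * real j - 1) / (2 * P)))"
      have ang: "0 < pi * (2 * real j + 1) / P" "pi * (2 * real j + 1) / P \<le> pi / 2" if "u \<le> j" "j \<le> n - 1" for j :: nat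
      proof -
        have "j < n" using that n1 by simp
        hence "2 * (2 * j + 1) \<le> P" using n by simp
        hence "real (2 * (2 * j + 1)) \<le> real P" by (simp only: of_nat_le_iff)
        hence "2 * (2 * real j + 1) \<le> P" by simp
        hence "pi * (2 * (2 * real j + 1)) \<le> pi * P" by (intro mult_left_mono) auto
        thus "pi * (2 * real j + 1) / P \<le> pi / 2" using P by (simp add: field_simps)
        show "0 < pi * (2 * real j + 1) / P" using P by (intro divide_pos_pos mult_pos_pos) auto
      qed
      have pos: "sin (pi * (2 * real j + 1) / P) > 0" if "u \<le> j" "j \<le> n - 1" for j :: nat
        using ang[OF that] pi_gt_zero by (intro sin_gt_zero) linarith+
      have eq: "?f j = c j * (B (Suc j) - B j)" if "u \<le> j" "j \<le> n - 1" for j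
      proof -
        define a b where "a = pi * (2 * real j + 1) ^ 2 / (2 * P)" and "b = pi * (2 * real j + 1) / P"
        have 1: "pi * (2 * real (Suc j) + 1) * (2 * real (Suc j) - 1) / (2 * P) = a + b"
          unfolding a_def b_def using P by (simp add: field_simps power2_eq_square)
        have 2: "pi * (2 * real j + 1) * (2 * real j - 1) / (2 * P) = a - b"
          unfolding a_def b_def using P by (simp add: field_simps power2_eq_square)
        have "B (Suc j) - B j = cos (a - b) - cos (a + b)" unfolding B_def 1 2 by simp
        also have "\<dots> = 2 * sin b * sin a" by (simp add: cos_add cos_diff)
        finally show ?thesis using pos[OF that] unfolding c_def a_def b_def by simp
      qed
      have "\<bar>\<Sum>j=u..n-1. ?f j\<bar> = \<bar>\<Sum>j=u..n-1. c j * (B (Suc j) - B j)\<bar>"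
        using eq by (intro arg_cong[where f = abs] sum.cong) auto
      also have "\<dots> \<le> 2 * c u"
      proof (rule abel_telescoping_bound[OF un])
        show "\<bar>B j\<bar> \<le> 1" for j unfolding B_def by simp
        show "c j \<ge> 0" if "u \<le> j" "j \<le> n - 1" for j using pos[OF that] unfolding c_def by simp
        show "c (Suc j) \<le> c j" if "u \<le> j" "j < n - 1" for j
        proof -
          have "sin (pi * (2 * real j + 1) / P) \<le> sin (pi * (2 * real (Suc j) + 1) / P)"
            using ang[of j] ang[of "Suc j"] that pi_gt_zero
            by (intro sin_monotone_2pi_le) (linarith, simp add: divide_right_mono, simp)
          thus ?thesis using pos[of j] that unfolding c_def by (intro divide_left_mono) auto
        qed
      qed
      also have "\<dots> = 1 / sin (pi * (2 * real u + 1) / P)" by (simp add: c_def)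
      also have "\<dots> \<le> 1 / (2 * (pi * (2 * real u + 1) / P) / pi)"
        using ang[of u] un u1 P by (intro divide_left_mono sin_ge_chord mult_pos_pos pos) (auto intro: less_imp_le)
      also have "2 * (pi * (2 * real u + 1) / P) / pi = 2 * (2 * real u + 1) / P" by simp
      also have "1 / (2 * (2 * real u + 1) / P) = s^2 / (2 * (2 * real u + 1))" using s(2) by simp
      also have "\<dots> \<le> s^2 / (2 * (sqrt 2 * s))" using u2 s by (intro divide_left_mono) auto
      also have "\<dots> = s / (2 * sqrt 2)" using s(1) by (simp add: power2_eq_square)
      finally show ?thesis .
    qed
    moreover have "2 * (\<Sum>j<k. ?f j) \<ge> s / 3 - 1 + 2 / (3 * s)"
    proof -
      have "(\<Sum>j<k. ?f j) \<ge> (\<Sum>j<k. (2 * real j + 1) ^ 2 / s^2)"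
      proof (intro sum_mono)
        fix j assume "j \<in> {..<k}"
        hence "real j \<le> real k - 1" by auto
        hence "2 * real j + 1 \<le> s" using k by linarith
        hence "(2 * real j + 1)^2 \<le> s^2" by (intro power_mono) auto
        hence "pi * (2 * real j + 1) ^ 2 / (2 * P) \<le> pi / 2" using P s by (simp add: field_simps)
        hence "2 * (pi * (2 * real j + 1) ^ 2 / (2 * P)) / pi \<le> ?f j" by (intro sin_ge_chord) auto
        thus "(2 * real j + 1) ^ 2 / s^2 \<le> ?f j" using s by simp
      qed
      also have "(\<Sum>j<k. (2 * real j + 1) ^ 2 / s^2) = real k * (4 * real k ^ 2 - 1) / 3 / s^2"
        by (simp add: sum_divide_distrib[symmetric] sum_odd_squares_real)
      finally have "2 * (\<Sum>j<k. ?f j) \<ge> 2 * real k * (4 * real k ^ 2 - 1) / (3 * s^2)" by simp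
      moreover have "2 * real k * (4 * real k ^ 2 - 1) \<ge> (s - 1) * ((s - 1)^2 - 1)"
      proof (rule mult_mono)
        have "(s - 1)^2 \<le> (2 * real k)^2" using k s by (intro power_mono) auto
        thus "(s - 1)^2 - 1 \<le> 4 * real k ^ 2 - 1" by (simp add: power_mult_distrib)
        have "1^2 \<le> (s - 1)^2" using s by (intro power_mono) auto
        thus "0 \<le> (s - 1)^2 - 1" by simp
      qed (use k s in auto)
      hence "2 * real k * (4 * real k ^ 2 - 1) / (3 * s^2) \<ge> (s - 1) * ((s - 1)^2 - 1) / (3 * s^2)"
        by (intro divide_right_mono) auto
      moreover have "(s - 1) * ((s - 1)^2 - 1) / (3 * s^2) = s / 3 - 1 + 2 / (3 * s)"
        using s(1) by (simp add: field_simps power2_eq_square)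
      ultimately show ?thesis by linarith
    qed
    ultimately show "2 * (\<Sum>j<n. ?f j) \<ge> s / 3 - 1 + 2 / (3 * s) - s / sqrt 2" by simp
  qed
qed

lemma card_square_roots_mod_prime:
  fixes P :: nat
  assumes P: "Factorial_Ring.prime P" "P > 2"
  shows "int (card {y\<in>{0..<int P}. [y^2 = a] (mod int P)}) = 1 + Legendre a (int P)"
proof -
  have PP: "Factorial_Ring.prime (int P)" using P(1) by simp
  have oddP: "odd P" using P prime_odd_nat by blast
  show ?thesis
proof (cases "int P dvd a")
  case True
  have "{y\<in>{0..<int P}. [y^2 = a] (mod int P)} = {0}"
  proof -
    have "y = 0" if "y \<in> {0..<int P}" "[y^2 = a] (mod int P)" for y
    proof -
      have "int P dvd y^2" using that(2) True by (simp add: cong_dvd_iff)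
      hence "int P dvd y" using PP prime_dvd_power by blast
      thus ?thesis using that(1) by (auto dest: zdvd_imp_le)
    qed
    moreover have "[0^2 = a] (mod int P)" using True by (simp add: unique_euclidean_semiring_class.cong_def)
    ultimately show ?thesis using P(2) by auto
  qed
  thus ?thesis using True by (simp add: Legendre_def cong_0_iff)
next
  case False
  show ?thesis
  proof (cases "QuadRes (int P) a")
    case QR: True
    then obtain z where z: "[z^2 = a] (mod int P)" unfolding QuadRes_def by auto
    define y where "y = z mod int P"
    have y: "[y^2 = a] (mod int P)" unfolding y_def using z by (simp add: unique_euclidean_semiring_class.cong_def power_mod)
    have ndvd: "\<not> int P dvd y" 
    proof
      assume "int P dvd y"
      hence "int P dvd y^2" by (simp add: power2_eq_square)
      thus False using y False cong_dvd_iff by blast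
    qed
    have yr: "0 < y" "y < int P" using ndvd P(2) pos_mod_bound[of "int P" z] pos_mod_sign[of "int P" z] unfolding y_def
      by (auto simp: order_less_le dvd_eq_mod_eq_0)
    have "{y\<in>{0..<int P}. [y^2 = a] (mod int P)} = {y, int P - y}"
    proof -
      have "w = y \<or> w = int P - y" if "w \<in> {0..<int P}" "[w^2 = a] (mod int P)" for w
      proof -
        have "[w^2 = y^2] (mod int P)" using that(2) y cong_sym cong_trans by blast
        hence "int P dvd (w - y) * (w + y)" 
          by (simp add: cong_iff_dvd_diff power2_eq_square algebra_simps)
        hence "int P dvd w - y \<or> int P dvd w + y" using PP prime_dvd_mult_iff by blast
        thus ?thesis
        proof
          assume "int P dvd w - y"
          moreover have "\<bar>w - y\<bar> < int P" using that yr by auto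
          ultimately show ?thesis using dvd_imp_le_int[of "w - y" "int P"] by force
        next
          assume "int P dvd w + y"
          then obtain k where k: "w + y = int P * k" by auto
          have "0 < int P * k" "int P * k < int P * 2" using k that yr unfolding k[symmetric] by simp_all
          have "0 < k" using \<open>0 < int P * k\<close> by (simp add: zero_less_mult_iff)
        moreover have "k < 2"
          using \<open>int P * k < int P * 2\<close> P(2) mult_less_cancel_left_pos[of "int P" k 2] by linarith
        ultimately have "k = 1" by simp
          thus ?thesis using k by auto
        qed
      qed
      moreover have "[(int P - y)^2 = a] (mod int P)"
      proof -
        have "[(int P - y)^2 = y^2] (mod int P)"
          by (simp add: cong_iff_dvd_diff power2_eq_square algebra_simps)
        thus ?thesis using y cong_trans by blast
      qed
      ultimately show ?thesis using y yr by auto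
    qed
    moreover have "y \<noteq> int P - y" using oddP by presburger
    moreover have "Legendre a (int P) = 1" using QR False unfolding Legendre_def by (simp add: cong_0_iff)
    ultimately show ?thesis by simp
  next
    case nQR: False
    hence "{y\<in>{0..<int P}. [y^2 = a] (mod int P)} = {}" unfolding QuadRes_def by auto
    moreover have "Legendre a (int P) = -1" using nQR False unfolding Legendre_def by (simp add: cong_0_iff)
    ultimately show ?thesis by (simp only:) simp
  qed
qed
qed

section \<open>The quadratic character modulo \<open>p\<close> and its Gauss sum\<close>

locale real_quadratic =
  fixes p :: nat
  assumes p_prime: "Factorial_Ring.prime p" and p_gt5: "p > 5" and p_mod4: "[p = 1] (mod 4)"
begin

definition chi :: "int \<Rightarrow> int" where "chi n = Legendre n (int p)"

text \<open>Two roles: \<open>- q\<close> is the inverse of 4 modulo \<open>p\<close>, and it is the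
  norm of \<open>(1 + sqrt p) / 2\<close>.\<close>

definition q :: nat where "q = (p - 1) div 4"

lemma p_eq: "p = 4 * q + 1"
proof -
  have "p mod 4 = 1 mod 4" using p_mod4 unfolding unique_euclidean_semiring_class.cong_def .
  thus ?thesis unfolding q_def by presburger
qed

lemma q_ge3: "q \<ge> 3" 
proof -
  have "q \<noteq> 2"
  proof
    assume "q = 2"
    hence "p = 9" using p_eq by linarith
    thus False using p_prime prime_product[of 3 3] by simp
  qed
  moreover have "q > 1" using p_gt5 p_eq by linarith
  ultimately show ?thesis by linarith
qed

lemma p_ge13: "p \<ge> 13" using q_ge3 p_eq by linarith

lemma p_int_prime: "Factorial_Ring.prime (int p)"
  using p_prime by simp

lemma chi_cong: "[a = b] (mod int p) \<Longrightarrow> chi a = chi b"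
proof -
  assume ab: "[a = b] (mod int p)"
  have 1: "[a = 0] (mod int p) \<longleftrightarrow> [b = 0] (mod int p)"
    using ab cong_sym cong_trans by blast
  have "[y^2 = a] (mod int p) \<longleftrightarrow> [y^2 = b] (mod int p)" for y
    using ab cong_sym cong_trans by blast
  hence 2: "QuadRes (int p) a \<longleftrightarrow> QuadRes (int p) b" by (simp add: QuadRes_def)
  show ?thesis unfolding chi_def Legendre_def using 1 2 by simp
qed

lemma chi_mod [simp]: "chi (a mod int p) = chi a"
  by (rule chi_cong) simp

lemma chi_values: "chi a = 0 \<or> chi a = 1 \<or> chi a = -1"
  unfolding chi_def Legendre_def by auto

lemma chi_eq_0_iff: "chi a = 0 \<longleftrightarrow> int p dvd a"
  unfolding chi_def Legendre_def by (auto simp: cong_0_iff)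

lemma chi_euler: "[chi a = a ^ (2 * q)] (mod int p)"
proof -
  have "(p - 1) div 2 = 2 * q" using p_eq by presburger
  thus ?thesis using euler_criterion[of p a] p_prime p_gt5 unfolding chi_def by simp
qed

lemma chi_eqI: "[chi a = chi b] (mod int p) \<Longrightarrow> chi a = chi b"
proof -
  assume "[chi a = chi b] (mod int p)"
  hence "int p dvd chi a - chi b" by (simp add: cong_iff_dvd_diff)
  moreover have "\<bar>chi a - chi b\<bar> < int p" using chi_values[of a] chi_values[of b] p_gt5 by auto
  ultimately show ?thesis using dvd_imp_le_int[of "chi a - chi b" "int p"] by force
qed

text \<open>Euler's criterion makes both sides congruent modulo \<open>p\<close>, and a difference
  of at most 2 in absolute value is then 0.\<close>

lemma chi_mult: "chi (a * b) = chi a * chi b"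
proof -
  have 1: "[chi (a * b) = a ^ (2 * q) * b ^ (2 * q)] (mod int p)"
    using chi_euler[of "a * b"] by (simp add: power_mult_distrib)
  have 2: "[chi a * chi b = a ^ (2 * q) * b ^ (2 * q)] (mod int p)"
    by (intro cong_mult chi_euler)
  have "[chi (a * b) = chi a * chi b] (mod int p)"
    using cong_trans[OF 1 cong_sym[OF 2]] .
  hence "int p dvd chi (a * b) - chi a * chi b" by (simp add: cong_iff_dvd_diff)
  moreover have "\<bar>chi (a * b) - chi a * chi b\<bar> < int p"
    using chi_values[of a] chi_values[of b] chi_values[of "a * b"] p_gt5 by auto
  ultimately show ?thesis using dvd_imp_le_int[of "chi (a * b) - chi a * chi b" "int p"] by force
qed

lemma chi_1 [simp]: "chi 1 = 1"
  using chi_mult[of 1 1] chi_eq_0_iff[of 1] p_gt5 by simp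

lemma chi_0 [simp]: "chi 0 = 0"
  by (simp add: chi_eq_0_iff)

text \<open>The exponent \<open>2 * q\<close> in Euler's criterion is even because
  \<open>p \<equiv> 1\<close> modulo 4.\<close>

lemma chi_minus1: "chi (-1) = 1"
proof -
  have "[chi (-1) = chi 1] (mod int p)" using chi_euler[of "-1"] by simp
  thus ?thesis using chi_eqI by fastforce
qed

lemma chi_minus [simp]: "chi (- a) = chi a"
  using chi_mult[of "-1" a] chi_minus1 by simp

lemma chi_reflect: "chi (int p - a) = chi a"
proof -
  have "chi (int p - a) = chi (-a)" by (rule chi_cong) (simp add: cong_iff_dvd_diff)
  thus ?thesis by simp
qed

lemma chi_square: "\<not> int p dvd a \<Longrightarrow> chi (a * a) = 1"
  using chi_values[of a] chi_eq_0_iff[of a] by (auto simp: chi_mult)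

lemma card_square_roots: "int (card {y\<in>{0..<int p}. [y^2 = a] (mod int p)}) = 1 + chi a"
  unfolding chi_def using card_square_roots_mod_prime[of p a] p_prime p_gt5 by simp

text \<open>Each residue \<open>a\<close> has exactly \<open>1 + chi a\<close> square roots modulo
  \<open>p\<close>.\<close>

lemma sum_over_squares:
  fixes f :: "int \<Rightarrow> 'a :: comm_ring_1"
  assumes "\<And>a. f (a mod int p) = f a"
  shows "(\<Sum>y\<in>{0..<int p}. f (y^2)) = (\<Sum>a\<in>{0..<int p}. (1 + of_int (chi a)) * f a)"
proof -
  let ?I = "{0..<int p}"
  have "(\<Sum>y\<in>?I. f (y^2)) = (\<Sum>y\<in>?I. f (y^2 mod int p))" using assms by simp
  also have "\<dots> = (\<Sum>a\<in>?I. \<Sum>y | y \<in> ?I \<and> y^2 mod int p = a. f (y^2 mod int p))"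
    using p_gt5 by (subst sum.group) auto
  also have "\<dots> = (\<Sum>a\<in>?I. of_nat (card {y\<in>?I. [y^2 = a] (mod int p)}) * f a)"
  proof (intro sum.cong refl)
    fix a assume a: "a \<in> ?I"
    have eq: "{y. y \<in> ?I \<and> y^2 mod int p = a} = {y\<in>?I. [y^2 = a] (mod int p)}"
      using a unfolding unique_euclidean_semiring_class.cong_def by (simp add: mod_pos_pos_trivial)
    have "(\<Sum>y | y \<in> ?I \<and> y^2 mod int p = a. f (y^2 mod int p)) = (\<Sum>y | y \<in> ?I \<and> y^2 mod int p = a. f a)"
      by (intro sum.cong) auto
    thus "(\<Sum>y | y \<in> ?I \<and> y^2 mod int p = a. f (y^2 mod int p)) = of_nat (card {y\<in>?I. [y^2 = a] (mod int p)}) * f a"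
      unfolding eq by simp
  qed
  also have "\<dots> = (\<Sum>a\<in>?I. (1 + of_int (chi a)) * f a)"
  proof (intro sum.cong refl)
    fix a
    have "of_nat (card {y\<in>?I. [y^2 = a] (mod int p)}) = (of_int (1 + chi a) :: 'a)"
      using card_square_roots[of a] by (metis of_int_of_nat_eq)
    thus "of_nat (card {y\<in>?I. [y^2 = a] (mod int p)}) * f a = (1 + of_int (chi a)) * f a" by simp
  qed
  finally show ?thesis .
qed

lemma sum_chi: "(\<Sum>a\<in>{0..<int p}. chi a) = 0"
  using sum_over_squares[of "\<lambda>_. 1 :: int"] by (simp add: sum.distrib)

lemma sum_mult_reindex:
  fixes f :: "int \<Rightarrow> 'a :: comm_monoid_add"
  assumes "\<And>a. f (a mod int p) = f a" and "\<not> int p dvd c"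
  shows "(\<Sum>a\<in>{0..<int p}. f (a * c)) = (\<Sum>a\<in>{0..<int p}. f a)"
proof -
  let ?I = "{0..<int p}" and ?g = "\<lambda>a. a * c mod int p"
  have "coprime c (int p)" using assms(2) p_int_prime by (metis coprime_commute prime_imp_coprime)
  hence inj: "inj_on ?g ?I"
  proof (intro inj_onI)
    fix x y assume xy: "x \<in> ?I" "y \<in> ?I" "?g x = ?g y"
    hence "[x * c = y * c] (mod int p)" by (simp add: unique_euclidean_semiring_class.cong_def)
    hence "[x = y] (mod int p)" using cong_mult_rcancel[OF \<open>coprime c (int p)\<close>] by simp
    thus "x = y" using xy by (intro cong_less_imp_eq_int[of x "int p" y]) auto
  qed
  have sub: "?g ` ?I \<subseteq> ?I" using p_gt5 by auto
  have "?g ` ?I = ?I" by (rule endo_inj_surj) (use inj sub in auto)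
  hence "(\<Sum>a\<in>?I. f a) = (\<Sum>a\<in>?I. f (?g a))" using sum.reindex[OF inj, of f] by simp
  thus ?thesis using assms(1) by simp
qed

definition ep :: "int \<Rightarrow> complex" where "ep k = cis (2 * pi * of_int k / of_nat p)"

lemma ep_add: "ep (a + b) = ep a * ep b"
  by (simp add: ep_def cis_mult ring_distribs add_divide_distrib)

lemma ep_0 [simp]: "ep 0 = 1" by (simp add: ep_def)

lemma ep_p_mult: "ep (int p * k) = 1"
proof -
  have "2 * pi * of_int (int p * k) / of_nat p = 2 * pi * of_int k" using p_gt5 by simp
  thus ?thesis unfolding ep_def by (simp add: cis_multiple_2pi)
qed

lemma ep_mod [simp]: "ep (a mod int p) = ep a"
proof -
  have "ep a = ep (int p * (a div int p) + a mod int p)" by simp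
  thus ?thesis by (simp only: ep_add ep_p_mult) simp
qed

lemma ep_mult_mod [simp]: "ep (b * (a mod int p)) = ep (b * a)"
  by (metis ep_mod mod_mult_right_eq)

lemma cnj_ep: "cnj (ep a) = ep (-a)"
  by (simp add: ep_def cis_cnj)

lemma ep_eq_1_iff: "ep a = 1 \<longleftrightarrow> int p dvd a"
proof
  assume "ep a = 1"
  hence "cos (2 * pi * of_int a / of_nat p) = 1" unfolding ep_def by (simp add: complex_eq_iff)
  then obtain k :: int where k: "2 * pi * of_int a / of_nat p = of_int k * 2 * pi"
    using cos_one_2pi_int by auto
  hence "real_of_int a = of_int k * of_nat p" using p_gt5 by (simp add: field_simps)
  hence "a = k * int p" by (metis of_int_eq_iff of_int_mult of_int_of_nat_eq)
  thus "int p dvd a" by simp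
next
  assume "int p dvd a" thus "ep a = 1" using ep_p_mult by auto
qed

lemma sum_ep: "(\<Sum>a\<in>{0..<int p}. ep (a * c)) = (if int p dvd c then of_nat p else 0)"
proof (cases "int p dvd c")
  case True
  hence "ep (a * c) = 1" for a by (subst ep_eq_1_iff) simp
  thus ?thesis using True by simp
next
  case False
  let ?I = "{0..<int p}"
  let ?S = "\<Sum>a\<in>?I. ep a"
  have "(\<Sum>a\<in>?I. ep (a * c)) = ?S" using False by (intro sum_mult_reindex) auto
  moreover have "?S = 0"
  proof -
    \<comment> \<open>Multiplication by \<open>ep 1\<close> only shifts the summation over a full
      period, so the sum is fixed by a factor different from 1.\<close>
    have "ep 1 * ?S = (\<Sum>a\<in>?I. ep (1 + a))" by (simp add: sum_distrib_left ep_add)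
    also have "\<dots> = (\<Sum>a\<in>{1..<int p + 1}. ep a)"
      by (rule sum.reindex_bij_witness[of _ "\<lambda>a. a - 1" "\<lambda>a. 1 + a"]) auto
    also have "{1..<int p + 1} = insert (int p) {1..<int p}" using p_gt5 by auto
    also have "(\<Sum>a\<in>\<dots>. ep a) = ep (int p) + (\<Sum>a\<in>{1..<int p}. ep a)" by simp
    also have "ep (int p) = ep 0" using ep_p_mult[of 1] by simp
    also have "ep 0 + (\<Sum>a\<in>{1..<int p}. ep a) = (\<Sum>a\<in>insert 0 {1..<int p}. ep a)" by simp
    also have "insert 0 {1..<int p} = ?I" using p_gt5 by auto
    finally have "(ep 1 - 1) * ?S = 0" by (simp add: algebra_simps)
    moreover have "ep 1 \<noteq> 1" using ep_eq_1_iff[of 1] p_gt5 by auto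
    ultimately show ?thesis by simp
  qed
  ultimately show ?thesis using False by simp
qed

definition gauss_sum :: complex where
  "gauss_sum = (\<Sum>a\<in>{0..<int p}. of_int (chi a) * ep a)"

text \<open>For \<open>n\<close> prime to \<open>p\<close> the substitution \<open>a * n\<close>
  pulls out \<open>chi n\<close>, which is its own inverse. If \<open>p\<close> divides
  \<open>n\<close>, the additive character is constant and both sides vanish, so the formula holds
  for every \<open>n\<close>.\<close>

lemma gauss_sum_twist: "(\<Sum>a\<in>{0..<int p}. of_int (chi a) * ep (a * n)) = of_int (chi n) * gauss_sum"
proof (cases "int p dvd n")
  case True
  hence "ep (a * n) = 1" for a by (subst ep_eq_1_iff) simp
  hence "(\<Sum>a\<in>{0..<int p}. of_int (chi a) * ep (a * n)) = of_int (\<Sum>a\<in>{0..<int p}. chi a)" by simp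
  thus ?thesis using True by (simp add: sum_chi chi_eq_0_iff[THEN iffD2])
next
  case False
  have c2: "chi n * chi n = 1" using False by (metis chi_square chi_mult)
  have "(\<Sum>a\<in>{0..<int p}. of_int (chi a) * ep (a * n)) = (\<Sum>a\<in>{0..<int p}. of_int (chi n * chi n) * (of_int (chi a) * ep (a * n)))"
    by (simp add: c2)
  also have "\<dots> = (\<Sum>a\<in>{0..<int p}. of_int (chi n) * (of_int (chi (a * n)) * ep (a * n)))"
    by (simp add: chi_mult mult_ac)
  also have "\<dots> = of_int (chi n) * (\<Sum>a\<in>{0..<int p}. of_int (chi (a * n)) * ep (a * n))"
    by (simp add: sum_distrib_left)
  also have "(\<Sum>a\<in>{0..<int p}. of_int (chi (a * n)) * ep (a * n)) = gauss_sum"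
    unfolding gauss_sum_def using False by (intro sum_mult_reindex[where f = "\<lambda>a. of_int (chi a) * ep a"]) auto
  finally show ?thesis .
qed

text \<open>One factor is expanded and the other is absorbed by the twist; orthogonality then leaves
  only \<open>a = p - 1\<close>, where the even character is 1.\<close>

lemma gauss_sum_squared: "gauss_sum ^ 2 = of_nat p"
proof -
  let ?I = "{0..<int p}"
  have "gauss_sum ^ 2 = (\<Sum>b\<in>?I. ep b * (of_int (chi b) * gauss_sum))"
    unfolding power2_eq_square by (subst (1) gauss_sum_def) (simp add: sum_distrib_left sum_distrib_right mult_ac)
  also have "\<dots> = (\<Sum>b\<in>?I. ep b * (\<Sum>a\<in>?I. of_int (chi a) * ep (a * b)))"
    by (simp add: gauss_sum_twist)
  also have "\<dots> = (\<Sum>b\<in>?I. \<Sum>a\<in>?I. of_int (chi a) * ep (b * (a + 1)))"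
    by (simp add: sum_distrib_left ep_add ring_distribs mult_ac)
  also have "\<dots> = (\<Sum>a\<in>?I. of_int (chi a) * (\<Sum>b\<in>?I. ep (b * (a + 1))))"
    by (subst sum.swap) (simp add: sum_distrib_left)
  also have "\<dots> = (\<Sum>a\<in>?I. if a = int p - 1 then of_nat p else 0)"
  proof (intro sum.cong refl)
    fix a assume a: "a \<in> ?I"
    show "of_int (chi a) * (\<Sum>b\<in>?I. ep (b * (a + 1))) = (if a = int p - 1 then of_nat p else 0)"
    proof (cases "a = int p - 1")
      case True
      have "chi (int p - 1) = 1" using chi_reflect[of 1] by simp
      thus ?thesis using True by (simp add: sum_ep)
    next
      case False
      hence "\<not> int p dvd a + 1" using a by (auto dest!: zdvd_imp_le)
      thus ?thesis using False by (simp add: sum_ep)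
    qed
  qed
  also have "\<dots> = of_nat p" using p_gt5 by simp
  finally show ?thesis .
qed

lemma cnj_gauss_sum: "cnj gauss_sum = gauss_sum"
proof -
  have "cnj gauss_sum = (\<Sum>a\<in>{0..<int p}. of_int (chi a) * ep (a * (-1)))"
    by (simp add: gauss_sum_def cnj_ep)
  also have "\<dots> = gauss_sum" by (subst gauss_sum_twist) (simp add: chi_minus1)
  finally show ?thesis .
qed

lemma gauss_sum_quadratic: "(\<Sum>y\<in>{0..<int p}. ep (c * y^2)) = of_int (chi c) * gauss_sum" if "\<not> int p dvd c"
proof -
  have "(\<Sum>y\<in>{0..<int p}. ep (c * y^2)) = (\<Sum>a\<in>{0..<int p}. (1 + of_int (chi a)) * ep (c * a))"
    using sum_over_squares[of "\<lambda>a. ep (c * a)"] by simp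
  also have "\<dots> = (\<Sum>a\<in>{0..<int p}. ep (a * c)) + (\<Sum>a\<in>{0..<int p}. of_int (chi a) * ep (a * c))"
    by (simp add: ring_distribs sum.distrib mult_ac)
  finally show ?thesis using that by (simp add: sum_ep gauss_sum_twist)
qed

lemma gauss_sum_real: obtains t where "gauss_sum = of_real t" "t^2 = real p"
proof -
  have "gauss_sum \<in> \<real>" using cnj_gauss_sum by (simp add: Reals_cnj_iff)
  then obtain t where t: "gauss_sum = of_real t" by (auto elim: Reals_cases)
  have "of_real (t^2) = (of_real (real p) :: complex)" using gauss_sum_squared t by simp
  hence "t^2 = real p" by (simp only: of_real_eq_iff)
  thus thesis using that t by blast
qed

text \<open>The twist by \<open>- q\<close> is harmless since \<open>chi (- q) = 1\<close>, as
  \<open>- 4 * q\<close> is 1 modulo \<open>p\<close>. It is chosen because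
  \<open>- q / p = 1 / (4 * p) - 1 / 4\<close>: the phase \<open>y^2 / (4 * p)\<close> varies slowly
  for \<open>\<bar>y\<bar> \<le> 2 * q\<close>, and \<open>- y^2 / 4\<close> depends, up to
  integers, only on the parity of \<open>y\<close>. Even \<open>y = 2 * m\<close> give cosines; odd
  \<open>y = 2 * j + 1\<close> are turned back by a right angle and give sines.\<close>

lemma gauss_sum_trig:
  "Re gauss_sum = 1 + 2 * (\<Sum>m=1..q. cos (2 * pi * real m ^ 2 / p)) + 2 * (\<Sum>j<q. sin (pi * (2 * real j + 1) ^ 2 / (2 * p)))"
proof -
  have q0: "q > 0" using q_ge3 by simp
  have p4: "int p = 4 * int q + 1" using p_eq by linarith
  have nd: "\<not> int p dvd - int q" using q0 p4 zdvd_imp_le[of "int p" "int q"] by auto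
  have "chi (- int q) = chi ((-int q) * (2 * 2))" 
    using chi_square[of 2] p_gt5 zdvd_imp_le[of "int p" 2] by (simp only: chi_mult) auto
  also have "\<dots> = chi 1" by (rule chi_cong) (simp add: cong_iff_dvd_diff, rule dvdI[of _ _ "-1"], simp add: p4)
  finally have chiq: "chi (- int q) = 1" by simp
  let ?e = "\<lambda>y. ep (- int q * y^2)"
  have "gauss_sum = (\<Sum>y\<in>{0..<int p}. ?e y)" using gauss_sum_quadratic[OF nd] chiq by simp
  \<comment> \<open>Representatives symmetric about 0: the summand is even in \<open>y\<close>, so
    the sum becomes 1 plus twice the sum over \<open>1..2 * q\<close>.\<close>
  also have "\<dots> = (\<Sum>y\<in>{-2 * int q..2 * int q}. ?e y)"
  proof (rule sum.reindex_bij_witness[of _ "\<lambda>y. y mod int p" "\<lambda>y. if y \<le> 2 * int q then y else y - int p"])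
    fix y assume "y \<in> {-2 * int q..2 * int q}"
    moreover from this have "y mod int p = (if y \<ge> 0 then y else y + int p)"
      using p4 by (auto simp: mod_pos_pos_trivial intro: int_mod_pos_eq[of _ _ "-1"] split: if_splits)
    ultimately show "(if y mod int p \<le> 2 * int q then y mod int p else y mod int p - int p) = y" using p4 by auto
    show "y mod int p \<in> {0..<int p}" using p_gt5 by simp
  next
    fix y assume y: "y \<in> {0..<int p}"
    thus "(if y \<le> 2 * int q then y else y - int p) mod int p = y" by auto
    show "(if y \<le> 2 * int q then y else y - int p) \<in> {-2 * int q..2 * int q}" using y p4 by auto
    show "?e (if y \<le> 2 * int q then y else y - int p) = ?e y"
    proof (cases "y \<le> 2 * int q")
      case False
      have "- int q * (y - int p)^2 = - int q * y^2 + int p * (- int q * (int p - 2 * y))"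
        by (simp add: power2_eq_square algebra_simps)
      hence "?e (y - int p) = ?e y * ep (int p * (- int q * (int p - 2 * y)))" by (simp only: ep_add)
      thus ?thesis using False by (simp only: ep_p_mult) simp
    qed simp
  qed
  also have "{-2 * int q..2 * int q} = insert 0 ({1..2 * int q} \<union> uminus ` {1..2 * int q})"
  proof (intro equalityI subsetI)
    fix y assume y: "y \<in> {-2 * int q..2 * int q}"
    consider "y = 0" | "y \<in> {1..2 * int q}" | "-y \<in> {1..2 * int q}" using y by force
    thus "y \<in> insert 0 ({1..2 * int q} \<union> uminus ` {1..2 * int q})"
    proof cases
      case 3
      thus ?thesis by (intro insertI2 UnI2 image_eqI[of _ _ "-y"]) auto
    qed auto
  qed auto
  also have "(\<Sum>y\<in>\<dots>. ?e y) = 1 + ((\<Sum>y\<in>{1..2 * int q}. ?e y) + (\<Sum>y\<in>uminus ` {1..2 * int q}. ?e y))"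
  proof -
    have "{1..2 * int q} \<inter> uminus ` {1..2 * int q} = {}" by auto
    thus ?thesis by (subst sum.insert) (auto simp: sum.union_disjoint)
  qed
  also have "(\<Sum>y\<in>uminus ` {1..2 * int q}. ?e y) = (\<Sum>y\<in>{1..2 * int q}. ?e y)"
    by (subst sum.reindex) auto
  also have "(\<Sum>y\<in>{1..2 * int q}. ?e y) = (\<Sum>y\<in>int ` ((\<lambda>m. 2 * m) ` {1..q} \<union> (\<lambda>j. 2 * j + 1) ` {..<q}). ?e y)"
  proof (intro sum.cong refl)
    show "{1..2 * int q} = int ` ((\<lambda>m. 2 * m) ` {1..q} \<union> (\<lambda>j. 2 * j + 1) ` {..<q})"
    proof (intro equalityI subsetI)
      fix y assume y: "y \<in> {1..2 * int q}"
      have "nat y \<in> (\<lambda>m. 2 * m) ` {1..q} \<union> (\<lambda>j. 2 * j + 1) ` {..<q}"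
      proof (cases "even (nat y)")
        case True
        then obtain m where m: "nat y = 2 * m" by auto
        hence "m \<in> {1..q}" using y by auto
        thus ?thesis using m by auto
      next
        case False
        then obtain m where m: "nat y = 2 * m + 1" by (auto elim: oddE)
        hence "m \<in> {..<q}" using y by auto
        thus ?thesis using m by auto
      qed
      moreover have "y = int (nat y)" using y by simp
      ultimately show "y \<in> int ` ((\<lambda>m. 2 * m) ` {1..q} \<union> (\<lambda>j. 2 * j + 1) ` {..<q})" by blast
    qed auto
  qed
  also have "\<dots> = (\<Sum>m=1..q. ?e (int (2 * m))) + (\<Sum>j<q. ?e (int (2 * j + 1)))"
  proof -
    let ?A = "(\<lambda>m. 2 * m) ` {1..q}" and ?B = "(\<lambda>j. 2 * j + 1) ` {..<q}"
    have disj: "?A \<inter> ?B = {}" by auto presburger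
    have "(\<Sum>y\<in>int ` (?A \<union> ?B). ?e y) = (\<Sum>m\<in>?A \<union> ?B. ?e (int m))"
      by (subst sum.reindex) auto
    also have "\<dots> = (\<Sum>m\<in>?A. ?e (int m)) + (\<Sum>m\<in>?B. ?e (int m))"
      using disj by (intro sum.union_disjoint) auto
    also have "(\<Sum>m\<in>?A. ?e (int m)) = (\<Sum>m=1..q. ?e (int (2 * m)))"
      by (subst sum.reindex) (auto simp: inj_on_def)
    also have "(\<Sum>m\<in>?B. ?e (int m)) = (\<Sum>j<q. ?e (int (2 * j + 1)))"
      by (subst sum.reindex) (auto simp: inj_on_def)
    finally show ?thesis .
  qed
  finally have g: "gauss_sum = 1 + 2 * ((\<Sum>m=1..q. ?e (int (2 * m))) + (\<Sum>j<q. ?e (int (2 * j + 1))))"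
    by simp
  have "real p = real (4 * q + 1)" using p_eq by (rule arg_cong)
  hence rq: "real q = (real p - 1) / 4" by simp
  have even: "Re (?e (int (2 * m))) = cos (2 * pi * real m ^ 2 / p)" for m
  proof -
    have "2 * pi * of_int (- int q * int (2 * m) ^ 2) / real p = 2 * pi * real m ^ 2 / p - 2 * pi * of_int (int m ^ 2)"
      using p_gt5 by (simp add: rq field_simps power2_eq_square)
    hence "Re (?e (int (2 * m))) = cos (2 * pi * real m ^ 2 / p - 2 * pi * of_int (int m ^ 2))" by (simp add: ep_def)
    thus ?thesis using cos_int_2pin[of "int m ^ 2"] sin_int_2pin[of "int m ^ 2"] by (simp only: cos_diff)
  qed
  have odd: "Re (?e (int (2 * j + 1))) = sin (pi * (2 * real j + 1) ^ 2 / (2 * p))" for j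
  proof -
    have "2 * pi * of_int (- int q * int (2 * j + 1) ^ 2) / real p = 
      (pi * (2 * real j + 1) ^ 2 / (2 * p) - pi / 2) - 2 * pi * of_int (int (j^2 + j))"
      using p_gt5 by (simp add: rq field_simps power2_eq_square)
    hence "Re (?e (int (2 * j + 1))) = cos ((pi * (2 * real j + 1) ^ 2 / (2 * p) - pi / 2) - 2 * pi * of_int (int (j^2 + j)))" by (simp add: ep_def)
    also have "\<dots> = cos (pi * (2 * real j + 1) ^ 2 / (2 * p) - pi / 2)"
      using cos_int_2pin[of "int (j^2 + j)"] sin_int_2pin[of "int (j^2 + j)"] by (subst cos_diff) simp
    also have "\<dots> = sin (pi * (2 * real j + 1) ^ 2 / (2 * p))" by (simp add: cos_diff)
    finally show ?thesis .
  qed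
  show ?thesis unfolding g using even odd by (simp add: Re_sum)
qed

theorem gauss_sum_eq: "gauss_sum = of_real (sqrt p)"
proof -
  obtain t where t: "gauss_sum = of_real t" "t^2 = real p" by (rule gauss_sum_real)
  define s where "s = sqrt (real p)"
  have s: "s > 0" "s^2 = p" "s \<ge> 3.6" unfolding s_def using p_ge13 by (auto intro!: real_le_rsqrt simp: power2_eq_square simp del: divide_le_eq_numeral1 le_divide_eq_numeral1 divide_le_eq_numeral le_divide_eq_numeral)
  have "real p = real (4 * q + 1)" using p_eq by (rule arg_cong)
  hence "real q = (real p - 1) / 4" by simp
  hence rq: "real q = (s^2 - 1) / 4" using s(2) by simp
  have q4: "4 * q < p" using p_eq by linarith
  have "s / 2 \<le> real q"
  proof -
    have "3 * s \<le> s^2" unfolding power2_eq_square using s by (intro mult_right_mono) auto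
    moreover have "3 \<le> s" using s(3) by simp
    ultimately have "s / 2 \<le> (s^2 - 1) / 4" by simp
    thus ?thesis unfolding rq .
  qed
  hence E: "1 + 2 * (\<Sum>m=1..q. cos (2 * pi * real m ^ 2 / p)) \<ge> - s / 3 - 1 / s - 1 / (3 * s^2)"
    using cos_square_sum_lower[OF q4 p_ge13] unfolding s_def by simp
  define O' where "O' = 2 * (\<Sum>j<q. sin (pi * (2 * real j + 1) ^ 2 / (2 * p)))"
  have O1: "sqrt 2 * s \<ge> 2 * real q - 1 \<Longrightarrow> O' \<ge> 0"
    and O2: "sqrt 2 * s \<le> 2 * real q - 1 \<Longrightarrow> O' \<ge> s / 3 - 1 + 2 / (3 * s) - s / sqrt 2"
    using sin_odd_square_sum_lower[OF q4 p_ge13] unfolding s_def O'_def by simp_all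
  have i1: "1 / s \<le> 1 / 3.6" using s by (intro divide_left_mono) auto
  have i2: "1 / (3 * s^2) \<le> 1 / 39" using s(2) p_ge13 by (intro divide_left_mono) auto
  have lower: "t \<ge> - s / 3 - 1 / s - 1 / (3 * s^2) + O'"
    using gauss_sum_trig E t unfolding O'_def by simp
  have "- s / 3 - 1 / s - 1 / (3 * s^2) + O' > - s"
  proof (cases "sqrt 2 * s \<ge> 2 * real q - 1")
    case True
    thus ?thesis using O1 i1 i2 s by simp
  next
    case False
    \<comment> \<open>For \<open>p = 13\<close> all sines are still in the nonnegative range, since
      \<open>2 * q - 1 = 5 \<le> sqrt 26\<close>. The numerical margin in the present case uses
      \<open>s \<ge> 4.12\<close>, which is available from \<open>p \<ge> 17\<close> on.\<close>
    have "p \<noteq> 13"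
    proof
      assume "p = 13"
      hence "real q = 3" using s(2) rq by simp
      moreover have "sqrt 2 * s = sqrt 26" unfolding s_def \<open>p = 13\<close> by (simp add: real_sqrt_mult[symmetric])
      moreover have "sqrt 26 \<ge> 5" by (rule real_le_rsqrt) simp
      ultimately show False using False by simp
    qed
    hence "p \<ge> 17" using p_ge13 p_eq by presburger
    hence s4: "s \<ge> 4.12" unfolding s_def by (intro real_le_rsqrt) (simp add: power2_eq_square)
    have i1: "1 / s \<le> 1 / 4.12" using s4 by (intro divide_left_mono) auto
    have i2: "1 / (3 * s^2) \<le> 1 / 51" using s(2) \<open>p \<ge> 17\<close> by (intro divide_left_mono) auto
    have "sqrt 2 \<ge> 141 / 100" by (rule real_le_rsqrt) (simp add: power2_eq_square)
    hence "(s / sqrt 2) * (141 / 100) \<le> (s / sqrt 2) * sqrt 2" using s by (intro mult_left_mono) auto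
    hence i3: "141 * (s / sqrt 2) \<le> 100 * s" by simp
    have i4: "2 / (3 * s) = 2 * (1 / s) / 3" by simp
    define r i z where "r = 1 / s" and "i = 1 / (3 * s^2)" and "z = s / sqrt 2"
    have "O' \<ge> s / 3 - 1 + 2 * r / 3 - z" using O2 False i4 unfolding r_def z_def by simp
    moreover have "103 * r \<le> 25" "51 * i \<le> 1" "141 * z \<le> 100 * s" "103 \<le> 25 * s"
      using i1 i2 i3 s4 unfolding r_def i_def z_def by simp_all
    ultimately show ?thesis unfolding r_def[symmetric] i_def[symmetric] by linarith
  qed
  hence "t > - s" using lower by simp
  moreover have "t = s \<or> t = - s" using t(2) s(2) by (metis power2_eq_iff)
  ultimately show ?thesis using t(1) unfolding s_def by auto
qed

end

section \<open>Generating functions of partitions\<close>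

text \<open>The set of allowed parts is arbitrary, so that infinite sets can be approximated by
  finite truncations.\<close>

definition part_lists :: "nat set \<Rightarrow> nat \<Rightarrow> nat list set" where
  "part_lists D n = {xs. sorted xs \<and> sum_list xs = n \<and> set xs \<subseteq> D}"

definition part_count :: "nat set \<Rightarrow> nat \<Rightarrow> nat" where "part_count D n = card (part_lists D n)"

lemma finite_part_lists:
  assumes "0 \<notin> D" shows "finite (part_lists D n)"
proof (rule finite_subset)
  show "part_lists D n \<subseteq> {xs. set xs \<subseteq> {..n} \<and> length xs \<le> n}"
  proof
    fix xs assume "xs \<in> part_lists D n"
    hence xs: "sum_list xs = n" "set xs \<subseteq> D" unfolding part_lists_def by auto
    have "length ys \<le> sum_list ys" if "0 \<notin> set ys" for ys :: "nat list" using that by (induction ys) auto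
    hence "length xs \<le> n" using xs assms by blast
    moreover have "set xs \<subseteq> {..n}" using xs(1) member_le_sum_list by auto
    ultimately show "xs \<in> {xs. set xs \<subseteq> {..n} \<and> length xs \<le> n}" by simp
  qed
  show "finite {xs. set xs \<subseteq> {..n} \<and> length xs \<le> n}" by (intro finite_lists_length_le) simp
qed

lemma part_lists_mono: "D \<subseteq> E \<Longrightarrow> part_lists D n \<subseteq> part_lists E n"
  unfolding part_lists_def by auto

lemma part_count_mono: "D \<subseteq> E \<Longrightarrow> 0 \<notin> E \<Longrightarrow> part_count D n \<le> part_count E n"
  unfolding part_count_def by (intro card_mono finite_part_lists part_lists_mono)

lemma part_count_truncate: "n \<le> M \<Longrightarrow> part_count (D \<inter> {..M}) n = part_count D n"
proof -
  assume "n \<le> M"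
  hence "part_lists (D \<inter> {..M}) n = part_lists D n"
    unfolding part_lists_def using member_le_sum_list order_trans by fastforce
  thus ?thesis unfolding part_count_def by simp
qed

lemma part_count_empty: "part_count {} n = (if n = 0 then 1 else 0)"
proof -
  have "part_lists {} n = (if n = 0 then {[]} else {})" unfolding part_lists_def by auto
  thus ?thesis unfolding part_count_def by simp
qed

text \<open>A partition either avoids the largest allowed part \<open>m\<close> or, being
  nondecreasing, ends in \<open>m\<close>; deleting that last entry leaves an arbitrary partition of
  \<open>n - m\<close>.\<close>

lemma part_count_insert:
  assumes E: "\<And>a. a \<in> E \<Longrightarrow> a < m" and nz: "m > 0" "0 \<notin> E"
  shows "part_count (insert m E) n = part_count E n + (if m \<le> n then part_count (insert m E) (n - m) else 0)"
proof -
  let ?B = "if m \<le> n then (\<lambda>xs. xs @ [m]) ` part_lists (insert m E) (n - m) else {}"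
  have eq: "part_lists (insert m E) n = part_lists E n \<union> ?B"
  proof (intro equalityI subsetI)
    fix xs assume xs: "xs \<in> part_lists (insert m E) n"
    show "xs \<in> part_lists E n \<union> ?B"
    proof (cases "m \<in> set xs")
      case False
      thus ?thesis using xs unfolding part_lists_def by auto
    next
      case True
      hence ne: "xs \<noteq> []" by auto
      define ys where "ys = butlast xs"
      have xy: "xs = ys @ [last xs]" unfolding ys_def using ne by simp
      have s: "sorted (ys @ [last xs])" using xs xy unfolding part_lists_def by simp
      have "m \<le> last xs" using True s xy by (metis Un_iff empty_iff empty_set insert_iff list.simps(15) order_refl set_append sorted_append)
      moreover have "last xs \<in> insert m E" using xs last_in_set[OF ne] unfolding part_lists_def by blast
      ultimately have l: "last xs = m" using E[of "last xs"] by auto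
      have xy: "xs = ys @ [m]" using xy l by simp
      hence "m \<le> n" "ys \<in> part_lists (insert m E) (n - m)" using xs unfolding part_lists_def by (auto simp: sorted_append)
      thus ?thesis using xy by auto
    qed
  next
    fix xs assume "xs \<in> part_lists E n \<union> ?B"
    thus "xs \<in> part_lists (insert m E) n"
    proof
      assume "xs \<in> part_lists E n" thus ?thesis unfolding part_lists_def by auto
    next
      assume "xs \<in> ?B"
      then obtain ys where ys: "m \<le> n" "xs = ys @ [m]" "ys \<in> part_lists (insert m E) (n - m)" by (auto split: if_splits)
      thus ?thesis using E unfolding part_lists_def by (auto simp: sorted_append intro: less_imp_le)
    qed
  qed
  have "m \<notin> set xs" if "xs \<in> part_lists E n" for xs
    using that E[of m] unfolding part_lists_def by blast
  moreover have "m \<in> set xs" if "xs \<in> ?B" for xs using that by (auto split: if_splits)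
  ultimately have "part_lists E n \<inter> ?B = {}" by blast
  hence "part_count (insert m E) n = part_count E n + card ?B"
    unfolding part_count_def eq using nz by (subst card_Un_disjoint) (auto intro!: finite_part_lists)
  also have "card ?B = (if m \<le> n then part_count (insert m E) (n - m) else 0)"
    unfolding part_count_def by (auto simp: card_image inj_on_def)
  finally show ?thesis .
qed

text \<open>The recursion reads \<open>C = B + q^m * C\<close> for the two series, so inserting a
  new largest part multiplies by \<open>1 / (1 - q^m)\<close>. Summability at real radius is carried
  along in the induction because convergence must be known before this equation can be solved for
  \<open>C\<close>.\<close>

lemma part_gf_finite:
  assumes "finite E" "0 \<notin> E"
  shows "(\<forall>r::real. 0 \<le> r \<and> r < 1 \<longrightarrow> summable (\<lambda>n. part_count E n * r ^ n)) \<and>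
         (\<forall>q::complex. norm q < 1 \<longrightarrow> (\<lambda>n. of_nat (part_count E n) * q ^ n) sums (\<Prod>m\<in>E. 1 / (1 - q ^ m)))"
  using assms
proof (induction E rule: finite_linorder_max_induct)
  case empty
  have eq: "of_nat (part_count {} n) * x ^ n = (if n = 0 then 1 else 0)" for n and x :: "'a :: real_normed_field"
    by (simp add: part_count_empty)
  show ?case unfolding eq using sums_single[of 0 "\<lambda>_. 1 :: complex"] by (auto simp: eq)
next
  case (insert m E)
  have m0: "m > 0" and E0: "0 \<notin> E" using insert.prems by auto
  have Em: "\<And>a. a \<in> E \<Longrightarrow> a < m" using insert.hyps by auto
  define b where "b = part_count E"
  define c where "c = part_count (insert m E)"
  have rec: "c n = b n + (if m \<le> n then c (n - m) else 0)" for n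
    unfolding b_def c_def by (rule part_count_insert[OF Em m0 E0])
  have sum_b: "summable (\<lambda>n. b n * r ^ n)" if "0 \<le> r" "r < 1" for r :: real using insert.IH E0 that unfolding b_def by blast
  have sums_b: "(\<lambda>n. of_nat (b n) * q ^ n) sums (\<Prod>m\<in>E. 1 / (1 - q ^ m))" if "norm q < 1" for q :: complex
    using insert.IH E0 that unfolding b_def by blast
  \<comment> \<open>The recursion bounds \<open>1 - r^m\<close> times any partial sum by the
    convergent series of \<open>b\<close>.\<close>
  have sum_c: "summable (\<lambda>n. c n * r ^ n)" if r: "0 \<le> r" "r < 1" for r :: real
  proof (rule summableI_nonneg_bounded)
    have rm: "r ^ m < 1" "0 \<le> r ^ m" using r m0 by (auto simp: power_less_one_iff)
    fix N
    have "(\<Sum>n<N. c n * r ^ n) = (\<Sum>n<N. b n * r ^ n) + (\<Sum>n<N. if m \<le> n then c (n - m) * r ^ n else 0)"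
      by (subst rec) (auto simp: distrib_right sum.distrib intro!: sum.cong)
    also have "(\<Sum>n<N. if m \<le> n then c (n - m) * r ^ n else 0) = (\<Sum>n\<in>{m..<N}. c (n - m) * r ^ n)"
      by (rule sum.mono_neutral_cong_right) auto
    also have "\<dots> = (\<Sum>k<N - m. c k * r ^ (k + m))"
      by (rule sum.reindex_bij_witness[of _ "\<lambda>k. k + m" "\<lambda>n. n - m"]) auto
    also have "\<dots> \<le> (\<Sum>k<N. c k * r ^ (k + m))" using r by (intro sum_mono2) auto
    also have "\<dots> = r ^ m * (\<Sum>k<N. c k * r ^ k)" by (simp add: sum_distrib_left power_add mult_ac)
    also have "(\<Sum>n<N. b n * r ^ n) \<le> (\<Sum>n. b n * r ^ n)" using r by (intro sum_le_suminf sum_b) auto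
    finally have "(\<Sum>n<N. c n * r ^ n) * (1 - r ^ m) \<le> (\<Sum>n. b n * r ^ n)" by (simp add: algebra_simps)
    thus "(\<Sum>n<N. c n * r ^ n) \<le> (\<Sum>n. b n * r ^ n) / (1 - r ^ m)" using rm by (simp add: pos_le_divide_eq)
  qed (use r in auto)
  have sums_c: "(\<lambda>n. of_nat (c n) * q ^ n) sums (\<Prod>m\<in>insert m E. 1 / (1 - q ^ m))" if q: "norm q < 1" for q :: complex
  proof -
    have "summable (\<lambda>n. norm (of_nat (c n) * q ^ n))" using sum_c[of "norm q"] q by (simp add: norm_mult norm_power)
    hence sm: "summable (\<lambda>n. of_nat (c n) * q ^ n)" by (rule summable_norm_cancel)
    define S where "S = (\<Sum>n. of_nat (c n) * q ^ n)"
    have S: "(\<lambda>n. of_nat (c n) * q ^ n) sums S" unfolding S_def using sm by (rule summable_sums)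
    define g where "g = (\<lambda>n. if m \<le> n then of_nat (c (n - m)) * q ^ n else 0)"
    have "(\<lambda>n. g (n + m)) sums (q ^ m * S)"
      using sums_mult[OF S, of "q ^ m"] unfolding g_def by (simp add: power_add mult_ac)
    moreover have "(\<Sum>i<m. g i) = 0" unfolding g_def by simp
    ultimately have "g sums (q ^ m * S)" using sums_iff_shift[of g m "q ^ m * S"] by simp
    from sums_add[OF sums_b[OF q] this]
    have "(\<lambda>n. of_nat (b n) * q ^ n + g n) sums ((\<Prod>m\<in>E. 1 / (1 - q ^ m)) + q ^ m * S)" .
    moreover have "of_nat (b n) * q ^ n + g n = of_nat (c n) * q ^ n" for n
      unfolding g_def by (subst (2) rec) (simp add: distrib_right)
    ultimately have "S = (\<Prod>m\<in>E. 1 / (1 - q ^ m)) + q ^ m * S" using S sums_unique2 by simp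
    moreover have "q ^ m \<noteq> 1"
    proof
      assume "q ^ m = 1"
      hence "norm q ^ m = 1" by (metis norm_one norm_power)
      thus False using q m0 by (metis norm_ge_zero power_less_one_iff less_irrefl)
    qed
    ultimately have "S = 1 / (1 - q ^ m) * (\<Prod>m\<in>E. 1 / (1 - q ^ m))" by (simp add: field_simps)
    thus ?thesis using S insert.hyps Em by (subst prod.insert) auto
  qed
  show ?case using sum_c sums_c unfolding c_def by blast
qed

text \<open>Coefficients with index below \<open>N\<close> only involve parts up to
  \<open>N\<close>. The partial sum is therefore below a finite product, which is at most the
  exponential of a geometric series independent of \<open>N\<close>.\<close>

lemma part_summable:
  fixes r :: real
  assumes D: "0 \<notin> D" and r: "0 \<le> r" "r < 1"
  shows "summable (\<lambda>n. part_count D n * r ^ n)"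
proof (rule summableI_nonneg_bounded)
  fix N
  have "(\<Sum>n<N. part_count D n * r ^ n) = (\<Sum>n<N. part_count (D \<inter> {..N}) n * r ^ n)"
    by (intro sum.cong refl) (simp add: part_count_truncate)
  also have "\<dots> \<le> (\<Sum>n. part_count (D \<inter> {..N}) n * r ^ n)"
    using part_gf_finite[of "D \<inter> {..N}"] D r by (intro sum_le_suminf) auto
  also have "\<dots> = (\<Prod>m\<in>D \<inter> {..N}. 1 / (1 - r ^ m))"
  proof -
    have "(\<lambda>n. of_nat (part_count (D \<inter> {..N}) n) * (of_real r :: complex) ^ n) sums (\<Prod>m\<in>D \<inter> {..N}. 1 / (1 - of_real r ^ m))"
      using part_gf_finite[of "D \<inter> {..N}"] D r by simp
    hence "(\<lambda>n. complex_of_real (part_count (D \<inter> {..N}) n * r ^ n)) sums of_real (\<Prod>m\<in>D \<inter> {..N}. 1 / (1 - r ^ m))" by simp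
    hence "(\<lambda>n. part_count (D \<inter> {..N}) n * r ^ n) sums (\<Prod>m\<in>D \<inter> {..N}. 1 / (1 - r ^ m))" by (simp only: sums_of_real_iff)
    thus ?thesis by (simp add: sums_iff)
  qed
  also have "\<dots> \<le> (\<Prod>m\<in>D \<inter> {..N}. exp (r ^ m / (1 - r)))"
  proof (intro prod_mono conjI)
    fix m assume m: "m \<in> D \<inter> {..N}"
    hence "m \<noteq> 0" using D by (metis IntD1)
    hence rm: "r ^ m \<le> r" "0 \<le> r ^ m" using r power_decreasing[of 1 m r] by auto
    hence rm1: "r ^ m < 1" using r by linarith
    show "0 \<le> 1 / (1 - r ^ m)" using rm1 by simp
    have "1 / (1 - r ^ m) = 1 + r ^ m / (1 - r ^ m)" using rm1 by (simp add: field_simps)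
    also have "\<dots> \<le> 1 + r ^ m / (1 - r)" using rm rm1 r by (intro add_left_mono divide_left_mono) auto
    also have "\<dots> \<le> exp (r ^ m / (1 - r))" by (rule exp_ge_add_one_self)
    finally show "1 / (1 - r ^ m) \<le> exp (r ^ m / (1 - r))" .
  qed
  also have "\<dots> = exp ((\<Sum>m\<in>D \<inter> {..N}. r ^ m) / (1 - r))" by (simp add: exp_sum sum_divide_distrib)
  also have "\<dots> \<le> exp ((1 / (1 - r)) / (1 - r))"
  proof -
    have "(\<Sum>m\<in>D \<inter> {..N}. r ^ m) \<le> (\<Sum>m. r ^ m)" using r by (intro sum_le_suminf summable_geometric) auto
    also have "\<dots> = 1 / (1 - r)" using r by (intro suminf_geometric) auto
    finally have "(\<Sum>m\<in>D \<inter> {..N}. r ^ m) / (1 - r) \<le> (1 / (1 - r)) / (1 - r)" using r by (intro divide_right_mono) auto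
    thus ?thesis by (simp only: exp_le_cancel_iff)
  qed
  finally show "(\<Sum>n<N. part_count D n * r ^ n) \<le> exp ((1 / (1 - r)) / (1 - r))" .
qed (use r in auto)

text \<open>Each coefficient is eventually constant in \<open>M\<close> and dominated by the one for
  \<open>D\<close>, so Tannery's theorem applies.\<close>

lemma part_gf_limit:
  fixes q :: complex
  assumes D: "0 \<notin> D" and q: "norm q < 1"
  shows "(\<lambda>M. \<Prod>m\<in>D \<inter> {..M}. 1 / (1 - q ^ m)) \<longlonglongrightarrow> (\<Sum>n. of_nat (part_count D n) * q ^ n)"
proof -
  have "(\<lambda>M. \<Sum>n. of_nat (part_count (D \<inter> {..M}) n) * q ^ n) \<longlonglongrightarrow> (\<Sum>n. of_nat (part_count D n) * q ^ n)"
  proof (rule conjunct2[OF conjunct2[OF tannerys_theorem]])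
    fix n
    have "eventually (\<lambda>M. of_nat (part_count D n) * q ^ n = of_nat (part_count (D \<inter> {..M}) n) * q ^ n) sequentially"
      using eventually_ge_at_top[of n] by eventually_elim (simp add: part_count_truncate)
    thus "(\<lambda>M. of_nat (part_count (D \<inter> {..M}) n) * q ^ n) \<longlonglongrightarrow> of_nat (part_count D n) * q ^ n"
      by (rule Lim_transform_eventually[OF tendsto_const])
  next
    show "summable (\<lambda>n. part_count D n * norm q ^ n)" using D q by (intro part_summable) auto
    show "\<forall>\<^sub>F (n, M) in at_top \<times>\<^sub>F sequentially. norm (of_nat (part_count (D \<inter> {..M}) n) * q ^ n) \<le> part_count D n * norm q ^ n"
    proof (rule always_eventually, clarify)
      fix n M
      have "part_count (D \<inter> {..M}) n \<le> part_count D n" using D by (intro part_count_mono) auto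
      thus "norm (of_nat (part_count (D \<inter> {..M}) n) * q ^ n) \<le> part_count D n * norm q ^ n"
        by (simp add: norm_mult norm_power mult_right_mono)
    qed
  qed simp
  moreover have "(\<Sum>n. of_nat (part_count (D \<inter> {..M}) n) * q ^ n) = (\<Prod>m\<in>D \<inter> {..M}. 1 / (1 - q ^ m))" for M
    using part_gf_finite[of "D \<inter> {..M}"] D q by (auto simp: sums_iff)
  ultimately show ?thesis by simp
qed

text \<open>Logarithm of one Euler factor \<open>1 / (1 - exp (- z))\<close>. For
  \<open>Re z > 0\<close> the argument of \<open>Ln\<close> lies in the right half plane, where the
  principal branch is holomorphic.\<close>

definition clog_factor :: "complex \<Rightarrow> complex" where "clog_factor z = - Ln (1 - exp (- z))"

definition log_gf :: "nat set \<Rightarrow> complex \<Rightarrow> complex" where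
  "log_gf D s = (\<Sum>m. if m \<in> D then clog_factor (of_nat m * s) else 0)"

lemma clog_factor_sums:
  assumes "Re z > 0"
  shows "(\<lambda>k. exp (- z) ^ k / of_nat k) sums clog_factor z"
proof -
  have "norm (exp (- z)) < 1" using assms by simp
  hence "norm (- exp (- z)) < 1" by simp
  from sums_minus[OF Ln_series'[OF this]] show ?thesis unfolding clog_factor_def by simp
qed

lemma norm_clog_factor_le:
  assumes "Re z > 0"
  shows "norm (clog_factor z) \<le> exp (- Re z) / (1 - exp (- Re z))"
proof -
  define r where "r = exp (- Re z)"
  have r: "0 < r" "r < 1" unfolding r_def using assms by auto
  have n: "norm (exp (- z)) = r" unfolding r_def by simp
  have sm: "summable (\<lambda>k. r ^ Suc k)" using r by (simp add: summable_Suc_iff)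
  have "(\<lambda>k. exp (- z) ^ Suc k / of_nat (Suc k)) sums clog_factor z"
    using clog_factor_sums[OF assms] by (subst sums_Suc_iff) simp
  hence "norm (clog_factor z) = norm (\<Sum>k. exp (- z) ^ Suc k / of_nat (Suc k))" by (simp add: sums_iff)
  also have "\<dots> \<le> (\<Sum>k. r ^ Suc k)"
  proof (rule norm_suminf_le[OF _ sm])
    fix k
    have "norm (exp (- z) ^ Suc k / of_nat (Suc k)) = r ^ Suc k / real (Suc k)"
      unfolding norm_divide norm_power n by (simp del: of_nat_Suc)
    also have "\<dots> \<le> r ^ Suc k / 1" using r by (intro divide_left_mono) auto
    finally show "norm (exp (- z) ^ Suc k / of_nat (Suc k)) \<le> r ^ Suc k" by simp
  qed
  also have "\<dots> = r / (1 - r)" using r by (simp add: suminf_mult suminf_geometric)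
  finally show ?thesis unfolding r_def .
qed

lemma log_gf_summable:
  assumes D: "0 \<notin> D" and s: "Re s > 0"
  shows "summable (\<lambda>m. norm (if m \<in> D then clog_factor (of_nat m * s) else 0))"
proof (rule summable_comparison_test_ev)
  define r where "r = exp (- Re s)"
  have r: "0 < r" "r < 1" unfolding r_def using s by auto
  show "summable (\<lambda>m. r ^ m / (1 - r))" using r by (intro summable_divide summable_geometric) auto
  show "eventually (\<lambda>m. norm (norm (if m \<in> D then clog_factor (of_nat m * s) else 0)) \<le> r ^ m / (1 - r)) sequentially"
  proof (intro always_eventually allI)
    fix m
    show "norm (norm (if m \<in> D then clog_factor (of_nat m * s) else 0)) \<le> r ^ m / (1 - r)"
    proof (cases "m \<in> D")
      case True
      hence m: "m > 0" using D by (intro gr0I) auto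
      have e: "exp (- Re (of_nat m * s)) = r ^ m" unfolding r_def exp_of_nat_mult[symmetric] by simp
      have "norm (clog_factor (of_nat m * s)) \<le> r ^ m / (1 - r ^ m)"
        using norm_clog_factor_le[of "of_nat m * s"] m s unfolding e by simp
      also have "\<dots> \<le> r ^ m / (1 - r)"
      proof -
        have "r ^ m \<le> r" using r m power_decreasing[of 1 m r] by simp
        thus ?thesis using r by (intro divide_left_mono mult_pos_pos) auto
      qed
      finally show ?thesis using True by simp
    qed (use r in auto)
  qed
qed

text \<open>The sum of logarithms fixes a branch of the logarithm of the infinite product; the
  exponentials of its partial sums are the finite products whose limit is already
  identified.\<close>

lemma part_gf_exp:
  assumes D: "0 \<notin> D" and s: "Re s > 0"
  shows "(\<lambda>n. of_nat (part_count D n) * exp (- s) ^ n) sums exp (log_gf D s)"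
proof -
  have q: "norm (exp (- s)) < 1" using s by simp
  have "(\<lambda>M. exp (\<Sum>m<M. if m \<in> D then clog_factor (of_nat m * s) else 0)) \<longlonglongrightarrow> exp (log_gf D s)"
    unfolding log_gf_def
    by (intro tendsto_exp summable_LIMSEQ summable_norm_cancel[OF log_gf_summable[OF D s]])
  hence "(\<lambda>M. exp (\<Sum>m<Suc M. if m \<in> D then clog_factor (of_nat m * s) else 0)) \<longlonglongrightarrow> exp (log_gf D s)"
    by (rule LIMSEQ_Suc)
  moreover have "exp (\<Sum>m<Suc M. if m \<in> D then clog_factor (of_nat m * s) else 0) = (\<Prod>m\<in>D \<inter> {..M}. 1 / (1 - exp (- s) ^ m))" for M
  proof -
    have "(\<Sum>m<Suc M. if m \<in> D then clog_factor (of_nat m * s) else 0) = (\<Sum>m\<in>D \<inter> {..M}. clog_factor (of_nat m * s))"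
    proof -
      have "{..<Suc M} \<inter> D = D \<inter> {..M}" by auto
      thus ?thesis using sum.inter_restrict[of "{..<Suc M}" "\<lambda>m. clog_factor (of_nat m * s)" D] by simp
    qed
    moreover have "exp (clog_factor (of_nat m * s)) = 1 / (1 - exp (- s) ^ m)" if "m \<in> D \<inter> {..M}" for m
    proof -
      have m: "m > 0" using that D by (intro gr0I) auto
      have e: "exp (- (of_nat m * s)) = exp (- s) ^ m" by (simp add: exp_of_nat_mult[symmetric])
      have "norm (exp (- s) ^ m) < 1" unfolding norm_power using q m by (simp add: power_less_one_iff)
      hence "1 - exp (- s) ^ m \<noteq> 0" by auto
      thus ?thesis unfolding clog_factor_def e by (simp add: exp_minus field_simps)
    qed
    ultimately show ?thesis by (simp add: exp_sum)
  qed
  ultimately have "exp (log_gf D s) = (\<Sum>n. of_nat (part_count D n) * exp (- s) ^ n)"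
    using part_gf_limit[OF D q] LIMSEQ_unique by simp
  moreover have "summable (\<lambda>n. norm (of_nat (part_count D n) * exp (- s) ^ n))"
    unfolding norm_mult norm_power norm_of_nat by (rule part_summable[OF D norm_ge_zero q])
  hence "summable (\<lambda>n. of_nat (part_count D n) * exp (- s) ^ n)" by (rule summable_norm_cancel)
  ultimately show ?thesis by (simp add: sums_iff)
qed

definition part_sum :: "nat set \<Rightarrow> nat \<Rightarrow> nat" where "part_sum D n = (\<Sum>k\<le>n. part_count D k)"

lemma part_sum_gf:
  assumes D: "0 \<notin> D" and s: "Re s > 0"
  shows "(\<lambda>n. of_nat (part_sum D n) * exp (- s) ^ n) sums (exp (log_gf D s) / (1 - exp (- s)))"
    and "summable (\<lambda>n. real (part_sum D n) * exp (- Re s) ^ n)"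
proof -
  have q: "norm (exp (- s)) < 1" using s by simp
  have main: "summable (\<lambda>n. norm (of_nat (part_count D n) * exp (- s) ^ n))" if "Re s > 0" for s :: complex
    using part_summable[OF D, of "norm (exp (- s))"] that by (simp add: norm_mult norm_power)
  have geo: "summable (\<lambda>n. norm (exp (- s) ^ n))" if "Re s > 0" for s :: complex
    using that by (simp add: norm_power summable_geometric)
  have prod: "(\<Sum>i\<le>n. (of_nat (part_count D i) * exp (- s) ^ i) * exp (- s) ^ (n - i)) = of_nat (part_sum D n) * exp (- s) ^ n" for n and s :: complex
    unfolding part_sum_def of_nat_sum sum_distrib_right
    by (intro sum.cong refl) (simp add: mult.assoc power_add[symmetric])
  have sums: "(\<lambda>n. of_nat (part_sum D n) * exp (- s) ^ n) sums (exp (log_gf D s) / (1 - exp (- s)))" if s: "Re s > 0" for s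
    using Cauchy_product_sums[OF main[OF s] geo[OF s]] part_gf_exp[OF D s] s
    unfolding prod by (simp add: sums_iff suminf_geometric)
  show "(\<lambda>n. of_nat (part_sum D n) * exp (- s) ^ n) sums (exp (log_gf D s) / (1 - exp (- s)))" by (rule sums[OF s])
  have "summable (\<lambda>n. of_nat (part_sum D n) * exp (- complex_of_real (Re s)) ^ n)"
    using sums[of "of_real (Re s)"] s by (simp add: sums_iff)
  hence "summable (\<lambda>n. Re (of_nat (part_sum D n) * exp (- complex_of_real (Re s)) ^ n))" by (rule summable_Re)
  moreover have "Re (of_nat (part_sum D n) * exp (- complex_of_real (Re s)) ^ n) = real (part_sum D n) * exp (- Re s) ^ n" for n
  proof -
    have "of_nat (part_sum D n) * exp (- complex_of_real (Re s)) ^ n = of_real (real (part_sum D n) * exp (- Re s) ^ n)"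
      by (simp add: exp_of_real[symmetric] del: exp_of_real)
    thus ?thesis by (simp only: Re_complex_of_real)
  qed
  ultimately show "summable (\<lambda>n. real (part_sum D n) * exp (- Re s) ^ n)" by (simp only:)
qed

section \<open>Monotone Riemann sums\<close>

text \<open>One bound for all \<open>t\<close>: linear at 0, and with exponent 3/4 at infinity. That
  exponent is large enough for the later uses: squared it beats \<open>exp t\<close> by
  \<open>exp (t / 2)\<close>, cubed it beats \<open>exp (2 * t)\<close> by
  \<open>exp (t / 4)\<close>.\<close>

lemma exp_minus_1_ge: "t \<ge> 0 \<Longrightarrow> t * exp (3 * t / 4) / 4 \<le> exp t - (1 :: real)"
proof -
  assume t: "t \<ge> 0"
  have e: "exp t = exp (3 * t / 4) * exp (t / 4)" by (simp add: exp_add[symmetric])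
  have "t / (1 + t) \<le> 1 - exp (- t)"
  proof -
    have "1 + t \<le> exp t" by (rule exp_ge_add_one_self)
    hence "exp (- t) \<le> 1 / (1 + t)" using t by (simp add: exp_minus inverse_eq_divide divide_left_mono)
    moreover have "t / (1 + t) = 1 - 1 / (1 + t)" using t by (simp add: field_simps)
    ultimately show ?thesis by linarith
  qed
  moreover have "exp (t / 4) \<ge> (1 + t) / 4"
  proof -
    have "1 + t / 4 \<le> exp (t / 4)" by (rule exp_ge_add_one_self)
    moreover have "(1 + t) / 4 = 1 / 4 + t / 4" by (simp add: add_divide_distrib)
    ultimately show ?thesis by linarith
  qed
  ultimately have "(t / (1 + t)) * ((1 + t) / 4) \<le> (1 - exp (- t)) * exp (t / 4)"
    using t by (intro mult_mono) auto
  moreover have "(t / (1 + t)) * ((1 + t) / 4) = t / 4" using t by simp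
  ultimately have "t / 4 \<le> (1 - exp (- t)) * exp (t / 4)" by (simp only:)
  hence "exp (3 * t / 4) * (t / 4) \<le> exp (3 * t / 4) * ((1 - exp (- t)) * exp (t / 4))" by (intro mult_left_mono) auto
  also have "\<dots> = exp t * (1 - exp (- t))" unfolding e by (simp add: mult_ac)
  also have "\<dots> = exp t - 1" by (simp add: right_diff_distrib exp_add[symmetric])
  finally show ?thesis by (simp add: mult_ac)
qed

text \<open>With \<open>f t = - ln (1 - exp (- t))\<close>, this is \<open>- t * f' t\<close>, and
  \<open>bose2 t\<close> below is \<open>t^2 * f'' t\<close>: the Taylor coefficients of a log
  factor in the scale free variable \<open>u / t\<close>. The value 1 at 0 is the continuous
  extension.\<close>

definition bose1 :: "real \<Rightarrow> real" where "bose1 t = (if t = 0 then 1 else t / (exp t - 1))"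
definition bose2 :: "real \<Rightarrow> real" where "bose2 t = (if t = 0 then 1 else t ^ 2 * exp t / (exp t - 1) ^ 2)"

lemma bose1_bounds: "t \<ge> 0 \<Longrightarrow> 0 < bose1 t" "t \<ge> 0 \<Longrightarrow> bose1 t \<le> 4 * exp (- t / 2)"
proof -
  assume t: "t \<ge> 0"
  have "0 < bose1 t \<and> bose1 t \<le> 4 * exp (- t / 2)"
  proof (cases "t = 0")
    case False
    hence t: "t > 0" using t by simp
    have "t / (exp t - 1) \<le> t / (t * exp (3 * t / 4) / 4)"
      using exp_minus_1_ge[of t] t by (intro divide_left_mono mult_pos_pos) auto
    also have "\<dots> = 4 * exp (- (3 * t / 4))" using t by (simp add: exp_minus field_simps)
    also have "\<dots> \<le> 4 * exp (- t / 2)" using t by simp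
    finally show ?thesis using t unfolding bose1_def by simp
  qed (simp add: bose1_def)
  thus "0 < bose1 t" "bose1 t \<le> 4 * exp (- t / 2)" by auto
qed

lemma bose2_bounds: "t \<ge> 0 \<Longrightarrow> 0 < bose2 t" "t \<ge> 0 \<Longrightarrow> bose2 t \<le> 16 * exp (- t / 2)"
proof -
  assume t: "t \<ge> 0"
  have "0 < bose2 t \<and> bose2 t \<le> 16 * exp (- t / 2)"
  proof (cases "t = 0")
    case False
    hence t: "t > 0" using t by simp
    have "t ^ 2 * exp t / (exp t - 1) ^ 2 \<le> t ^ 2 * exp t / (t * exp (3 * t / 4) / 4) ^ 2"
      using exp_minus_1_ge[of t] t by (intro divide_left_mono mult_pos_pos power_mono zero_less_power) auto
    also have "(t * exp (3 * t / 4) / 4) ^ 2 = t ^ 2 * (exp t * exp (t / 2)) / 16"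
      by (simp add: power_mult_distrib power_divide exp_double[symmetric] exp_add[symmetric])
    also have "t ^ 2 * exp t / \<dots> = 16 * exp (- t / 2)" using t by (simp add: exp_minus field_simps)
    finally show ?thesis using t unfolding bose2_def by simp
  qed (simp add: bose2_def)
  thus "0 < bose2 t" "bose2 t \<le> 16 * exp (- t / 2)" by auto
qed

lemma continuous_bose1: "continuous_on {0..} bose1"
proof (rule continuous_at_imp_continuous_on, rule ballI)
  fix t :: real assume "t \<in> {0..}"
  show "isCont bose1 t"
  proof (cases "t = 0")
    case True
    have "((\<lambda>t::real. t / (exp t - 1)) \<longlongrightarrow> 1) (at 0)" by real_asymp
    hence "(bose1 \<longlongrightarrow> 1) (at 0)"
      by (rule Lim_transform_eventually) (auto simp: bose1_def eventually_at_filter)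
    thus ?thesis using True by (simp add: isCont_def bose1_def)
  next
    case False
    hence "isCont (\<lambda>t. t / (exp t - 1)) t" by (intro continuous_intros) auto
    moreover have "eventually (\<lambda>u. u / (exp u - 1) = bose1 u) (nhds t)"
      using False t1_space_nhds[of t 0] by (auto simp: bose1_def elim: eventually_mono)
    ultimately show ?thesis by (rule isCont_cong[THEN iffD1, rotated])
  qed
qed

lemma continuous_bose2: "continuous_on {0..} bose2"
proof (rule continuous_at_imp_continuous_on, rule ballI)
  fix t :: real assume "t \<in> {0..}"
  show "isCont bose2 t"
  proof (cases "t = 0")
    case True
    have "((\<lambda>t::real. t ^ 2 * exp t / (exp t - 1) ^ 2) \<longlongrightarrow> 1) (at 0)" by real_asymp
    hence "(bose2 \<longlongrightarrow> 1) (at 0)"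
      by (rule Lim_transform_eventually) (auto simp: bose2_def eventually_at_filter)
    thus ?thesis using True by (simp add: isCont_def bose2_def)
  next
    case False
    hence "isCont (\<lambda>t. t ^ 2 * exp t / (exp t - 1) ^ 2) t" by (intro continuous_intros) auto
    moreover have "eventually (\<lambda>u. u ^ 2 * exp u / (exp u - 1) ^ 2 = bose2 u) (nhds t)"
      using False t1_space_nhds[of t 0] by (auto simp: bose2_def elim: eventually_mono)
    ultimately show ?thesis by (rule isCont_cong[THEN iffD1, rotated])
  qed
qed

lemma bose1_antimono: "0 \<le> a \<Longrightarrow> a \<le> b \<Longrightarrow> bose1 b \<le> bose1 a"
proof -
  have pos: "bose1 b \<le> bose1 a" if "0 < a" "a \<le> b" for a b
  proof -
    have "a * (exp b - 1) - b * (exp a - 1) \<ge> 0"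
    proof -
      have "(\<lambda>b. a * (exp b - 1) - b * (exp a - 1)) a \<le> (\<lambda>b. a * (exp b - 1) - b * (exp a - 1)) b"
      proof (rule DERIV_nonneg_imp_nondecreasing[OF that(2)])
        fix x assume x: "a \<le> x" "x \<le> b"
        have d: "((\<lambda>b. a * (exp b - 1) - b * (exp a - 1)) has_real_derivative a * exp x - (exp a - 1)) (at x)"
          by (auto intro!: derivative_eq_intros)
        have "1 - a \<le> exp (- a)" using exp_ge_add_one_self[of "- a"] by simp
        hence "exp a * (1 - a) \<le> exp a * exp (- a)" by (intro mult_left_mono) auto
        hence "exp a - 1 \<le> a * exp a" by (simp add: exp_minus algebra_simps)
        also have "\<dots> \<le> a * exp x" using x that by (intro mult_left_mono) auto
        finally show "\<exists>y. ((\<lambda>b. a * (exp b - 1) - b * (exp a - 1)) has_real_derivative y) (at x) \<and> 0 \<le> y"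
          using d by (intro exI[of _ "a * exp x - (exp a - 1)"]) auto
      qed
      thus ?thesis by simp
    qed
    thus ?thesis using that unfolding bose1_def by (simp add: field_simps)
  qed
  assume ab: "0 \<le> a" "a \<le> b"
  show ?thesis
  proof (cases "a = 0")
    case True
    have "bose1 b \<le> 1"
    proof (cases "b = 0")
      case False
      have "b \<le> exp b - 1" using exp_ge_add_one_self[of b] by linarith
      thus ?thesis using False ab unfolding bose1_def by (simp add: divide_le_eq)
    qed (simp add: bose1_def)
    thus ?thesis using True by (simp add: bose1_def)
  qed (use pos ab in auto)
qed

text \<open>The form in which monotonicity is visible: \<open>x / sinh x\<close> decreases for
  positive \<open>x\<close> by the mean value theorem.\<close>

lemma bose2_sinh: "t \<noteq> 0 \<Longrightarrow> bose2 t = ((t/2) / sinh (t/2)) ^ 2"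
proof -
  assume t: "t \<noteq> 0"
  have "exp t - 1 = 2 * exp (t/2) * sinh (t/2)"
  proof -
    have 1: "exp t = exp (t/2) * exp (t/2)" and 2: "exp (t/2) * exp (- (t/2)) = 1"
      by (simp_all add: exp_add[symmetric])
    show ?thesis unfolding 1 sinh_field_def using 2 by (simp add: right_diff_distrib mult.assoc)
  qed
  hence "(exp t - 1) ^ 2 = 4 * exp t * sinh (t/2) ^ 2" by (simp add: power_mult_distrib exp_double[symmetric])
  thus ?thesis using t unfolding bose2_def by (simp add: power_divide field_simps)
qed

lemma bose2_antimono: "0 \<le> a \<Longrightarrow> a \<le> b \<Longrightarrow> bose2 b \<le> bose2 a"
proof -
  have pos: "a / sinh a \<ge> b / sinh b" if "0 < a" "a \<le> b" for a b :: real
  proof -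
    have "a * sinh b - b * sinh a \<ge> 0"
    proof -
      have "(\<lambda>b. a * sinh b - b * sinh a) a \<le> (\<lambda>b. a * sinh b - b * sinh a) b"
      proof (rule DERIV_nonneg_imp_nondecreasing[OF that(2)])
        fix x assume x: "a \<le> x" "x \<le> b"
        have d: "((\<lambda>b. a * sinh b - b * sinh a) has_real_derivative a * cosh x - sinh a) (at x)"
          by (auto intro!: derivative_eq_intros)
        obtain u where u: "0 < u" "u < a" "sinh a - sinh 0 = (a - 0) * cosh u"
        proof -
          have "\<exists>u>0. u < a \<and> sinh a - sinh 0 = (a - 0) * cosh u"
            using \<open>0 < a\<close> by (intro MVT2) (auto intro!: derivative_eq_intros)
          thus thesis using that by blast
        qed
        have "sinh a = a * cosh u" using u by simp
        also have "\<dots> \<le> a * cosh x" using u x that by (intro mult_left_mono) (auto simp: cosh_real_nonneg_le_iff)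
        finally show "\<exists>y. ((\<lambda>b. a * sinh b - b * sinh a) has_real_derivative y) (at x) \<and> 0 \<le> y"
          using d by (intro exI[of _ "a * cosh x - sinh a"]) auto
      qed
      thus ?thesis by simp
    qed
    moreover have "sinh a > 0" "sinh b > 0" using that by auto
    ultimately show ?thesis by (simp add: field_simps)
  qed
  assume ab: "0 \<le> a" "a \<le> b"
  show ?thesis
  proof (cases "a = 0")
    case True
    have "bose2 b \<le> 1"
    proof (cases "b = 0")
      case False
      hence b: "b > 0" using ab by simp
      obtain u where u: "0 < u" "u < b/2" "sinh (b/2) - sinh 0 = (b/2 - 0) * cosh u"
      proof -
        have "\<exists>u>0. u < b/2 \<and> sinh (b/2) - sinh 0 = (b/2 - 0) * cosh u"
          using b by (intro MVT2) (auto intro!: derivative_eq_intros)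
        thus thesis using that by blast
      qed
      have "b/2 * 1 \<le> b/2 * cosh u" using b by (intro mult_left_mono cosh_real_ge_1) auto
      hence "b/2 \<le> sinh (b/2)" using u by simp
      hence "(b/2) / sinh (b/2) \<le> 1" using b by (simp add: divide_le_eq)
      moreover have "(b/2) / sinh (b/2) \<ge> 0" using b by simp
      ultimately show ?thesis unfolding bose2_sinh[OF False] by (rule power_le_one[rotated])
    qed (simp add: bose2_def)
    thus ?thesis using True by (simp add: bose2_def)
  next
    case False
    hence a: "a > 0" "b > 0" using ab by auto
    have "(b/2) / sinh (b/2) \<le> (a/2) / sinh (a/2)" using a ab by (intro pos) auto
    thus ?thesis using a by (auto simp: bose2_sinh intro!: power_mono)
  qed
qed

text \<open>On each cell from \<open>j * h\<close> to \<open>(j + 1) * h\<close>, both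
  \<open>h * G (j * h + c)\<close> and the integral lie between \<open>h * G ((j + 1) * h)\<close>
  and \<open>h * G (j * h)\<close>, so the errors telescope to at most \<open>h * G 0\<close>.
  Uniformity in the offset \<open>c\<close> matters, since the offsets will be the residues modulo
  \<open>p\<close> times \<open>x\<close>. The number \<open>I\<close> is the integral of
  \<open>G\<close> over the half line, obtained as a supremum.\<close>

lemma monotone_Riemann_sum:
  fixes G :: "real \<Rightarrow> real"
  assumes anti: "\<And>a b. 0 \<le> a \<Longrightarrow> a \<le> b \<Longrightarrow> G b \<le> G a"
    and cont: "continuous_on {0..} G"
    and pos: "\<And>t. t \<ge> 0 \<Longrightarrow> G t > 0"
    and dec: "\<And>t. t \<ge> 0 \<Longrightarrow> G t \<le> C * exp (- t / 2)"
  shows "\<exists>I>0. \<forall>h>0. \<forall>c\<in>{0..h}. summable (\<lambda>j::nat. G (j * h + c)) \<and> \<bar>h * (\<Sum>j. G (j * h + c)) - I\<bar> \<le> h * G 0"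
proof -
  have summ: "summable (\<lambda>j::nat. G (j * h + c))" if "h > 0" "c \<ge> 0" for h c
  proof (rule summable_comparison_test_ev)
    have "C > 0" using pos[of 0] dec[of 0] by simp
    have "exp (- h / 2) < 1" using that by simp
    thus "summable (\<lambda>j. C * exp (- h / 2) ^ j)" by (intro summable_mult summable_geometric) simp
    show "eventually (\<lambda>j. norm (G (real j * h + c)) \<le> C * exp (- h / 2) ^ j) sequentially"
    proof (intro always_eventually allI)
      fix j :: nat
      have nn: "real j * h + c \<ge> 0" using that by simp
      have "norm (G (real j * h + c)) = G (real j * h + c)" using pos[OF nn] by simp
      also have "\<dots> \<le> C * exp (- (real j * h + c) / 2)" by (rule dec[OF nn])
      also have "\<dots> \<le> C * exp (real j * (- h / 2))" using \<open>C > 0\<close> that by (intro mult_left_mono) auto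
      finally show "norm (G (real j * h + c)) \<le> C * exp (- h / 2) ^ j" by (simp only: exp_of_nat_mult)
    qed
  qed
  have intg: "G integrable_on {a..b}" if "0 \<le> a" for a b
    using that by (intro integrable_continuous_real continuous_on_subset[OF cont]) auto
  define J where "J = (\<lambda>N h. integral {0..real N * h} G)"
  have J_Suc: "J (Suc N) h = J N h + integral {real N * h..real (Suc N) * h} G" if "h > 0" for N h
    unfolding J_def using that
    by (intro Henstock_Kurzweil_Integration.integral_combine[symmetric] intg) (auto intro!: mult_right_mono)
  have piece: "h * G (real (Suc N) * h) \<le> integral {real N * h..real (Suc N) * h} G"
    "integral {real N * h..real (Suc N) * h} G \<le> h * G (real N * h)" if h: "h > 0" for N h
  proof -
    have i: "G integrable_on {real N * h..real (Suc N) * h}" using h by (intro intg) auto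
    have len: "real (Suc N) * h - real N * h = h" by (simp add: algebra_simps)
    have "integral {real N * h..real (Suc N) * h} (\<lambda>_. G (real (Suc N) * h)) \<le> integral {real N * h..real (Suc N) * h} G"
    proof (rule integral_le[OF _ i])
      fix x assume x: "x \<in> {real N * h..real (Suc N) * h}"
      have "0 \<le> x" using x h by (auto intro: order_trans[rotated])
      thus "G (real (Suc N) * h) \<le> G x" using x by (intro anti) auto
    qed auto
    thus "h * G (real (Suc N) * h) \<le> integral {real N * h..real (Suc N) * h} G"
      using h len by (simp del: of_nat_Suc add: mult_right_mono)
    have "integral {real N * h..real (Suc N) * h} G \<le> integral {real N * h..real (Suc N) * h} (\<lambda>_. G (real N * h))"
    proof (rule integral_le[OF i])
      fix x assume x: "x \<in> {real N * h..real (Suc N) * h}"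
      thus "G x \<le> G (real N * h)" using h by (intro anti) auto
    qed auto
    thus "integral {real N * h..real (Suc N) * h} G \<le> h * G (real N * h)"
      using h len by (simp del: of_nat_Suc add: mult_right_mono)
  qed
  have diff: "\<bar>h * (\<Sum>j<N. G (real j * h + c)) - J N h\<bar> \<le> h * (G 0 - G (real N * h))" if h: "h > 0" "c \<in> {0..h}" for N h c
  proof (induction N)
    case 0
    thus ?case unfolding J_def by simp
  next
    case (Suc N)
    have "G (real N * h + c) \<le> G (real N * h)" using h by (intro anti) auto
    moreover have "G (real (Suc N) * h) \<le> G (real N * h + c)" using h by (intro anti) (auto simp: algebra_simps)
    ultimately have "h * G (real N * h + c) \<le> h * G (real N * h)" "h * G (real (Suc N) * h) \<le> h * G (real N * h + c)"
      using h by auto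
    hence "\<bar>h * G (real N * h + c) - integral {real N * h..real (Suc N) * h} G\<bar> \<le> h * G (real N * h) - h * G (real (Suc N) * h)"
      using piece[OF h(1), of N] by linarith
    moreover have "h * (\<Sum>j<Suc N. G (real j * h + c)) - J (Suc N) h =
      (h * (\<Sum>j<N. G (real j * h + c)) - J N h) + (h * G (real N * h + c) - integral {real N * h..real (Suc N) * h} G)"
      using h by (simp add: J_Suc distrib_left)
    ultimately show ?case using Suc by (simp add: right_diff_distrib)
  qed
  define I where "I = (SUP T\<in>{0..}. integral {0..T} G)"
  have Jmono: "integral {0..a} G \<le> integral {0..b} G" if "0 \<le> a" "a \<le> b" for a b
    using that pos by (intro integral_subset_le intg) (auto intro: less_imp_le)
  have bdd: "bdd_above ((\<lambda>T. integral {0..T} G) ` {0..})"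
  proof (rule bdd_aboveI2)
    fix T :: real assume T: "T \<in> {0..}"
    obtain N :: nat where N: "T \<le> real N" using real_arch_simple by blast
    have s: "summable (\<lambda>j. G (real j))" using summ[of 1 0] by simp
    have "integral {0..T} G \<le> J N 1" unfolding J_def using T N by (intro Jmono) auto
    also have "\<dots> \<le> (\<Sum>j<N. G (real j * 1 + 0)) + (G 0 - G (real N))" using diff[of 1 0 N] by simp
    also have "\<dots> \<le> (\<Sum>j. G (real j)) + G 0"
      using pos[of "real N"] sum_le_suminf[OF s, of "{..<N}"] pos by (simp add: less_imp_le add_mono)
    finally show "integral {0..T} G \<le> (\<Sum>j. G (real j)) + G 0" .
  qed
  have lim: "(\<lambda>N. J N h) \<longlonglongrightarrow> I" if h: "h > 0" for h
  proof (rule increasing_tendsto)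
    show "eventually (\<lambda>N. J N h \<le> I) sequentially"
      unfolding J_def I_def using h by (intro always_eventually allI cSUP_upper[OF _ bdd]) auto
    fix x assume "x < I"
    then obtain T where T: "T \<ge> 0" "x < integral {0..T} G"
      unfolding I_def using less_cSUP_iff[OF _ bdd] by auto
    obtain N :: nat where N: "T / h \<le> real N" using real_arch_simple by blast
    have "x < J n h" if "n \<ge> N" for n
    proof -
      have "T \<le> real N * h" using N h by (simp add: field_simps)
      also have "\<dots> \<le> real n * h" using that h by (intro mult_right_mono) auto
      finally have "integral {0..T} G \<le> J n h" unfolding J_def using T by (intro Jmono) auto
      thus ?thesis using T by simp
    qed
    thus "eventually (\<lambda>N. x < J N h) sequentially" by (rule eventually_sequentiallyI)
  qed
  have "I > 0"
  proof -
    have "0 < 1 * G (real (Suc 0) * 1)" using pos[of 1] by simp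
    also have "\<dots> \<le> J 1 1" using piece(1)[of 1 0] unfolding J_def by simp
    also have "\<dots> \<le> I" unfolding J_def I_def by (intro cSUP_upper[OF _ bdd]) auto
    finally show ?thesis .
  qed
  moreover have "\<bar>h * (\<Sum>j. G (real j * h + c)) - I\<bar> \<le> h * G 0" if h: "h > 0" "c \<in> {0..h}" for h c
  proof (rule tendsto_upperbound)
    have "summable (\<lambda>j. G (real j * h + c))" using h by (intro summ) auto
    thus "(\<lambda>N. \<bar>h * (\<Sum>j<N. G (real j * h + c)) - J N h\<bar>) \<longlonglongrightarrow> \<bar>h * (\<Sum>j. G (real j * h + c)) - I\<bar>"
      using h by (intro tendsto_intros summable_LIMSEQ lim)
    show "eventually (\<lambda>N. \<bar>h * (\<Sum>j<N. G (real j * h + c)) - J N h\<bar> \<le> h * G 0) sequentially"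
    proof (intro always_eventually allI)
      fix N
      have "G (real N * h) > 0" using h by (intro pos) auto
      hence "h * (G 0 - G (real N * h)) \<le> h * G 0" using h by (intro mult_left_mono) auto
      thus "\<bar>h * (\<Sum>j<N. G (real j * h + c)) - J N h\<bar> \<le> h * G 0" using diff[OF h, of N] by linarith
    qed
  qed simp
  ultimately show ?thesis using summ by (intro exI[of _ I]) auto
qed

section \<open>Expansion of the generating function near the origin\<close>

lemma clog_factor_derivs:
  assumes z: "Re z > 0"
  shows "(clog_factor has_field_derivative - 1 / (exp z - 1)) (at z)"
    and "((\<lambda>z. - 1 / (exp z - 1)) has_field_derivative exp z / (exp z - 1) ^ 2) (at z)"
    and "((\<lambda>z. exp z / (exp z - 1) ^ 2) has_field_derivative - (exp z * (exp z + 1)) / (exp z - 1) ^ 3) (at z)"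
proof -
  have n: "norm (exp (- z)) < 1" using z by simp
  have "Re (exp (- z)) < 1" using le_less_trans[OF complex_Re_le_cmod n] .
  hence re: "Re (1 - exp (- z)) > 0" by simp
  hence nn: "1 - exp (- z) \<notin> \<real>\<^sub>\<le>\<^sub>0" by (auto simp: complex_nonpos_Reals_iff)
  have "exp (- z) \<noteq> 1" using n by (metis norm_one less_irrefl)
  hence ne: "exp z - 1 \<noteq> 0" by (simp add: exp_minus)
  have "((\<lambda>z. 1 - exp (- z)) has_field_derivative exp (- z)) (at z)" by (auto intro!: derivative_eq_intros)
  from DERIV_minus[OF DERIV_chain2[OF has_field_derivative_Ln[OF nn] this]]
  have "(clog_factor has_field_derivative - (inverse (1 - exp (- z)) * exp (- z))) (at z)"
    unfolding clog_factor_def[abs_def] .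
  also have "- (inverse (1 - exp (- z)) * exp (- z)) = - 1 / (exp z - 1)"
    using ne by (simp add: exp_minus field_simps)
  finally show "(clog_factor has_field_derivative - 1 / (exp z - 1)) (at z)" .
  have d: "((\<lambda>z. exp z - 1) has_field_derivative exp z) (at z)" by (auto intro!: derivative_eq_intros)
  from DERIV_divide[OF DERIV_const[of "-1"] d ne]
  show "((\<lambda>z. - 1 / (exp z - 1)) has_field_derivative exp z / (exp z - 1) ^ 2) (at z)"
    by (simp add: power2_eq_square)
  have d2: "((\<lambda>z. (exp z - 1) ^ 2) has_field_derivative 2 * (exp z - 1) * exp z) (at z)"
    by (auto intro!: derivative_eq_intros)
  have ne2: "(exp z - 1) ^ 2 \<noteq> 0" using ne by simp
  define w where "w = exp z"
  have "(w * (w - 1) ^ 2 - w * (2 * (w - 1) * w)) / ((w - 1) ^ 2 * (w - 1) ^ 2) = - (w * (w + 1)) / (w - 1) ^ 3"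
  proof -
    have "w * (w - 1) ^ 2 - w * (2 * (w - 1) * w) = (- (w * (w + 1))) * (w - 1)"
      by (simp add: power2_eq_square algebra_simps)
    moreover have "(w - 1) ^ 2 * (w - 1) ^ 2 = (w - 1) ^ 3 * (w - 1)"
      by (simp add: power2_eq_square power3_eq_cube mult_ac)
    ultimately show ?thesis using ne unfolding w_def by simp
  qed
  thus "((\<lambda>z. exp z / (exp z - 1) ^ 2) has_field_derivative - (exp z * (exp z + 1)) / (exp z - 1) ^ 3) (at z)"
    using DERIV_divide[OF DERIV_exp d2 ne2] unfolding w_def by simp
qed

text \<open>At fixed real part \<open>exp z - 1\<close> has its least modulus on the real axis, so
  the bound holds on the whole half plane \<open>Re z \<ge> t\<close>, the convex set on which
  Taylor's formula is applied.\<close>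

lemma clog_factor_third_bound:
  assumes t: "t > 0" and z: "Re z \<ge> t"
  shows "norm (- (exp z * (exp z + 1)) / (exp z - 1) ^ 3) \<le> 128 * exp (- t / 4) / t ^ 3"
proof -
  define u where "u = Re z"
  have u: "u > 0" "u \<ge> t" using t z unfolding u_def by auto
  have e: "norm (exp z) = exp u" unfolding u_def by simp
  have "exp u - 1 \<le> norm (exp z - 1)" using norm_triangle_ineq2[of "exp z" 1] e by simp
  moreover have "u * exp (3 * u / 4) / 4 \<le> exp u - 1" using u by (intro exp_minus_1_ge) simp
  ultimately have den: "u * exp (3 * u / 4) / 4 \<le> norm (exp z - 1)" by linarith
  have "norm (exp z + 1) \<le> exp u + 1" using norm_triangle_ineq[of "exp z" 1] e by simp
  also have "\<dots> \<le> 2 * exp u" using u by simp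
  finally have num: "norm (exp z * (exp z + 1)) \<le> exp u * (2 * exp u)"
    unfolding norm_mult e by (intro mult_left_mono) auto
  have "norm (- (exp z * (exp z + 1)) / (exp z - 1) ^ 3) = norm (exp z * (exp z + 1)) / norm (exp z - 1) ^ 3"
    by (simp add: norm_divide norm_power)
  also have "\<dots> \<le> (exp u * (2 * exp u)) / (u * exp (3 * u / 4) / 4) ^ 3"
    using den num u by (intro frac_le power_mono zero_less_power) auto
  also have "(u * exp (3 * u / 4) / 4) ^ 3 = u ^ 3 * (exp u * exp u * exp (u / 4)) / 64"
  proof -
    have "exp (3 * u / 4) ^ 3 = exp u * exp u * exp (u / 4)"
      by (simp add: exp_of_nat_mult[symmetric] exp_add[symmetric] field_simps)
    thus ?thesis by (simp add: power_mult_distrib power_divide)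
  qed
  also have "(exp u * (2 * exp u)) / (u ^ 3 * (exp u * exp u * exp (u / 4)) / 64) = 128 * exp (- u / 4) / u ^ 3"
    using u by (simp add: exp_minus field_simps)
  also have "\<dots> \<le> 128 * exp (- t / 4) / t ^ 3"
    using u t by (intro frac_le power_mono mult_left_mono) auto
  finally show ?thesis .
qed

text \<open>Second order expansion at \<open>t\<close> in the imaginary direction. The factor
  \<open>1 / t^3\<close> in the bound for the third derivative turns \<open>u\<close> into the ratio
  \<open>u / t\<close>; for \<open>t = m * x\<close> and \<open>u = m * y\<close> this ratio does
  not depend on \<open>m\<close>.\<close>

lemma clog_factor_Taylor:
  assumes t: "t > 0"
  shows "norm (clog_factor (of_real t + \<i> * of_real u) - clog_factor (of_real t) + \<i> * of_real (u / t * bose1 t)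
      + of_real ((u / t) ^ 2 / 2 * bose2 t)) \<le> 64 * exp (- t / 4) * \<bar>u / t\<bar> ^ 3"
proof -
  define f where "f = (\<lambda>i::nat. if i = 0 then clog_factor else if i = 1 then (\<lambda>z. - 1 / (exp z - 1))
     else if i = 2 then (\<lambda>z. exp z / (exp z - 1) ^ 2) else (\<lambda>z. - (exp z * (exp z + 1)) / (exp z - 1) ^ 3))"
  define z :: complex where "z = of_real t + \<i> * of_real u"
  have f0: "f 0 = clog_factor" and f1: "f (Suc 0) = (\<lambda>z. - 1 / (exp z - 1))" and f2: "f 2 = (\<lambda>z. exp z / (exp z - 1) ^ 2)"
    unfolding f_def by simp_all
  have ne: "exp t - 1 \<noteq> 0" using t by simp
  have "norm (f 0 z - (\<Sum>i\<le>2. f i (of_real t) * (z - of_real t) ^ i / fact i)) \<le> (128 * exp (- t / 4) / t ^ 3) * norm (z - of_real t) ^ Suc 2 / fact 2"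
  proof (rule complex_Taylor[where S = "{z. Re z \<ge> t}"])
    show "convex {z. t \<le> Re z}" by (rule convex_halfspace_Re_ge)
    fix i x assume x: "x \<in> {z. t \<le> Re z}" and i: "i \<le> (2::nat)"
    have "Re x > 0" using x t by simp
    from clog_factor_derivs[OF this] i show "(f i has_field_derivative f (Suc i) x) (at x within {z. t \<le> Re z})"
      unfolding f_def by (cases "i = 0"; cases "i = 1"; cases "i = 2") (auto intro: has_field_derivative_at_within)
  next
    fix x assume "x \<in> {z. t \<le> Re z}"
    thus "norm (f (Suc 2) x) \<le> 128 * exp (- t / 4) / t ^ 3" unfolding f_def using clog_factor_third_bound[OF t, of x] by simp
  qed (auto simp: z_def)
  also have "norm (z - of_real t) = \<bar>u\<bar>" unfolding z_def by (simp add: norm_mult)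
  also have "(128 * exp (- t / 4) / t ^ 3) * \<bar>u\<bar> ^ Suc 2 / fact 2 = 64 * exp (- t / 4) * \<bar>u / t\<bar> ^ 3"
    using t by (simp add: abs_divide power_divide fact_numeral numeral_3_eq_3)
  also have "(\<Sum>i\<le>2. f i (of_real t) * (z - of_real t) ^ i / fact i) =
     clog_factor (of_real t) - \<i> * of_real (u / t * bose1 t) - of_real ((u / t) ^ 2 / 2 * bose2 t)"
  proof -
    have zt: "z - of_real t = \<i> * of_real u" unfolding z_def by simp
    have 1: "f (Suc 0) (of_real t) * (\<i> * of_real u) = - (\<i> * of_real (u / t * bose1 t))"
    proof -
      have "f (Suc 0) (of_real t) = of_real (- 1 / (exp t - 1))" unfolding f1 by (simp add: exp_of_real[symmetric])
      moreover have "u / t * bose1 t = u / (exp t - 1)" unfolding bose1_def using t by simp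
      ultimately show ?thesis by (simp add: mult_ac)
    qed
    have f2t: "f 2 (of_real t) = of_real (exp t / (exp t - 1) ^ 2)"
      unfolding f2 by (simp add: exp_of_real[symmetric])
    have 2: "f 2 (of_real t) * (\<i> * of_real u) ^ 2 / fact 2 = - of_real (exp t / (exp t - 1) ^ 2 * (u ^ 2 / 2))"
      unfolding f2t by (simp add: power_mult_distrib fact_numeral del: of_real_exp)
    have 3: "exp t / (exp t - 1) ^ 2 * (u ^ 2 / 2) = (u / t) ^ 2 / 2 * bose2 t"
      unfolding bose2_def using t by (simp add: power_divide mult_ac)
    have "(\<Sum>i\<le>2. f i (of_real t) * (z - of_real t) ^ i / fact i) = f 0 (of_real t) + f (Suc 0) (of_real t) * (\<i> * of_real u)
       + f 2 (of_real t) * (\<i> * of_real u) ^ 2 / fact 2"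
    proof -
      have "{..2::nat} = {0, Suc 0, 2}" by auto
      thus ?thesis unfolding zt by simp
    qed
    thus ?thesis unfolding 1 2 3 f0 by simp
  qed
  finally show ?thesis unfolding f0 z_def by (simp add: algebra_simps)
qed

text \<open>Each term of the logarithmic series has real part at most its value at the real point;
  only the deficit of the first term is kept.\<close>

lemma Re_clog_factor_le:
  assumes z: "Re z > 0"
  shows "Re (clog_factor z) \<le> Re (clog_factor (of_real (Re z))) - (exp (- Re z) - Re (exp (- z)))"
proof -
  define r where "r = exp (- Re z)"
  have r: "0 < r" "r < 1" unfolding r_def using z by auto
  have nr: "norm (exp (- z)) = r" unfolding r_def by simp
  have "(\<lambda>k. Re (exp (- of_real (Re z)) ^ k / of_nat k) - Re (exp (- z) ^ k / of_nat k)) sums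
     (Re (clog_factor (of_real (Re z))) - Re (clog_factor z))"
    using z by (intro sums_diff sums_Re clog_factor_sums) auto
  moreover have "Re (exp (- of_real (Re z)) ^ k / of_nat k) = r ^ k / real k" for k
  proof -
    have "exp (- complex_of_real (Re z)) ^ k / of_nat k = of_real (r ^ k / real k)"
      unfolding r_def by (simp add: exp_of_real[symmetric])
    thus ?thesis by (simp only: Re_complex_of_real)
  qed
  moreover have "Re (exp (- z) ^ k / of_nat k) = Re (exp (- z) ^ k) / real k" for k
    using Re_divide_of_nat[of "exp (- z) ^ k" k] by simp
  ultimately have s: "(\<lambda>k. r ^ k / real k - Re (exp (- z) ^ k) / real k) sums (Re (clog_factor (of_real (Re z))) - Re (clog_factor z))"
    by (simp only:)
  have nn: "r ^ k / real k - Re (exp (- z) ^ k) / real k \<ge> 0" for k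
  proof -
    have "Re (exp (- z) ^ k) \<le> norm (exp (- z) ^ k)" by (rule complex_Re_le_cmod)
    also have "\<dots> = r ^ k" by (simp add: norm_power nr del: norm_exp_eq_Re)
    finally show ?thesis by (simp add: divide_right_mono)
  qed
  have "(\<Sum>k\<in>{1}. r ^ k / real k - Re (exp (- z) ^ k) / real k) \<le> (\<Sum>k. r ^ k / real k - Re (exp (- z) ^ k) / real k)"
    using s nn by (intro sum_le_suminf) (auto simp: sums_iff)
  also have "\<dots> = Re (clog_factor (of_real (Re z))) - Re (clog_factor z)" using s by (simp add: sums_iff)
  finally show ?thesis unfolding r_def by simp
qed

text \<open>The integral of \<open>bose1\<close> over the positive half line. \<open>SOME\<close>
  picks the number provided by \<open>monotone_Riemann_sum\<close>; the estimate determines it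
  uniquely as \<open>h\<close> tends to 0.\<close>

definition bose1_int :: real where
  "bose1_int = (SOME I. I > 0 \<and> (\<forall>h>0. \<forall>c\<in>{0..h}. summable (\<lambda>j::nat. bose1 (j * h + c)) \<and> \<bar>h * (\<Sum>j. bose1 (j * h + c)) - I\<bar> \<le> h * bose1 0))"

definition bose2_int :: real where
  "bose2_int = (SOME I. I > 0 \<and> (\<forall>h>0. \<forall>c\<in>{0..h}. summable (\<lambda>j::nat. bose2 (j * h + c)) \<and> \<bar>h * (\<Sum>j. bose2 (j * h + c)) - I\<bar> \<le> h * bose2 0))"

lemma bose1_int:
  "bose1_int > 0" "h > 0 \<Longrightarrow> c \<in> {0..h} \<Longrightarrow> summable (\<lambda>j::nat. bose1 (j * h + c))"
  "h > 0 \<Longrightarrow> c \<in> {0..h} \<Longrightarrow> \<bar>h * (\<Sum>j. bose1 (j * h + c)) - bose1_int\<bar> \<le> h"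
proof -
  have "\<exists>I. I > 0 \<and> (\<forall>h>0. \<forall>c\<in>{0..h}. summable (\<lambda>j::nat. bose1 (j * h + c)) \<and> \<bar>h * (\<Sum>j. bose1 (j * h + c)) - I\<bar> \<le> h * bose1 0)"
    using monotone_Riemann_sum[OF bose1_antimono continuous_bose1 bose1_bounds(1) bose1_bounds(2)] by blast
  from someI_ex[OF this, folded bose1_int_def]
  show "bose1_int > 0" "h > 0 \<Longrightarrow> c \<in> {0..h} \<Longrightarrow> summable (\<lambda>j::nat. bose1 (j * h + c))"
    "h > 0 \<Longrightarrow> c \<in> {0..h} \<Longrightarrow> \<bar>h * (\<Sum>j. bose1 (j * h + c)) - bose1_int\<bar> \<le> h"
    by (auto simp: bose1_def[of 0])
qed

lemma bose2_int:
  "bose2_int > 0" "h > 0 \<Longrightarrow> c \<in> {0..h} \<Longrightarrow> summable (\<lambda>j::nat. bose2 (j * h + c))"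
  "h > 0 \<Longrightarrow> c \<in> {0..h} \<Longrightarrow> \<bar>h * (\<Sum>j. bose2 (j * h + c)) - bose2_int\<bar> \<le> h"
proof -
  have "\<exists>I. I > 0 \<and> (\<forall>h>0. \<forall>c\<in>{0..h}. summable (\<lambda>j::nat. bose2 (j * h + c)) \<and> \<bar>h * (\<Sum>j. bose2 (j * h + c)) - I\<bar> \<le> h * bose2 0)"
    using monotone_Riemann_sum[OF bose2_antimono continuous_bose2 bose2_bounds(1) bose2_bounds(2)] by blast
  from someI_ex[OF this, folded bose2_int_def]
  show "bose2_int > 0" "h > 0 \<Longrightarrow> c \<in> {0..h} \<Longrightarrow> summable (\<lambda>j::nat. bose2 (j * h + c))"
    "h > 0 \<Longrightarrow> c \<in> {0..h} \<Longrightarrow> \<bar>h * (\<Sum>j. bose2 (j * h + c)) - bose2_int\<bar> \<le> h"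
    by (auto simp: bose2_def[of 0])
qed

text \<open>The chord bound for \<open>sin (\<bar>u\<bar> / 2)\<close>, squared.\<close>

lemma one_minus_cos_ge: "\<bar>u\<bar> \<le> pi \<Longrightarrow> 2 * u ^ 2 / pi ^ 2 \<le> 1 - cos u"
proof -
  assume u: "\<bar>u\<bar> \<le> pi"
  have "2 * (\<bar>u\<bar> / 2) / pi \<le> sin (\<bar>u\<bar> / 2)" using u by (intro sin_ge_chord) auto
  hence "(\<bar>u\<bar> / pi) ^ 2 \<le> sin (\<bar>u\<bar> / 2) ^ 2" by (intro power_mono) auto
  moreover have "cos u = 1 - 2 * sin (\<bar>u\<bar> / 2) ^ 2" using cos_double_sin[of "\<bar>u\<bar> / 2"] by simp
  ultimately show ?thesis by (simp add: power_divide)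
qed

lemma norm_cis_minus_1_square: "norm (cis u - 1) ^ 2 = 2 * (1 - cos u)"
proof -
  have "norm (cis u - 1) ^ 2 = (cos u - 1) ^ 2 + sin u ^ 2" by (simp add: cmod_power2)
  also have "\<dots> = 2 * (1 - cos u)" using sin_cos_squared_add[of u] by (simp add: power2_eq_square algebra_simps)
  finally show ?thesis .
qed

text \<open>The residue \<open>b\<close> coprime to \<open>p\<close> guarantees that the allowed
  parts have no common factor. With a common factor the generating function would be as large at
  other points of the circle as at the real one.\<close>

locale residue_parts =
  fixes p :: nat and R :: "nat set" and b :: nat
  assumes p1: "p > 1" and R: "R \<subseteq> {1..<p}" and b: "b \<in> R" and cop: "coprime b p"
begin

definition D :: "nat set" where "D = {m. m mod p \<in> R}"

lemma zero_notin_D: "0 \<notin> D" using R unfolding D_def by auto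

lemma finite_R: "finite R" using R finite_subset by blast

lemma card_R_pos: "card R > 0" using b finite_R card_gt_0_iff by blast

lemma suminf_D:
  fixes f :: "nat \<Rightarrow> 'a :: banach"
  assumes tot: "summable (\<lambda>m. if m \<in> D then f m else 0)" and cls: "\<And>a. a \<in> R \<Longrightarrow> summable (\<lambda>j. f (j * p + a))"
  shows "(\<Sum>m. if m \<in> D then f m else 0) = (\<Sum>a\<in>R. \<Sum>j. f (j * p + a))"
proof -
  define g where "g = (\<lambda>m. if m \<in> D then f m else 0)"
  have "(\<lambda>j. sum g {j * p..<j * p + p}) sums (\<Sum>m. g m)"
    using tot p1 unfolding g_def by (intro sums_group summable_sums) auto
  moreover have "sum g {j * p..<j * p + p} = (\<Sum>a\<in>R. f (j * p + a))" for j
  proof -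
    have "sum g {j * p..<j * p + p} = (\<Sum>a<p. g (j * p + a))"
      by (rule sum.reindex_bij_witness[of _ "\<lambda>a. j * p + a" "\<lambda>m. m - j * p"]) auto
    also have "\<dots> = (\<Sum>a<p. if a \<in> R then f (j * p + a) else 0)"
      by (intro sum.cong refl) (simp add: g_def D_def)
    also have "\<dots> = (\<Sum>a\<in>{..<p} \<inter> R. f (j * p + a))" by (simp add: sum.inter_restrict)
    also have "{..<p} \<inter> R = R" using R by auto
    finally show ?thesis .
  qed
  ultimately have "(\<Sum>m. g m) = (\<Sum>j. \<Sum>a\<in>R. f (j * p + a))" by (simp add: sums_iff)
  also have "\<dots> = (\<Sum>a\<in>R. \<Sum>j. f (j * p + a))" by (rule suminf_sum) (rule cls)
  finally show ?thesis unfolding g_def .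
qed

lemma exp_summable: "x > 0 \<Longrightarrow> c > 0 \<Longrightarrow> summable (\<lambda>m::nat. exp (- (real m * x) / c))"
proof -
  assume "x > 0" "c > 0"
  hence "exp (- x / c) < 1" by simp
  hence "summable (\<lambda>m. exp (- x / c) ^ m)" by (intro summable_geometric) simp
  thus ?thesis by (simp add: exp_of_nat_mult[symmetric])
qed

text \<open>Splitting by residues \<open>a\<close> modulo \<open>p\<close> gives Riemann sums of
  mesh \<open>p * x\<close> with offset \<open>a * x\<close>. The leading term therefore depends on
  \<open>R\<close> only through its cardinality.\<close>

lemma bose_sum_aux:
  fixes G :: "real \<Rightarrow> real" and x I C :: real
  assumes G: "\<And>t. t \<ge> 0 \<Longrightarrow> 0 < G t" "\<And>t. t \<ge> 0 \<Longrightarrow> G t \<le> C * exp (- t / 2)"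
    and rs: "\<And>(h::real) (c::real). h > 0 \<Longrightarrow> c \<in> {0..h} \<Longrightarrow> summable (\<lambda>j::nat. G (j * h + c))"
      "\<And>(h::real) (c::real). h > 0 \<Longrightarrow> c \<in> {0..h} \<Longrightarrow> \<bar>h * (\<Sum>j. G (j * h + c)) - I\<bar> \<le> h"
    and x: "x > 0"
  shows "summable (\<lambda>m. if m \<in> D then G (real m * x) else 0)"
    and "\<bar>(\<Sum>m. if m \<in> D then G (real m * x) else 0) - card R * I / (p * x)\<bar> \<le> card R"
proof -
  show tot: "summable (\<lambda>m. if m \<in> D then G (real m * x) else 0)"
  proof (rule summable_comparison_test_ev)
    show "summable (\<lambda>m. C * exp (- (real m * x) / 2))" using x by (intro summable_mult exp_summable) auto
    show "eventually (\<lambda>m. norm (if m \<in> D then G (real m * x) else 0) \<le> C * exp (- (real m * x) / 2)) sequentially"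
    proof (intro always_eventually allI)
      fix m
      have "0 < G (real m * x)" "G (real m * x) \<le> C * exp (- (real m * x) / 2)" using G x by auto
      thus "norm (if m \<in> D then G (real m * x) else 0) \<le> C * exp (- (real m * x) / 2)" by auto
    qed
  qed
  define h where "h = p * x"
  have h: "h > 0" unfolding h_def using x p1 by simp
  have c: "real a * x \<in> {0..h}" if "a \<in> R" for a
  proof -
    have "a \<le> p" using that R by auto
    thus ?thesis unfolding h_def using x by (auto intro!: mult_right_mono)
  qed
  have eq: "G (real (j * p + a) * x) = G (real j * h + real a * x)" for j a unfolding h_def by (simp add: algebra_simps)
  have "(\<Sum>m. if m \<in> D then G (real m * x) else 0) = (\<Sum>a\<in>R. \<Sum>j. G (real (j * p + a) * x))"
    by (rule suminf_D) (use tot rs(1)[OF h c] in \<open>simp_all only: eq\<close>)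
  hence "(\<Sum>m. if m \<in> D then G (real m * x) else 0) - card R * I / (p * x) = (\<Sum>a\<in>R. (\<Sum>j. G (real j * h + real a * x)) - I / h)"
    unfolding eq h_def by (simp add: sum_subtractf)
  also have "\<bar>\<dots>\<bar> \<le> (\<Sum>a\<in>R. \<bar>(\<Sum>j. G (real j * h + real a * x)) - I / h\<bar>)" by (rule sum_abs)
  also have "\<dots> \<le> (\<Sum>a\<in>R. 1)"
  proof (rule sum_mono)
    fix a assume a: "a \<in> R"
    have "(\<Sum>j. G (real j * h + real a * x)) - I / h = (h * (\<Sum>j. G (real j * h + real a * x)) - I) / h" using h by (simp add: field_simps)
    also have "\<bar>\<dots>\<bar> \<le> h / h" unfolding abs_divide using rs(2)[OF h c[OF a]] h by (intro divide_mono) auto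
    finally show "\<bar>(\<Sum>j. G (real j * h + real a * x)) - I / h\<bar> \<le> 1" using h by simp
  qed
  finally show "\<bar>(\<Sum>m. if m \<in> D then G (real m * x) else 0) - card R * I / (p * x)\<bar> \<le> card R" by simp
qed

text \<open>This is \<open>- x\<close> times the derivative of \<open>log_gf D\<close> at
  \<open>x\<close>; \<open>B2 x\<close> is \<open>x^2\<close> times the second derivative.\<close>

definition B1 :: "real \<Rightarrow> real" where "B1 x = (\<Sum>m. if m \<in> D then bose1 (real m * x) else 0)"
definition B2 :: "real \<Rightarrow> real" where "B2 x = (\<Sum>m. if m \<in> D then bose2 (real m * x) else 0)"

lemma B1_summable: "(x::real) > 0 \<Longrightarrow> summable (\<lambda>m. if m \<in> D then bose1 (real m * x) else 0)"
  by (rule bose_sum_aux(1)[of bose1 4 bose1_int]) (use bose1_bounds bose1_int in auto)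

lemma B1_asymp:
  fixes x :: real
  shows "x > 0 \<Longrightarrow> \<bar>B1 x - card R * bose1_int / (p * x)\<bar> \<le> card R"
  unfolding B1_def by (rule bose_sum_aux(2)[of bose1 4 bose1_int]) (use bose1_bounds bose1_int in auto)

lemma B2_summable: "(x::real) > 0 \<Longrightarrow> summable (\<lambda>m. if m \<in> D then bose2 (real m * x) else 0)"
  by (rule bose_sum_aux(1)[of bose2 16 bose2_int]) (use bose2_bounds bose2_int in auto)

lemma B2_asymp:
  fixes x :: real
  shows "x > 0 \<Longrightarrow> \<bar>B2 x - card R * bose2_int / (p * x)\<bar> \<le> card R"
  unfolding B2_def by (rule bose_sum_aux(2)[of bose2 16 bose2_int]) (use bose2_bounds bose2_int in auto)

text \<open>All terms are expanded with the same ratio \<open>y / x\<close>, so the errors add up to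
  \<open>64 * \<bar>y / x\<bar>^3\<close> times a geometric series with value at most
  \<open>8 / x\<close>; hence the constant 512.\<close>

lemma log_gf_Taylor:
  assumes x: "0 < x" "x \<le> 1"
  shows "norm (log_gf D (of_real x + \<i> * of_real y) - log_gf D (of_real x) + \<i> * of_real (y / x * B1 x) + of_real ((y / x) ^ 2 / 2 * B2 x))
    \<le> 512 * \<bar>y / x\<bar> ^ 3 / x"
proof -
  define s where "s = of_real x + \<i> * of_real y"
  define E where "E = (\<lambda>m. if m \<in> D then clog_factor (of_nat m * s) - clog_factor (of_nat m * of_real x) + \<i> * of_real (y / x * bose1 (real m * x))
     + of_real ((y / x) ^ 2 / 2 * bose2 (real m * x)) else 0)"
  have sx: "Re s > 0" "Re (complex_of_real x) > 0" unfolding s_def using x by auto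
  note sums1 = summable_sums[OF summable_norm_cancel[OF log_gf_summable[OF zero_notin_D sx(1)]], folded log_gf_def]
  note sums2 = summable_sums[OF summable_norm_cancel[OF log_gf_summable[OF zero_notin_D sx(2)]], folded log_gf_def]
  have sums3: "(\<lambda>m. complex_of_real (if m \<in> D then bose1 (real m * x) else 0)) sums of_real (B1 x)"
    unfolding B1_def by (intro sums_of_real summable_sums B1_summable x)
  have sums4: "(\<lambda>m. complex_of_real (if m \<in> D then bose2 (real m * x) else 0)) sums of_real (B2 x)"
    unfolding B2_def by (intro sums_of_real summable_sums B2_summable x)
  have "E sums (log_gf D s - log_gf D (of_real x) + \<i> * of_real (y / x) * of_real (B1 x) + of_real ((y / x) ^ 2 / 2) * of_real (B2 x))"
  proof -
    have "E = (\<lambda>m. (if m \<in> D then clog_factor (of_nat m * s) else 0) - (if m \<in> D then clog_factor (of_nat m * of_real x) else 0)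
       + \<i> * of_real (y / x) * complex_of_real (if m \<in> D then bose1 (real m * x) else 0)
       + of_real ((y / x) ^ 2 / 2) * complex_of_real (if m \<in> D then bose2 (real m * x) else 0))"
      unfolding E_def by (auto simp: mult.assoc)
    thus ?thesis by (simp only:) (intro sums_add sums_diff sums_mult sums1 sums2 sums3 sums4)
  qed
  hence Esum: "log_gf D s - log_gf D (of_real x) + \<i> * of_real (y / x * B1 x) + of_real ((y / x) ^ 2 / 2 * B2 x) = (\<Sum>m. E m)"
    by (simp add: sums_iff mult.assoc)
  have bnd: "norm (E m) \<le> 64 * \<bar>y / x\<bar> ^ 3 * exp (- (real m * x) / 4)" for m
  proof (cases "m \<in> D")
    case True
    hence m: "m > 0" using zero_notin_D by (intro gr0I) auto
    define t where "t = real m * x"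
    define u where "u = real m * y"
    have t: "t > 0" unfolding t_def using m x by simp
    have ut: "u / t = y / x" unfolding u_def t_def using m by simp
    have e: "of_nat m * s = of_real t + \<i> * of_real u" "of_nat m * complex_of_real x = of_real t"
      unfolding s_def t_def u_def by (simp_all add: algebra_simps)
    have "E m = clog_factor (of_real t + \<i> * of_real u) - clog_factor (of_real t) + \<i> * of_real (u / t * bose1 t)
      + of_real ((u / t) ^ 2 / 2 * bose2 t)"
      unfolding E_def e ut using True by (simp add: t_def)
    also have "norm \<dots> \<le> 64 * exp (- t / 4) * \<bar>u / t\<bar> ^ 3" by (rule clog_factor_Taylor[OF t])
    finally have "norm (E m) \<le> 64 * exp (- t / 4) * \<bar>y / x\<bar> ^ 3" by (simp only: ut)
    thus ?thesis unfolding t_def by (simp only: mult_ac)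
  next
    case False
    thus ?thesis unfolding E_def by simp
  qed
  have sm: "summable (\<lambda>m. 64 * \<bar>y / x\<bar> ^ 3 * exp (- (real m * x) / 4))" using x by (intro summable_mult exp_summable) auto
  have "norm (\<Sum>m. E m) \<le> (\<Sum>m. 64 * \<bar>y / x\<bar> ^ 3 * exp (- (real m * x) / 4))"
    by (rule norm_suminf_le[OF bnd sm])
  also have "\<dots> = 64 * \<bar>y / x\<bar> ^ 3 * (\<Sum>m. exp (- (real m * x) / 4))"
    using x by (intro suminf_mult exp_summable) auto
  also have "(\<Sum>m. exp (- (real m * x) / 4)) \<le> 8 / x"
  proof -
    have e1: "exp (- x / 4) < 1" using x by simp
    have "(\<Sum>m. exp (- (real m * x) / 4)) = (\<Sum>m. exp (- x / 4) ^ m)" by (simp add: exp_of_nat_mult[symmetric])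
    also have "\<dots> = 1 / (1 - exp (- x / 4))" using e1 by (intro suminf_geometric) simp
    also have "\<dots> \<le> 1 / (x / 8)"
    proof (intro divide_left_mono)
      have "1 + x / 4 \<le> exp (x / 4)" by (rule exp_ge_add_one_self)
      hence "exp (- x / 4) \<le> 1 / (1 + x / 4)" using x by (simp add: exp_minus inverse_eq_divide divide_left_mono)
      also have "\<dots> \<le> 1 - x / 8" using x by (simp add: field_simps)
      finally show "x / 8 \<le> 1 - exp (- x / 4)" by simp
    qed (use x e1 in auto)
    finally show ?thesis by simp
  qed
  finally have "norm (\<Sum>m. E m) \<le> 64 * \<bar>y / x\<bar> ^ 3 * (8 / x)" by (simp add: mult_left_mono)
  thus ?thesis unfolding Esum[symmetric] s_def by simp
qed

text \<open>The decay away from the real axis is already forced by the parts congruent to \<open>b\<close>.\<close>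

definition W :: "real \<Rightarrow> real \<Rightarrow> real" where
  "W x y = exp (- (real b * x)) * (1 / (1 - exp (- (real p * x))) - Re (cis (real b * y) / (1 - exp (- (real p * x)) * cis (real p * y))))"

text \<open>Of \<open>D\<close> only the parts \<open>j * p + b\<close> are kept, and of each
  logarithm only the first term of its series. The remaining sum of
  \<open>exp (- m * x) * (1 - cos (m * y))\<close> is a difference of two geometric series, whose
  closed form is \<open>W x y\<close>.\<close>

lemma Re_log_gf_le:
  assumes x: "x > 0"
  shows "Re (log_gf D (of_real x + \<i> * of_real y)) \<le> Re (log_gf D (of_real x)) - W x y"
proof -
  define s where "s = of_real x + \<i> * of_real y"
  define f where "f = (\<lambda>m. exp (- (real m * x)) * (1 - cos (real m * y)))"
  have sx: "Re s > 0" "Re (complex_of_real x) > 0" unfolding s_def using x by auto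
  note sums1 = sums_Re[OF summable_sums[OF summable_norm_cancel[OF log_gf_summable[OF zero_notin_D sx(1)]], folded log_gf_def]]
  note sums2 = sums_Re[OF summable_sums[OF summable_norm_cancel[OF log_gf_summable[OF zero_notin_D sx(2)]], folded log_gf_def]]
  have f0: "f m \<ge> 0" for m unfolding f_def by simp
  have fle: "f m \<le> 2 * exp (- (real m * x) / 1)" for m
    unfolding f_def using cos_ge_minus_one[of "real m * y"] by (simp add: mult.commute)
  have fsum: "summable f"
  proof (rule summable_comparison_test_ev)
    show "summable (\<lambda>m. 2 * exp (- (real m * x) / 1))" by (intro summable_mult exp_summable x) simp
    show "eventually (\<lambda>m. norm (f m) \<le> 2 * exp (- (real m * x) / 1)) sequentially"
      using f0 fle by (intro always_eventually allI) simp
  qed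
  have diff: "(\<lambda>m. Re (if m \<in> D then clog_factor (of_nat m * of_real x) else 0) - Re (if m \<in> D then clog_factor (of_nat m * s) else 0)) sums
     (Re (log_gf D (of_real x)) - Re (log_gf D s))"
    by (rule sums_diff[OF sums2 sums1])
  have trm: "(if m \<in> D then f m else 0) \<le> Re (if m \<in> D then clog_factor (of_nat m * of_real x) else 0) - Re (if m \<in> D then clog_factor (of_nat m * s) else 0)" for m
  proof (cases "m \<in> D")
    case True
    hence m: "m > 0" using zero_notin_D by (intro gr0I) auto
    define z where "z = of_nat m * s"
    have rz: "Re z = real m * x" "Im z = real m * y" unfolding z_def s_def by simp_all
    have "Re (clog_factor z) \<le> Re (clog_factor (of_real (Re z))) - (exp (- Re z) - Re (exp (- z)))"
      using m x rz by (intro Re_clog_factor_le) simp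
    moreover have "exp (- Re z) - Re (exp (- z)) = f m" unfolding f_def Re_exp rz by (simp add: rz right_diff_distrib)
    ultimately have "f m \<le> Re (clog_factor (of_real (Re z))) - Re (clog_factor z)" by linarith
    moreover have "complex_of_real (Re z) = of_nat m * of_real x" unfolding rz by simp
    ultimately show ?thesis using True unfolding z_def by (simp only: if_True)
  qed simp
  have sumD: "summable (\<lambda>m. if m \<in> D then f m else 0)"
    by (rule summable_comparison_test_ev[OF _ fsum]) (auto simp: f0 abs_of_nonneg)
  define \<rho> where "\<rho> = exp (- (p * x))"
  have \<rho>: "0 < \<rho>" "\<rho> < 1" unfolding \<rho>_def using x p1 by auto
  have rem: "Re (of_real r * w) = r * Re w" for r w by simp
  have s1: "(\<lambda>j. exp (- (real b * x)) * \<rho> ^ j) sums (exp (- (real b * x)) * (1 / (1 - \<rho>)))"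
    using \<rho> by (intro sums_mult geometric_sums) auto
  have s2: "(\<lambda>j. (exp (- (real b * x)) * cis (b * y)) * (\<rho> * cis (p * y)) ^ j) sums ((exp (- (real b * x)) * cis (b * y)) * (1 / (1 - \<rho> * cis (p * y))))"
    using \<rho> by (intro sums_mult geometric_sums) (auto simp: norm_mult)
  have fj: "exp (- (real b * x)) * \<rho> ^ j - Re ((exp (- (real b * x)) * cis (b * y)) * (\<rho> * cis (p * y)) ^ j) = f (j * p + b)" for j
  proof -
    have e: "exp (- (real b * x)) * \<rho> ^ j = exp (- (real (j * p + b) * x))"
      unfolding \<rho>_def exp_of_nat_mult[symmetric] exp_add[symmetric] by (simp add: algebra_simps)
    have "cis (b * y) * cis (p * y) ^ j = cis (real (j * p + b) * y)"
      unfolding Complex.DeMoivre cis_mult by (simp add: algebra_simps)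
    hence "(exp (- (real b * x)) * cis (b * y)) * (\<rho> * cis (p * y)) ^ j = of_real (exp (- (real b * x)) * \<rho> ^ j) * cis (real (j * p + b) * y)"
      by (simp add: power_mult_distrib mult_ac)
    hence "Re ((exp (- (real b * x)) * cis (b * y)) * (\<rho> * cis (p * y)) ^ j) = exp (- (real (j * p + b) * x)) * cos (real (j * p + b) * y)"
      by (simp only: rem e cis.sel)
    thus ?thesis unfolding e f_def by (simp add: right_diff_distrib)
  qed
  have "(\<lambda>j. f (j * p + b)) sums (exp (- (real b * x)) * (1 / (1 - \<rho>)) - Re ((exp (- (real b * x)) * cis (b * y)) * (1 / (1 - \<rho> * cis (p * y)))))"
    using sums_diff[OF s1 sums_Re[OF s2]] unfolding fj .
  moreover have "exp (- (real b * x)) * (1 / (1 - \<rho>)) - Re ((exp (- (real b * x)) * cis (b * y)) * (1 / (1 - \<rho> * cis (p * y)))) = W x y"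
  proof -
    have "(exp (- (real b * x)) * cis (b * y)) * (1 / (1 - \<rho> * cis (p * y))) = of_real (exp (- (real b * x))) * (cis (b * y) / (1 - \<rho> * cis (p * y)))"
      by simp
    hence "Re ((exp (- (real b * x)) * cis (b * y)) * (1 / (1 - \<rho> * cis (p * y)))) = exp (- (real b * x)) * Re (cis (b * y) / (1 - \<rho> * cis (p * y)))"
      by (simp only: rem)
    thus ?thesis unfolding W_def \<rho>_def[symmetric] by (simp add: right_diff_distrib)
  qed
  ultimately have sW: "(\<lambda>j. f (j * p + b)) sums W x y" by (simp only:)
  have bD: "j * p + b \<in> D" for j using b R unfolding D_def by auto
  have "W x y \<le> (\<Sum>m. if m \<in> D then f m else 0)"
  proof -
    have "(\<Sum>j. f (j * p + b)) \<le> (\<Sum>m. if m \<in> D then f m else 0)"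
    proof (rule suminf_le_const)
      show "summable (\<lambda>j. f (j * p + b))" using sW by (simp add: sums_iff)
      fix J
      have inj: "inj_on (\<lambda>j. j * p + b) {..<J}" using p1 by (auto simp: inj_on_def)
      have "(\<Sum>j<J. f (j * p + b)) = (\<Sum>m\<in>(\<lambda>j. j * p + b) ` {..<J}. if m \<in> D then f m else 0)"
        unfolding sum.reindex[OF inj] by (simp add: bD)
      also have "\<dots> \<le> (\<Sum>m. if m \<in> D then f m else 0)"
        using sumD f0 by (intro sum_le_suminf) auto
      finally show "(\<Sum>j<J. f (j * p + b)) \<le> (\<Sum>m. if m \<in> D then f m else 0)" .
    qed
    thus ?thesis using sW by (simp add: sums_iff)
  qed
  also have "\<dots> \<le> Re (log_gf D (of_real x)) - Re (log_gf D s)"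
    using sums_le[OF trm summable_sums[OF sumD] diff] .
  finally show ?thesis unfolding s_def by simp
qed

section \<open>Lower bounds for the decay off the real axis\<close>

lemma norm_Z_square:
  "norm (1 - of_real \<rho> * cis u) ^ 2 = (1 - \<rho>) ^ 2 + \<rho> * norm (cis u - 1) ^ 2"
proof -
  have "norm (1 - of_real \<rho> * cis u) ^ 2 = (1 - \<rho> * cos u) ^ 2 + (\<rho> * sin u) ^ 2" by (simp add: cmod_power2)
  also have "\<dots> = 1 - 2 * \<rho> * cos u + \<rho> ^ 2 * (cos u ^ 2 + sin u ^ 2)"
    unfolding power2_diff power_mult_distrib distrib_left by simp
  also have "cos u ^ 2 + sin u ^ 2 = 1" by simp
  also have "1 - 2 * \<rho> * cos u + \<rho> ^ 2 * 1 = (1 - \<rho>) ^ 2 + \<rho> * (2 * (1 - cos u))" by (simp add: power2_eq_square algebra_simps)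
  finally show ?thesis by (simp only: norm_cis_minus_1_square)
qed

text \<open>The assumption makes \<open>Z\<close> exceed \<open>1 - \<rho>\<close> in modulus by the
  factor \<open>1 + \<mu> / 12\<close>, so that even the modulus of the oscillating geometric series
  falls below the real one. The constants come from
  \<open>(1 + \<mu> / 12)^2 \<le> 1 + \<mu> / 5\<close>, then
  \<open>1 + \<mu> / 12 \<le> 13 / 12\<close>, and \<open>exp (- (b * x)) \<ge> 1 / 2\<close>;
  together they leave the denominator 26.\<close>

lemma W_lower_aux:
  fixes x y \<mu> :: real
  assumes x: "0 < x" "p * x \<le> 1 / 2" and \<mu>: "0 \<le> \<mu>" "\<mu> \<le> 1"
    and key: "(1 - exp (- (p * x))) ^ 2 * \<mu> / 5 \<le> exp (- (p * x)) * norm (cis (p * y) - 1) ^ 2"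
  shows "W x y \<ge> \<mu> / (26 * p * x)"
proof -
  define \<rho> where "\<rho> = exp (- (p * x))"
  define Z where "Z = 1 - of_real \<rho> * cis (p * y)"
  have \<rho>1: "1 - p * x \<le> \<rho>" unfolding \<rho>_def using exp_ge_add_one_self[of "- (p * x)"] by simp
  have \<rho>: "1/2 \<le> \<rho>" "\<rho> < 1" "1 - \<rho> \<le> p * x" using \<rho>1 x p1 unfolding \<rho>_def by auto
  have px: "p * x > 0" using x p1 by simp
  have "((1 - \<rho>) * (1 + \<mu> / 12)) ^ 2 = (1 - \<rho>) ^ 2 * (1 + \<mu> / 6 + \<mu> * \<mu> / 144)"
  proof -
    have "(1 + \<mu> / 12) ^ 2 = 1 + \<mu> / 6 + \<mu> * \<mu> / 144" by (simp add: power2_eq_square field_simps)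
    thus ?thesis by (simp only: power_mult_distrib)
  qed
  also have "\<dots> \<le> (1 - \<rho>) ^ 2 * (1 + \<mu> / 5)"
  proof (intro mult_left_mono)
    have "\<mu> * \<mu> \<le> \<mu> * 1" using \<mu> by (intro mult_left_mono) auto
    thus "1 + \<mu> / 6 + \<mu> * \<mu> / 144 \<le> 1 + \<mu> / 5" using \<mu> by simp
  qed auto
  also have "\<dots> \<le> norm Z ^ 2" unfolding Z_def norm_Z_square using key unfolding \<rho>_def[symmetric] by (simp add: distrib_left)
  finally have nZ: "(1 - \<rho>) * (1 + \<mu> / 12) \<le> norm Z" by (rule power2_le_imp_le) simp
  have "Re (cis (b * y) / Z) \<le> norm (cis (b * y) / Z)" by (rule complex_Re_le_cmod)
  also have "\<dots> = 1 / norm Z" by (simp add: norm_divide)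
  also have "\<dots> \<le> 1 / ((1 - \<rho>) * (1 + \<mu> / 12))"
  proof (intro divide_left_mono nZ)
    have "(1 - \<rho>) * (1 + \<mu> / 12) > 0" using \<rho> \<mu> by (intro mult_pos_pos) auto
    thus "norm Z * ((1 - \<rho>) * (1 + \<mu> / 12)) > 0" using nZ by (metis mult_pos_pos less_le_trans)
  qed simp
  finally have "1 / (1 - \<rho>) - Re (cis (b * y) / Z) \<ge> 1 / (1 - \<rho>) - 1 / ((1 - \<rho>) * (1 + \<mu> / 12))" by simp
  moreover have "1 / (1 - \<rho>) - 1 / ((1 - \<rho>) * (1 + \<mu> / 12)) = (1 / (1 - \<rho>)) * ((\<mu> / 12) / (1 + \<mu> / 12))"
  proof -
    define \<sigma> \<tau> where "\<sigma> = 1 - \<rho>" and "\<tau> = \<mu> / 12"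
    have "\<sigma> \<noteq> 0" "1 + \<tau> \<noteq> 0" unfolding \<sigma>_def \<tau>_def using \<rho> \<mu> by auto
    moreover from this have "\<tau> / (1 + \<tau>) = 1 - 1 / (1 + \<tau>)" by (simp add: field_simps)
    ultimately show ?thesis unfolding \<sigma>_def[symmetric] \<tau>_def[symmetric] by (simp add: right_diff_distrib)
  qed
  moreover have "(1 / (1 - \<rho>)) * ((\<mu> / 12) / (1 + \<mu> / 12)) \<ge> (1 / (p * x)) * ((\<mu> / 12) / (13 / 12))"
    using \<rho> \<mu> px by (intro mult_mono divide_left_mono) auto
  ultimately have lb: "1 / (1 - \<rho>) - Re (cis (b * y) / Z) \<ge> \<mu> / (13 * (p * x))" by simp
  have "exp (- (real b * x)) \<ge> 1 / 2"
  proof -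
    have "real b * x \<le> real p * x" using b R x by (intro mult_right_mono) auto
    hence "\<rho> \<le> exp (- (real b * x))" unfolding \<rho>_def by simp
    thus ?thesis using \<rho> by simp
  qed
  hence "exp (- (real b * x)) * (1 / (1 - \<rho>) - Re (cis (b * y) / Z)) \<ge> 1 / 2 * (\<mu> / (13 * (p * x)))"
    using lb \<mu> px by (intro mult_mono) auto
  thus ?thesis unfolding W_def \<rho>_def[symmetric] Z_def[symmetric] by (simp add: mult.assoc)
qed

text \<open>Here \<open>p * y\<close> stays within half a turn, so \<open>cis (p * y)\<close> moves
  away from 1 at a rate proportional to \<open>y\<close>.\<close>

lemma W_lower_small:
  fixes x y :: real
  assumes x: "0 < x" "p * x \<le> 1 / 2" and y: "\<bar>y\<bar> \<le> pi / p"
  shows "W x y \<ge> min 1 ((y / x) ^ 2) / (26 * p * x)"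
proof (rule W_lower_aux[OF x])
  define \<rho> where "\<rho> = exp (- (p * x))"
  have \<rho>1: "1 - p * x \<le> \<rho>" unfolding \<rho>_def using exp_ge_add_one_self[of "- (p * x)"] by simp
  have \<rho>: "1/2 \<le> \<rho>" "\<rho> < 1" "1 - \<rho> \<le> p * x" using \<rho>1 x p1 unfolding \<rho>_def by auto
  have "(1 - \<rho>) ^ 2 * min 1 ((y / x) ^ 2) / 5 \<le> (p * x) ^ 2 * (y / x) ^ 2 / 5"
    using \<rho> by (intro divide_right_mono mult_mono power_mono) auto
  also have "\<dots> = (p * y) ^ 2 / 5" using x by (simp add: power_mult_distrib power_divide)
  also have "\<dots> \<le> 1 / 2 * (2 * (2 * (p * y) ^ 2 / pi ^ 2))"
  proof -
    have "pi ^ 2 \<le> 3.15 ^ 2" using pi_approx by (intro power_mono) auto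
    hence "pi ^ 2 \<le> 10" by (simp add: power2_eq_square)
    hence "(p * y) ^ 2 / 5 \<le> 2 * (p * y) ^ 2 / pi ^ 2" by (simp add: field_simps mult_right_mono)
    thus ?thesis by simp
  qed
  also have "\<dots> \<le> \<rho> * norm (cis (p * y) - 1) ^ 2"
    unfolding norm_cis_minus_1_square
  proof (intro mult_mono)
    have "\<bar>p * y\<bar> \<le> pi" using y p1 by (simp add: abs_mult field_simps)
    thus "2 * (p * y) ^ 2 / pi ^ 2 \<le> 1 - cos (p * y)" by (rule one_minus_cos_ge)
  qed (use \<rho> in auto)
  finally show "(1 - exp (- (p * x))) ^ 2 * min 1 ((y / x) ^ 2) / 5 \<le> exp (- (p * x)) * norm (cis (p * y) - 1) ^ 2"
    unfolding \<rho>_def .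
qed auto

text \<open>Two sources of decay. Unless \<open>p * y\<close> is nearly a multiple of
  \<open>2 * pi\<close>, the denominator \<open>Z\<close> is large. If it is, then
  \<open>b * s = t * p + 1\<close> makes \<open>cis y\<close> nearly equal to
  \<open>cis (b * y) ^ s\<close>; since \<open>\<bar>y\<bar>\<close> is between
  \<open>pi / p\<close> and \<open>pi\<close>, \<open>cis y\<close> is away from 1, hence so is
  \<open>cis (b * y)\<close>, and the numerator loses real part.\<close>

lemma W_lower_large: "\<exists>c>0. \<exists>x0>0. \<forall>(x::real) (y::real). 0 < x \<and> x \<le> x0 \<and> pi / p \<le> \<bar>y\<bar> \<and> \<bar>y\<bar> \<le> pi \<longrightarrow> W x y \<ge> c / x"
proof -
  have b0: "b > 0" using b R by auto
  obtain s where s: "[b * s = 1] (mod p)" using cong_solve_coprime_nat[OF cop] by auto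
  have s0: "s > 0" using s p1 by (intro gr0I) (auto simp: unique_euclidean_semiring_class.cong_def)
  obtain t where t: "b * s = t * p + 1"
  proof -
    have "b * s mod p = 1" using s p1 by (simp add: unique_euclidean_semiring_class.cong_def)
    hence "b * s = (b * s div p) * p + 1" by (metis div_mult_mod_eq)
    thus thesis using that by blast
  qed
  \<comment> \<open>\<open>\<delta>\<close> will be a lower bound for the distance of
    \<open>cis (b * y)\<close> from 1, so that
    \<open>1 - cos (b * y) \<ge> \<delta>^2 / 2 = 2 * \<theta>\<close>. Half of this gain is spent
    on replacing \<open>Z\<close> by \<open>1 - \<rho>\<close>.\<close>
  define \<delta> where "\<delta> = 1 / (real p * real s)"
  have \<delta>: "0 < \<delta>" "\<delta> \<le> 1"
  proof -
    show "0 < \<delta>" unfolding \<delta>_def using p1 s0 by simp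
    have "1 * 1 \<le> real p * real s" using p1 s0 by (intro mult_mono) auto
    thus "\<delta> \<le> 1" unfolding \<delta>_def by simp
  qed
  define \<theta> where "\<theta> = \<delta> ^ 2 / 4"
  have "\<delta> ^ 2 \<le> 1" using \<delta> by (simp add: power_le_one)
  hence \<theta>: "0 < \<theta>" "\<theta> \<le> 1 / 4" unfolding \<theta>_def using \<delta> by auto
  \<comment> \<open>The second bound ensures \<open>t * norm (cis (p * y) - 1) \<le> 1 / p\<close>,
    half of the lower bound \<open>2 / p\<close> for \<open>norm (cis y - 1)\<close>.\<close>
  define x0 where "x0 = min (1 / (2 * p)) (1 / (real p * (real t + 1) * real p))"
  define c where "c = \<theta> ^ 2 / (52 * p)"
  have x00: "x0 > 0" unfolding x0_def using p1 by simp
  have c0: "c > 0" unfolding c_def using \<theta> p1 by simp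
  have "W x y \<ge> c / x" if h: "0 < x" "x \<le> x0" "pi / p \<le> \<bar>y\<bar>" "\<bar>y\<bar> \<le> pi" for x y :: real
  proof -
    define \<rho> where "\<rho> = exp (- (p * x))"
    define Z where "Z = 1 - of_real \<rho> * cis (p * y)"
    have "x \<le> 1 / (2 * p)" "x \<le> 1 / (real p * (real t + 1) * real p)" using h unfolding x0_def by auto
    have tp: "real p * (real t + 1) * real p > 0" using p1 by (intro mult_pos_pos) auto
    have px: "p * x \<le> 1 / 2" using \<open>x \<le> 1 / (2 * p)\<close> p1 by (simp add: field_simps)
    have tx: "real p * (real t + 1) * real p * x \<le> 1"
      using \<open>x \<le> 1 / (real p * (real t + 1) * real p)\<close> tp by (metis pos_le_divide_eq mult.commute)
    have px0: "p * x > 0" using h p1 by simp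
    have \<rho>1: "1 - p * x \<le> \<rho>" unfolding \<rho>_def using exp_ge_add_one_self[of "- (p * x)"] by simp
    have \<rho>: "1/2 \<le> \<rho>" "\<rho> < 1" "1 - \<rho> \<le> p * x" using \<rho>1 px px0 unfolding \<rho>_def by auto
    show ?thesis
    proof (cases "\<theta> * (1 - \<rho>) \<le> norm (cis (p * y) - 1)")
      case True
      have "W x y \<ge> (\<theta> ^ 2) / (26 * p * x)"
      proof (rule W_lower_aux[OF h(1) px])
        have "\<theta> ^ 2 \<le> 1 ^ 2" using \<theta> by (intro power_mono) auto
        thus "\<theta> ^ 2 \<le> 1" by simp
        have "(\<theta> * (1 - \<rho>)) ^ 2 \<le> norm (cis (p * y) - 1) ^ 2" using True \<theta> \<rho> by (intro power_mono) auto
        hence "(1 - \<rho>) ^ 2 * \<theta> ^ 2 / 5 \<le> 1 / 2 * norm (cis (p * y) - 1) ^ 2"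
          by (simp add: power_mult_distrib mult.commute) (smt (verit) zero_le_power2)
        also have "\<dots> \<le> \<rho> * norm (cis (p * y) - 1) ^ 2" using \<rho> by (intro mult_right_mono) auto
        finally show "(1 - exp (- (p * x))) ^ 2 * \<theta> ^ 2 / 5 \<le> exp (- (p * x)) * norm (cis (p * y) - 1) ^ 2"
          unfolding \<rho>_def .
      qed simp
      moreover have "c / x \<le> \<theta> ^ 2 / (26 * p * x)" unfolding c_def using h p1 by (simp add: field_simps)
      ultimately show ?thesis by linarith
    next
      case False
      have "2 / p \<le> norm (cis y - 1)"
      proof -
        have "2 * y ^ 2 / pi ^ 2 \<le> 1 - cos y" using h by (intro one_minus_cos_ge)
        hence "(2 * \<bar>y\<bar> / pi) ^ 2 \<le> norm (cis y - 1) ^ 2" unfolding norm_cis_minus_1_square by (simp add: power_divide power_mult_distrib)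
        hence "2 * \<bar>y\<bar> / pi \<le> norm (cis y - 1)" by (rule power2_le_imp_le) simp
        moreover have "2 / p \<le> 2 * \<bar>y\<bar> / pi" using h(3) p1 by (simp add: field_simps)
        ultimately show ?thesis by linarith
      qed
      also have "norm (cis y - 1) \<le> s * norm (cis (b * y) - 1) + t * norm (cis (p * y) - 1)"
      proof -
        have e: "cis (b * y) ^ s = cis (p * y) ^ t * cis y"
        proof -
          have "real s * (real b * y) = real (b * s) * y" by simp
          also have "\<dots> = real t * (real p * y) + y" unfolding t by (simp add: algebra_simps)
          finally show ?thesis by (simp only: Complex.DeMoivre cis_mult)
        qed
        have "norm (cis y - 1) = norm (cis (p * y) ^ t * (cis y - 1))" by (simp add: norm_mult norm_power)
        also have "\<dots> = norm ((cis (b * y) ^ s - 1 ^ s) - (cis (p * y) ^ t - 1 ^ t))"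
          by (simp add: right_diff_distrib e)
        also have "\<dots> \<le> norm (cis (b * y) ^ s - 1 ^ s) + norm (cis (p * y) ^ t - 1 ^ t)" by (rule norm_triangle_ineq4)
        also have "\<dots> \<le> s * norm (cis (b * y) - 1) + t * norm (cis (p * y) - 1)"
          by (intro add_mono norm_power_diff) auto
        finally show ?thesis .
      qed
      also have "t * norm (cis (p * y) - 1) \<le> 1 / p"
      proof -
        have "norm (cis (p * y) - 1) \<le> \<theta> * (1 - \<rho>)" using False by simp
        also have "\<dots> \<le> 1 * (p * x)" using \<theta> \<rho> by (intro mult_mono) auto
        finally have "t * norm (cis (p * y) - 1) \<le> (t + 1) * (p * x)" by (intro mult_mono) auto
        also have "\<dots> \<le> 1 / p" using tx p1 by (simp add: field_simps)
        finally show ?thesis .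
      qed
      finally have "1 / p \<le> s * norm (cis (b * y) - 1)" by (simp add: field_simps)
      hence "\<delta> \<le> norm (cis (b * y) - 1)" unfolding \<delta>_def using s0 p1 by (simp add: field_simps)
      hence "\<delta> ^ 2 \<le> norm (cis (b * y) - 1) ^ 2" using \<delta> by (intro power_mono) auto
      hence cosb: "2 * \<theta> \<le> 1 - cos (b * y)" unfolding norm_cis_minus_1_square \<theta>_def by simp
      have "(1 - \<rho>) ^ 2 \<le> norm Z ^ 2" unfolding Z_def norm_Z_square using \<rho> by simp
      hence nZ: "1 - \<rho> \<le> norm Z" by (rule power2_le_imp_le) simp
      have Z0: "Z \<noteq> 0" using nZ \<rho> by auto
      have "norm (cis (b * y) / Z - cis (b * y) / (1 - \<rho>)) = norm ((1 - \<rho>) - Z) / (norm Z * (1 - \<rho>))"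
      proof -
        have "complex_of_real (1 - \<rho>) \<noteq> 0" using \<rho> by simp
        hence "cis (b * y) / Z - cis (b * y) / (of_real (1 - \<rho>)) = cis (b * y) * ((of_real (1 - \<rho>)) - Z) / (Z * of_real (1 - \<rho>))"
          using Z0 by (simp add: field_simps)
        hence "norm (cis (b * y) / Z - cis (b * y) / (of_real (1 - \<rho>))) = norm (of_real (1 - \<rho>) - Z) / (norm Z * norm (complex_of_real (1 - \<rho>)))"
          by (simp only: norm_divide norm_mult norm_cis mult_1)
        also have "norm (complex_of_real (1 - \<rho>)) = 1 - \<rho>" unfolding norm_of_real using \<rho> by simp
        finally show ?thesis by simp
      qed
      also have "(1 - \<rho>) - Z = of_real \<rho> * (cis (p * y) - 1)" unfolding Z_def by (simp add: algebra_simps)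
      also have "norm (of_real \<rho> * (cis (p * y) - 1)) \<le> 1 * (\<theta> * (1 - \<rho>))"
        unfolding norm_mult using \<rho> False by (intro mult_mono) auto
      also have "1 * (\<theta> * (1 - \<rho>)) / (norm Z * (1 - \<rho>)) = \<theta> / norm Z" using \<rho> by simp
      also have "\<theta> / norm Z \<le> \<theta> / (1 - \<rho>)" using nZ \<rho> \<theta> by (intro divide_left_mono) (auto intro!: mult_pos_pos intro: less_le_trans)
      finally have dist: "norm (cis (b * y) / Z - cis (b * y) / (1 - \<rho>)) \<le> \<theta> / (1 - \<rho>)"
        using \<rho> by (simp add: divide_right_mono)
      have "Re (cis (b * y) / Z) - Re (cis (b * y) / (1 - \<rho>)) \<le> \<theta> / (1 - \<rho>)"
        using complex_Re_le_cmod[of "cis (b * y) / Z - cis (b * y) / (1 - \<rho>)"] dist by simp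
      moreover have "Re (cis (b * y) / (1 - \<rho>)) = cos (b * y) / (1 - \<rho>)"
      proof -
        have "Re (cis (b * y) / of_real (1 - \<rho>)) = cos (b * y) / (1 - \<rho>)" by (simp only: Re_divide_of_real cis.sel)
        thus ?thesis by simp
      qed
      ultimately have "Re (cis (b * y) / Z) \<le> (cos (b * y) + \<theta>) / (1 - \<rho>)" by (simp add: add_divide_distrib)
      hence "1 / (1 - \<rho>) - Re (cis (b * y) / Z) \<ge> (1 - cos (b * y) - \<theta>) / (1 - \<rho>)" by (simp add: diff_divide_distrib add_divide_distrib)
      moreover have "(1 - cos (b * y) - \<theta>) / (1 - \<rho>) \<ge> \<theta> / (p * x)" using cosb \<rho> \<theta> px0 by (intro frac_le) auto
      ultimately have lb: "1 / (1 - \<rho>) - Re (cis (b * y) / Z) \<ge> \<theta> / (p * x)" by linarith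
      have "exp (- (real b * x)) \<ge> 1 / 2"
      proof -
        have "real b * x \<le> real p * x" using b R h by (intro mult_right_mono) auto
        hence "\<rho> \<le> exp (- (real b * x))" unfolding \<rho>_def by simp
        thus ?thesis using \<rho> by simp
      qed
      hence "exp (- (real b * x)) * (1 / (1 - \<rho>) - Re (cis (b * y) / Z)) \<ge> 1 / 2 * (\<theta> / (p * x))"
        using lb \<theta> px0 by (intro mult_mono) auto
      hence "W x y \<ge> \<theta> / (2 * (p * x))" unfolding W_def \<rho>_def[symmetric] Z_def[symmetric] by simp
      moreover have "c / x \<le> \<theta> / (2 * (p * x))"
      proof -
        have "\<theta> * \<theta> \<le> \<theta> * 1" using \<theta> by (intro mult_left_mono) auto
        hence "\<theta> ^ 2 / (52 * p) \<le> \<theta> / (2 * p)" using p1 \<theta> by (simp add: field_simps power2_eq_square)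
        hence "c / x \<le> \<theta> / (2 * p) / x" unfolding c_def using h by (intro divide_right_mono) auto
        thus ?thesis by (simp add: mult.assoc)
      qed
      ultimately show ?thesis by linarith
    qed
  qed
  thus ?thesis using c0 x00 by blast
qed

text \<open>One formula for both regimes: quadratic in \<open>y / x\<close> near the axis, and a
  constant multiple of \<open>1 / x\<close> as soon as \<open>\<bar>y\<bar> \<ge> x\<close>.\<close>

lemma W_lower: "\<exists>c>0. \<exists>x0>0. \<forall>(x::real) (y::real). 0 < x \<and> x \<le> x0 \<and> \<bar>y\<bar> \<le> pi \<longrightarrow> W x y \<ge> c * min 1 ((y / x) ^ 2) / x"
proof -
  obtain c1 x1 where c1: "c1 > 0" "x1 > 0" "\<And>x y. 0 < x \<Longrightarrow> x \<le> x1 \<Longrightarrow> pi / p \<le> \<bar>y\<bar> \<Longrightarrow> \<bar>y\<bar> \<le> pi \<Longrightarrow> W x y \<ge> c1 / x"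
    using W_lower_large by blast
  define c where "c = min c1 (1 / (26 * p))"
  define x0 where "x0 = min x1 (1 / (2 * p))"
  have "c > 0" "x0 > 0" unfolding c_def x0_def using c1 p1 by auto
  moreover have "W x y \<ge> c * min 1 ((y / x) ^ 2) / x" if h: "0 < x" "x \<le> x0" "\<bar>y\<bar> \<le> pi" for x y :: real
  proof (cases "\<bar>y\<bar> \<le> pi / p")
    case True
    have "p * x \<le> 1 / 2" using h p1 unfolding x0_def by (simp add: field_simps)
    from W_lower_small[OF h(1) this True] have "W x y \<ge> (1 / (26 * p)) * min 1 ((y / x) ^ 2) / x" by simp
    moreover have "c * min 1 ((y / x) ^ 2) / x \<le> (1 / (26 * p)) * min 1 ((y / x) ^ 2) / x"
      using h unfolding c_def by (intro divide_right_mono mult_right_mono) auto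
    ultimately show ?thesis by linarith
  next
    case False
    hence "W x y \<ge> c1 / x" using h c1(3)[of x y] unfolding x0_def by auto
    moreover have "c * min 1 ((y / x) ^ 2) / x \<le> c1 * 1 / x"
      using h c1 \<open>c > 0\<close> unfolding c_def by (intro divide_right_mono mult_mono) auto
    ultimately show ?thesis by simp
  qed
  ultimately show ?thesis by blast
qed

end

section \<open>The saddle point\<close>

lemma integral_cis_multiple:
  fixes k :: int
  shows "has_bochner_integral lborel (\<lambda>y. indicator {- pi..pi} y *\<^sub>R cis (of_int k * y)) (if k = 0 then of_real (2 * pi) else 0)"
proof (cases "k = 0")
  case True
  have "has_bochner_integral lborel (\<lambda>y. indicator {- pi..pi} y *\<^sub>R cis (of_int k * y)) (of_real pi - of_real (- pi))"
    by (rule has_bochner_integral_FTC_Icc)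
       (use True in \<open>auto intro!: derivative_eq_intros continuous_intros simp: has_vector_derivative_def scaleR_conv_of_real fun_eq_iff\<close>)
  thus ?thesis using True by simp
next
  case False
  define F where "F = (\<lambda>y. cis (of_int k * y) / (\<i> * of_int k))"
  have "has_bochner_integral lborel (\<lambda>y. indicator {- pi..pi} y *\<^sub>R cis (of_int k * y)) (F pi - F (- pi))"
  proof (rule has_bochner_integral_FTC_Icc)
    show "- pi \<le> pi" by simp
    show "continuous_on {- pi..pi} (\<lambda>y. cis (of_int k * y))" by (intro continuous_intros)
    fix y :: real
    have "((\<lambda>y. cis (of_int k * y)) has_derivative (\<lambda>t. (of_int k * t) *\<^sub>R (\<i> * cis (of_int k * y)))) (at y within {- pi..pi})"
      by (intro has_derivative_cis has_derivative_mult_right has_derivative_ident)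
    hence "(F has_derivative (\<lambda>t. (of_int k * t) *\<^sub>R (\<i> * cis (of_int k * y)) / (\<i> * of_int k))) (at y within {- pi..pi})"
      unfolding F_def divide_inverse by (rule has_derivative_mult_left)
    moreover have "(of_int k * t) *\<^sub>R (\<i> * cis (of_int k * y)) / (\<i> * of_int k) = t *\<^sub>R cis (of_int k * y)" for t
    proof -
      have eq: "(of_int k * t) *\<^sub>R (\<i> * cis (of_int k * y)) = (of_real t * cis (of_int k * y)) * (\<i> * of_int k)"
        by (simp add: scaleR_conv_of_real mult_ac)
      have "\<i> * of_int k \<noteq> 0" using False by simp
      thus ?thesis unfolding eq unfolding scaleR_conv_of_real by (rule nonzero_mult_div_cancel_right)
    qed
    ultimately show "(F has_vector_derivative cis (of_int k * y)) (at y within {- pi..pi})"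
      unfolding has_vector_derivative_def by simp
  qed
  moreover have "F pi - F (- pi) = 0"
  proof -
    have "cis (of_int k * pi) = cis (of_int k * (- pi))"
      using sin_npi_int[of k] by (simp add: complex_eq_iff mult.commute)
    thus ?thesis unfolding F_def by simp
  qed
  ultimately show ?thesis using False by simp
qed

text \<open>Cauchy's integrand for the \<open>n\<close>-th partial sum on the circle of radius
  \<open>exp (- x)\<close>. The extension by 0 lets \<open>y\<close> be rescaled while the domain of
  integration stays the whole line.\<close>

definition circle_integrand :: "nat set \<Rightarrow> nat \<Rightarrow> real \<Rightarrow> real \<Rightarrow> complex" where
  "circle_integrand D n x y = indicator {- pi..pi} y *\<^sub>R
     (exp (log_gf D (of_real x + \<i> * of_real y)) / (1 - exp (- (of_real x + \<i> * of_real y))) * cis (real n * y))"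

text \<open>The coefficient series converges absolutely on the circle, hence may be integrated term
  by term, and orthogonality keeps only \<open>k = n\<close>.\<close>

lemma part_sum_circle_integral:
  assumes D: "0 \<notin> D" and x: "x > 0"
  shows "integrable lborel (circle_integrand D n x)"
    and "integral\<^sup>L lborel (circle_integrand D n x) = of_real (2 * pi * part_sum D n * exp (- (real n * x)))"
proof -
  define c where "c = (\<lambda>k. real (part_sum D k) * exp (- x) ^ k)"
  define f where "f = (\<lambda>k y. c k *\<^sub>R (indicator {- pi..pi} y *\<^sub>R cis (of_int (int n - int k) * y)))"
  have c0: "c k \<ge> 0" for k unfolding c_def by simp
  have sc: "summable c" unfolding c_def using part_sum_gf(2)[OF D, of "of_real x"] x by simp
  have fi: "has_bochner_integral lborel (f k) (c k *\<^sub>R (if int n - int k = 0 then of_real (2 * pi) else 0))" for k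
    unfolding f_def by (intro has_bochner_integral_scaleR_right integral_cis_multiple)
  have nf: "norm (f k y) = c k * indicator {- pi..pi} y" for k y
    unfolding f_def using c0 by (simp add: indicator_def)
  have f_sums: "(\<lambda>k. f k y) sums circle_integrand D n x y" for y
  proof -
    define s where "s = of_real x + \<i> * of_real y"
    have "Re s > 0" unfolding s_def using x by simp
    from sums_scaleR_right[OF sums_mult2[OF part_sum_gf(1)[OF D this], of "cis (real n * y)"], of "indicator {- pi..pi} y"]
    have "(\<lambda>k. indicator {- pi..pi} y *\<^sub>R (of_nat (part_sum D k) * exp (- s) ^ k * cis (real n * y))) sums circle_integrand D n x y"
      unfolding circle_integrand_def s_def .
    moreover have "indicator {- pi..pi} y *\<^sub>R (of_nat (part_sum D k) * exp (- s) ^ k * cis (real n * y)) = f k y" for k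
    proof -
      have "exp (- s) = of_real (exp (- x)) * cis (- y)"
        unfolding s_def by (simp add: exp_eq_polar)
      hence "exp (- s) ^ k = of_real (exp (- x) ^ k) * cis (real k * (- y))"
        by (simp only: power_mult_distrib Complex.DeMoivre of_real_power)
      hence "of_nat (part_sum D k) * exp (- s) ^ k * cis (real n * y) = of_real (c k) * (cis (real k * (- y)) * cis (real n * y))"
        unfolding c_def by simp
      also have "cis (real k * (- y)) * cis (real n * y) = cis (of_int (int n - int k) * y)"
        unfolding cis_mult by (simp add: algebra_simps)
      finally show ?thesis unfolding f_def by (simp add: scaleR_conv_of_real)
    qed
    ultimately show ?thesis by simp
  qed
  have 1: "integrable lborel (f k)" for k using fi has_bochner_integral_iff by blast
  have 2: "AE y in lborel. summable (\<lambda>k. norm (f k y))"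
    unfolding nf by (intro AE_I2 summable_mult2 sc)
  have "(\<integral>y. norm (f k y) \<partial>lborel) = c k * (2 * pi)" for k
    unfolding nf by simp
  hence 3: "summable (\<lambda>k. (\<integral>y. norm (f k y) \<partial>lborel))" using summable_mult2[OF sc] by simp
  have eq: "(\<lambda>y. \<Sum>k. f k y) = circle_integrand D n x" using f_sums by (intro ext sums_unique[symmetric])
  show "integrable lborel (circle_integrand D n x)" using integrable_suminf[OF 1 2 3] unfolding eq .
  have "(\<lambda>k. integral\<^sup>L lborel (f k)) sums integral\<^sup>L lborel (circle_integrand D n x)"
    using sums_integral[OF 1 2 3] unfolding eq .
  moreover have "integral\<^sup>L lborel (f k) = (if k = n then of_real (c n * (2 * pi)) else 0)" for k
    using has_bochner_integral_integral_eq[OF fi[of k]] by (auto simp: scaleR_conv_of_real)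
  ultimately have "(\<lambda>k. if k = n then complex_of_real (c n * (2 * pi)) else 0) sums integral\<^sup>L lborel (circle_integrand D n x)"
    by simp
  from sums_unique2[OF this sums_single]
  have "integral\<^sup>L lborel (circle_integrand D n x) = of_real (c n * (2 * pi))" by simp
  thus "integral\<^sup>L lborel (circle_integrand D n x) = of_real (2 * pi * part_sum D n * exp (- (real n * x)))"
    unfolding c_def by (simp add: exp_of_nat_mult[symmetric] mult_ac)
qed

lemma integrable_inverse_1_plus_square_lborel: "integrable lborel (\<lambda>x::real. inverse (1 + x ^ 2))"
  using integrable_inverse_1_plus_square by (simp add: set_integrable_def)

text \<open>A multiple of \<open>1 / (1 + v^2)\<close> dominates the integrand. Positivity is read
  off from the interval \<open>[0, 1]\<close>; it is what later allows one asymptotic constant to be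
  divided by the other.\<close>

lemma gaussian_integral_pos:
  fixes \<kappa> :: real
  assumes "\<kappa> > 0"
  shows "integrable lborel (\<lambda>v. exp (- (\<kappa> * v ^ 2 / 2)))" "(\<integral>v. exp (- (\<kappa> * v ^ 2 / 2)) \<partial>lborel) > 0"
proof -
  define C where "C = max 1 (2 / \<kappa>)"
  have bnd: "exp (- (\<kappa> * v ^ 2 / 2)) \<le> C * inverse (1 + v ^ 2)" for v
  proof -
    have "1 + v ^ 2 \<le> C * (1 + \<kappa> * v ^ 2 / 2)"
    proof -
      have "1 \<le> C" "2 / \<kappa> \<le> C" unfolding C_def by auto
      hence "1 + (2 / \<kappa>) * (\<kappa> * v ^ 2 / 2) \<le> C + C * (\<kappa> * v ^ 2 / 2)" using assms by (intro add_mono mult_right_mono) auto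
      thus ?thesis using assms by (simp add: distrib_left)
    qed
    also have "\<dots> \<le> C * exp (\<kappa> * v ^ 2 / 2)"
      unfolding C_def by (intro mult_left_mono exp_ge_add_one_self) auto
    finally have "(1 + v ^ 2) * exp (- (\<kappa> * v ^ 2 / 2)) \<le> C * exp (\<kappa> * v ^ 2 / 2) * exp (- (\<kappa> * v ^ 2 / 2))"
      by (intro mult_right_mono) auto
    hence "(1 + v ^ 2) * exp (- (\<kappa> * v ^ 2 / 2)) \<le> C" by (simp add: mult.assoc exp_add[symmetric])
    moreover have "1 + v ^ 2 > 0" by (simp add: add_pos_nonneg)
    ultimately show ?thesis by (simp add: field_simps)
  qed
  show int: "integrable lborel (\<lambda>v. exp (- (\<kappa> * v ^ 2 / 2)))"
  proof (rule Bochner_Integration.integrable_bound)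
    show "integrable lborel (\<lambda>v. C * inverse (1 + v ^ 2))"
      by (intro integrable_mult_right integrable_inverse_1_plus_square_lborel)
    show "AE v in lborel. norm (exp (- (\<kappa> * v ^ 2 / 2))) \<le> norm (C * inverse (1 + v ^ 2))"
    proof (rule AE_I2)
      fix v
      show "norm (exp (- (\<kappa> * v ^ 2 / 2))) \<le> norm (C * inverse (1 + v ^ 2))"
        using bnd[of v] unfolding real_norm_def by (smt (verit) exp_gt_zero)
    qed
  qed simp
  have "(\<integral>v. indicator {0..1::real} v * exp (- (\<kappa> / 2)) \<partial>lborel) \<le> (\<integral>v. exp (- (\<kappa> * v ^ 2 / 2)) \<partial>lborel)"
  proof (rule integral_mono[OF _ int])
    show "integrable lborel (\<lambda>v::real. indicator {0..1} v * exp (- (\<kappa> / 2)))" by simp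
    fix v :: real
    have "v ^ 2 \<le> 1" if "0 \<le> v" "v \<le> 1" using that by (simp add: power_le_one)
    thus "indicator {0..1} v * exp (- (\<kappa> / 2)) \<le> exp (- (\<kappa> * v ^ 2 / 2))"
      using assms by (auto simp: indicator_def mult_left_le)
  qed
  moreover have "(\<integral>v. indicator {0..1::real} v * exp (- (\<kappa> / 2)) \<partial>lborel) = exp (- (\<kappa> / 2))" by simp
  ultimately show "(\<integral>v. exp (- (\<kappa> * v ^ 2 / 2)) \<partial>lborel) > 0" by (smt (verit) exp_gt_zero)
qed

section \<open>The saddle integral and its limit\<close>

context residue_parts
begin

text \<open>Leading coefficients: \<open>B1 x\<close> and \<open>B2 x\<close> are
  \<open>\<kappa>1 / x\<close> and \<open>\<kappa>2 / x\<close> up to bounded errors.\<close>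

definition \<kappa>1 :: real where "\<kappa>1 = card R * bose1_int / p"
definition \<kappa>2 :: real where "\<kappa>2 = card R * bose2_int / p"

lemma \<kappa>_pos: "\<kappa>1 > 0" "\<kappa>2 > 0"
  unfolding \<kappa>1_def \<kappa>2_def using card_R_pos bose1_int(1) bose2_int(1) p1 by auto

text \<open>The generating function of the partial sums at the real point \<open>x\<close>, kept in
  closed form as the normalising factor.\<close>

definition g0 :: "real \<Rightarrow> real" where "g0 x = exp (Re (log_gf D (of_real x))) / (1 - exp (- x))"

text \<open>The scale \<open>y = x^{3/2} v\<close> is the width of the saddle at the real point \<open>x\<close>.\<close>

definition saddle_integrand :: "nat \<Rightarrow> real \<Rightarrow> real \<Rightarrow> complex" where
  "saddle_integrand n x v = circle_integrand D n x (x * sqrt x * v) / of_real (g0 x)"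

lemma g0_pos: "x > 0 \<Longrightarrow> g0 x > 0"
  unfolding g0_def by simp

text \<open>The substitution \<open>y = x * sqrt x * v\<close> in the circle integral, whose
  Jacobian appears in the normalisation.\<close>

lemma saddle_integrand:
  assumes x: "x > 0"
  shows "integrable lborel (saddle_integrand n x)"
    and "of_real (2 * pi * (part_sum D n / (x * sqrt x * g0 x * exp (real n * x)))) = integral\<^sup>L lborel (saddle_integrand n x)"
proof -
  define c where "c = x * sqrt x"
  have c: "c > 0" unfolding c_def using x by simp
  have int: "integrable lborel (\<lambda>v. circle_integrand D n x (0 + c * v))"
    using c by (intro lborel_integrable_real_affine part_sum_circle_integral(1)[OF zero_notin_D x]) auto
  thus "integrable lborel (saddle_integrand n x)"
    unfolding saddle_integrand_def c_def by (intro integrable_divide) simp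
  have "integral\<^sup>L lborel (circle_integrand D n x) = \<bar>c\<bar> *\<^sub>R (\<integral>v. circle_integrand D n x (0 + c * v) \<partial>lborel)"
    using c by (intro lborel_integral_real_affine) auto
  hence "of_real (2 * pi * part_sum D n * exp (- (real n * x))) = of_real c * (\<integral>v. circle_integrand D n x (c * v) \<partial>lborel)"
    unfolding part_sum_circle_integral(2)[OF zero_notin_D x] using c by (simp add: scaleR_conv_of_real)
  moreover have "integral\<^sup>L lborel (saddle_integrand n x) = (\<integral>v. circle_integrand D n x (c * v) \<partial>lborel) / of_real (g0 x)"
    unfolding saddle_integrand_def c_def by simp
  ultimately have "of_real c * (of_real (g0 x) * integral\<^sup>L lborel (saddle_integrand n x)) = of_real (2 * pi * part_sum D n * exp (- (real n * x)))"
    using g0_pos[OF x] by simp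
  hence "integral\<^sup>L lborel (saddle_integrand n x) = of_real (2 * pi * part_sum D n * exp (- (real n * x))) / (of_real c * of_real (g0 x))"
    using g0_pos[OF x] c by (simp add: field_simps)
  thus "of_real (2 * pi * (part_sum D n / (x * sqrt x * g0 x * exp (real n * x)))) = integral\<^sup>L lborel (saddle_integrand n x)"
    unfolding c_def by (simp add: exp_minus field_simps)
qed

lemma Im_log_gf_real: "x > 0 \<Longrightarrow> Im (log_gf D (of_real x)) = 0"
proof -
  assume x: "x > 0"
  have "Re (of_real x) > 0" using x by simp
  from sums_Im[OF summable_sums[OF summable_norm_cancel[OF log_gf_summable[OF zero_notin_D this]], folded log_gf_def]]
  have "(\<lambda>m. Im (if m \<in> D then clog_factor (of_nat m * of_real x) else 0)) sums Im (log_gf D (of_real x))" .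
  moreover have "Im (if m \<in> D then clog_factor (of_nat m * of_real x) else 0) = 0" for m
  proof (cases "m \<in> D")
    case True
    hence "m > 0" using zero_notin_D by (intro gr0I) auto
    hence "exp (- (real m * x)) < 1" using x by simp
    hence "0 < 1 - exp (- (real m * x))" by simp
    moreover have "1 - exp (- (of_nat m * of_real x)) = complex_of_real (1 - exp (- (real m * x)))"
      by (simp add: exp_of_real[symmetric])
    ultimately show ?thesis unfolding clog_factor_def by (simp only: Ln_of_real) simp
  qed simp
  ultimately show ?thesis by (simp add: sums_iff)
qed

lemma saddle_integrand_eq:
  assumes x: "x > 0" and y: "\<bar>x * sqrt x * v\<bar> \<le> pi"
  defines "s \<equiv> of_real x + \<i> * of_real (x * sqrt x * v)"
  shows "saddle_integrand n x v = exp (log_gf D s - log_gf D (of_real x) + \<i> * of_real (real n * (x * sqrt x * v)))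
     * (of_real (1 - exp (- x)) / (1 - exp (- s)))"
proof -
  have "log_gf D (of_real x) = of_real (Re (log_gf D (of_real x)))"
    using Im_log_gf_real[OF x] by (simp add: complex_eq_iff)
  hence "complex_of_real (g0 x) = exp (log_gf D (of_real x)) / of_real (1 - exp (- x))"
    unfolding g0_def by (metis exp_of_real of_real_divide)
  moreover have "indicator {- pi..pi} (x * sqrt x * v) = (1::real)" using y by (auto simp: indicator_def)
  ultimately show ?thesis
    unfolding saddle_integrand_def circle_integrand_def s_def exp_add exp_diff cis_conv_exp by simp
qed

text \<open>In the variable \<open>v\<close> the decay exponent is \<open>c * v^2\<close> as long as
  \<open>x * v^2 \<le> 1\<close>. Beyond that it is only \<open>c / x\<close>, but there the cut-off
  gives \<open>x^3 * v^2 \<le> pi^2\<close>, and \<open>exp (- (c / x))\<close> is at most a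
  multiple of \<open>x^3\<close>. So one dominating function serves for all \<open>n\<close> and all
  small \<open>x\<close>.\<close>

lemma saddle_integrand_bound:
  "\<exists>C. \<exists>x0>0. \<forall>x n v. 0 < x \<and> x \<le> x0 \<longrightarrow> norm (saddle_integrand n x v) \<le> C * inverse (1 + v ^ 2)"
proof -
  obtain c x0 where c: "c > 0" "x0 > 0" "\<And>x y. 0 < x \<Longrightarrow> x \<le> x0 \<Longrightarrow> \<bar>y\<bar> \<le> pi \<Longrightarrow> W x y \<ge> c * min 1 ((y / x) ^ 2) / x"
    using W_lower by blast
  define C where "C = max 1 (1 / c) + 27 * (1 + pi ^ 2) / c ^ 3"
  have C0: "C \<ge> 0" unfolding C_def using c by (intro add_nonneg_nonneg) auto
  have "norm (saddle_integrand n x v) \<le> C * inverse (1 + v ^ 2)" if x: "0 < x" "x \<le> min x0 1" for x n v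
  proof (cases "\<bar>x * sqrt x * v\<bar> \<le> pi")
    case False
    hence "indicator {- pi..pi} (x * sqrt x * v) = (0::real)" by (auto simp: indicator_def)
    hence "saddle_integrand n x v = 0" unfolding saddle_integrand_def circle_integrand_def by simp
    thus ?thesis using C0 by simp
  next
    case True
    define y where "y = x * sqrt x * v"
    define s where "s = of_real x + \<i> * of_real y"
    have v1: "1 + v ^ 2 > 0" by (simp add: add_pos_nonneg)
    have y: "\<bar>y\<bar> \<le> pi" using True unfolding y_def .
    have "norm (exp (log_gf D s - log_gf D (of_real x) + \<i> * of_real (real n * y))) = exp (Re (log_gf D s) - Re (log_gf D (of_real x)))"
      by simp
    also have "\<dots> \<le> exp (- W x y)" using Re_log_gf_le[OF x(1), of y] unfolding s_def by simp
    finally have A: "norm (exp (log_gf D s - log_gf D (of_real x) + \<i> * of_real (real n * y))) \<le> exp (- W x y)" .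
    have B: "norm (of_real (1 - exp (- x)) / (1 - exp (- s))) \<le> 1"
    proof -
      have "norm (exp (- s)) = exp (- x)" unfolding s_def by simp
      hence "1 - exp (- x) \<le> norm (1 - exp (- s))" using norm_triangle_ineq2[of 1 "exp (- s)"] by simp
      moreover have "1 - exp (- x) > 0" using x by simp
      ultimately have "(1 - exp (- x)) / norm (1 - exp (- s)) \<le> 1" by (subst divide_le_eq_1_pos) linarith+
      thus ?thesis unfolding norm_divide norm_of_real using \<open>1 - exp (- x) > 0\<close> by (simp only: abs_of_pos)
    qed
    have "norm (saddle_integrand n x v) \<le> exp (- W x y) * 1"
      unfolding saddle_integrand_eq[OF x(1) True] norm_mult
      using A B unfolding s_def y_def by (intro mult_mono) auto
    also have "\<dots> \<le> exp (- (c * min 1 ((y / x) ^ 2) / x))" using c(3)[OF x(1) _ y] x by simp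
    also have "\<dots> \<le> C * inverse (1 + v ^ 2)"
    proof -
      have yx: "(y / x) ^ 2 = x * v ^ 2" unfolding y_def using x by (simp add: power_mult_distrib)
      show ?thesis
      proof (cases "x * v ^ 2 \<le> 1")
        case True
        hence "c * min 1 ((y / x) ^ 2) / x = c * v ^ 2" unfolding yx using x by simp
        moreover have "exp (- (c * v ^ 2)) \<le> max 1 (1 / c) * inverse (1 + v ^ 2)"
        proof -
          define M where "M = max 1 (1 / c)"
          have "1 \<le> M" "1 / c \<le> M" unfolding M_def by auto
          hence "1 + (1 / c) * (c * v ^ 2) \<le> M + M * (c * v ^ 2)" using c by (intro add_mono mult_right_mono) auto
          hence "1 + v ^ 2 \<le> M * (1 + c * v ^ 2)" using c by (simp add: distrib_left)
          also have "\<dots> \<le> M * exp (c * v ^ 2)"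
            unfolding M_def by (intro mult_left_mono exp_ge_add_one_self) auto
          finally have "(1 + v ^ 2) * exp (- (c * v ^ 2)) \<le> M * exp (c * v ^ 2) * exp (- (c * v ^ 2))"
            by (intro mult_right_mono) auto
          hence "(1 + v ^ 2) * exp (- (c * v ^ 2)) \<le> M" by (simp add: mult.assoc exp_add[symmetric])
          thus ?thesis unfolding M_def[symmetric] using v1 by (simp add: field_simps)
        qed
        moreover have "max 1 (1 / c) * inverse (1 + v ^ 2) \<le> C * inverse (1 + v ^ 2)"
          unfolding C_def using c v1 by (intro mult_right_mono) auto
        ultimately show ?thesis by simp
      next
        case False
        hence e: "c * min 1 ((y / x) ^ 2) / x = c / x" unfolding yx using x by simp
        have "(c / x) ^ 3 / 27 \<le> exp (c / x)"
        proof -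
          have "c / x / 3 \<le> exp (c / x / 3)" using exp_ge_add_one_self[of "c / x / 3"] by linarith
          hence "(c / x / 3) ^ 3 \<le> exp (c / x / 3) ^ 3" using c x by (intro power_mono) auto
          thus ?thesis by (simp add: exp_of_nat_mult[symmetric] power_divide)
        qed
        hence "exp (- (c / x)) \<le> 27 * x ^ 3 / c ^ 3" using c x by (simp add: exp_minus field_simps)
        also have "\<dots> \<le> 27 * (1 + pi ^ 2) / c ^ 3 * inverse (1 + v ^ 2)"
        proof -
          have "y ^ 2 = x ^ 3 * v ^ 2" unfolding y_def using x by (simp add: power_mult_distrib power2_eq_square power3_eq_cube)
          moreover have "y ^ 2 \<le> pi ^ 2" using y by (metis abs_ge_zero power2_abs power_mono)
          moreover have "x ^ 3 \<le> 1" using x by (simp add: power_le_one)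
          ultimately have "x ^ 3 * (1 + v ^ 2) \<le> 1 + pi ^ 2" by (simp add: distrib_left)
          hence "27 * (x ^ 3 * (1 + v ^ 2)) / c ^ 3 * inverse (1 + v ^ 2) \<le> 27 * (1 + pi ^ 2) / c ^ 3 * inverse (1 + v ^ 2)"
            using c v1 by (intro mult_right_mono divide_right_mono mult_left_mono) auto
          moreover have "27 * (x ^ 3 * (1 + v ^ 2)) / c ^ 3 * inverse (1 + v ^ 2) = 27 * x ^ 3 / c ^ 3"
            using v1 by simp
          ultimately show ?thesis by (simp only:)
        qed
        also have "\<dots> \<le> C * inverse (1 + v ^ 2)"
          unfolding C_def using c v1 by (intro mult_right_mono) auto
        finally show ?thesis unfolding e .
      qed
    qed
    finally show ?thesis .
  qed
  moreover have "min x0 1 > 0" using c by simp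
  ultimately show ?thesis by blast
qed

text \<open>The solution of \<open>n * x = \<kappa>1 / x\<close>, the leading part of the saddle
  equation \<open>n * x = B1 x\<close> of \<open>log_gf D\<close>.\<close>

definition saddle :: "nat \<Rightarrow> real" where "saddle n = sqrt (\<kappa>1 / n)"

lemma saddle_pos: "n > 0 \<Longrightarrow> saddle n > 0" unfolding saddle_def using \<kappa>_pos by simp

lemma saddle_tendsto: "filterlim saddle (at_right 0) sequentially"
proof -
  have "(\<lambda>n. \<kappa>1 / real n) \<longlonglongrightarrow> 0" by real_asymp
  hence "(\<lambda>n. sqrt (\<kappa>1 / real n)) \<longlonglongrightarrow> sqrt 0" by (rule tendsto_real_sqrt)
  moreover have "eventually (\<lambda>n. saddle n > 0) sequentially"
    using eventually_gt_at_top[of 0] by eventually_elim (rule saddle_pos)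
  ultimately show ?thesis unfolding filterlim_at saddle_def[abs_def, symmetric]
    by (auto elim: eventually_mono)
qed

lemma saddle_tendsto_0: "saddle \<longlonglongrightarrow> 0"
  using saddle_tendsto unfolding filterlim_at by blast

text \<open>Numerator and denominator are asymptotic to \<open>x\<close> and
  \<open>x * (1 + \<i> * sqrt x * v)\<close> with \<open>x = saddle n\<close>, and these agree to
  leading order.\<close>

lemma saddle_factor_tendsto:
  "(\<lambda>n. of_real (1 - exp (- saddle n)) / (1 - exp (- (of_real (saddle n) + \<i> * of_real (saddle n * sqrt (saddle n) * v))))) \<longlonglongrightarrow> (1::complex)"
proof -
  define s where "s = (\<lambda>n. complex_of_real (saddle n) + \<i> * of_real (saddle n * sqrt (saddle n) * v))"
  have ev: "eventually (\<lambda>n. saddle n > 0) sequentially"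
    using eventually_gt_at_top[of 0] by eventually_elim (rule saddle_pos)
  have main: "(\<lambda>n. (1 - exp (- z n)) / z n) \<longlonglongrightarrow> 1" if z: "z \<longlonglongrightarrow> 0" "eventually (\<lambda>n. z n \<noteq> 0) sequentially" for z :: "nat \<Rightarrow> complex"
  proof -
    have "filterlim (\<lambda>n. - z n) (at 0) sequentially"
      unfolding filterlim_at using tendsto_minus[OF z(1)] z(2) by (auto elim: eventually_mono)
    from filterlim_compose[OF lim_exp_minus_1 this]
    have "(\<lambda>n. (exp (- z n) - 1) / (- z n)) \<longlonglongrightarrow> 1" .
    moreover have "(exp (- z n) - 1) / (- z n) = (1 - exp (- z n)) / z n" for n
      by (simp add: divide_simps)
    ultimately show ?thesis by simp
  qed
  have l0: "(\<lambda>n. complex_of_real (saddle n)) \<longlonglongrightarrow> of_real 0" by (intro tendsto_of_real saddle_tendsto_0)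
  have lsq: "(\<lambda>n. complex_of_real (sqrt (saddle n))) \<longlonglongrightarrow> of_real (sqrt 0)" by (intro tendsto_of_real tendsto_real_sqrt saddle_tendsto_0)
  have sf: "s n = of_real (saddle n) * (1 + \<i> * of_real (sqrt (saddle n)) * of_real v)" for n
    unfolding s_def by (simp add: algebra_simps)
  have lr: "(\<lambda>n. 1 + \<i> * of_real (sqrt (saddle n)) * of_real v) \<longlonglongrightarrow> 1 + \<i> * of_real (sqrt 0) * of_real v"
    by (intro tendsto_intros lsq)
  have "s \<longlonglongrightarrow> of_real 0 * (1 + \<i> * of_real (sqrt 0) * of_real v)"
    unfolding sf[abs_def] by (intro tendsto_mult l0 lr)
  hence ls: "s \<longlonglongrightarrow> 0" by simp
  have ne: "eventually (\<lambda>n. s n \<noteq> 0) sequentially"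
    using ev by eventually_elim (auto simp: s_def complex_eq_iff)
  have ne': "eventually (\<lambda>n. complex_of_real (saddle n) \<noteq> 0) sequentially"
    using ev by eventually_elim auto
  have m1: "(\<lambda>n. (1 - exp (- complex_of_real (saddle n))) / of_real (saddle n)) \<longlonglongrightarrow> 1"
    by (rule main) (use l0 ne' in auto)
  have "(\<lambda>n. ((1 - exp (- complex_of_real (saddle n))) / of_real (saddle n)) /
     (((1 - exp (- s n)) / s n) * (1 + \<i> * of_real (sqrt (saddle n)) * of_real v))) \<longlonglongrightarrow> 1 / (1 * (1 + \<i> * of_real (sqrt 0) * of_real v))"
    by (intro tendsto_divide tendsto_mult m1 main ls ne lr) simp
  hence "(\<lambda>n. ((1 - exp (- complex_of_real (saddle n))) / of_real (saddle n)) /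
     (((1 - exp (- s n)) / s n) * (1 + \<i> * of_real (sqrt (saddle n)) * of_real v))) \<longlonglongrightarrow> 1" by simp
  moreover have "eventually (\<lambda>n. ((1 - exp (- complex_of_real (saddle n))) / of_real (saddle n)) /
     (((1 - exp (- s n)) / s n) * (1 + \<i> * of_real (sqrt (saddle n)) * of_real v)) = of_real (1 - exp (- saddle n)) / (1 - exp (- s n))) sequentially"
    using ev ne
  proof eventually_elim
    case (elim n)
    define r where "r = 1 + \<i> * of_real (sqrt (saddle n)) * of_real v"
    have sr: "s n = of_real (saddle n) * r" unfolding sf r_def ..
    have "r \<noteq> 0" "complex_of_real (saddle n) \<noteq> 0" using elim unfolding sr by auto
    hence "((1 - exp (- complex_of_real (saddle n))) / of_real (saddle n)) / (((1 - exp (- s n)) / s n) * r)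
       = (1 - exp (- complex_of_real (saddle n))) / (1 - exp (- s n))"
      unfolding sr by simp
    moreover have "1 - exp (- complex_of_real (saddle n)) = of_real (1 - exp (- saddle n))"
      by (simp add: exp_of_real[symmetric])
    ultimately show ?case unfolding r_def by simp
  qed
  ultimately show ?thesis unfolding s_def by (rule Lim_transform_eventually)
qed

text \<open>What remains of the linear term is
  \<open>\<i> * (y / x) * (\<kappa>1 / x - B1 x)\<close>, where the last factor is bounded and
  \<open>y / x = sqrt x * v\<close> tends to 0. The cubic error is of order \<open>sqrt x\<close> as
  well. Only the quadratic term survives, because \<open>x * B2 x\<close> tends to
  \<open>\<kappa>2\<close>.\<close>

lemma saddle_exponent_tendsto:
  "(\<lambda>n. log_gf D (of_real (saddle n) + \<i> * of_real (saddle n * sqrt (saddle n) * v)) - log_gf D (of_real (saddle n))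
      + \<i> * of_real (real n * (saddle n * sqrt (saddle n) * v))) \<longlonglongrightarrow> of_real (- (\<kappa>2 * v ^ 2 / 2))"
proof -
  define E where "E = (\<lambda>x n. log_gf D (of_real x + \<i> * of_real (x * sqrt x * v)) - log_gf D (of_real x)
      + \<i> * of_real (real n * (x * sqrt x * v)))"
  have bnd: "norm (E (saddle n) n - of_real (- (\<kappa>2 * v ^ 2 / 2))) \<le> sqrt (saddle n) * (512 * \<bar>v\<bar> ^ 3 + card R * \<bar>v\<bar>) + saddle n * (v ^ 2 / 2 * card R)"
    if n: "n > 0" and x1: "saddle n \<le> 1" for n
  proof -
    define x where "x = saddle n"
    define y where "y = x * sqrt x * v"
    have x: "0 < x" "x \<le> 1" unfolding x_def using saddle_pos[OF n] x1 by auto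
    have "x ^ 2 = \<kappa>1 / n" unfolding x_def saddle_def using \<kappa>_pos n by simp
    hence nx: "real n * x ^ 2 = \<kappa>1" using n by simp
    have yx: "y / x = sqrt x * v" unfolding y_def using x by simp
    have ny: "real n * y = (y / x) * (\<kappa>1 / x)" unfolding nx[symmetric] using x by (simp add: power2_eq_square)
    have xs: "sqrt x * sqrt x = x" using x by simp
    define T where "T = log_gf D (of_real x + \<i> * of_real y) - log_gf D (of_real x) + \<i> * of_real (y / x * B1 x) + of_real ((y / x) ^ 2 / 2 * B2 x)"
    have "norm T \<le> 512 * \<bar>y / x\<bar> ^ 3 / x" unfolding T_def by (rule log_gf_Taylor[OF x])
    also have "\<dots> = 512 * sqrt x * \<bar>v\<bar> ^ 3"
    proof -
      have "\<bar>y / x\<bar> ^ 3 = (sqrt x * sqrt x) * sqrt x * \<bar>v\<bar> ^ 3"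
        unfolding yx abs_mult power_mult_distrib using x by (simp add: power3_eq_cube)
      thus ?thesis unfolding xs using x by simp
    qed
    finally have T: "norm T \<le> 512 * sqrt x * \<bar>v\<bar> ^ 3" .
    have U: "\<bar>(y / x) * (\<kappa>1 / x - B1 x)\<bar> \<le> sqrt x * \<bar>v\<bar> * card R"
    proof -
      have "\<bar>\<kappa>1 / x - B1 x\<bar> \<le> card R" using B1_asymp[OF x(1)] unfolding \<kappa>1_def by (simp add: abs_minus_commute)
      thus ?thesis unfolding abs_mult yx using x by (intro mult_mono) auto
    qed
    have V: "\<bar>v ^ 2 / 2 * (\<kappa>2 - x * B2 x)\<bar> \<le> v ^ 2 / 2 * (x * card R)"
    proof -
      have "\<kappa>2 - x * B2 x = - (x * (B2 x - card R * bose2_int / (p * x)))"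
        unfolding \<kappa>2_def using x p1 by (simp add: field_simps)
      hence "\<bar>\<kappa>2 - x * B2 x\<bar> = x * \<bar>B2 x - card R * bose2_int / (p * x)\<bar>" using x by (simp add: abs_mult)
      also have "\<dots> \<le> x * card R" using B2_asymp[OF x(1)] x by (intro mult_left_mono) auto
      finally show ?thesis unfolding abs_mult by (intro mult_mono) auto
    qed
    have y2: "(y / x) ^ 2 / 2 * B2 x = v ^ 2 / 2 * (x * B2 x)"
      unfolding yx power_mult_distrib using x by simp
    have "E x n - of_real (- (\<kappa>2 * v ^ 2 / 2)) = T + \<i> * of_real ((y / x) * (\<kappa>1 / x - B1 x)) + of_real (v ^ 2 / 2 * (\<kappa>2 - x * B2 x))"
      unfolding E_def T_def y_def[symmetric] ny y2 by (simp add: algebra_simps)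
    also have "norm \<dots> \<le> norm T + \<bar>(y / x) * (\<kappa>1 / x - B1 x)\<bar> + \<bar>v ^ 2 / 2 * (\<kappa>2 - x * B2 x)\<bar>"
      by (intro order_trans[OF norm_triangle_ineq] add_mono) (simp_all add: norm_mult del: of_real_mult of_real_diff of_real_divide)
    also have "\<dots> \<le> 512 * sqrt x * \<bar>v\<bar> ^ 3 + sqrt x * \<bar>v\<bar> * card R + v ^ 2 / 2 * (x * card R)"
      by (intro add_mono T U V)
    finally show ?thesis unfolding x_def by (simp add: algebra_simps)
  qed
  have "(\<lambda>n. sqrt (saddle n) * (512 * \<bar>v\<bar> ^ 3 + card R * \<bar>v\<bar>) + saddle n * (v ^ 2 / 2 * card R)) \<longlonglongrightarrow>
     sqrt 0 * (512 * \<bar>v\<bar> ^ 3 + card R * \<bar>v\<bar>) + 0 * (v ^ 2 / 2 * card R)"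
    by (intro tendsto_add tendsto_mult tendsto_const tendsto_real_sqrt saddle_tendsto_0)
  hence "(\<lambda>n. sqrt (saddle n) * (512 * \<bar>v\<bar> ^ 3 + card R * \<bar>v\<bar>) + saddle n * (v ^ 2 / 2 * card R)) \<longlonglongrightarrow> 0" by simp
  moreover have "eventually (\<lambda>n. norm (E (saddle n) n - of_real (- (\<kappa>2 * v ^ 2 / 2))) \<le>
     sqrt (saddle n) * (512 * \<bar>v\<bar> ^ 3 + card R * \<bar>v\<bar>) + saddle n * (v ^ 2 / 2 * card R)) sequentially"
    using order_tendstoD(2)[OF saddle_tendsto_0 zero_less_one] eventually_gt_at_top[of 0]
    by eventually_elim (rule bnd, auto)
  ultimately have "(\<lambda>n. E (saddle n) n - of_real (- (\<kappa>2 * v ^ 2 / 2))) \<longlonglongrightarrow> 0"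
    by (rule Lim_null_comparison[rotated])
  thus ?thesis unfolding E_def by (rule LIM_zero_cancel)
qed

lemma saddle_integrand_tendsto:
  "(\<lambda>n. saddle_integrand n (saddle n) v) \<longlonglongrightarrow> of_real (exp (- (\<kappa>2 * v ^ 2 / 2)))"
proof -
  have "(\<lambda>n. exp (log_gf D (of_real (saddle n) + \<i> * of_real (saddle n * sqrt (saddle n) * v)) - log_gf D (of_real (saddle n))
      + \<i> * of_real (real n * (saddle n * sqrt (saddle n) * v))) *
      (of_real (1 - exp (- saddle n)) / (1 - exp (- (of_real (saddle n) + \<i> * of_real (saddle n * sqrt (saddle n) * v))))))
     \<longlonglongrightarrow> exp (of_real (- (\<kappa>2 * v ^ 2 / 2))) * 1"
    by (intro tendsto_mult tendsto_exp saddle_exponent_tendsto saddle_factor_tendsto)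
  moreover have "(\<lambda>n. \<bar>saddle n * sqrt (saddle n) * v\<bar>) \<longlonglongrightarrow> \<bar>0 * sqrt 0 * v\<bar>"
    by (intro tendsto_rabs tendsto_mult tendsto_const tendsto_real_sqrt saddle_tendsto_0)
  hence "eventually (\<lambda>n. \<bar>saddle n * sqrt (saddle n) * v\<bar> < pi) sequentially"
    by (rule order_tendstoD(2)) simp
  with eventually_gt_at_top[of 0]
  have "eventually (\<lambda>n. exp (log_gf D (of_real (saddle n) + \<i> * of_real (saddle n * sqrt (saddle n) * v)) - log_gf D (of_real (saddle n))
      + \<i> * of_real (real n * (saddle n * sqrt (saddle n) * v))) *
      (of_real (1 - exp (- saddle n)) / (1 - exp (- (of_real (saddle n) + \<i> * of_real (saddle n * sqrt (saddle n) * v)))))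
     = saddle_integrand n (saddle n) v) sequentially"
    by eventually_elim (rule saddle_integrand_eq[symmetric], auto intro: saddle_pos)
  ultimately have "(\<lambda>n. saddle_integrand n (saddle n) v) \<longlonglongrightarrow> exp (of_real (- (\<kappa>2 * v ^ 2 / 2))) * 1"
    by (rule Lim_transform_eventually)
  thus ?thesis by (simp add: exp_of_real[symmetric])
qed

theorem part_sum_asymp:
  "(\<lambda>n. part_sum D n / (saddle n * sqrt (saddle n) * g0 (saddle n) * exp (real n * saddle n)))
     \<longlonglongrightarrow> (\<integral>v. exp (- (\<kappa>2 * v ^ 2 / 2)) \<partial>lborel) / (2 * pi)"
proof -
  obtain C x0 where C: "x0 > 0" "\<And>x n v. 0 < x \<Longrightarrow> x \<le> x0 \<Longrightarrow> norm (saddle_integrand n x v) \<le> C * inverse (1 + v ^ 2)"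
    using saddle_integrand_bound by blast
  \<comment> \<open>The dominating function is valid only once \<open>saddle n\<close> is below
    \<open>x0\<close>; hence the shift of the sequence by \<open>N\<close> before dominated
    convergence.\<close>
  have "eventually (\<lambda>n. saddle n < x0 \<and> n > 0) sequentially"
    using order_tendstoD(2)[OF saddle_tendsto_0 C(1)] eventually_gt_at_top[of 0] by eventually_elim auto
  then obtain N where N: "\<And>n. n \<ge> N \<Longrightarrow> saddle n < x0 \<and> n > 0" unfolding eventually_sequentially by blast
  have "(\<lambda>n. integral\<^sup>L lborel (saddle_integrand (n + N) (saddle (n + N)))) \<longlonglongrightarrow> (\<integral>v. complex_of_real (exp (- (\<kappa>2 * v ^ 2 / 2))) \<partial>lborel)"
  proof (rule integral_dominated_convergence)
    show "integrable lborel (\<lambda>v. C * inverse (1 + v ^ 2))"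
      by (intro integrable_mult_right integrable_inverse_1_plus_square_lborel)
    show "AE v in lborel. (\<lambda>n. saddle_integrand (n + N) (saddle (n + N)) v) \<longlonglongrightarrow> complex_of_real (exp (- (\<kappa>2 * v ^ 2 / 2)))"
      by (intro AE_I2 LIMSEQ_ignore_initial_segment saddle_integrand_tendsto)
    fix n
    have n: "saddle (n + N) < x0" "n + N > 0" using N[of "n + N"] by auto
    show "saddle_integrand (n + N) (saddle (n + N)) \<in> borel_measurable lborel"
      using saddle_integrand(1)[OF saddle_pos[OF n(2)]] by (rule borel_measurable_integrable)
    show "AE v in lborel. norm (saddle_integrand (n + N) (saddle (n + N)) v) \<le> C * inverse (1 + v ^ 2)"
      using n C(2)[OF saddle_pos[OF n(2)]] by (intro AE_I2) auto
  qed simp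
  hence "(\<lambda>n. integral\<^sup>L lborel (saddle_integrand n (saddle n))) \<longlonglongrightarrow> (\<integral>v. complex_of_real (exp (- (\<kappa>2 * v ^ 2 / 2))) \<partial>lborel)"
    by (rule LIMSEQ_offset)
  also have "(\<integral>v. complex_of_real (exp (- (\<kappa>2 * v ^ 2 / 2))) \<partial>lborel) = of_real (\<integral>v. exp (- (\<kappa>2 * v ^ 2 / 2)) \<partial>lborel)"
    by (rule integral_complex_of_real)
  finally have "(\<lambda>n. integral\<^sup>L lborel (saddle_integrand n (saddle n))) \<longlonglongrightarrow> of_real (\<integral>v. exp (- (\<kappa>2 * v ^ 2 / 2)) \<partial>lborel)" .
  moreover have "eventually (\<lambda>n. integral\<^sup>L lborel (saddle_integrand n (saddle n)) =
     of_real (2 * pi * (part_sum D n / (saddle n * sqrt (saddle n) * g0 (saddle n) * exp (real n * saddle n))))) sequentially"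
    using eventually_gt_at_top[of 0] by eventually_elim (rule saddle_integrand(2)[symmetric, OF saddle_pos])
  ultimately have "(\<lambda>n. complex_of_real (2 * pi * (part_sum D n / (saddle n * sqrt (saddle n) * g0 (saddle n) * exp (real n * saddle n)))))
     \<longlonglongrightarrow> of_real (\<integral>v. exp (- (\<kappa>2 * v ^ 2 / 2)) \<partial>lborel)"
    by (rule Lim_transform_eventually)
  hence "(\<lambda>n. 2 * pi * (part_sum D n / (saddle n * sqrt (saddle n) * g0 (saddle n) * exp (real n * saddle n))))
     \<longlonglongrightarrow> (\<integral>v. exp (- (\<kappa>2 * v ^ 2 / 2)) \<partial>lborel)"
    unfolding tendsto_of_real_iff .
  from tendsto_divide[OF this tendsto_const[of "2 * pi"]] show ?thesis by simp
qed

end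

section \<open>The logarithmic ratio near zero\<close>

text \<open>Along the radius to \<open>z\<close>, the derivative of the partial sum plus
  \<open>Ln (1 - t * z)\<close> collapses to one term of modulus at most \<open>t^N / d\<close>,
  where \<open>d > 0\<close> bounds \<open>norm (1 - t * z)\<close> from below. Integration over
  \<open>t\<close> gives the error \<open>1 / ((N + 1) * d)\<close>.\<close>

lemma tendsto_boundary_Ln_series:
  assumes z: "norm z = 1" "z \<noteq> (1 :: complex)"
  shows "(\<lambda>N. \<Sum>n=1..N. z ^ n / of_nat n) \<longlonglongrightarrow> - Ln (1 - z)"
proof -
  have pos: "Re (1 - of_real t * z) > 0" if "t \<in> {0..1}" for t
  proof -
    have "Re (of_real t * z) \<le> 1"
      using complex_Re_le_cmod[of "of_real t * z"] z that by (simp add: norm_mult)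
    moreover have "Re (of_real t * z) \<noteq> 1"
    proof
      assume eq: "Re (of_real t * z) = 1"
      have "norm (of_real t * z) \<le> 1" using z that by (simp add: norm_mult)
      hence "Re (of_real t * z) ^ 2 + Im (of_real t * z) ^ 2 \<le> 1"
        by (metis cmod_power2 norm_ge_zero power_le_one)
      hence "Im (of_real t * z) = 0" using eq by simp
      hence tz: "of_real t * z = 1" using eq by (simp add: complex_eq_iff)
      hence "norm (of_real t * z) = 1" by simp
      hence "t = 1" using z that by (simp add: norm_mult)
      thus False using tz z by simp
    qed
    ultimately show ?thesis by simp
  qed
  obtain d where d: "d > 0" "\<And>t. t \<in> {0..1} \<Longrightarrow> d \<le> norm (1 - of_real t * z)"
  proof -
    have "continuous_on {0..1::real} (\<lambda>t. norm (1 - of_real t * z))" by (intro continuous_intros)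
    then obtain t0 where t0: "t0 \<in> {0..1}" "\<And>t. t \<in> {0..1} \<Longrightarrow> norm (1 - of_real t0 * z) \<le> norm (1 - of_real t * z)"
      using continuous_attains_inf[of "{0..1::real}" "\<lambda>t. norm (1 - of_real t * z)"] by auto
    have "1 - of_real t0 * z \<noteq> 0" using pos[OF t0(1)] by (metis less_irrefl zero_complex.sel(1))
    hence "norm (1 - of_real t0 * z) > 0" by simp
    thus thesis using that t0 by blast
  qed
  define S where "S = (\<lambda>N. \<Sum>n=1..N. z ^ n / of_nat n)"
  have bound: "norm (S N + Ln (1 - z)) \<le> 1 / (real (Suc N) * d)" for N
  proof -
    define F where "F = (\<lambda>t::real. (\<Sum>n=1..N. (of_real t * z) ^ n / of_nat n) + Ln (1 - of_real t * z))"
    define F' where "F' = (\<lambda>t::real. - z * (of_real t * z) ^ N / (1 - of_real t * z))"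
    have der: "(F has_vector_derivative F' t) (at t)" if "t \<in> {0<..<1}" for t
    proof -
      have nz: "1 - of_real t * z \<noteq> 0" using pos[of t] that by (auto simp: complex_eq_iff)
      have nn: "1 - of_real t * z \<notin> \<real>\<^sub>\<le>\<^sub>0" using pos[of t] that by (auto simp: complex_nonpos_Reals_iff)
      define w where "w = of_real t * z"
      have "((\<lambda>u. (\<Sum>n=1..N. (u * z) ^ n / of_nat n) + Ln (1 - u * z)) has_field_derivative
         (\<Sum>n=1..N. w ^ (n - 1) * z) + (- z) / (1 - w)) (at (of_real t))"
      proof (intro DERIV_add DERIV_sum)
        fix n assume n: "n \<in> {1..N}"
        have "((\<lambda>u. (u * z) ^ n) has_field_derivative of_nat n * (w ^ (n - 1) * z)) (at (of_real t))"
          unfolding w_def by (rule derivative_eq_intros refl)+ simp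
        from DERIV_cdivide[OF this, of "of_nat n"]
        show "((\<lambda>u. (u * z) ^ n / of_nat n) has_field_derivative w ^ (n - 1) * z) (at (of_real t))" using n by simp
      next
        show "((\<lambda>u. Ln (1 - u * z)) has_field_derivative (- z) / (1 - w)) (at (of_real t))"
        proof -
          have "((\<lambda>u. 1 - u * z) has_field_derivative - z) (at (of_real t))"
            by (rule derivative_eq_intros refl)+ simp
          from DERIV_chain2[OF has_field_derivative_Ln[OF nn] this] show ?thesis
            unfolding w_def by (simp add: divide_inverse mult_ac)
        qed
      qed
      also have "(\<Sum>n=1..N. w ^ (n - 1) * z) = z * (\<Sum>n<N. w ^ n)"
        unfolding sum_distrib_left
        by (rule sum.reindex_bij_witness[of _ Suc "\<lambda>n. n - 1"]) auto
      also have "z * (\<Sum>n<N. w ^ n) = (z - z * w ^ N) / (1 - w)"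
        using nz unfolding w_def[symmetric] by (simp add: sum_gp_strict right_diff_distrib)
      also have "\<dots> + (- z) / (1 - w) = F' t"
        unfolding F'_def w_def[symmetric] by (simp only: add_divide_distrib[symmetric]) simp
      finally show ?thesis unfolding F_def by (rule has_vector_derivative_real_field)
    qed
    have contF: "continuous_on {0..1} F"
      unfolding F_def
    proof (intro continuous_intros)
      fix t :: real assume "t \<in> {0..1}"
      thus "1 - of_real t * z \<notin> \<real>\<^sub>\<le>\<^sub>0" using pos[of t] by (auto simp: complex_nonpos_Reals_iff)
    qed auto
    have "norm (F 1 - F 0) \<le> 1 ^ Suc N / (real (Suc N) * d) - 0 ^ Suc N / (real (Suc N) * d)"
    proof (rule differentiable_bound_general[where f = F and \<phi> = "\<lambda>t. t ^ Suc N / (real (Suc N) * d)" and f' = F' and \<phi>' = "\<lambda>t. t ^ N / d"])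
      fix t :: real assume t: "0 < t" "t < 1"
      show "(F has_vector_derivative F' t) (at t)" using der t by simp
      have "((\<lambda>t. t ^ Suc N / (real (Suc N) * d)) has_real_derivative (real (Suc N) * t ^ N) / (real (Suc N) * d)) (at t)"
        using DERIV_cdivide[OF DERIV_pow[of "Suc N" t UNIV], of "real (Suc N) * d"] by simp
      thus "((\<lambda>t. t ^ Suc N / (real (Suc N) * d)) has_vector_derivative t ^ N / d) (at t)"
        by (simp add: has_real_derivative_iff_has_vector_derivative[symmetric])
      have "norm (F' t) = t ^ N / norm (1 - of_real t * z)"
        unfolding F'_def using z t by (simp add: norm_mult norm_divide norm_power)
      also have "\<dots> \<le> t ^ N / d" using d t by (intro divide_left_mono) (auto intro!: mult_pos_pos intro: less_le_trans)
      finally show "norm (F' t) \<le> t ^ N / d" .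
    qed (use contF in \<open>auto intro!: continuous_intros\<close>, use d in simp)
    moreover have "F 1 = S N + Ln (1 - z)" "F 0 = 0" unfolding F_def S_def by (auto simp: power_0_left)
    ultimately show ?thesis by simp
  qed
  have "(\<lambda>N. S N + Ln (1 - z)) \<longlonglongrightarrow> 0"
  proof (rule Lim_null_comparison)
    show "eventually (\<lambda>N. norm (S N + Ln (1 - z)) \<le> 1 / (real (Suc N) * d)) sequentially" using bound by simp
    show "(\<lambda>N. 1 / (real (Suc N) * d)) \<longlonglongrightarrow> 0" using d(1) by real_asymp
  qed
  from tendsto_add[OF this tendsto_const[of "- Ln (1 - z)"]] show ?thesis unfolding S_def by simp
qed

context real_quadratic
begin

lemma sum_nat_int: "(\<Sum>a\<in>{0..<int p}. f a) = (\<Sum>a<p. f (int a))"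
  by (rule sum.reindex_bij_witness[of _ int nat]) auto

lemma sum_chi_nat: "(\<Sum>a<p. real_of_int (chi (int a))) = 0"
  using sum_chi unfolding sum_nat_int by (metis of_int_0 of_int_sum)

lemma sum_chi_reflect:
  fixes f :: "real \<Rightarrow> real"
  shows "(\<Sum>a<p. of_int (chi (int a)) * f (real a)) = (\<Sum>a<p. of_int (chi (int a)) * f (real p - real a))"
proof -
  have *: "(\<Sum>a<p. of_int (chi (int a)) * g (real a)) = (\<Sum>a=1..<p. of_int (chi (int a)) * g (real a))" for g :: "real \<Rightarrow> real"
  proof -
    have "{..<p} = insert 0 {1..<p}" using p_gt5 by auto
    thus ?thesis by simp
  qed
  have "(\<Sum>a<p. of_int (chi (int a)) * f (real a)) = (\<Sum>a=1..<p. of_int (chi (int a)) * f (real a))" by (rule *)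
  also have "\<dots> = (\<Sum>a=1..<p. of_int (chi (int p - int a)) * f (real p - real a))"
    by (rule sum.reindex_bij_witness[of _ "\<lambda>a. p - a" "\<lambda>a. p - a"]) (auto simp: of_nat_diff)
  also have "\<dots> = (\<Sum>a<p. of_int (chi (int a)) * f (real p - real a))"
    unfolding chi_reflect using *[of "\<lambda>x. f (real p - x)"] by simp
  finally show ?thesis .
qed

text \<open>Replacing \<open>a\<close> by \<open>p - a\<close> preserves the even character and, as
  the character sums to 0, turns the sum into its negative.\<close>

lemma sum_mult_chi: "(\<Sum>a<p. of_int (chi (int a)) * real a) = 0"
proof -
  have "(\<Sum>a<p. of_int (chi (int a)) * real a) = (\<Sum>a<p. of_int (chi (int a)) * (real p - real a))"
    using sum_chi_reflect[of "\<lambda>x. x"] by simp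
  also have "\<dots> = (\<Sum>a<p. of_int (chi (int a))) * real p - (\<Sum>a<p. of_int (chi (int a)) * real a)"
    by (simp add: right_diff_distrib sum_subtractf sum_distrib_right)
  finally show ?thesis by (simp add: sum_chi_nat)
qed

lemma abs_chi_le: "\<bar>real_of_int (chi a)\<bar> \<le> 1"
  using chi_values[of a] by auto

text \<open>Over a full period the character annihilates constants and, being even, also linear
  functions; only the second order remainder of \<open>f\<close> counts.\<close>

lemma chi_block_bound:
  fixes f f' f'' :: "real \<Rightarrow> real" and T M :: real
  assumes f: "\<And>t. t \<in> {T..T + p} \<Longrightarrow> (f has_real_derivative f' t) (at t)"
    and f': "\<And>t. t \<in> {T..T + p} \<Longrightarrow> (f' has_real_derivative f'' t) (at t)"
    and M: "\<And>t. t \<in> {T..T + p} \<Longrightarrow> \<bar>f'' t\<bar> \<le> M"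
  shows "\<bar>\<Sum>a<p. of_int (chi (int a)) * f (T + a)\<bar> \<le> p ^ 3 * M"
proof -
  have M0: "M \<ge> 0" using M[of T] by force
  have 1: "\<bar>f (T + a) - f T - a * f' T\<bar> \<le> p ^ 2 * M" if a: "a < p" for a :: nat
  proof (cases "a = 0")
    case False
    obtain u where u: "T < u" "u < T + a" "f (T + a) - f T = a * f' u"
      using MVT2[of T "T + a" f f'] f a False by auto
    obtain v where v: "T < v" "v < u" "f' u - f' T = (u - T) * f'' v"
      using MVT2[of T u f' f''] f' a u by auto
    have "f (T + a) - f T - a * f' T = a * ((u - T) * f'' v)" unfolding v(3)[symmetric] using u(3) by (simp add: algebra_simps)
    also have "\<bar>\<dots>\<bar> = a * ((u - T) * \<bar>f'' v\<bar>)" using u by (simp add: abs_mult)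
    also have "\<dots> \<le> p * (p * M)" using a u v M0 M[of v] by (intro mult_mono) auto
    finally show ?thesis by (simp add: power2_eq_square)
  qed (use M0 in auto)
  have "(\<Sum>a<p. of_int (chi (int a)) * (f (T + a) - f T - a * f' T)) = 
    (\<Sum>a<p. of_int (chi (int a)) * f (T + a)) - (\<Sum>a<p. of_int (chi (int a))) * f T
      - (\<Sum>a<p. of_int (chi (int a)) * a) * f' T"
    by (simp add: algebra_simps sum_subtractf sum.distrib sum_distrib_left sum_distrib_right)
  hence "(\<Sum>a<p. of_int (chi (int a)) * f (T + a)) = (\<Sum>a<p. of_int (chi (int a)) * (f (T + a) - f T - a * f' T))"
    by (simp add: sum_chi_nat sum_mult_chi)
  also have "\<bar>\<dots>\<bar> \<le> (\<Sum>a<p. \<bar>of_int (chi (int a)) * (f (T + a) - f T - a * f' T)\<bar>)" by (rule sum_abs)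
  also have "\<dots> \<le> (\<Sum>a<p. 1 * (p ^ 2 * M))"
    unfolding abs_mult by (intro sum_mono mult_mono 1 abs_chi_le) auto
  also have "\<dots> = p ^ 3 * M" by (simp add: power3_eq_cube power2_eq_square)
  finally show ?thesis .
qed

definition log_factor :: "real \<Rightarrow> real" where "log_factor z = - ln (1 - exp (- z))"

text \<open>Formally minus the sum of \<open>chi m * ln m\<close>, whose terms do not tend to 0.
  Grouped in periods the sum converges absolutely, the \<open>j\<close>-th block being of order
  \<open>1 / j^2\<close>.\<close>

definition log_ratio_limit :: real where
  "log_ratio_limit = (\<Sum>j. - (\<Sum>a<p. of_int (chi (int a)) * ln (real j * real p + real a)))"

text \<open>With \<open>z = t * x\<close> the second derivative in \<open>t\<close> is
  \<open>z^2 * exp z / (exp z - 1)^2\<close> divided by \<open>t^2\<close>, hence at most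
  \<open>4 / t^2\<close> whatever \<open>x\<close> is. This uniformity permits the limit under the
  sum over blocks.\<close>

lemma log_factor_block_bound:
  assumes "x > 0" "j > 0"
  shows "\<bar>\<Sum>a<p. of_int (chi (int a)) * log_factor ((real j * real p + real a) * x)\<bar> \<le> 4 * p / real j ^ 2"
proof -
  define f where "f = (\<lambda>t. log_factor (t * x))"
  define f' where "f' = (\<lambda>t. - x / (exp (t * x) - 1))"
  define f'' where "f'' = (\<lambda>t. x ^ 2 * exp (t * x) / (exp (t * x) - 1) ^ 2)"
  define T where "T = real j * real p"
  have T: "T > 0" unfolding T_def using assms p_gt5 by simp
  have "\<bar>\<Sum>a<p. of_int (chi (int a)) * f (T + a)\<bar> \<le> p ^ 3 * (4 / T ^ 2)"
  proof (rule chi_block_bound)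
    fix t assume t: "t \<in> {T..T + real p}"
    hence tx: "t * x > 0" using T assms by simp
    hence e: "exp (- (t * x)) < 1" "exp (t * x) > 1" by simp_all
    show "(f has_real_derivative f' t) (at t)"
    proof -
      have d: "((\<lambda>t. 1 - exp (- (t * x))) has_real_derivative x * exp (- (t * x))) (at t)"
        by (auto intro!: derivative_eq_intros)
      have "1 - exp (- (t * x)) > 0" using e by simp
      from DERIV_minus[OF DERIV_chain2[OF DERIV_ln[OF this] d]]
      have "(f has_real_derivative - (inverse (1 - exp (- (t * x))) * (x * exp (- (t * x))))) (at t)"
        unfolding f_def log_factor_def .
      also have "- (inverse (1 - exp (- (t * x))) * (x * exp (- (t * x)))) = f' t"
        unfolding f'_def using e by (simp add: exp_minus field_simps)
      finally show ?thesis .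
    qed
    show "(f' has_real_derivative f'' t) (at t)"
    proof -
      have d: "((\<lambda>t. exp (t * x) - 1) has_real_derivative x * exp (t * x)) (at t)"
        by (auto intro!: derivative_eq_intros)
      have ne: "exp (t * x) - 1 \<noteq> 0" using e(2) by linarith
      from DERIV_divide[OF DERIV_const[of "- x"] d ne]
      have "(f' has_real_derivative (0 * (exp (t * x) - 1) - (- x) * (x * exp (t * x))) / ((exp (t * x) - 1) * (exp (t * x) - 1))) (at t)"
        unfolding f'_def .
      thus ?thesis unfolding f''_def by (simp add: power2_eq_square mult_ac)
    qed
    define z where "z = t * x"
    have z: "z > 0" using tx z_def by simp
    have "exp z - 1 = exp (z/2) * (exp (z/2) - exp (-(z/2)))"
      by (simp add: right_diff_distrib exp_add[symmetric])
    also have "\<dots> \<ge> exp (z/2) * (z/2)"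
    proof (intro mult_left_mono)
      have "exp (z/2) \<ge> 1 + z/2" by (rule exp_ge_add_one_self)
      moreover have "exp (-(z/2)) \<le> 1" using z by simp
      ultimately show "z/2 \<le> exp (z/2) - exp (-(z/2))" by linarith
    qed auto
    finally have "(exp (z/2) * (z/2)) ^ 2 \<le> (exp z - 1) ^ 2" using z by (intro power_mono) auto
    moreover have "(exp (z/2) * (z/2)) ^ 2 = exp z * z ^ 2 / 4"
      by (simp add: power_mult_distrib exp_double[symmetric] power_divide)
    ultimately have le: "exp z * z ^ 2 \<le> 4 * (exp z - 1) ^ 2" by simp
    have "\<bar>f'' t\<bar> = x ^ 2 * (exp z / (exp z - 1) ^ 2)" unfolding f''_def z_def by (simp add: abs_mult)
    also have "exp z / (exp z - 1) ^ 2 \<le> 4 / z ^ 2" using le z by (simp add: field_simps)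
    also have "x ^ 2 * (4 / z ^ 2) = 4 / t ^ 2" using assms tx unfolding z_def by (simp add: field_simps power2_eq_square)
    also have "\<dots> \<le> 4 / T ^ 2" using t T by (intro divide_left_mono power_mono mult_pos_pos zero_less_power) auto
    finally show "\<bar>f'' t\<bar> \<le> 4 / T ^ 2" using mult_left_mono by fastforce
  qed
  also have "p ^ 3 * (4 / T ^ 2) = 4 * p / real j ^ 2"
    unfolding T_def using p_gt5 assms by (simp add: field_simps power2_eq_square power3_eq_cube)
  finally show ?thesis unfolding f_def T_def by simp
qed

lemma log_ratio_tannery:
  "((\<lambda>x. \<Sum>j. \<Sum>a<p. of_int (chi (int a)) * log_factor ((real j * real p + real a) * x)) \<longlongrightarrow> log_ratio_limit) (at_right 0)"
  "summable (\<lambda>j. norm (- (\<Sum>a<p. of_int (chi (int a)) * ln (real j * real p + real a))))"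
proof -
  define b where "b = (\<lambda>j::nat. - (\<Sum>a<p. of_int (chi (int a)) * ln (real j * real p + real a)))"
  define D where "D = (\<lambda>(j::nat) x. \<Sum>a<p. of_int (chi (int a)) * log_factor ((real j * real p + real a) * x))"
  have lim: "(D j \<longlongrightarrow> b j) (at_right 0)" for j
  proof -
    \<comment> \<open>Adding \<open>ln x\<close> to each term changes nothing, as the character sums
      to 0 over a period, and it cancels the singularity of \<open>log_factor\<close> at 0.\<close>
    have "((\<lambda>x. \<Sum>a<p. of_int (chi (int a)) * (log_factor ((real j * real p + real a) * x) + ln x)) \<longlongrightarrow>
       (\<Sum>a<p. of_int (chi (int a)) * (- ln (real j * real p + real a)))) (at_right 0)"
    proof (rule tendsto_sum)
      fix a :: nat
      show "((\<lambda>x. of_int (chi (int a)) * (log_factor ((real j * real p + real a) * x) + ln x)) \<longlongrightarrow>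
         of_int (chi (int a)) * (- ln (real j * real p + real a))) (at_right 0)"
      proof (cases "a = 0")
        case False
        define c where "c = real j * real p + real a"
        have "c > 0" using False unfolding c_def by (simp add: add_nonneg_pos)
        hence "((\<lambda>x. log_factor (c * x) + ln x) \<longlongrightarrow> - ln c) (at_right 0)"
          unfolding log_factor_def by real_asymp
        thus ?thesis unfolding c_def by (intro tendsto_mult tendsto_const)
      qed simp
    qed
    moreover have "(\<Sum>a<p. of_int (chi (int a)) * (log_factor ((real j * real p + real a) * x) + ln x)) = D j x" for x
    proof -
      have "(\<Sum>a<p. of_int (chi (int a)) * (log_factor ((real j * real p + real a) * x) + ln x)) =
        D j x + (\<Sum>a<p. of_int (chi (int a))) * ln x"
        unfolding D_def by (simp add: distrib_left sum.distrib sum_distrib_right)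
      thus ?thesis by (simp add: sum_chi_nat)
    qed
    ultimately show ?thesis unfolding b_def by (simp add: sum_negf)
  qed
  have "eventually (\<lambda>(j, x). norm (D j x) \<le> 4 * p / real j ^ 2) (at_top \<times>\<^sub>F at_right 0)"
  proof -
    have "eventually (\<lambda>j::nat. j > 0) at_top" by (rule eventually_gt_at_top)
    moreover have "eventually (\<lambda>x::real. x > 0) (at_right 0)" by (simp add: eventually_at_right_less)
    ultimately show ?thesis unfolding eventually_prod_filter
      by (intro exI[of _ "\<lambda>j. j > 0"] exI[of _ "\<lambda>x. x > 0"] conjI allI impI)
        (simp_all add: D_def log_factor_block_bound[simplified])
  qed
  moreover have "summable (\<lambda>j. 4 * p / real j ^ 2)"
    by (simp add: inverse_power_summable[of 2, where 'a = real] divide_inverse summable_mult)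
  ultimately have T: "eventually (\<lambda>x. summable (\<lambda>j. norm (D j x))) (at_right 0) \<and> summable (\<lambda>j. norm (b j)) \<and>
      ((\<lambda>x. \<Sum>j. D j x) \<longlongrightarrow> (\<Sum>j. b j)) (at_right 0)"
    using lim by (intro tannerys_theorem) auto
  thus "((\<lambda>x. \<Sum>j. \<Sum>a<p. of_int (chi (int a)) * log_factor ((real j * real p + real a) * x)) \<longlongrightarrow> log_ratio_limit) (at_right 0)"
    unfolding log_ratio_limit_def D_def b_def by simp
  show "summable (\<lambda>j. norm (- (\<Sum>a<p. of_int (chi (int a)) * ln (real j * real p + real a))))"
    using T unfolding b_def by simp
qed

lemma log_factor_summable: "x > 0 \<Longrightarrow> summable (\<lambda>m. log_factor (real (Suc m) * x))"
proof (rule summable_comparison_test_ev)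
  assume x: "x > 0"
  have e: "exp (- x) < 1" using x by simp
  show "summable (\<lambda>m. exp (- x) ^ Suc m / (1 - exp (- x)))"
    using e by (intro summable_divide) (simp add: summable_Suc_iff summable_geometric)
  show "eventually (\<lambda>m. norm (log_factor (real (Suc m) * x)) \<le> exp (- x) ^ Suc m / (1 - exp (- x))) sequentially"
  proof (intro always_eventually allI)
    fix m
    define w where "w = exp (- x) ^ Suc m"
    have w: "w = exp (- (real (Suc m) * x))" unfolding w_def exp_of_nat_mult[symmetric] by simp
    have w1: "0 < w" "w \<le> exp (- x)" using x e power_decreasing[of 1 "Suc m" "exp (- x)"] unfolding w_def by auto
    hence w2: "w < 1" using e by linarith
    have "ln (1 / (1 - w)) \<le> 1 / (1 - w) - 1" using w2 by (intro ln_le_minus_one) simp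
    also have "\<dots> = w / (1 - w)" using w2 by (simp add: field_simps)
    also have "\<dots> \<le> w / (1 - exp (- x))" by (intro divide_left_mono mult_pos_pos; use w1 w2 e in linarith)
    finally have "- ln (1 - w) \<le> w / (1 - exp (- x))" using w2 by (simp add: ln_div)
    moreover have "ln (1 - w) \<le> 0" using w1 w2 by simp
    ultimately show "norm (log_factor (real (Suc m) * x)) \<le> exp (- x) ^ Suc m / (1 - exp (- x))"
      unfolding log_factor_def w[symmetric] w_def[symmetric] by simp
  qed
qed

lemma log_ratio_series_tendsto:
  "((\<lambda>x. \<Sum>m. of_int (chi (int m)) * log_factor (real m * x)) \<longlongrightarrow> log_ratio_limit) (at_right 0)"
proof (rule Lim_transform_eventually[OF log_ratio_tannery(1)])
  have "(\<Sum>j. \<Sum>a<p. of_int (chi (int a)) * log_factor ((real j * real p + real a) * x)) =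
        (\<Sum>m. of_int (chi (int m)) * log_factor (real m * x))" if x: "x > 0" for x
  proof -
    define g where "g = (\<lambda>m. of_int (chi (int m)) * log_factor (real m * x))"
    have "summable (\<lambda>m. norm (g (Suc m)))"
    proof (rule summable_comparison_test_ev)
      show "summable (\<lambda>m. norm (log_factor (real (Suc m) * x)))"
      proof -
        have "norm (log_factor (real (Suc m) * x)) = log_factor (real (Suc m) * x)" for m
          unfolding log_factor_def using x by (simp add: ln_le_zero_iff del: of_nat_Suc)
        thus ?thesis using log_factor_summable[OF x] by simp
      qed
      show "eventually (\<lambda>m. norm (norm (g (Suc m))) \<le> norm (log_factor (real (Suc m) * x))) sequentially"
        unfolding g_def by (intro always_eventually allI) (auto simp: abs_mult intro!: mult_left_le_one_le abs_chi_le)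
    qed
    hence "summable g" using summable_norm_cancel summable_Suc_iff by blast
    hence "(\<lambda>j. sum g {j * p..<j * p + p}) sums (\<Sum>m. g m)" using p_gt5 by (intro sums_group summable_sums) auto
    moreover have "sum g {j * p..<j * p + p} = (\<Sum>a<p. of_int (chi (int a)) * log_factor ((real j * real p + real a) * x))" for j
    proof -
      have "sum g {j * p..<j * p + p} = (\<Sum>a<p. g (j * p + a))"
        by (rule sum.reindex_bij_witness[of _ "\<lambda>a. j * p + a" "\<lambda>m. m - j * p"]) auto
      also have "\<dots> = (\<Sum>a<p. of_int (chi (int a)) * log_factor ((real j * real p + real a) * x))"
      proof (intro sum.cong refl)
        fix a
        have "chi (int (j * p + a)) = chi (int a)" by (rule chi_cong) (simp add: cong_iff_dvd_diff)
        thus "g (j * p + a) = of_int (chi (int a)) * log_factor ((real j * real p + real a) * x)"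
          unfolding g_def by simp
      qed
      finally show ?thesis .
    qed
    ultimately show ?thesis unfolding g_def by (simp add: sums_iff)
  qed
  thus "\<forall>\<^sub>F x in at_right 0. (\<Sum>j. \<Sum>a<p. of_int (chi (int a)) * log_factor ((real j * real p + real a) * x)) =
        (\<Sum>m. of_int (chi (int m)) * log_factor (real m * x))"
    by (intro eventually_mono[OF eventually_at_right_less])
qed

text \<open>For \<open>j \<le> J\<close> the numbers \<open>ln (j * p + a)\<close> add up to
  \<open>ln (rGamma_series (a / p) J)\<close> plus terms constant or linear in \<open>a\<close>,
  which the character kills. In the limit the blocks become logarithms of the reciprocal Gamma
  function at \<open>a / p\<close>, and averaging over \<open>a\<close> and \<open>p - a\<close>
  brings in the reflection formula.\<close>

lemma log_ratio_limit_eq: "log_ratio_limit = - (\<Sum>a<p. of_int (chi (int a)) * ln (sin (pi * real a / p))) / 2"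
proof -
  define b where "b = (\<lambda>j::nat. - (\<Sum>a<p. of_int (chi (int a)) * ln (real j * real p + real a)))"
  have "summable b" unfolding b_def using log_ratio_tannery(2) by (rule summable_norm_cancel)
  hence "(\<lambda>J. \<Sum>j<J. b j) \<longlonglongrightarrow> log_ratio_limit"
    unfolding log_ratio_limit_def b_def[symmetric] by (rule summable_LIMSEQ)
  hence lim1: "(\<lambda>J. \<Sum>j\<le>J. b j) \<longlonglongrightarrow> log_ratio_limit"
    using LIMSEQ_Suc[of "\<lambda>J. \<Sum>j<J. b j"] by (simp add: lessThan_Suc_atMost)
  have frac: "real a / p > 0" "real a / p < 1" if "a \<in> {1..<p}" for a using that by auto
  have zero: "(\<Sum>a<p. of_int (chi (int a)) * g a) = (\<Sum>a=1..<p. of_int (chi (int a)) * g a)" for g :: "nat \<Rightarrow> real"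
  proof -
    have "{..<p} = insert 0 {1..<p}" using p_gt5 by auto
    thus ?thesis by simp
  qed
  have "eventually (\<lambda>J. (\<Sum>j\<le>J. b j) = - (\<Sum>a=1..<p. of_int (chi (int a)) * ln (rGamma_series (real a / p) J))) sequentially"
    using eventually_gt_at_top[of 0]
  proof eventually_elim
    case (elim J)
    have lnG: "ln (rGamma_series (real a / p) J) = (\<Sum>j\<le>J. ln (real j * real p + real a)) - (real J + 1) * ln p - ln (fact J) - real a / p * ln J"
      if a: "a \<in> {1..<p}" for a
    proof -
      have pp: "pochhammer (real a / p) (J + 1) > 0" using frac[OF a] by (intro pochhammer_pos) auto
      have "ln (rGamma_series (real a / p) J) = ln (pochhammer (real a / p) (J + 1)) - (ln (fact J) + real a / p * ln J)"
        unfolding rGamma_series_def using pp elim by (simp add: ln_div ln_mult)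
      also have "ln (pochhammer (real a / p) (J + 1)) = (\<Sum>j\<le>J. ln (real a / p + real j))"
        unfolding pochhammer_prod using frac[OF a]
        by (subst ln_prod) (auto simp: add_pos_nonneg atLeast0LessThan lessThan_Suc_atMost)
      also have "\<dots> = (\<Sum>j\<le>J. ln (real j * real p + real a) - ln p)"
      proof (intro sum.cong refl)
        fix j
        have "real a / p + real j = (real j * real p + real a) / p" using p_gt5 by (simp add: field_simps)
        moreover have "real j * real p + real a > 0" using a by (intro add_nonneg_pos) auto
        ultimately show "ln (real a / p + real j) = ln (real j * real p + real a) - ln p"
          using p_gt5 by (simp add: ln_div)
      qed
      finally show ?thesis by (simp add: sum_subtractf algebra_simps)
    qed
    have "(\<Sum>a=1..<p. of_int (chi (int a)) * ln (rGamma_series (real a / p) J)) =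
      (\<Sum>a=1..<p. of_int (chi (int a)) * ((\<Sum>j\<le>J. ln (real j * real p + real a)) - (real J + 1) * ln p - ln (fact J) - real a / p * ln J))"
      by (intro sum.cong refl) (simp add: lnG)
    also have "\<dots> = (\<Sum>a<p. of_int (chi (int a)) * ((\<Sum>j\<le>J. ln (real j * real p + real a)) - (real J + 1) * ln p - ln (fact J) - real a / p * ln J))"
      by (rule zero[symmetric])
    also have "\<dots> = (\<Sum>a<p. of_int (chi (int a)) * (\<Sum>j\<le>J. ln (real j * real p + real a)))
        - (\<Sum>a<p. of_int (chi (int a))) * ((real J + 1) * ln p + ln (fact J))
        - (\<Sum>a<p. of_int (chi (int a)) * real a) * (ln J / p)"
      by (simp add: algebra_simps sum_subtractf sum.distrib sum_distrib_left sum_distrib_right)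
    also have "\<dots> = (\<Sum>a<p. of_int (chi (int a)) * (\<Sum>j\<le>J. ln (real j * real p + real a)))"
      by (simp add: sum_chi_nat sum_mult_chi)
    also have "\<dots> = (\<Sum>j\<le>J. \<Sum>a<p. of_int (chi (int a)) * ln (real j * real p + real a))"
      by (simp add: sum_distrib_left) (rule sum.swap)
    finally show ?case unfolding b_def by (simp add: sum_negf)
  qed
  hence "(\<lambda>J. - (\<Sum>a=1..<p. of_int (chi (int a)) * ln (rGamma_series (real a / p) J))) \<longlonglongrightarrow> log_ratio_limit"
    by (rule Lim_transform_eventually[OF lim1])
  moreover have "(\<lambda>J. - (\<Sum>a=1..<p. of_int (chi (int a)) * ln (rGamma_series (real a / p) J))) \<longlonglongrightarrow>
      - (\<Sum>a=1..<p. of_int (chi (int a)) * ln (rGamma (real a / p)))"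
  proof (intro tendsto_intros rGamma_series_LIMSEQ)
    fix a assume "a \<in> {1..<p}"
    from Gamma_real_pos[OF frac(1)[OF this]] have "Gamma (real a / real p) \<noteq> 0" by linarith
    thus "rGamma (real a / p) \<noteq> 0" unfolding rGamma_inverse_Gamma by simp
  qed
  ultimately have "log_ratio_limit = - (\<Sum>a=1..<p. of_int (chi (int a)) * ln (rGamma (real a / p)))"
    using LIMSEQ_unique by blast
  also have "\<dots> = - (\<Sum>a<p. of_int (chi (int a)) * ln (rGamma (real a / p)))" by (simp only: zero)
  finally have L1: "log_ratio_limit = - (\<Sum>a<p. of_int (chi (int a)) * ln (rGamma (real a / p)))" .
  have L2: "log_ratio_limit = - (\<Sum>a<p. of_int (chi (int a)) * ln (rGamma ((real p - real a) / p)))"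
    unfolding L1 using sum_chi_reflect[of "\<lambda>x. ln (rGamma (x / p))"] by simp
  have "2 * log_ratio_limit = - (\<Sum>a<p. of_int (chi (int a)) * (ln (rGamma (real a / p)) + ln (rGamma ((real p - real a) / p))))"
    using L1 L2 by (simp add: distrib_left sum.distrib)
  also have "(\<Sum>a<p. of_int (chi (int a)) * (ln (rGamma (real a / p)) + ln (rGamma ((real p - real a) / p)))) =
    (\<Sum>a=1..<p. of_int (chi (int a)) * (ln (rGamma (real a / p)) + ln (rGamma ((real p - real a) / p))))" by (rule zero)
  also have "\<dots> = (\<Sum>a=1..<p. of_int (chi (int a)) * (ln (sin (pi * real a / p)) - ln pi))"
  proof (intro sum.cong refl)
    fix a assume a: "a \<in> {1..<p}"
    define y where "y = real a / p"
    have y: "0 < y" "y < 1" unfolding y_def using frac[OF a] by auto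
    have y': "(real p - real a) / p = 1 - y" unfolding y_def using p_gt5 by (simp add: field_simps)
    have "of_real (rGamma y * rGamma (1 - y)) = (of_real (sin (pi * y) / pi) :: complex)"
    proof -
      have "sin (complex_of_real pi * of_real y) = of_real (sin (pi * y))"
        using sin_of_real[of "pi * y", where 'a = complex] by simp
      thus ?thesis
        using rGamma_reflection_complex[of "of_real y"] rGamma_complex_of_real[of y] rGamma_complex_of_real[of "1 - y"] by simp
    qed
    hence refl: "rGamma y * rGamma (1 - y) = sin (pi * y) / pi" by (simp only: of_real_eq_iff)
    have g: "rGamma t > 0" if "t > 0" for t :: real
      using Gamma_real_pos[OF that] by (simp add: rGamma_inverse_Gamma)
    have "ln (rGamma y) + ln (rGamma (1 - y)) = ln (sin (pi * y) / pi)"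
      using ln_mult[of "rGamma y" "rGamma (1 - y)"] g[of y] g[of "1 - y"] y unfolding refl by simp
    also have "\<dots> = ln (sin (pi * y)) - ln pi"
      using sin_gt_zero[of "pi * y"] y by (subst ln_div) auto
    finally show "of_int (chi (int a)) * (ln (rGamma (real a / p)) + ln (rGamma ((real p - real a) / p))) =
      of_int (chi (int a)) * (ln (sin (pi * real a / p)) - ln pi)"
      unfolding y' y_def[symmetric] by (simp add: y_def)
  qed
  also have "\<dots> = (\<Sum>a<p. of_int (chi (int a)) * (ln (sin (pi * real a / p)) - ln pi))" by (rule zero[symmetric])
  also have "\<dots> = (\<Sum>a<p. of_int (chi (int a)) * ln (sin (pi * real a / p))) - (\<Sum>a<p. of_int (chi (int a))) * ln pi"
    by (simp add: right_diff_distrib sum_subtractf sum_distrib_right)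
  finally show ?thesis by (simp add: sum_chi_nat)
qed

text \<open>The twist formula replaces \<open>chi n * gauss_sum\<close> by additive characters, so
  the series becomes a finite combination of boundary logarithm series. Their real parts involve
  \<open>norm (1 - ep a) = 2 * sin (pi * a / p)\<close>, from which the constant \<open>ln 2\<close>
  drops out. Convergence of the series is obtained on the way.\<close>

lemma L_value: "(\<lambda>N. \<Sum>n=1..N. of_int (chi (int n)) / real n) \<longlonglongrightarrow> 2 * log_ratio_limit / sqrt p"
proof -
  have zero: "(\<Sum>a<p. of_int (chi (int a)) * g a) = (\<Sum>a=1..<p. of_int (chi (int a)) * g a)" for g :: "nat \<Rightarrow> 'a :: comm_ring_1"
  proof -
    have "{..<p} = insert 0 {1..<p}" using p_gt5 by auto
    thus ?thesis by simp
  qed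
  have eppow: "ep (int a * int n) = ep (int a) ^ n" for a n
    unfolding ep_def Complex.DeMoivre by (rule arg_cong[of _ _ cis]) simp
  have "of_real (\<Sum>n=1..N. of_int (chi (int n)) / real n) * gauss_sum =
      (\<Sum>a=1..<p. of_int (chi (int a)) * (\<Sum>n=1..N. ep (int a) ^ n / of_nat n))" for N
  proof -
    have "of_real (\<Sum>n=1..N. of_int (chi (int n)) / real n) * gauss_sum =
      (\<Sum>n=1..N. (of_int (chi (int n)) * gauss_sum) / of_nat n)" by (simp add: sum_distrib_right)
    also have "\<dots> = (\<Sum>n=1..N. (\<Sum>a<p. of_int (chi (int a)) * ep (int a) ^ n) / of_nat n)"
      unfolding gauss_sum_twist[symmetric] sum_nat_int by (simp add: eppow)
    also have "\<dots> = (\<Sum>n=1..N. \<Sum>a<p. of_int (chi (int a)) * (ep (int a) ^ n / of_nat n))"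
      by (simp add: sum_divide_distrib)
    also have "\<dots> = (\<Sum>a<p. of_int (chi (int a)) * (\<Sum>n=1..N. ep (int a) ^ n / of_nat n))"
      by (subst sum.swap) (simp add: sum_distrib_left)
    finally show ?thesis by (simp only: zero)
  qed
  moreover have "(\<lambda>N. \<Sum>a=1..<p. of_int (chi (int a)) * (\<Sum>n=1..N. ep (int a) ^ n / of_nat n)) \<longlonglongrightarrow>
     (\<Sum>a=1..<p. of_int (chi (int a)) * (- Ln (1 - ep (int a))))"
  proof (intro tendsto_intros tendsto_boundary_Ln_series)
    fix a assume a: "a \<in> {1..<p}"
    show "norm (ep (int a)) = 1" by (simp add: ep_def)
    show "ep (int a) \<noteq> 1" using a by (auto simp: ep_eq_1_iff dest!: nat_dvd_not_less)
  qed
  ultimately have "(\<lambda>N. of_real (\<Sum>n=1..N. of_int (chi (int n)) / real n) * gauss_sum) \<longlonglongrightarrow> 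
     (\<Sum>a=1..<p. of_int (chi (int a)) * (- Ln (1 - ep (int a))))" by simp
  hence "(\<lambda>N. Re (of_real (\<Sum>n=1..N. of_int (chi (int n)) / real n) * gauss_sum)) \<longlonglongrightarrow> 
     Re (\<Sum>a=1..<p. of_int (chi (int a)) * (- Ln (1 - ep (int a))))" by (rule tendsto_Re)
  hence lim: "(\<lambda>N. (\<Sum>n=1..N. of_int (chi (int n)) / real n) * sqrt p) \<longlonglongrightarrow> 
     Re (\<Sum>a=1..<p. of_int (chi (int a)) * (- Ln (1 - ep (int a))))" by (simp add: gauss_sum_eq)
  have "Re (\<Sum>a=1..<p. of_int (chi (int a)) * (- Ln (1 - ep (int a)))) =
     - (\<Sum>a=1..<p. of_int (chi (int a)) * (ln 2 + ln (sin (pi * real a / p))))"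
    unfolding Re_sum sum_negf[symmetric]
  proof (intro sum.cong refl)
    fix a assume a: "a \<in> {1..<p}"
    have e1: "ep (int a) \<noteq> 1" using a by (auto simp: ep_eq_1_iff dest!: nat_dvd_not_less)
    have s: "sin (pi * real a / p) > 0" using a by (intro sin_gt_zero) (auto simp: field_simps)
    have "norm (1 - ep (int a)) = norm (exp (\<i> * of_real (2 * pi * real a / p)) - 1)"
      by (simp add: ep_def cis_conv_exp norm_minus_commute)
    also have "\<dots> = 2 * sin (pi * real a / p)" unfolding dist_exp_i_1 using s by simp
    finally have "Re (Ln (1 - ep (int a))) = ln (2 * sin (pi * real a / p))" using e1 by simp
    thus "Re (of_int (chi (int a)) * (- Ln (1 - ep (int a)))) = - (of_int (chi (int a)) * (ln 2 + ln (sin (pi * real a / p))))"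
      using s by (simp add: ln_mult)
  qed
  also have "\<dots> = - (\<Sum>a<p. of_int (chi (int a)) * (ln 2 + ln (sin (pi * real a / p))))" by (simp only: zero)
  also have "\<dots> = - (\<Sum>a<p. of_int (chi (int a)) * ln (sin (pi * real a / p))) - (\<Sum>a<p. of_int (chi (int a))) * ln 2"
    by (simp add: distrib_left sum.distrib sum_distrib_right)
  also have "\<dots> = 2 * log_ratio_limit" by (simp add: sum_chi_nat log_ratio_limit_eq)
  finally have "(\<lambda>N. (\<Sum>n=1..N. of_int (chi (int n)) / real n) * sqrt p / sqrt p) \<longlonglongrightarrow> 2 * log_ratio_limit / sqrt p"
    using lim p_gt5 by (intro tendsto_divide tendsto_const) auto
  thus ?thesis using p_gt5 by simp
qed

end

section \<open>The ratio of the partition sums\<close>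

context real_quadratic
begin

definition class_residues :: "int \<Rightarrow> nat set" where "class_residues e = {a \<in> {1..<p}. chi (int a) = e}"

text \<open>Orthogonality of \<open>chi\<close> to the constant 1; this equality makes the two
  saddles and widths coincide.\<close>

lemma card_class_residues: "card (class_residues 1) = card (class_residues (-1))"
proof -
  have fin: "finite (class_residues e)" for e unfolding class_residues_def by simp
  have "0 = (\<Sum>a<p. real_of_int (chi (int a)))" using sum_chi_nat by simp
  also have "\<dots> = (\<Sum>a\<in>class_residues 1 \<union> class_residues (-1). real_of_int (chi (int a)))"
  proof (rule sum.mono_neutral_right)
    show "class_residues 1 \<union> class_residues (-1) \<subseteq> {..<p}" unfolding class_residues_def by auto
    show "\<forall>a\<in>{..<p} - (class_residues 1 \<union> class_residues (-1)). real_of_int (chi (int a)) = 0"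
    proof
      fix a assume a: "a \<in> {..<p} - (class_residues 1 \<union> class_residues (-1))"
      show "real_of_int (chi (int a)) = 0"
      proof (cases "a = 0")
        case False
        thus ?thesis using a chi_values[of "int a"] unfolding class_residues_def by auto
      qed simp
    qed
  qed simp
  also have "\<dots> = (\<Sum>a\<in>class_residues 1. real_of_int (chi (int a))) + (\<Sum>a\<in>class_residues (-1). real_of_int (chi (int a)))"
    by (rule sum.union_disjoint[OF fin fin]) (auto simp: class_residues_def)
  also have "(\<Sum>a\<in>class_residues 1. real_of_int (chi (int a))) = (\<Sum>a\<in>class_residues 1. 1)"
    by (rule sum.cong) (auto simp: class_residues_def)
  also have "(\<Sum>a\<in>class_residues (-1). real_of_int (chi (int a))) = (\<Sum>a\<in>class_residues (-1). - 1)"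
    by (rule sum.cong) (auto simp: class_residues_def)
  finally show ?thesis by simp
qed

lemma residue_parts_class:
  assumes "e = 1 \<or> e = -1"
  shows "\<exists>b. residue_parts p (class_residues e) b"
proof -
  have "1 \<in> class_residues 1" unfolding class_residues_def using p_gt5 by simp
  hence "card (class_residues 1) > 0" by (auto simp: card_gt_0_iff class_residues_def)
  hence "card (class_residues e) > 0" using assms card_class_residues by auto
  then obtain b where b: "b \<in> class_residues e" by (metis card_gt_0_iff ex_in_conv)
  have "\<not> p dvd b" using b unfolding class_residues_def by (auto dest: dvd_imp_le)
  hence "coprime b p" using p_prime prime_imp_coprime coprime_commute by blast
  hence "residue_parts p (class_residues e) b"
    using b p_gt5 by unfold_locales (auto simp: class_residues_def)
  thus ?thesis ..
qed

lemma class_residues_D: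
  assumes "e = 1 \<or> e = -1"
  shows "residue_parts.D p (class_residues e) = {m. chi (int m) = e}"
proof -
  obtain b where "residue_parts p (class_residues e) b" using residue_parts_class[OF assms] by blast
  then interpret residue_parts p "class_residues e" b .
  have c: "chi (int (m mod p)) = chi (int m)" for m by (simp add: zmod_int)
  have "m mod p \<in> class_residues e \<longleftrightarrow> chi (int m) = e" for m
  proof (cases "m mod p = 0")
    case True
    thus ?thesis using assms c[of m] by (auto simp: class_residues_def)
  next
    case False
    moreover have "m mod p < p" using p_gt5 by simp
    ultimately show ?thesis unfolding class_residues_def using c by auto
  qed
  thus ?thesis unfolding D_def by blast
qed

lemma sum_partitions:
  assumes "e = 1 \<or> e = -1"
  shows "(\<Sum>n = 0..\<nu>. real (card (legendre_partitions p e n))) = real (part_sum {m. chi (int m) = e} \<nu>)"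
proof -
  have "chi 0 \<noteq> e" using assms by auto
  hence "legendre_partitions p e n = part_lists {m. chi (int m) = e} n" for n
    unfolding legendre_partitions_def part_lists_def chi_def[symmetric]
    by (intro Collect_cong conj_cong refl) (auto intro!: gr0I)
  thus ?thesis unfolding part_sum_def part_count_def atMost_atLeast0 by simp
qed

lemma Re_log_gf_difference:
  assumes x: "x > 0"
  shows "Re (log_gf {m. chi (int m) = 1} (of_real x)) - Re (log_gf {m. chi (int m) = -1} (of_real x)) =
    (\<Sum>m. of_int (chi (int m)) * log_factor (real m * x))"
proof -
  have sx: "Re (complex_of_real x) > 0" using x by simp
  have S: "(\<lambda>m. Re (if m \<in> {m. chi (int m) = e} then clog_factor (of_nat m * of_real x) else 0)) sums Re (log_gf {m. chi (int m) = e} (of_real x))"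
    if "e \<noteq> 0" for e
    unfolding log_gf_def using that by (intro sums_Re summable_sums summable_norm_cancel[OF log_gf_summable] sx) auto
  have R: "Re (clog_factor (of_nat m * of_real x)) = log_factor (real m * x)" if "m > 0" for m :: nat
  proof -
    have "exp (- (real m * x)) < 1" using that x by simp
    hence "0 < 1 - exp (- (real m * x))" by simp
    moreover have "1 - exp (- (of_nat m * of_real x)) = complex_of_real (1 - exp (- (real m * x)))"
      by (simp add: exp_of_real[symmetric])
    ultimately show ?thesis unfolding clog_factor_def log_factor_def by (simp only: Ln_of_real) simp
  qed
  have "Re (if m \<in> {m. chi (int m) = 1} then clog_factor (of_nat m * of_real x) else 0)
      - Re (if m \<in> {m. chi (int m) = -1} then clog_factor (of_nat m * of_real x) else 0) = of_int (chi (int m)) * log_factor (real m * x)" for m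
  proof (cases "m = 0")
    case False
    thus ?thesis using chi_values[of "int m"] R[of m] by auto
  qed simp
  with sums_diff[OF S[of 1] S[of "-1"]] show ?thesis by (simp add: sums_iff)
qed

text \<open>Both asymptotic formulas are taken at the same points with the same constant, so
  everything cancels except the quotient of the two \<open>g0\<close>, in which the factor
  \<open>1 - exp (- x)\<close> cancels too.\<close>

theorem partition_ratio_tendsto:
  "(\<lambda>\<nu>. (\<Sum>n = 0..\<nu>. real (p_plus p n)) / (\<Sum>n = 0..\<nu>. real (p_minus p n))) \<longlonglongrightarrow> exp log_ratio_limit"
proof -
  define Dp where "Dp = {m. chi (int m) = 1}"
  define Dm where "Dm = {m. chi (int m) = -1}"
  obtain bp bm where "residue_parts p (class_residues 1) bp" "residue_parts p (class_residues (-1)) bm"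
    using residue_parts_class by blast
  then interpret P: residue_parts p "class_residues 1" bp + M: residue_parts p "class_residues (-1)" bm by simp_all
  have D: "P.D = Dp" "M.D = Dm" unfolding Dp_def Dm_def by (rule class_residues_D; simp)+
  define I where "I = (\<integral>v. exp (- (P.\<kappa>2 * v ^ 2 / 2)) \<partial>lborel) / (2 * pi)"
  have "I > 0" unfolding I_def using gaussian_integral_pos(2)[OF P.\<kappa>_pos(2)] by simp
  have \<kappa>: "M.\<kappa>2 = P.\<kappa>2" "M.\<kappa>1 = P.\<kappa>1" unfolding P.\<kappa>2_def M.\<kappa>2_def P.\<kappa>1_def M.\<kappa>1_def card_class_residues by simp_all
  have sad: "M.saddle = P.saddle" unfolding P.saddle_def[abs_def] M.saddle_def[abs_def] \<kappa> ..
  define T where "T = (\<lambda>n. P.saddle n * sqrt (P.saddle n))"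
  define E where "E = (\<lambda>n. exp (real n * P.saddle n))"
  have "(\<lambda>n. (part_sum Dp n / (T n * P.g0 (P.saddle n) * E n)) / (part_sum Dm n / (T n * M.g0 (P.saddle n) * E n))) \<longlonglongrightarrow> I / I"
    using P.part_sum_asymp M.part_sum_asymp \<open>I > 0\<close> unfolding \<kappa> sad D I_def[symmetric] T_def E_def
    by (intro tendsto_divide) auto
  moreover have "(\<lambda>n. P.g0 (P.saddle n) / M.g0 (P.saddle n)) \<longlonglongrightarrow> exp log_ratio_limit"
  proof -
    have "(\<lambda>n. exp (\<Sum>m. of_int (chi (int m)) * log_factor (real m * P.saddle n))) \<longlonglongrightarrow> exp log_ratio_limit"
      by (intro tendsto_exp filterlim_compose[OF log_ratio_series_tendsto P.saddle_tendsto])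
    moreover have "eventually (\<lambda>n. exp (\<Sum>m. of_int (chi (int m)) * log_factor (real m * P.saddle n)) = P.g0 (P.saddle n) / M.g0 (P.saddle n)) sequentially"
      using eventually_gt_at_top[of 0]
    proof eventually_elim
      case (elim n)
      hence x: "P.saddle n > 0" by (rule P.saddle_pos)
      have "1 - exp (- P.saddle n) > 0" using x by simp
      thus ?case unfolding Re_log_gf_difference[OF x, symmetric] P.g0_def M.g0_def D Dp_def Dm_def by (simp add: exp_diff)
    qed
    ultimately show ?thesis by (rule Lim_transform_eventually)
  qed
  ultimately have "(\<lambda>n. (part_sum Dp n / (T n * P.g0 (P.saddle n) * E n)) / (part_sum Dm n / (T n * M.g0 (P.saddle n) * E n))
     * (P.g0 (P.saddle n) / M.g0 (P.saddle n))) \<longlonglongrightarrow> I / I * exp log_ratio_limit"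
    by (rule tendsto_mult)
  moreover have "eventually (\<lambda>n. (part_sum Dp n / (T n * P.g0 (P.saddle n) * E n)) / (part_sum Dm n / (T n * M.g0 (P.saddle n) * E n))
     * (P.g0 (P.saddle n) / M.g0 (P.saddle n)) = part_sum Dp n / part_sum Dm n) sequentially"
    using eventually_gt_at_top[of 0]
  proof eventually_elim
    case (elim n)
    hence x: "P.saddle n > 0" by (rule P.saddle_pos)
    have "T n > 0" "E n > 0" "P.g0 (P.saddle n) > 0" "M.g0 (P.saddle n) > 0"
      unfolding T_def E_def using x P.g0_pos M.g0_pos by auto
    thus ?case by (cases "part_sum Dm n = 0") (simp_all add: field_simps)
  qed
  ultimately have "(\<lambda>n. part_sum Dp n / part_sum Dm n) \<longlonglongrightarrow> I / I * exp log_ratio_limit"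
    by (rule Lim_transform_eventually)
  thus ?thesis unfolding p_plus_def p_minus_def Dp_def Dm_def using \<open>I > 0\<close> by (simp add: sum_partitions)
qed

end

section \<open>The ring of integers\<close>

text \<open>If \<open>v\<close> is the denominator in lowest terms, every power \<open>v^k\<close>
  divides \<open>D\<close>, which is impossible for \<open>v \<ge> 2\<close> once \<open>2^k\<close>
  exceeds \<open>\<bar>D\<bar>\<close>.\<close>

lemma rational_bounded_denominator:
  fixes x :: real
  assumes "x \<in> \<rat>" and D: "D \<noteq> 0" "\<And>k. of_int D * x ^ k \<in> \<int>"
  shows "x \<in> \<int>"
proof -
  obtain u v where uv: "v > 0" "coprime u v" "x = of_int u / of_int v"
    using assms(1) by (auto elim: Rats_cases')
  have dv: "v ^ k dvd D" for k
  proof -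
    obtain z where z: "of_int D * x ^ k = of_int z" using D(2)[of k] by (auto elim: Ints_cases)
    hence "of_int D * of_int u ^ k = (of_int z * of_int v ^ k :: real)"
      using uv by (simp add: power_divide field_simps)
    hence "D * u ^ k = z * v ^ k" by (metis of_int_eq_iff of_int_mult of_int_power)
    hence "v ^ k dvd D * u ^ k" by simp
    moreover have "coprime (v ^ k) (u ^ k)" using uv(2) by (simp add: coprime_commute)
    ultimately show ?thesis using coprime_dvd_mult_left_iff by blast
  qed
  have "v = 1"
  proof (rule ccontr)
    assume "v \<noteq> 1"
    hence "v \<ge> 2" using uv by simp
    define k where "k = nat \<bar>D\<bar>"
    have "v ^ k \<le> \<bar>D\<bar>" using dv[of k] D(1) by (metis abs_dvd_iff dvd_imp_le_int dvd_abs_iff abs_of_pos uv(1) zero_less_power)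
    moreover have "2 ^ k \<le> v ^ k" using \<open>v \<ge> 2\<close> by (intro power_mono) auto
    moreover have "int k < 2 ^ k" by (metis of_nat_less_two_power)
    ultimately show False unfolding k_def by simp
  qed
  thus ?thesis using uv by simp
qed

context real_quadratic
begin

section \<open>The quadratic field and its conjugation\<close>

abbreviation rt :: real where "rt \<equiv> sqrt (real p)"

lemma rt_square: "rt * rt = real p" by simp

lemma rt_irrational: "rt \<notin> \<rat>"
proof
  assume "rt \<in> \<rat>"
  moreover have "algebraic_int rt" by (intro algebraic_int_sqrt int_imp_algebraic_int) simp
  ultimately have "rt \<in> \<int>" using rational_algebraic_int_is_int by blast
  then obtain n where n: "rt = of_int n" by (auto elim: Ints_cases)
  have "real_of_int (n * n) = of_int (int p)" using rt_square n by simp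
  hence nn: "n * n = int p" by (simp only: of_int_eq_iff)
  hence "int p dvd n" using p_int_prime prime_dvd_mult_iff by (metis dvd_refl)
  hence "int p * int p dvd n * n" by (intro mult_dvd_mono)
  thus False unfolding nn using p_gt5 by simp
qed

lemma rt_combination_unique:
  assumes "a \<in> \<rat>" "b \<in> \<rat>" "c \<in> \<rat>" "d \<in> \<rat>" "a + b * rt = c + d * rt"
  shows "a = c \<and> b = d"
proof -
  have "b = d"
  proof (rule ccontr)
    assume "b \<noteq> d"
    hence "rt = (c - a) / (b - d)" using assms(5) by (simp add: field_simps)
    moreover have "(c - a) / (b - d) \<in> \<rat>" using assms by (intro Rats_divide Rats_diff)
    ultimately show False using rt_irrational by simp
  qed
  thus ?thesis using assms by simp
qed

definition K :: "real set" where "K = quadratic_field p"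

lemma K_altdef: "K = {a + b * rt | a b. a \<in> \<rat> \<and> b \<in> \<rat>}"
  unfolding K_def quadratic_field_def ..

lemma KI: "a \<in> \<rat> \<Longrightarrow> b \<in> \<rat> \<Longrightarrow> a + b * rt \<in> K"
  unfolding K_altdef by blast

lemma KE: 
  assumes "x \<in> K" obtains a b where "a \<in> \<rat>" "b \<in> \<rat>" "x = a + b * rt"
  using assms unfolding K_altdef by blast

text \<open>The nontrivial automorphism, read off from the unique rational coordinates; outside
  \<open>K\<close> no such \<open>y\<close> exists and the value is arbitrary.\<close>

definition cj :: "real \<Rightarrow> real" where
  "cj x = (THE y. \<exists>a b. a \<in> \<rat> \<and> b \<in> \<rat> \<and> x = a + b * rt \<and> y = a - b * rt)"

lemma cj_eq:
  assumes "a \<in> \<rat>" "b \<in> \<rat>" shows "cj (a + b * rt) = a - b * rt"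
  unfolding cj_def
proof (rule the_equality)
  show "\<exists>a' b'. a' \<in> \<rat> \<and> b' \<in> \<rat> \<and> a + b * rt = a' + b' * rt \<and> a - b * rt = a' - b' * rt"
    using assms by blast
next
  fix y assume "\<exists>a' b'. a' \<in> \<rat> \<and> b' \<in> \<rat> \<and> a + b * rt = a' + b' * rt \<and> y = a' - b' * rt"
  thus "y = a - b * rt" using rt_combination_unique[OF assms] by blast
qed

lemma K_mult: 
  assumes "x \<in> K" "y \<in> K" shows "x * y \<in> K" "cj (x * y) = cj x * cj y"
proof -
  obtain a b c d where h: "a \<in> \<rat>" "b \<in> \<rat>" "x = a + b * rt" "c \<in> \<rat>" "d \<in> \<rat>" "y = c + d * rt"
    using assms by (auto elim!: KE)
  have e: "x * y = (a * c + b * d * p) + (a * d + b * c) * rt"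
    unfolding h using rt_square by (simp add: algebra_simps)
  have r: "a * c + b * d * p \<in> \<rat>" "a * d + b * c \<in> \<rat>" using h by auto
  show "x * y \<in> K" unfolding e using r by (intro KI)
  have "cj (x * y) = (a * c + b * d * p) - (a * d + b * c) * rt" unfolding e by (rule cj_eq[OF r])
  also have "\<dots> = (a - b * rt) * (c - d * rt)" using rt_square by (simp add: algebra_simps)
  also have "\<dots> = cj x * cj y" unfolding h using h by (simp only: cj_eq)
  finally show "cj (x * y) = cj x * cj y" .
qed

lemma K_add: 
  assumes "x \<in> K" "y \<in> K" shows "x + y \<in> K" "cj (x + y) = cj x + cj y"
proof -
  obtain a b c d where h: "a \<in> \<rat>" "b \<in> \<rat>" "x = a + b * rt" "c \<in> \<rat>" "d \<in> \<rat>" "y = c + d * rt"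
    using assms by (auto elim!: KE)
  have e: "x + y = (a + c) + (b + d) * rt" unfolding h by (simp add: algebra_simps)
  have r: "a + c \<in> \<rat>" "b + d \<in> \<rat>" using h by auto
  show "x + y \<in> K" unfolding e using r by (intro KI)
  have "cj (x + y) = (a + c) - (b + d) * rt" unfolding e by (rule cj_eq[OF r])
  also have "\<dots> = cj x + cj y" unfolding h using h by (simp only: cj_eq) (simp add: algebra_simps)
  finally show "cj (x + y) = cj x + cj y" .
qed

lemma K_Rats: "x \<in> \<rat> \<Longrightarrow> x \<in> K" "x \<in> \<rat> \<Longrightarrow> cj x = x"
  using KI[of x 0] cj_eq[of x 0] by auto

lemma K_of_int [simp]: "of_int n \<in> K" "cj (of_int n) = of_int n"
  using K_Rats by auto

lemma K_of_nat [simp]: "of_nat n \<in> K" "cj (of_nat n) = of_nat n"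
  using K_Rats by auto

lemma K_0_1 [simp]: "0 \<in> K" "1 \<in> K" "cj 0 = 0" "cj 1 = 1"
  using K_Rats by auto

lemma cj_eq_0_iff: "x \<in> K \<Longrightarrow> cj x = 0 \<longleftrightarrow> x = 0"
proof -
  assume "x \<in> K"
  then obtain a b where h: "a \<in> \<rat>" "b \<in> \<rat>" "x = a + b * rt" by (rule KE)
  have "a - b * rt = 0 \<longleftrightarrow> a = 0 \<and> b = 0"
    using rt_combination_unique[of a "-b" 0 0] h by auto
  moreover have "a + b * rt = 0 \<longleftrightarrow> a = 0 \<and> b = 0"
    using rt_combination_unique[of a b 0 0] h by auto
  ultimately show ?thesis using cj_eq[OF h(1,2)] h(3) by simp
qed

lemma K_inverse: "x \<in> K \<Longrightarrow> inverse x \<in> K"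
proof -
  assume "x \<in> K"
  then obtain a b where h: "a \<in> \<rat>" "b \<in> \<rat>" "x = a + b * rt" by (rule KE)
  show ?thesis
  proof (cases "x = 0")
    case False
    define N where "N = a ^ 2 - p * b ^ 2"
    have "x * (a - b * rt) = N" unfolding h N_def using rt_square by (simp add: algebra_simps power2_eq_square)
    moreover have "a - b * rt \<noteq> 0" using cj_eq_0_iff[OF \<open>x \<in> K\<close>] cj_eq[OF h(1,2)] h(3) False by simp
    ultimately have "N \<noteq> 0" using False by auto
    have "inverse x = (a - b * rt) / N" using \<open>x * (a - b * rt) = N\<close> \<open>N \<noteq> 0\<close> False by (simp add: field_simps)
    also have "\<dots> = a / N + (- b / N) * rt" by (simp add: diff_divide_distrib)
    also have "\<dots> \<in> K" using h unfolding N_def by (intro KI) auto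
    finally show ?thesis .
  qed simp
qed

lemma K_divide: "x \<in> K \<Longrightarrow> y \<in> K \<Longrightarrow> x / y \<in> K"
  using K_mult(1)[of x "inverse y"] K_inverse by (simp add: divide_inverse)

lemma cj_divide: "x \<in> K \<Longrightarrow> y \<in> K \<Longrightarrow> y \<noteq> 0 \<Longrightarrow> cj (x / y) = cj x / cj y"
  using K_mult(2)[of "x / y" y] K_divide[of x y] cj_eq_0_iff[of y] by (simp add: field_simps)

lemma cj_power: "x \<in> K \<Longrightarrow> x ^ n \<in> K \<and> cj (x ^ n) = cj x ^ n"
  by (induction n) (auto simp: K_mult)

section \<open>The ring generated by \<open>om\<close> is the ring of integers\<close>

definition om :: real where "om = (1 + rt) / 2"
definition om' :: real where "om' = (1 - rt) / 2"

lemma om_altdef: "om = 1/2 + (1/2) * rt" and om'_altdef: "om' = 1/2 + (-1/2) * rt"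
  unfolding om_def om'_def by (simp_all add: field_simps)

lemma om_K [simp]: "om \<in> K" "om' \<in> K"
proof -
  show "om \<in> K" unfolding om_altdef by (rule KI) auto
  show "om' \<in> K" unfolding om'_altdef by (rule KI) auto
qed

lemma cj_om [simp]: "cj om = om'" "cj om' = om"
  using cj_eq[of "1/2" "1/2"] cj_eq[of "1/2" "-1/2"] unfolding om_altdef om'_altdef by auto

lemma real_p_eq: "real p = 4 * real q + 1"
proof -
  have "real p = real (4 * q + 1)" using p_eq by (rule arg_cong)
  thus ?thesis by simp
qed

lemma om_square: "om * om = om + real q"
  unfolding om_def using rt_square real_p_eq by (simp add: field_simps)

lemma om_add: "om + om' = 1" and om_mult: "om * om' = - real q" and om_diff: "om - om' = rt"
  unfolding om_def om'_def using rt_square real_p_eq by (simp_all add: field_simps)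

definition OK :: "real set" where "OK = {of_int x + of_int y * om | x y. True}"

lemma OKI [intro]: "of_int x + of_int y * om \<in> OK" unfolding OK_def by blast

lemma OKE: assumes "z \<in> OK" obtains x y where "z = of_int x + of_int y * om"
  using assms unfolding OK_def by blast

lemma OK_K: "z \<in> OK \<Longrightarrow> z \<in> K"
  by (auto elim!: OKE intro!: K_add K_mult)

lemma OK_add: "z \<in> OK \<Longrightarrow> w \<in> OK \<Longrightarrow> z + w \<in> OK"
proof (elim OKE)
  fix x y x' y' :: int
  assume "z = of_int x + of_int y * om" "w = of_int x' + of_int y' * om"
  hence "z + w = of_int (x + x') + of_int (y + y') * om" by (simp add: algebra_simps)
  thus ?thesis by (simp only: OKI)
qed

lemma OK_mult: "z \<in> OK \<Longrightarrow> w \<in> OK \<Longrightarrow> z * w \<in> OK"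
proof (elim OKE)
  fix x y x' y' :: int
  assume h: "z = of_int x + of_int y * om" "w = of_int x' + of_int y' * om"
  have "z * w = of_int x * of_int x' + (of_int x * of_int y' + of_int y * of_int x') * om + of_int y * of_int y' * (om * om)"
    unfolding h by (simp add: algebra_simps)
  also have "\<dots> = of_int (x * x' + y * y' * int q) + of_int (x * y' + y * x' + y * y') * om"
    unfolding om_square by (simp add: algebra_simps)
  finally show ?thesis by (simp only: OKI)
qed

lemma OK_of_int [simp]: "of_int n \<in> OK" using OKI[of n 0] by simp
lemma OK_of_nat [simp]: "of_nat n \<in> OK" using OK_of_int[of "int n"] by simp
lemma OK_0_1 [simp]: "0 \<in> OK" "1 \<in> OK" using OK_of_int[of 0] OK_of_int[of 1] by simp_all
lemma OK_om [simp]: "om \<in> OK" using OKI[of 0 1] by simp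

lemma OK_minus: "z \<in> OK \<Longrightarrow> - z \<in> OK"
  using OK_mult[of "of_int (-1)" z] OK_of_int[of "-1"] by simp

lemma OK_coords_unique:
  assumes "of_int x + of_int y * om = of_int x' + of_int y' * om" shows "x = x' \<and> y = y'"
proof -
  have "(of_int x + of_int y / 2) + (of_int y / 2) * rt = (of_int x' + of_int y' / 2) + (of_int y' / 2) * rt"
    using assms unfolding om_def by (simp add: field_simps)
  hence "real_of_int x + of_int y / 2 = of_int x' + of_int y' / 2 \<and> real_of_int y / 2 = of_int y' / 2"
    by (intro rt_combination_unique) auto
  thus ?thesis by auto
qed

lemma cj_OK: "cj (of_int x + of_int y * om) = of_int x + of_int y * om'"
  by (simp add: K_add K_mult)

lemma OK_cj: "z \<in> OK \<Longrightarrow> cj z \<in> OK"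
proof (elim OKE)
  fix x y assume "z = of_int x + of_int y * om"
  hence "cj z = of_int (x + y) + of_int (- y) * om" unfolding cj_OK[symmetric] using om_add cj_OK[of x y]
    by (simp add: algebra_simps flip: distrib_left)
  thus ?thesis by (simp only: OKI)
qed

lemma norm_int: "z \<in> OK \<Longrightarrow> \<exists>n::int. z * cj z = of_int n"
proof (elim OKE)
  fix x y assume h: "z = of_int x + of_int y * om"
  have "z * cj z = of_int x * of_int x + of_int x * of_int y * (om + om') + of_int y * of_int y * (om * om')"
    unfolding h cj_OK by (simp add: algebra_simps)
  also have "\<dots> = of_int (x * x + x * y - y * y * int q)" unfolding om_add om_mult by simp
  finally show ?thesis by blast
qed

lemma algebraic_int_quadratic:
  fixes x :: real and t n :: int
  assumes "x * x - of_int t * x + of_int n = 0" shows "algebraic_int x"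
proof (rule algebraic_int.intros[of "[:of_int n, - of_int t, 1:]"])
  show "\<forall>i. Polynomial.coeff [:of_int n, - of_int t, 1 :: real:] i \<in> \<int>"
    by (auto simp: coeff_pCons split: nat.splits)
  show "poly [:of_int n, - of_int t, 1:] x = 0" using assms by (simp add: algebra_simps)
qed simp

lemma OK_algebraic_int: "z \<in> OK \<Longrightarrow> algebraic_int z"
proof (elim OKE)
  fix x y assume h: "z = of_int x + of_int y * om"
  have "z * z - of_int (2 * x + y) * z + of_int (x * x + x * y - y * y * int q) = of_int y * of_int y * (om * om - om - real q)"
    unfolding h by (simp add: algebra_simps)
  also have "\<dots> = 0" unfolding om_square by simp
  finally show ?thesis by (rule algebraic_int_quadratic)
qed

text \<open>A common denominator for all powers of \<open>z\<close>. Unlike a monic equation, this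
  form of integrality passes directly to \<open>z + 1\<close> and to the norm, the two facts from
  which the trace is recovered.\<close>

definition bounded_powers :: "real \<Rightarrow> bool" where
  "bounded_powers z \<longleftrightarrow> (\<exists>D::int. D \<noteq> 0 \<and> (\<forall>k. \<exists>u v::int. of_int D * z ^ k = of_int u + of_int v * rt))"

text \<open>A common denominator of the powers below the degree also serves for the higher ones,
  since the monic equation expresses these through lower powers with integer coefficients.\<close>

lemma algebraic_int_bounded_powers:
  assumes "algebraic_int z" "z \<in> K" shows "bounded_powers z"
proof -
  obtain P where P: "lead_coeff P = 1" "\<forall>i. Polynomial.coeff P i \<in> \<int>" "poly P z = 0"
    using assms(1) by (auto elim: algebraic_int.cases)
  define n where "n = degree P"
  have "\<forall>i. \<exists>D::int. D \<noteq> 0 \<and> (\<exists>u v::int. of_int D * z ^ i = of_int u + of_int v * rt)"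
  proof
    fix i
    have "z ^ i \<in> K" using cj_power[OF assms(2)] by blast
    then obtain a b where ab: "a \<in> \<rat>" "b \<in> \<rat>" "z ^ i = a + b * rt" by (rule KE)
    obtain a1 a2 where a: "a2 > 0" "a = of_int a1 / of_int a2" using ab(1) by (auto elim: Rats_cases')
    obtain b1 b2 where b: "b2 > 0" "b = of_int b1 / of_int b2" using ab(2) by (auto elim: Rats_cases')
    have "of_int (a2 * b2) * z ^ i = of_int (a1 * b2) + of_int (b1 * a2) * rt"
      unfolding ab(3) a b using a b by (simp add: field_simps)
    moreover have "a2 * b2 \<noteq> 0" using a b by simp
    ultimately show "\<exists>D::int. D \<noteq> 0 \<and> (\<exists>u v::int. of_int D * z ^ i = of_int u + of_int v * rt)" by blast
  qed
  then obtain d where d: "\<And>i. d i \<noteq> (0::int)" "\<And>i. \<exists>u v::int. of_int (d i) * z ^ i = of_int u + of_int v * rt"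
    by metis
  define D where "D = (\<Prod>i<n. d i)"
  have D0: "D \<noteq> 0" unfolding D_def using d(1) by simp
  have "\<exists>u v::int. of_int D * z ^ k = of_int u + of_int v * rt" for k
  proof (induction k rule: less_induct)
    case (less k)
    show ?case
    proof (cases "k < n")
      case True
      hence "D = (\<Prod>i\<in>{..<n} - {k}. d i) * d k" unfolding D_def by (subst prod.remove[of _ k]) auto
      moreover obtain u v where "of_int (d k) * z ^ k = of_int u + of_int v * rt" using d(2) by blast
      ultimately have "of_int D * z ^ k = of_int ((\<Prod>i\<in>{..<n} - {k}. d i) * u) + of_int ((\<Prod>i\<in>{..<n} - {k}. d i) * v) * rt"
        by (simp add: mult.assoc distrib_left)
      thus ?thesis by blast
    next
      case False
      have "0 = poly P z * z ^ (k - n)" using P by simp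
      also have "\<dots> = (\<Sum>i\<le>n. Polynomial.coeff P i * z ^ i) * z ^ (k - n)" unfolding poly_altdef n_def ..
      also have "(\<Sum>i\<le>n. Polynomial.coeff P i * z ^ i) = (\<Sum>i<n. Polynomial.coeff P i * z ^ i) + z ^ n"
        using P(1) unfolding n_def by (simp add: lessThan_Suc_atMost[symmetric])
      also have "((\<Sum>i<n. Polynomial.coeff P i * z ^ i) + z ^ n) * z ^ (k - n) = (\<Sum>i<n. Polynomial.coeff P i * z ^ (i + (k - n))) + z ^ k"
        using False by (simp add: distrib_right sum_distrib_right power_add[symmetric] mult.assoc)
      finally have zk: "z ^ k = - (\<Sum>i<n. Polynomial.coeff P i * z ^ (i + (k - n)))" by simp
      have "\<exists>u v::int. of_int D * (Polynomial.coeff P i * z ^ (i + (k - n))) = of_int u + of_int v * rt" if i: "i < n" for i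
      proof -
        obtain u v where "of_int D * z ^ (i + (k - n)) = of_int u + of_int v * rt"
        proof -
          have "i + (k - n) < k" using i False by simp
          from less[OF this] show thesis using that by blast
        qed
        moreover obtain c where "Polynomial.coeff P i = of_int c" using P(2) by (metis Ints_cases)
        ultimately have "of_int D * (Polynomial.coeff P i * z ^ (i + (k - n))) = of_int (c * u) + of_int (c * v) * rt"
          by (metis (no_types, opaque_lifting) distrib_left mult.assoc mult.left_commute of_int_mult)
        thus ?thesis by blast
      qed
      then obtain u v :: "nat \<Rightarrow> int" where uv: "\<And>i. i < n \<Longrightarrow> of_int D * (Polynomial.coeff P i * z ^ (i + (k - n))) = of_int (u i) + of_int (v i) * rt"
        by metis
      have "of_int D * z ^ k = - (\<Sum>i<n. of_int D * (Polynomial.coeff P i * z ^ (i + (k - n))))"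
        unfolding zk by (simp add: sum_distrib_left)
      also have "\<dots> = - (\<Sum>i<n. of_int (u i) + of_int (v i) * rt)" using uv by simp
      also have "\<dots> = of_int (- (\<Sum>i<n. u i)) + of_int (- (\<Sum>i<n. v i)) * rt"
        by (simp add: sum.distrib sum_distrib_right)
      finally show ?thesis by blast
    qed
  qed
  thus ?thesis unfolding bounded_powers_def using D0 by blast
qed

lemma bounded_powers_plus1: "bounded_powers z \<Longrightarrow> bounded_powers (z + 1)"
proof -
  assume "bounded_powers z"
  then obtain D where D: "D \<noteq> 0" "\<forall>k. \<exists>u v::int. of_int D * z ^ k = of_int u + of_int v * rt"
    unfolding bounded_powers_def by blast
  then obtain u v :: "nat \<Rightarrow> int" where uv: "\<And>k. of_int D * z ^ k = of_int (u k) + of_int (v k) * rt" by metis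
  have "of_int D * (z + 1) ^ k = of_int (\<Sum>i\<le>k. int (k choose i) * u i) + of_int (\<Sum>i\<le>k. int (k choose i) * v i) * rt" for k
  proof -
    have "of_int D * (z + 1) ^ k = (\<Sum>i\<le>k. of_nat (k choose i) * (of_int D * z ^ i))"
      by (simp add: binomial_ring sum_distrib_left mult_ac)
    also have "\<dots> = (\<Sum>i\<le>k. of_nat (k choose i) * (of_int (u i) + of_int (v i) * rt))" by (simp only: uv)
    also have "\<dots> = of_int (\<Sum>i\<le>k. int (k choose i) * u i) + of_int (\<Sum>i\<le>k. int (k choose i) * v i) * rt"
      by (simp add: distrib_left sum.distrib sum_distrib_right mult.assoc)
    finally show ?thesis .
  qed
  thus ?thesis unfolding bounded_powers_def using D(1) by blast
qed

text \<open>\<open>D^2 * (z * cj z)^k\<close> is the norm of \<open>D * z^k\<close>, hence an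
  integer for every \<open>k\<close>.\<close>

lemma bounded_powers_norm: "bounded_powers z \<Longrightarrow> z \<in> K \<Longrightarrow> z * cj z \<in> \<int>"
proof -
  assume bp: "bounded_powers z" and zK: "z \<in> K"
  obtain D where D: "D \<noteq> 0" "\<forall>k. \<exists>u v::int. of_int D * z ^ k = of_int u + of_int v * rt"
    using bp unfolding bounded_powers_def by blast
  obtain a b where h: "a \<in> \<rat>" "b \<in> \<rat>" "z = a + b * rt" using zK by (rule KE)
  have "z * cj z = (a + b * rt) * (a - b * rt)" unfolding h(3) cj_eq[OF h(1,2)] ..
  also have "\<dots> = a * a - b * b * p" using rt_square by (simp add: algebra_simps)
  finally have rat: "z * cj z \<in> \<rat>" using h by auto
  have bd: "of_int (D * D) * (z * cj z) ^ k \<in> \<int>" for k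
  proof -
    obtain u v where uv: "of_int D * z ^ k = of_int u + of_int v * rt" using D(2) by blast
    have "cj (of_int D * z ^ k) = of_int D * cj z ^ k" using cj_power[OF zK, of k] by (simp add: K_mult)
    hence "of_int D * cj z ^ k = of_int u - of_int v * rt" unfolding uv by (subst (asm) cj_eq) auto
    hence "of_int (D * D) * (z * cj z) ^ k = (of_int u + of_int v * rt) * (of_int u - of_int v * rt)"
      unfolding uv[symmetric] by (simp add: power_mult_distrib mult_ac)
    also have "\<dots> = of_int (u * u - v * v * int p)" using rt_square by (simp add: algebra_simps)
    finally show ?thesis by (metis Ints_of_int)
  qed
  have "D * D \<noteq> 0" using D(1) by simp
  from rational_bounded_denominator[OF rat this bd] show ?thesis .
qed

text \<open>With \<open>N z = z * cj z\<close> the trace is \<open>N (z + 1) - N z - 1\<close>, so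
  norm and trace are integers. Since \<open>p\<close> is squarefree, \<open>B = 2 * b\<close> is an
  integer as well, and \<open>p \<equiv> 1\<close> modulo 4 forces \<open>A = 2 * a\<close> and
  \<open>B\<close> to have the same parity.\<close>

lemma algebraic_int_OK:
  assumes z: "algebraic_int z" "z \<in> K" shows "z \<in> OK"
proof -
  obtain a b where h: "a \<in> \<rat>" "b \<in> \<rat>" "z = a + b * rt" using z(2) by (rule KE)
  have cz: "cj z = a - b * rt" unfolding h(3) by (rule cj_eq[OF h(1,2)])
  have bp: "bounded_powers z" by (rule algebraic_int_bounded_powers[OF z])
  have n1: "z * cj z \<in> \<int>" by (rule bounded_powers_norm[OF bp z(2)])
  have "(z + 1) * cj (z + 1) \<in> \<int>" using bounded_powers_plus1[OF bp] z(2) by (intro bounded_powers_norm K_add) auto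
  hence "(z + 1) * (cj z + 1) \<in> \<int>" using z(2) by (simp add: K_add)
  moreover have "z + cj z = 2 * a" using cz h(3) by linarith
  hence "(z + 1) * (cj z + 1) - z * cj z - 1 = 2 * a" by (simp add: algebra_simps)
  ultimately have "2 * a \<in> \<int>" using n1 by (metis Ints_1 Ints_diff)
  then obtain A where A: "2 * a = of_int A" by (auto elim: Ints_cases)
  obtain N where N: "z * cj z = of_int N" using n1 by (auto elim: Ints_cases)
  have pb: "real p * (2 * b) ^ 2 = of_int (A * A - 4 * N)"
  proof -
    have "z * cj z = (a + b * rt) * (a - b * rt)" using cz h(3) by metis
    hence "of_int N = a * a - b * b * p" using N rt_square by (simp add: algebra_simps)
    hence "of_int (A * A - 4 * N) = (2 * a) * (2 * a) - 4 * (a * a - b * b * p)" by (simp add: A[symmetric])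
    thus ?thesis by (simp add: power2_eq_square algebra_simps)
  qed
  have "2 * b \<in> \<int>"
  proof -
    have "2 * b \<in> \<rat>" using h by auto
    then obtain u v where uv: "v > 0" "coprime u v" "2 * b = of_int u / of_int v" by (auto elim: Rats_cases')
    have "real_of_int (int p * u ^ 2) = of_int ((A * A - 4 * N) * v ^ 2)"
      using pb uv(1) unfolding uv(3) by (simp add: field_simps power_divide)
    hence "int p * u ^ 2 = (A * A - 4 * N) * v ^ 2" by (simp only: of_int_eq_iff)
    hence "v ^ 2 dvd int p * u ^ 2" by simp
    hence vp: "v ^ 2 dvd int p" using uv(2) by (metis coprime_commute coprime_dvd_mult_left_iff coprime_power_left_iff coprime_power_right_iff)
    hence "v dvd int p" by (metis dvd_trans dvd_triv_left power2_eq_square)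
    hence "v = 1 \<or> v = int p" using p_int_prime uv(1) by (simp add: prime_int_iff)
    moreover have "v \<noteq> int p"
    proof
      assume "v = int p"
      hence "int p * int p dvd int p" using vp by (simp add: power2_eq_square)
      thus False using p_gt5 by simp
    qed
    ultimately show ?thesis using uv by simp
  qed
  then obtain B where B: "2 * b = of_int B" by (auto elim: Ints_cases)
  have "real_of_int (int p * B ^ 2) = of_int (A * A - 4 * N)" using pb unfolding B by simp
  hence "int p * B ^ 2 = A * A - 4 * N" by (simp only: of_int_eq_iff)
  moreover have "int p = 4 * int q + 1" using p_eq by linarith
  ultimately have "(4 * int q + 1) * B ^ 2 = A * A - 4 * N" by (simp only:)
  hence "A * A - B * B = 2 * (2 * (N + int q * B ^ 2))" by (simp add: algebra_simps power2_eq_square)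
  hence "even (A * A - B * B)" by (metis dvd_triv_left)
  hence "even (A - B)" by simp
  then obtain C where C: "A - B = 2 * C" by (rule dvdE)
  hence "A = 2 * C + B" by simp
  hence "real_of_int A = 2 * of_int C + of_int B" by simp
  hence "a = of_int C + of_int B / 2" using A by simp
  hence "z = of_int C + of_int B * om" unfolding h(3) om_def using B by (simp add: field_simps)
  thus ?thesis by auto
qed

definition R :: "real ring" where "R = ring_of_integers K"

lemma R_simps [simp]: "carrier R = OK" "x \<otimes>\<^bsub>R\<^esub> y = x * y" "x \<oplus>\<^bsub>R\<^esub> y = x + y" "\<one>\<^bsub>R\<^esub> = 1" "\<zero>\<^bsub>R\<^esub> = 0"
proof -
  have "{x \<in> K. algebraic_int x} = OK" using algebraic_int_OK OK_algebraic_int OK_K by blast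
  thus "carrier R = OK" unfolding R_def ring_of_integers_def by simp
qed (simp_all add: R_def ring_of_integers_def)

lemma R_cring: "cring R"
proof (rule cringI)
  show "abelian_group R"
  proof (rule abelian_groupI)
    fix x assume "x \<in> carrier R"
    thus "\<exists>y\<in>carrier R. y \<oplus>\<^bsub>R\<^esub> x = \<zero>\<^bsub>R\<^esub>" using OK_minus by (intro bexI[of _ "- x"]) auto
  qed (auto simp: OK_add)
  show "comm_monoid R" by (rule comm_monoidI) (auto simp: OK_mult)
qed (auto simp: algebra_simps)

lemma R_ring: "ring R" using R_cring by (rule cring.axioms)

text \<open>Closure under negation is contained in the last condition, through the ring element
  \<open>-1\<close>.\<close>

lemma R_ideal_iff:
  "ideal I R \<longleftrightarrow> I \<subseteq> OK \<and> 0 \<in> I \<and> (\<forall>x\<in>I. \<forall>y\<in>I. x + y \<in> I) \<and> (\<forall>x\<in>I. \<forall>r\<in>OK. r * x \<in> I)"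
proof
  assume I: "ideal I R"
  then interpret ideal I R .
  have "I \<subseteq> OK" using a_subset by simp
  moreover have "0 \<in> I" using additive_subgroup.zero_closed[OF is_additive_subgroup] by simp
  moreover have "x + y \<in> I" if "x \<in> I" "y \<in> I" for x y using additive_subgroup.a_closed[OF is_additive_subgroup that] by simp
  moreover have "r * x \<in> I" if "x \<in> I" "r \<in> OK" for x r using I_l_closed[of x r] that by simp
  ultimately show "I \<subseteq> OK \<and> 0 \<in> I \<and> (\<forall>x\<in>I. \<forall>y\<in>I. x + y \<in> I) \<and> (\<forall>x\<in>I. \<forall>r\<in>OK. r * x \<in> I)"
    by (intro conjI ballI)
next
  assume I: "I \<subseteq> OK \<and> 0 \<in> I \<and> (\<forall>x\<in>I. \<forall>y\<in>I. x + y \<in> I) \<and> (\<forall>x\<in>I. \<forall>r\<in>OK. r * x \<in> I)"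
  interpret cring R by (rule R_cring)
  show "ideal I R"
  proof (rule idealI[OF R_ring])
    show "subgroup I (add_monoid R)"
    proof (rule add.subgroupI)
      fix x assume x: "x \<in> I"
      have "\<ominus>\<^bsub>R\<^esub> x = - x" using I x OK_minus by (intro minus_equality) auto
      moreover have "of_int (-1) * x \<in> I" using I x OK_of_int by blast
      ultimately show "\<ominus>\<^bsub>R\<^esub> x \<in> I" by simp
    qed (use I in auto)
  qed (use I in \<open>auto simp: mult.commute\<close>)
qed

end

section \<open>The mean of the ideal counting function\<close>

context real_quadratic
begin

text \<open>Gauss's lemma: among the doubles of \<open>1..2 * q\<close>, exactly those of
  \<open>q + 1..2 * q\<close> exceed half of \<open>p\<close>, which makes \<open>q\<close> sign
  changes.\<close>

lemma chi_2: "chi 2 = (-1) ^ q"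
proof -
  have n0: "[2 \<noteq> 0] (mod int p)" using p_gt5 by (auto simp: cong_0_iff dest: zdvd_imp_le)
  interpret G: GAUSS p 2
    by unfold_locales (use p_prime p_gt5 n0 in auto)
  have p4: "int p = 4 * int q + 1" using p_eq by linarith
  hence half: "(int p - 1) div 2 = 2 * int q" by simp
  have "G.C = G.B"
  proof -
    have "x mod int p = x" if "x \<in> G.B" for x
      using that p4 unfolding G.B_def G.A_def half by (auto intro!: mod_pos_pos_trivial)
    thus ?thesis unfolding G.C_def by force
  qed
  hence "G.E = (\<lambda>x. x * 2) ` {int q + 1..2 * int q}"
    unfolding G.E_def G.B_def G.A_def half by (auto simp: image_iff)
  hence "card G.E = q" by (simp add: card_image inj_on_def)
  thus ?thesis using G.gauss_lemma unfolding chi_def by simp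
qed

text \<open>Quadratic reciprocity; the sign is absent because \<open>(p - 1) div 2 = 2 * q\<close>
  is even.\<close>

lemma chi_prime: 
  assumes l: "Factorial_Ring.prime l" "l > 2"
  shows "Legendre (int p) (int l) = chi (int l)"
proof (cases "l = p")
  case True
  thus ?thesis by (simp add: chi_def)
next
  case False
  have "Legendre (int p) (int l) * chi (int l) = (-1) ^ ((p - 1) div 2 * ((l - 1) div 2))"
    unfolding chi_def using Quadratic_Reciprocity[of p l] p_prime p_gt5 l False by simp
  also have "(p - 1) div 2 = 2 * q" using p_eq by presburger
  also have "(-1 :: int) ^ (2 * q * ((l - 1) div 2)) = 1" by (simp add: power_mult)
  finally have "Legendre (int p) (int l) * chi (int l) = 1" .
  moreover have "Legendre (int p) (int l) \<in> {0, 1, -1}" "chi (int l) \<in> {0, 1, -1}"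
    using chi_values[of "int l"] by (auto simp: Legendre_def)
  ultimately show ?thesis by auto
qed

text \<open>The norm of \<open>b + om\<close>, a polynomial of discriminant \<open>p\<close>. The
  lattice spanned by \<open>a\<close> and \<open>b + om\<close> is an ideal exactly when
  \<open>a\<close> divides this value.\<close>

definition root_poly :: "int \<Rightarrow> int" where "root_poly b = b ^ 2 + b - int q"

definition roots_mod :: "nat \<Rightarrow> int set" where
  "roots_mod a = {b\<in>{0..<int a}. int a dvd root_poly b}"

definition num_roots :: "nat \<Rightarrow> nat" where "num_roots a = card (roots_mod a)"

lemma finite_roots_mod [simp]: "finite (roots_mod a)"
  by (rule finite_subset[of _ "{0..<int a}"]) (auto simp: roots_mod_def)

lemma root_poly_square: "4 * root_poly b = (2 * b + 1) ^ 2 - int p"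
proof -
  have "int p = 4 * int q + 1" using p_eq by linarith
  thus ?thesis unfolding root_poly_def by (simp add: power2_eq_square algebra_simps)
qed

lemma root_poly_diff: "root_poly b - root_poly b' = (b - b') * (b + b' + 1)"
  unfolding root_poly_def by (simp add: power2_eq_square algebra_simps)

lemma root_poly_cong: "int a dvd b - b' \<Longrightarrow> int a dvd root_poly b \<longleftrightarrow> int a dvd root_poly b'"
  using root_poly_diff[of b b'] by (metis dvd_mult2 dvd_diff_commute diff_add_cancel dvd_add_right_iff)

lemma root_poly_mod: "int a dvd root_poly (b mod int a) \<longleftrightarrow> int a dvd root_poly b"
  by (rule root_poly_cong) (simp add: mod_eq_dvd_iff[symmetric])

lemma num_roots_1 [simp]: "num_roots 1 = 1"
proof -
  have "roots_mod 1 = {0}" unfolding roots_mod_def by auto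
  thus ?thesis unfolding num_roots_def by simp
qed

lemma num_roots_Suc_0 [simp]: "num_roots (Suc 0) = 1"
  using num_roots_1 by simp

text \<open>The Chinese remainder theorem, restricted to roots.\<close>

lemma num_roots_mult:
  assumes "coprime a b" "a > 0" "b > 0"
  shows "num_roots (a * b) = num_roots a * num_roots b"
proof -
  have cop: "coprime (int a) (int b)" using assms(1) by simp
  have "bij_betw (\<lambda>x. (x mod int a, x mod int b)) (roots_mod (a * b)) (roots_mod a \<times> roots_mod b)"
  proof (rule bij_betwI')
    fix x y assume xy: "x \<in> roots_mod (a * b)" "y \<in> roots_mod (a * b)"
    show "((x mod int a, x mod int b) = (y mod int a, y mod int b)) = (x = y)"
    proof
      assume "(x mod int a, x mod int b) = (y mod int a, y mod int b)"
      hence "int a dvd x - y" "int b dvd x - y" by (auto simp: mod_eq_dvd_iff)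
      hence "int a * int b dvd x - y" using cop by (rule divides_mult)
      hence "x mod (int a * int b) = y mod (int a * int b)" by (simp add: mod_eq_dvd_iff)
      thus "x = y" using xy by (simp add: roots_mod_def)
    qed simp
  next
    fix x assume x: "x \<in> roots_mod (a * b)"
    hence "int a * int b dvd root_poly x" by (simp add: roots_mod_def)
    hence "int a dvd root_poly x" "int b dvd root_poly x"
      using dvd_mult_left dvd_mult_right by blast+
    thus "(x mod int a, x mod int b) \<in> roots_mod a \<times> roots_mod b"
      using assms by (simp add: roots_mod_def root_poly_mod)
  next
    fix z assume z: "z \<in> roots_mod a \<times> roots_mod b"
    obtain u v where uv: "z = (u, v)" "u \<in> roots_mod a" "v \<in> roots_mod b" using z by auto
    obtain x where x: "[x = u] (mod int a)" "[x = v] (mod int b)"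
      using binary_chinese_remainder_int[OF cop] by blast
    define w where "w = x mod (int a * int b)"
    have wa: "w mod int a = u" using x(1) uv(2) unfolding w_def roots_mod_def
      by (simp add: unique_euclidean_semiring_class.cong_def mod_mod_cancel)
    have wb: "w mod int b = v" using x(2) uv(3) unfolding w_def roots_mod_def
      by (simp add: unique_euclidean_semiring_class.cong_def mod_mod_cancel)
    have "int a dvd root_poly w" using uv(2) root_poly_mod[of a w] wa by (simp add: roots_mod_def)
    moreover have "int b dvd root_poly w" using uv(3) root_poly_mod[of b w] wb by (simp add: roots_mod_def)
    ultimately have "int a * int b dvd root_poly w" using cop by (intro divides_mult)
    moreover have "0 \<le> w" "w < int a * int b" unfolding w_def using assms by simp_all
    ultimately have "w \<in> roots_mod (a * b)" by (simp add: roots_mod_def)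
    thus "\<exists>x\<in>roots_mod (a * b). z = (x mod int a, x mod int b)" using wa wb uv by auto
  qed
  from bij_betw_same_card[OF this] show ?thesis unfolding num_roots_def by (simp add: card_cartesian_product)
qed

text \<open>For odd \<open>l\<close>, completing the square turns roots into square roots of
  \<open>p\<close> modulo \<open>l\<close>, and reciprocity rewrites their number. Modulo 2,
  \<open>b^2 + b\<close> is always even, so there are two roots or none according to the parity of
  \<open>q\<close>, in agreement with \<open>chi_2\<close>.\<close>

lemma num_roots_prime:
  assumes l: "Factorial_Ring.prime l"
  shows "int (num_roots l) = 1 + chi (int l)"
proof (cases "l = 2")
  case True
  have r: "b \<in> roots_mod 2 \<longleftrightarrow> b \<in> {0, 1} \<and> even q" for b
  proof -
    have "even (root_poly b) \<longleftrightarrow> even q" unfolding root_poly_def by auto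
    moreover have "b \<in> {0..<2} \<longleftrightarrow> b \<in> {0, 1}" by auto
    ultimately show ?thesis unfolding roots_mod_def by auto
  qed
  hence "roots_mod 2 = (if even q then {0, 1} else {})" by auto
  thus ?thesis unfolding True num_roots_def using chi_2 by simp
next
  case False
  hence l2: "l > 2" using prime_ge_2_nat[OF l] by simp
  have odd: "odd l" using l l2 prime_odd_nat by blast
  have pl: "Factorial_Ring.prime (int l)" using l by simp
  let ?Y = "{y\<in>{0..<int l}. [y^2 = int p] (mod int l)}"
  have nd2: "\<not> int l dvd 2" using l2 by (auto dest: zdvd_imp_le)
  have nd4: "int l dvd 4 * z \<longleftrightarrow> int l dvd z" for z
    using prime_dvd_mult_iff[OF pl, of 4 z] prime_dvd_mult_iff[OF pl, of 2 2] nd2 by auto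
  have key: "b \<in> roots_mod l \<Longrightarrow> (2 * b + 1) mod int l \<in> ?Y" for b
  proof -
    assume "b \<in> roots_mod l"
    hence "int l dvd 4 * root_poly b" by (auto simp: roots_mod_def)
    hence "[(2 * b + 1) ^ 2 = int p] (mod int l)" unfolding root_poly_square by (simp add: cong_iff_dvd_diff)
    thus "(2 * b + 1) mod int l \<in> ?Y" using l2 by (simp add: unique_euclidean_semiring_class.cong_def power_mod)
  qed
  have "bij_betw (\<lambda>b. (2 * b + 1) mod int l) (roots_mod l) ?Y"
  proof (rule bij_betwI')
    fix x y assume xy: "x \<in> roots_mod l" "y \<in> roots_mod l"
    show "((2 * x + 1) mod int l = (2 * y + 1) mod int l) = (x = y)"
    proof
      assume "(2 * x + 1) mod int l = (2 * y + 1) mod int l"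
      hence "int l dvd 2 * (x - y)" by (simp add: mod_eq_dvd_iff algebra_simps)
      hence "int l dvd x - y" using prime_dvd_mult_iff[OF pl, of 2 "x - y"] nd2 by blast
      hence "x mod int l = y mod int l" by (simp add: mod_eq_dvd_iff)
      thus "x = y" using xy by (simp add: roots_mod_def)
    qed simp
  next
    fix x assume "x \<in> roots_mod l" thus "(2 * x + 1) mod int l \<in> ?Y" by (rule key)
  next
    fix y assume y: "y \<in> ?Y"
    obtain y' where y': "odd y'" "[y' = y] (mod int l)"
    proof (cases "odd y")
      case False
      thus thesis using that[of "y + int l"] odd by (simp add: unique_euclidean_semiring_class.cong_def)
    qed (use that[of y] in simp)
    then obtain b0 where b0: "y' = 2 * b0 + 1" by (auto elim: oddE)
    define b where "b = b0 mod int l"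
    have "[y' ^ 2 = int p] (mod int l)" using y y'(2) cong_pow cong_trans by blast
    hence "int l dvd 4 * root_poly b0" unfolding root_poly_square b0 by (simp add: cong_iff_dvd_diff)
    hence "int l dvd root_poly b" unfolding b_def root_poly_mod by (simp add: nd4)
    hence "b \<in> roots_mod l" unfolding b_def roots_mod_def using l2 by simp
    moreover have "(2 * b + 1) mod int l = y"
    proof -
      have "(2 * b + 1) mod int l = (2 * b0 + 1) mod int l" unfolding b_def by (metis mod_add_left_eq mod_mult_right_eq)
      thus ?thesis using y'(2) y unfolding b0 by (simp add: unique_euclidean_semiring_class.cong_def)
    qed
    ultimately show "\<exists>x\<in>roots_mod l. y = (2 * x + 1) mod int l" by auto
  qed
  hence "num_roots l = card ?Y" unfolding num_roots_def by (rule bij_betw_same_card)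
  thus ?thesis using card_square_roots_mod_prime[OF l l2, of "int p"] chi_prime[OF l l2] by simp
qed

text \<open>Hensel lifting: from \<open>(2 * b + 1)^2 - 4 * root_poly b = p\<close>, every root
  modulo a prime \<open>l \<noteq> p\<close> is simple, so it lifts uniquely at each step. This
  includes \<open>l = 2\<close>.\<close>

lemma num_roots_prime_power:
  assumes l: "Factorial_Ring.prime l" "l \<noteq> p"
  shows "num_roots (l ^ Suc e) = num_roots l"
proof (induction e)
  case (Suc e)
  have pl: "Factorial_Ring.prime (int l)" using l by simp
  have l0: "l > 0" using l prime_gt_0_nat by blast
  let ?M = "l ^ Suc e"
  let ?N = "l ^ Suc (Suc e)"
  have NM: "int ?N = int ?M * int l" by simp
  have lM: "int l dvd int ?M" by simp
  have unit: "\<not> int l dvd 2 * b + 1" if "int l dvd root_poly b" for b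
  proof
    assume "int l dvd 2 * b + 1"
    hence "int l dvd (2 * b + 1) ^ 2 - 4 * root_poly b" using that by (simp add: power2_eq_square)
    hence "int l dvd int p" by (simp add: root_poly_square)
    thus False using l p_prime primes_dvd_imp_eq by auto
  qed
  have "bij_betw (\<lambda>b. b mod int ?M) (roots_mod ?N) (roots_mod ?M)"
  proof (rule bij_betwI')
    fix x y assume xy: "x \<in> roots_mod ?N" "y \<in> roots_mod ?N"
    show "(x mod int ?M = y mod int ?M) = (x = y)"
    proof
      assume "x mod int ?M = y mod int ?M"
      hence "int ?M dvd x - y" by (simp only: mod_eq_dvd_iff)
      hence "int l dvd x - y" using lM dvd_trans by blast
      have "int ?N dvd root_poly x" "int ?N dvd root_poly y" using xy by (simp_all only: roots_mod_def mem_Collect_eq)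
      hence dv: "int ?N dvd (x - y) * (x + y + 1)" using root_poly_diff[of x y] dvd_diff by metis
      have "int l dvd root_poly x" using \<open>int ?N dvd root_poly x\<close> NM dvd_mult_right by metis
      hence "\<not> int l dvd 2 * x + 1" by (rule unit)
      moreover have "x + y + 1 = (2 * x + 1) - (x - y)" by simp
      ultimately have "\<not> int l dvd x + y + 1" using \<open>int l dvd x - y\<close> by (metis dvd_diffD1 dvd_diff_left_iff)
      hence "coprime (int l) (x + y + 1)" using pl prime_imp_coprime by blast
      hence "coprime (int ?N) (x + y + 1)" by simp
      hence "int ?N dvd x - y" using dv coprime_dvd_mult_left_iff by blast
      hence "x mod int ?N = y mod int ?N" by (simp only: mod_eq_dvd_iff)
      moreover have "x mod int ?N = x" "y mod int ?N = y"
        using xy unfolding roots_mod_def mem_Collect_eq by (simp_all only: atLeastLessThan_iff mod_pos_pos_trivial)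
      ultimately show "x = y" by simp
    qed simp
  next
    fix x assume x: "x \<in> roots_mod ?N"
    hence "int ?N dvd root_poly x" by (simp only: roots_mod_def mem_Collect_eq)
    hence "int ?M dvd root_poly x" using NM dvd_mult_left by metis
    moreover have "int ?M > 0" using l0 by simp
    ultimately show "x mod int ?M \<in> roots_mod ?M"
      unfolding roots_mod_def mem_Collect_eq root_poly_mod by simp
  next
    fix y assume y: "y \<in> roots_mod ?M"
    hence My: "int ?M dvd root_poly y" "0 \<le> y" "y < int ?M" by (simp_all only: roots_mod_def mem_Collect_eq atLeastLessThan_iff)
    then obtain g where g: "root_poly y = int ?M * g" by auto
    have "int l dvd root_poly y" using My(1) lM dvd_trans by blast
    hence "coprime (2 * y + 1) (int l)" using unit pl prime_imp_coprime coprime_commute by blast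
    then obtain t where t: "[(2 * y + 1) * t = - g] (mod int l)"
      using cong_solve_coprime_int[of "2 * y + 1" "int l"] cong_scalar_right[of _ 1 "int l" "-g"] 
      by (metis mult.assoc mult_1)
    define x where "x = (y + int ?M * t) mod int ?N"
    have Nz: "int ?N > 0" using l0 by simp
    have "root_poly (y + int ?M * t) = root_poly y + int ?M * t * (2 * y + 1) + (int ?M * t) ^ 2"
      unfolding root_poly_def by (simp add: power2_eq_square algebra_simps)
    also have "\<dots> = int ?M * (g + (2 * y + 1) * t) + int ?M * int ?M * t ^ 2"
      unfolding g by (simp add: power2_eq_square algebra_simps)
    also have "int ?N dvd \<dots>"
    proof (intro dvd_add)
      have "int l dvd g + (2 * y + 1) * t" using t by (simp add: cong_iff_dvd_diff add.commute)
      thus "int ?N dvd int ?M * (g + (2 * y + 1) * t)" unfolding NM by (rule mult_dvd_mono[OF dvd_refl])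
      show "int ?N dvd int ?M * int ?M * t ^ 2" unfolding NM using lM by (intro dvd_mult2 mult_dvd_mono) auto
    qed
    finally have "int ?N dvd root_poly x" unfolding x_def root_poly_mod .
    hence xr: "x \<in> roots_mod ?N" unfolding roots_mod_def mem_Collect_eq x_def using Nz by simp
    have "x mod int ?M = (y + int ?M * t) mod int ?M"
      unfolding x_def NM by (simp add: mod_mod_cancel)
    also have "\<dots> = y" using My by simp
    finally show "\<exists>x\<in>roots_mod ?N. y = x mod int ?M" using xr by blast
  qed
  from bij_betw_same_card[OF this] Suc show ?case unfolding num_roots_def by simp
qed simp

text \<open>A root modulo \<open>p^2\<close> would make \<open>2 * b + 1\<close> divisible by
  \<open>p\<close>, its square by \<open>p^2\<close>, and then \<open>p\<close> itself by
  \<open>p^2\<close>.\<close>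

lemma num_roots_p_power: "e \<ge> 2 \<Longrightarrow> num_roots (p ^ e) = 0"
proof -
  assume e: "e \<ge> 2"
  have pp: "int p * int p dvd int (p ^ e)" using le_imp_power_dvd[OF e, of "int p"] by (simp add: power2_eq_square)
  have "\<not> int (p ^ e) dvd root_poly b" for b
  proof
    assume "int (p ^ e) dvd root_poly b"
    hence "int p * int p dvd 4 * root_poly b" using pp dvd_trans dvd_mult by metis
    hence d: "int p * int p dvd (2 * b + 1) ^ 2 - int p" by (simp only: root_poly_square)
    hence "int p dvd (2 * b + 1) ^ 2 - int p" using dvd_mult_left by blast
    hence "int p dvd (2 * b + 1) ^ 2" by (simp add: dvd_diff_left_iff dvd_diffD1)
    hence "int p dvd 2 * b + 1" using p_int_prime prime_dvd_power by blast
    hence "int p * int p dvd (2 * b + 1) ^ 2" unfolding power2_eq_square by (intro mult_dvd_mono)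
    from dvd_diff[OF this d] have "int p * int p dvd int p" by simp
    thus False using p_gt5 by simp
  qed
  thus ?thesis unfolding num_roots_def roots_mod_def by simp
qed

text \<open>Every nonzero ideal is \<open>m\<close> times an ideal with basis \<open>a\<close>,
  \<open>b + om\<close>, and has norm \<open>m^2 * a\<close>. The sum runs over the possible
  \<open>m\<close>, with \<open>a = n div m^2\<close>.\<close>

definition ideal_count :: "nat \<Rightarrow> nat" where
  "ideal_count n = (\<Sum>m | m ^ 2 dvd n. num_roots (n div m ^ 2))"

lemma finite_square_divisors: "n > 0 \<Longrightarrow> finite {m::nat. m ^ 2 dvd n}"
proof (rule finite_subset)
  assume "n > 0"
  thus "{m. m ^ 2 dvd n} \<subseteq> {..n}"
    by (auto simp: power2_eq_square dest!: dvd_imp_le) (metis le_square order_trans)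
qed simp

text \<open>The exponent of \<open>l\<close> and the part prime to \<open>l\<close> of a square
  divisor can be chosen independently, because \<open>l\<close> does not divide
  \<open>n\<close>.\<close>

lemma square_dvd_prime_power_mult:
  fixes l k n :: nat
  assumes l: "Factorial_Ring.prime l" "\<not> l dvd n" and n: "n > 0"
  shows "bij_betw (\<lambda>(i, m). l ^ i * m) ({i. 2 * i \<le> k} \<times> {m. m ^ 2 dvd n}) {m. m ^ 2 dvd l ^ k * n}"
proof (rule bij_betwI')
  have nd: "\<not> l dvd m" if "m ^ 2 dvd n" for m
    using l(2) that by (metis dvd_mult_left dvd_trans power2_eq_square)
  {
    fix x y assume xy: "x \<in> {i. 2 * i \<le> k} \<times> {m. m ^ 2 dvd n}" "y \<in> {i. 2 * i \<le> k} \<times> {m. m ^ 2 dvd n}"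
    obtain i m j w where e: "x = (i, m)" "y = (j, w)" by (cases x, cases y)
    have m: "\<not> l dvd m" "\<not> l dvd w" using xy nd unfolding e by auto
    have "i = j \<and> m = w" if "l ^ i * m = l ^ j * w"
    proof -
      have mult: "multiplicity l (l ^ i * m) = i" if "\<not> l dvd m" for i m
        using l(1) that by (intro multiplicity_eqI) (auto simp: prime_gt_0_nat)
      have "i = j" using mult[OF m(1), of i] mult[OF m(2), of j] that by simp
      thus ?thesis using that l(1) prime_gt_0_nat by auto
    qed
    thus "((case x of (i, m) \<Rightarrow> l ^ i * m) = (case y of (i, m) \<Rightarrow> l ^ i * m)) = (x = y)" unfolding e by auto
  next
    fix x assume x: "x \<in> {i. 2 * i \<le> k} \<times> {m. m ^ 2 dvd n}"
    obtain i m where e: "x = (i, m)" by (cases x)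
    have "l ^ (2 * i) dvd l ^ k" using x unfolding e by (intro le_imp_power_dvd) auto
    moreover have "m ^ 2 dvd n" using x e by auto
    ultimately show "(case x of (i, m) \<Rightarrow> l ^ i * m) \<in> {m. m ^ 2 dvd l ^ k * n}"
      unfolding e by (simp add: power_mult_distrib power_mult[symmetric] mult.commute[of _ 2] mult_dvd_mono)
  next
    fix y assume "y \<in> {m. m ^ 2 dvd l ^ k * n}"
    hence y: "y ^ 2 dvd l ^ k * n" by simp
    have "l ^ k * n > 0" using l(1) n prime_gt_0_nat by auto
    hence y0: "y > 0" using y by (intro gr0I) auto
    obtain i m where im: "y = l ^ i * m" "\<not> l dvd m"
      using multiplicity_decompose'[of y l] y0 l(1) by (metis neq0_conv not_prime_unit)
    have cop: "coprime l m" "coprime l n" using l im prime_imp_coprime by blast+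
    have "l ^ (2 * i) dvd l ^ k * n" using y unfolding im by (metis dvd_mult_left mult.commute power_mult power_mult_distrib)
    hence "l ^ (2 * i) dvd l ^ k" using cop(2) by (metis coprime_dvd_mult_left_iff coprime_power_left_iff)
    hence "2 * i \<le> k" using l(1) prime_gt_1_nat by (intro power_dvd_imp_le)
    moreover have "m ^ 2 dvd l ^ k * n" using y unfolding im by (metis dvd_mult_right power_mult_distrib)
    hence "m ^ 2 dvd n" using cop(1) by (metis coprime_commute coprime_dvd_mult_right_iff coprime_power_left_iff coprime_power_right_iff)
    ultimately show "\<exists>x\<in>{i. 2 * i \<le> k} \<times> {m. m ^ 2 dvd n}. y = (case x of (i, m) \<Rightarrow> l ^ i * m)"
      using im by (intro bexI[of _ "(i, m)"]) auto
  }
qed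

lemma dvd_prime_power_mult:
  fixes l k n :: nat
  assumes l: "Factorial_Ring.prime l" "\<not> l dvd n" and n: "n > 0"
  shows "bij_betw (\<lambda>(i, m). l ^ i * m) ({..k} \<times> {m. m dvd n}) {m. m dvd l ^ k * n}"
proof (rule bij_betwI')
  have nd: "\<not> l dvd m" if "m dvd n" for m
    using l(2) that dvd_trans by blast
  {
    fix x y assume xy: "x \<in> {..k} \<times> {m. m dvd n}" "y \<in> {..k} \<times> {m. m dvd n}"
    obtain i m j w where e: "x = (i, m)" "y = (j, w)" by (cases x, cases y)
    have m: "\<not> l dvd m" "\<not> l dvd w" using xy nd unfolding e by auto
    have "i = j \<and> m = w" if "l ^ i * m = l ^ j * w"
    proof -
      have mult: "multiplicity l (l ^ i * m) = i" if "\<not> l dvd m" for i m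
        using l(1) that by (intro multiplicity_eqI) (auto simp: prime_gt_0_nat)
      have "i = j" using mult[OF m(1), of i] mult[OF m(2), of j] that by simp
      thus ?thesis using that l(1) prime_gt_0_nat by auto
    qed
    thus "((case x of (i, m) \<Rightarrow> l ^ i * m) = (case y of (i, m) \<Rightarrow> l ^ i * m)) = (x = y)" unfolding e by auto
  next
    fix x assume x: "x \<in> {..k} \<times> {m. m dvd n}"
    obtain i m where e: "x = (i, m)" by (cases x)
    show "(case x of (i, m) \<Rightarrow> l ^ i * m) \<in> {m. m dvd l ^ k * n}"
      using x unfolding e by (auto intro!: mult_dvd_mono le_imp_power_dvd)
  next
    fix y assume "y \<in> {m. m dvd l ^ k * n}"
    hence y: "y dvd l ^ k * n" by simp
    have "l ^ k * n > 0" using l(1) n prime_gt_0_nat by auto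
    hence y0: "y > 0" using y by (intro gr0I) auto
    obtain i m where im: "y = l ^ i * m" "\<not> l dvd m"
      using multiplicity_decompose'[of y l] y0 l(1) by (metis neq0_conv not_prime_unit)
    have cop: "coprime l m" "coprime l n" using l im prime_imp_coprime by blast+
    have "l ^ i dvd l ^ k * n" using y unfolding im by (metis dvd_mult_left)
    hence "l ^ i dvd l ^ k" using cop(2) by (metis coprime_dvd_mult_left_iff coprime_power_left_iff)
    hence "i \<le> k" using l(1) prime_gt_1_nat by (intro power_dvd_imp_le)
    moreover have "m dvd l ^ k * n" using y unfolding im by (metis dvd_mult_right)
    hence "m dvd n" using cop(1) by (metis coprime_commute coprime_dvd_mult_right_iff coprime_power_right_iff)
    ultimately show "\<exists>x\<in>{..k} \<times> {m. m dvd n}. y = (case x of (i, m) \<Rightarrow> l ^ i * m)"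
      using im by (intro bexI[of _ "(i, m)"]) auto
  }
qed

text \<open>Raising \<open>k\<close> by 2 adds \<open>num_roots (l^k)\<close> on the left and the
  two highest powers of \<open>chi l\<close> on the right. For \<open>l \<noteq> p\<close> both are
  \<open>1 + chi l\<close>, as \<open>chi l\<close> is 1 or -1; for \<open>l = p\<close> both are
  0.\<close>

lemma num_roots_prime_power_sum:
  assumes l: "Factorial_Ring.prime l"
  shows "(\<Sum>i | 2 * i \<le> k. int (num_roots (l ^ (k - 2 * i)))) = (\<Sum>j\<le>k. chi (int l) ^ j)"
proof (induction k rule: less_induct)
  case (less k)
  consider "k = 0" | "k = 1" | k' where "k = k' + 2" by (metis One_nat_def add_2_eq_Suc' not0_implies_Suc)
  thus ?case
  proof cases
    case 1
    thus ?thesis by simp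
  next
    case 2
    have "{i::nat. 2 * i \<le> 1} = {0}" by auto
    thus ?thesis using 2 num_roots_prime[OF l] by simp
  next
    case 3
    have set: "{i. 2 * i \<le> k} = insert 0 (Suc ` {i. 2 * i \<le> k'})"
    proof (intro equalityI subsetI)
      fix i assume "i \<in> {i. 2 * i \<le> k}"
      thus "i \<in> insert 0 (Suc ` {i. 2 * i \<le> k'})" using 3 by (cases i) auto
    qed (use 3 in auto)
    have fin: "finite {i::nat. 2 * i \<le> k'}" by (rule finite_subset[of _ "{..k'}"]) auto
    have "(\<Sum>i | 2 * i \<le> k. int (num_roots (l ^ (k - 2 * i)))) =
      int (num_roots (l ^ k)) + (\<Sum>i | 2 * i \<le> k'. int (num_roots (l ^ (k' - 2 * i))))"
      unfolding set using fin 3 by (subst sum.insert) (auto simp: sum.reindex)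
    also have "\<dots> = int (num_roots (l ^ k)) + (\<Sum>j\<le>k'. chi (int l) ^ j)" using less[of k'] 3 by simp
    also have "int (num_roots (l ^ k)) = chi (int l) ^ (k' + 1) + chi (int l) ^ (k' + 2)"
    proof (cases "l = p")
      case True
      thus ?thesis using num_roots_p_power[of k] 3 by (simp add: chi_eq_0_iff[THEN iffD2])
    next
      case False
      have "chi (int l) \<noteq> 0" using False l p_prime primes_dvd_imp_eq by (auto simp: chi_eq_0_iff)
      hence "chi (int l) = 1 \<or> chi (int l) = -1" using chi_values by blast
      moreover have "int (num_roots (l ^ k)) = 1 + chi (int l)"
        using num_roots_prime_power[OF l False, of "k' + 1"] num_roots_prime[OF l] 3 by simp
      ultimately show ?thesis by auto
    qed
    finally show ?thesis using 3 by simp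
  qed
qed

text \<open>The coefficient form of the factorisation of the Dedekind zeta function into the Riemann
  zeta function and the L-series of \<open>chi\<close>. Both sides are multiplicative, and the
  induction splits off one full prime power at a time.\<close>

theorem ideal_count_eq: "n > 0 \<Longrightarrow> int (ideal_count n) = (\<Sum>d | d dvd n. chi (int d))"
proof (induction n rule: less_induct)
  case (less n)
  show ?case
  proof (cases "n = 1")
    case True
    have "{m::nat. m ^ 2 dvd 1} = {1}" "{d::nat. d dvd 1} = {1}" by auto
    thus ?thesis unfolding ideal_count_def True by simp
  next
    case False
    then obtain l where l: "Factorial_Ring.prime l" "l dvd n" using prime_factor_nat by blast
    obtain k n' where kn: "n = l ^ k * n'" "\<not> l dvd n'"
      using multiplicity_decompose'[of n l] less(2) l(1) by (metis neq0_conv not_prime_unit)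
    have k0: "k \<noteq> 0" using kn l by (cases k) auto
    have n'0: "n' > 0" using kn less(2) by (intro gr0I) auto
    have "1 * n' < l ^ k * n'" using k0 l(1) n'0 prime_gt_1_nat by (intro mult_strict_right_mono one_less_power) auto
    hence IH: "int (ideal_count n') = (\<Sum>d | d dvd n'. chi (int d))" using less n'0 kn by simp
    have l0: "l > 0" using l prime_gt_0_nat by blast
    have "int (ideal_count n) = (\<Sum>m | m ^ 2 dvd l ^ k * n'. int (num_roots (n div m ^ 2)))"
      unfolding ideal_count_def kn by simp
    also have "\<dots> = (\<Sum>(i, m)\<in>{i. 2 * i \<le> k} \<times> {m. m ^ 2 dvd n'}. int (num_roots (n div (l ^ i * m) ^ 2)))"
      using sum.reindex_bij_betw[OF square_dvd_prime_power_mult[OF l(1) kn(2) n'0, of k], symmetric]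
      by (simp add: case_prod_unfold)
    also have "\<dots> = (\<Sum>(i, m)\<in>{i. 2 * i \<le> k} \<times> {m. m ^ 2 dvd n'}. int (num_roots (l ^ (k - 2 * i))) * int (num_roots (n' div m ^ 2)))"
    proof (rule sum.cong[OF refl])
      fix x assume x: "x \<in> {i. 2 * i \<le> k} \<times> {m. m ^ 2 dvd n'}"
      obtain i m where xim: "x = (i, m)" by (cases x)
      have im: "2 * i \<le> k" "m ^ 2 dvd n'" using x xim by auto
      have m0: "m > 0" using im n'0 by (intro gr0I) auto
      obtain t where t: "n' = m ^ 2 * t" using im by auto
      have t0: "t > 0" using t n'0 by (intro gr0I) auto
      have "n = (l ^ i * m) ^ 2 * (l ^ (k - 2 * i) * t)"
      proof -
        have "l ^ k = (l ^ i) ^ 2 * l ^ (k - 2 * i)" using im(1)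
          by (simp add: power_mult[symmetric] power_add[symmetric] mult.commute)
        thus ?thesis unfolding kn t by (simp add: power_mult_distrib mult_ac)
      qed
      hence "n div (l ^ i * m) ^ 2 = l ^ (k - 2 * i) * t" using l0 m0 by simp
      moreover have "n' div m ^ 2 = t" using t m0 by simp
      moreover have "coprime (l ^ (k - 2 * i)) t"
      proof -
        have "\<not> l dvd t" using kn(2) t by auto
        thus ?thesis using l(1) prime_imp_coprime by auto
      qed
      ultimately have "num_roots (n div (l ^ i * m) ^ 2) = num_roots (l ^ (k - 2 * i)) * num_roots (n' div m ^ 2)"
        using num_roots_mult[of "l ^ (k - 2 * i)" t] t0 l0 by simp
      thus "(case x of (i, m) \<Rightarrow> int (num_roots (n div (l ^ i * m) ^ 2))) =
        (case x of (i, m) \<Rightarrow> int (num_roots (l ^ (k - 2 * i))) * int (num_roots (n' div m ^ 2)))"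
        unfolding xim by simp
    qed
    also have "\<dots> = (\<Sum>i | 2 * i \<le> k. int (num_roots (l ^ (k - 2 * i)))) * int (ideal_count n')"
      unfolding ideal_count_def by (simp add: sum_product sum.cartesian_product)
    also have "\<dots> = (\<Sum>j\<le>k. chi (int l) ^ j) * (\<Sum>d | d dvd n'. chi (int d))"
      by (simp only: num_roots_prime_power_sum[OF l(1)] IH)
    also have "\<dots> = (\<Sum>(j, d)\<in>{..k} \<times> {d. d dvd n'}. chi (int l) ^ j * chi (int d))"
      by (simp add: sum_product sum.cartesian_product)
    also have "\<dots> = (\<Sum>(j, d)\<in>{..k} \<times> {d. d dvd n'}. chi (int (l ^ j * d)))"
    proof -
      have "chi (int l) ^ j = chi (int l ^ j)" for j by (induction j) (auto simp: chi_mult)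
      thus ?thesis by (simp add: chi_mult)
    qed
    also have "\<dots> = (\<Sum>d | d dvd l ^ k * n'. chi (int d))"
      using sum.reindex_bij_betw[OF dvd_prime_power_mult[OF l(1) kn(2) n'0, of k], of "\<lambda>d. chi (int d)"]
      by (simp add: case_prod_unfold)
    finally show ?thesis by (simp only: kn)
  qed
qed

text \<open>Complete periods contribute 0, so fewer than \<open>p\<close> terms of modulus at most 1
  remain.\<close>

lemma abs_sum_chi_le: "\<bar>\<Sum>d\<in>{1..n}. real_of_int (chi (int d))\<bar> \<le> p"
proof -
  have per: "(\<Sum>d<j * p + r. chi (int d)) = (\<Sum>d<r. chi (int d))" for j r
  proof (induction j)
    case (Suc j)
    have "(\<Sum>d<Suc j * p + r. chi (int d)) = (\<Sum>d<p. chi (int d)) + (\<Sum>d=p..<p + (j * p + r). chi (int d))"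
      by (simp add: lessThan_atLeast0 sum.atLeastLessThan_concat add.assoc)
    also have "(\<Sum>d=p..<p + (j * p + r). chi (int d)) = (\<Sum>d<j * p + r. chi (int (p + d)))"
      by (rule sum.reindex_bij_witness[of _ "\<lambda>d. p + d" "\<lambda>d. d - p"]) auto
    also have "\<dots> = (\<Sum>d<j * p + r. chi (int d))"
      by (intro sum.cong refl chi_cong) (simp add: cong_iff_dvd_diff)
    also have "(\<Sum>d<p. chi (int d)) = 0"
    proof -
      have "(\<Sum>a\<in>{0..<int p}. chi a) = (\<Sum>d<p. chi (int d))"
        by (rule sum.reindex_bij_witness[of _ int nat]) auto
      thus ?thesis using sum_chi by simp
    qed
    finally show ?case using Suc by simp
  qed simp
  have "{..<Suc n} = insert 0 {1..n}" by auto
  hence "(\<Sum>d\<in>{1..n}. chi (int d)) = (\<Sum>d<Suc n. chi (int d))" by simp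
  also have "\<dots> = (\<Sum>d<Suc n mod p. chi (int d))" using per[of "Suc n div p" "Suc n mod p"] by simp
  finally have "\<bar>\<Sum>d\<in>{1..n}. chi (int d)\<bar> = \<bar>\<Sum>d<Suc n mod p. chi (int d)\<bar>" by simp
  also have "\<dots> \<le> (\<Sum>d<Suc n mod p. \<bar>chi (int d)\<bar>)" by (rule sum_abs)
  also have "\<dots> \<le> (\<Sum>d<Suc n mod p. 1)" 
  proof (rule sum_mono)
    fix d show "\<bar>chi (int d)\<bar> \<le> 1" using chi_values[of "int d"] by auto
  qed
  also have "\<dots> \<le> int p" using mod_less_divisor[of p "Suc n"] p_gt5 by (simp add: less_imp_le del: mod_less_divisor)
  finally have "of_int \<bar>\<Sum>d\<in>{1..n}. chi (int d)\<bar> \<le> (of_int (int p) :: real)" by (simp only: of_int_le_iff)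
  thus ?thesis by simp
qed

lemma sum_ideal_count:
  "(\<Sum>n=1..N. real (ideal_count n)) = (\<Sum>d=1..N. of_int (chi (int d)) * real (N div d))"
proof -
  have "(\<Sum>n=1..N. real (ideal_count n)) = (\<Sum>n=1..N. \<Sum>d | d dvd n. real_of_int (chi (int d)))"
  proof (intro sum.cong refl)
    fix n assume "n \<in> {1..N}"
    hence "real_of_int (int (ideal_count n)) = real_of_int (\<Sum>d | d dvd n. chi (int d))" by (subst ideal_count_eq) auto
    thus "real (ideal_count n) = (\<Sum>d | d dvd n. real_of_int (chi (int d)))" by simp
  qed
  also have "\<dots> = (\<Sum>n=1..N. \<Sum>d=1..N. if d dvd n then real_of_int (chi (int d)) else 0)"
  proof (rule sum.cong[OF refl])
    fix n assume n: "n \<in> {1..N}"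
    hence "{d. d dvd n} = {d\<in>{1..N}. d dvd n}" by (auto dest: dvd_imp_le simp: Suc_le_eq intro!: gr0I)
    thus "(\<Sum>d | d dvd n. real_of_int (chi (int d))) = (\<Sum>d=1..N. if d dvd n then real_of_int (chi (int d)) else 0)"
      by (simp only: sum.inter_filter finite_atLeastAtMost)
  qed
  also have "\<dots> = (\<Sum>d=1..N. \<Sum>n=1..N. if d dvd n then real_of_int (chi (int d)) else 0)" by (rule sum.swap)
  also have "\<dots> = (\<Sum>d=1..N. of_int (chi (int d)) * real (N div d))"
  proof (intro sum.cong refl)
    fix d assume d: "d \<in> {1..N}"
    have "bij_betw (\<lambda>k. d * k) {1..N div d} {n\<in>{1..N}. d dvd n}"
    proof (rule bij_betwI')
      fix y assume "y \<in> {n\<in>{1..N}. d dvd n}"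
      then obtain k where "y = d * k" "1 \<le> y" "y \<le> N" by auto
      thus "\<exists>x\<in>{1..N div d}. y = d * x" using d by (intro bexI[of _ k]) (auto simp: less_eq_div_iff_mult_less_eq mult.commute Suc_le_eq)
    qed (use d in \<open>auto simp: less_eq_div_iff_mult_less_eq mult.commute\<close>)
    hence "card {n\<in>{1..N}. d dvd n} = N div d" using bij_betw_same_card by fastforce
    hence "(\<Sum>n\<in>{n\<in>{1..N}. d dvd n}. real_of_int (chi (int d))) = of_int (chi (int d)) * real (N div d)" by simp
    thus "(\<Sum>n=1..N. if d dvd n then real_of_int (chi (int d)) else 0) = of_int (chi (int d)) * real (N div d)"
      by (simp only: sum.inter_filter[symmetric] finite_atLeastAtMost)
  qed
  finally show ?thesis .
qed

text \<open>The sum over \<open>d\<close> is cut at \<open>sqrt N\<close>. Below,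
  \<open>N div d\<close> is replaced by \<open>N / d\<close> with an error of at most 1 for each
  \<open>d\<close>. Above, \<open>N div d\<close> is decreasing and the character sums are bounded,
  so partial summation bounds the rest by a multiple of \<open>N / sqrt N\<close>. Both errors are
  of order \<open>sqrt N\<close>.\<close>

lemma sum_ideal_count_asymp:
  assumes L: "(\<lambda>N. \<Sum>n=1..N. of_int (chi (int n)) / real n) \<longlonglongrightarrow> L"
  shows "(\<lambda>N. (\<Sum>n=1..N. real (ideal_count n)) / real N) \<longlonglongrightarrow> L"
proof -
  define y where "y = (\<lambda>N. nat \<lfloor>sqrt (real N)\<rfloor>)"
  define S where "S = (\<lambda>N. \<Sum>n=1..N. of_int (chi (int n)) / real n :: real)"
  have ylim: "filterlim y at_top at_top"
    unfolding y_def
    by (intro filterlim_compose[OF filterlim_nat_sequentially] filterlim_compose[OF filterlim_floor_sequentially]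
      filterlim_compose[OF sqrt_at_top] filterlim_real_sequentially)
  have "(\<lambda>N. S (y N)) \<longlonglongrightarrow> L" using L ylim unfolding S_def by (rule filterlim_compose)
  moreover have "(\<lambda>N. (\<Sum>n=1..N. real (ideal_count n)) / real N - S (y N)) \<longlonglongrightarrow> 0"
  proof (rule Lim_null_comparison)
    show "(\<lambda>N. (sqrt N + 2 * real p * (real N / sqrt N)) / real N) \<longlonglongrightarrow> 0" by real_asymp
    show "eventually (\<lambda>N. norm ((\<Sum>n=1..N. real (ideal_count n)) / real N - S (y N)) \<le> (sqrt N + 2 * real p * (real N / sqrt N)) / real N) sequentially"
      using eventually_gt_at_top[of 0]
    proof eventually_elim
      case (elim N)
      have s1: "sqrt N \<ge> 1" using elim by simp
      have yN: "real (y N) \<le> sqrt N" "sqrt N < real (y N) + 1" unfolding y_def using s1 by linarith+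
      have "sqrt N \<le> N" using s1 elim by (metis of_nat_0_le_iff real_sqrt_ge_1_iff real_sqrt_le_iff sqrt_le_D real_le_lsqrt power2_eq_square mult_left_mono mult_cancel_left1 le_add_same_cancel2 real_sqrt_ge_one mult_le_cancel_left1 real_sqrt_mult_self abs_of_nat)
      hence yle: "y N \<le> N" using yN(1) by linarith
      have split: "{1..N} = {1..y N} \<union> {y N + 1..N}" using yle by auto
      define A where "A = (\<Sum>d=1..y N. of_int (chi (int d)) * real (N div d))"
      define B where "B = (\<Sum>d=y N + 1..N. of_int (chi (int d)) * real (N div d))"
      have tot: "(\<Sum>n=1..N. real (ideal_count n)) = A + B"
      proof -
        have "(\<Sum>d\<in>{1..N}. of_int (chi (int d)) * real (N div d)) = A + B"
          unfolding A_def B_def by (subst split, intro sum.union_disjoint) auto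
        thus ?thesis by (simp only: sum_ideal_count)
      qed
      have "\<bar>A - real N * S (y N)\<bar> \<le> sqrt N"
      proof -
        have "A - real N * S (y N) = (\<Sum>d=1..y N. of_int (chi (int d)) * (real (N div d) - real N / real d))"
          unfolding A_def S_def by (simp add: sum_distrib_left right_diff_distrib sum_subtractf mult_ac)
        also have "\<bar>\<dots>\<bar> \<le> (\<Sum>d=1..y N. \<bar>of_int (chi (int d)) * (real (N div d) - real N / real d)\<bar>)" by (rule sum_abs)
        also have "\<dots> \<le> (\<Sum>d=1..y N. 1 * 1)"
          unfolding abs_mult
        proof (intro sum_mono mult_mono)
          fix d assume d: "d \<in> {1..y N}"
          show "\<bar>real_of_int (chi (int d))\<bar> \<le> 1" using chi_values[of "int d"] by auto
          have "real N / real d = real (N div d) + real (N mod d) / real d" by (rule of_nat_of_nat_div_aux)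
          moreover have "real (N mod d) / real d \<ge> 0" "real (N mod d) / real d \<le> 1" using d by (auto simp: less_imp_le)
          ultimately have "real N / real d - real (N div d) \<ge> 0" "real N / real d - real (N div d) \<le> 1" by linarith+
          thus "\<bar>real (N div d) - real N / real d\<bar> \<le> 1" by linarith
        qed auto
        finally show ?thesis using yN by simp
      qed
      moreover have "\<bar>B\<bar> \<le> 2 * real p * (real N / sqrt N)"
      proof (cases "y N + 1 \<le> N")
        case True
        \<comment> \<open>Character sums divided by \<open>p\<close>, to have the bound 1 required
          for partial summation; the upper limit \<open>m - 1\<close> makes
          \<open>X (Suc d) - X d\<close> the term at \<open>d\<close>.\<close>
        define X where "X = (\<lambda>m::nat. (\<Sum>d\<in>{1..m - 1}. real_of_int (chi (int d))) / p)"
        have X: "real_of_int (chi (int d)) = p * (X (Suc d) - X d)" if "d \<ge> 1" for d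
        proof -
          have "{1..d} = insert d {1..d-1}" using that by auto
          thus ?thesis using that p_gt5 unfolding X_def by (simp add: diff_divide_distrib[symmetric])
        qed
        have "B = p * (\<Sum>d=y N + 1..N. real (N div d) * (X (Suc d) - X d))"
          unfolding B_def sum_distrib_left by (intro sum.cong refl) (simp add: X)
        moreover have "\<bar>\<Sum>d=y N + 1..N. real (N div d) * (X (Suc d) - X d)\<bar> \<le> 2 * real (N div (y N + 1))"
          using True
        proof (rule abel_telescoping_bound)
          fix m assume "y N + 1 \<le> m"
          thus "real (N div Suc m) \<le> real (N div m)" by (simp add: div_le_mono2)
        next
          fix m show "\<bar>X m\<bar> \<le> 1" unfolding X_def using abs_sum_chi_le[of "m - 1"] p_gt5 by (simp add: field_simps)
        qed simp
        ultimately have "\<bar>B\<bar> \<le> p * (2 * real (N div (y N + 1)))" by (simp add: abs_mult mult_left_mono)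
        also have "real (N div (y N + 1)) \<le> real N / sqrt N"
        proof -
          have "real (N div (y N + 1)) \<le> real N / real (y N + 1)" by (rule of_nat_div_le_of_nat)
          also have "\<dots> \<le> real N / sqrt N" using yN s1 by (intro divide_left_mono) auto
          finally show ?thesis .
        qed
        finally show ?thesis using p_gt5 by (simp add: mult_left_mono mult_ac)
      next
        case False
        hence "B = 0" unfolding B_def by simp
        thus ?thesis by simp
      qed
      ultimately have "\<bar>A + B - real N * S (y N)\<bar> \<le> sqrt N + 2 * real p * (real N / sqrt N)" by linarith
      hence "\<bar>A + B - real N * S (y N)\<bar> / real N \<le> (sqrt N + 2 * real p * (real N / sqrt N)) / real N"
        by (rule divide_right_mono) simp
      moreover have "(A + B) / real N - S (y N) = (A + B - real N * S (y N)) / real N" using elim by (simp add: field_simps)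
      ultimately show ?case unfolding tot by simp
    qed
  qed
  ultimately have "(\<lambda>N. S (y N) + ((\<Sum>n=1..N. real (ideal_count n)) / real N - S (y N))) \<longlonglongrightarrow> L + 0" by (rule tendsto_add)
  thus ?thesis by simp
qed

end

section \<open>Lattice points in hyperbolic regions\<close>

text \<open>\<open>X\<close> stands for a field element and \<open>Y\<close> for its conjugate.
  Multiplication by a unit \<open>u\<close> multiplies \<open>X / \<bar>Y\<bar>\<close> by
  \<open>u^2\<close> in absolute value, so for \<open>E = \<epsilon>^2\<close> the range from 1 to
  \<open>E\<close>, half open, singles out one representative modulo powers of
  \<open>\<epsilon>\<close>; \<open>X > 0\<close> fixes the sign. The strict last inequality also
  excludes \<open>Y = 0\<close>.\<close>

definition hyp_region :: "real \<Rightarrow> real \<Rightarrow> (real \<times> real) set" where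
  "hyp_region E t = {(X, Y). 0 < X \<and> \<bar>X * Y\<bar> \<le> t \<and> \<bar>Y\<bar> \<le> X \<and> X < E * \<bar>Y\<bar>}"

lemma hyp_region_scale:
  assumes "T > 0"
  shows "(X / T, Y / T) \<in> hyp_region E 1 \<longleftrightarrow> (X, Y) \<in> hyp_region E (T ^ 2)"
proof -
  have "\<bar>X / T * (Y / T)\<bar> = \<bar>X * Y\<bar> / T ^ 2" by (simp add: power2_eq_square abs_mult)
  moreover have "\<bar>X * Y\<bar> / T ^ 2 \<le> 1 \<longleftrightarrow> \<bar>X * Y\<bar> \<le> T ^ 2" using assms by (subst divide_le_eq) simp
  ultimately have 1: "\<bar>X / T * (Y / T)\<bar> \<le> 1 \<longleftrightarrow> \<bar>X * Y\<bar> \<le> T ^ 2" by (simp only:)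
  have 2: "\<bar>Y / T\<bar> = \<bar>Y\<bar> / T" using assms by simp
  have 3: "X / T < E * (\<bar>Y\<bar> / T) \<longleftrightarrow> X < E * \<bar>Y\<bar>" 
    using assms divide_less_cancel[of X T "E * \<bar>Y\<bar>"] by simp
  show ?thesis unfolding hyp_region_def mem_Collect_eq prod.case 1 2 3 using assms
    by (simp add: zero_less_divide_iff divide_le_cancel)
qed

lemma hyp_region_bounds:
  assumes "(X, Y) \<in> hyp_region E 1" "E > 1"
  shows "0 < X" "X \<le> E" "\<bar>Y\<bar> \<le> 1"
proof -
  have XY: "0 < X" "\<bar>X * Y\<bar> \<le> 1" "\<bar>Y\<bar> \<le> X" "X < E * \<bar>Y\<bar>" using assms unfolding hyp_region_def by auto
  have "\<bar>Y\<bar> * \<bar>Y\<bar> \<le> X * \<bar>Y\<bar>" using XY by (intro mult_right_mono) auto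
  also have "\<dots> \<le> 1" using XY by (simp add: abs_mult)
  finally have "\<bar>Y\<bar> ^ 2 \<le> 1" by (simp add: power2_eq_square)
  thus Y: "\<bar>Y\<bar> \<le> 1" by (simp add: abs_square_le_1)
  have "E * \<bar>Y\<bar> \<le> E * 1" using Y assms by (intro mult_left_mono) auto
  thus "X \<le> E" using XY by linarith
  show "0 < X" by fact
qed

lemma hyp_region_measurable [measurable]: "hyp_region E t \<in> sets (borel \<Otimes>\<^sub>M borel)"
proof -
  have "hyp_region E t = {z \<in> space (borel \<Otimes>\<^sub>M borel). 0 < fst z \<and> \<bar>fst z * snd z\<bar> \<le> t \<and> \<bar>snd z\<bar> \<le> fst z \<and> fst z < E * \<bar>snd z\<bar>}"
    unfolding hyp_region_def by (auto simp: space_pair_measure)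
  also have "\<dots> \<in> sets (borel \<Otimes>\<^sub>M borel)" by measurable
  finally show ?thesis .
qed

text \<open>For fixed \<open>X > 0\<close> the admissible \<open>\<bar>Y\<bar>\<close> run from
  \<open>X / E\<close> to the smaller of \<open>X\<close> and \<open>1 / X\<close>. The bound
  changes at \<open>X = 1\<close>, and the range is empty beyond \<open>X = sqrt E\<close>; the
  rational contributions of the two pieces cancel.\<close>

lemma nn_integral_hyp_region:
  assumes E: "E > 1"
  shows "(\<integral>\<^sup>+X. \<integral>\<^sup>+Y. indicator (hyp_region E 1) (X, Y) \<partial>lborel \<partial>lborel) = ennreal (ln E)"
proof -
  define h1 where "h1 = (\<lambda>X::real. ennreal (2 * (X - X / E)) * indicator {0..1} X)"
  define h2 where "h2 = (\<lambda>X::real. ennreal (2 * (1 / X - X / E)) * indicator {1..sqrt E} X)"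
  have sE: "sqrt E > 1" using E by simp
  have inner: "(\<integral>\<^sup>+Y. indicator (hyp_region E 1) (X, Y) \<partial>lborel) = h1 X + h2 X" if X: "X \<noteq> 1" "X \<noteq> 0" for X
  proof (cases "X > 0")
    case False
    hence "(\<integral>\<^sup>+Y. indicator (hyp_region E 1) (X, Y) \<partial>lborel) = (\<integral>\<^sup>+(Y::real). 0 \<partial>lborel)"
      by (intro nn_integral_cong) (auto simp: hyp_region_def)
    thus ?thesis using False X sE unfolding h1_def h2_def by (auto simp: indicator_def)
  next
    case True
    define m where "m = min X (1 / X)"
    have eq: "indicator (hyp_region E 1) (X, Y) = (indicator {X/E<..m} Y + indicator {-m..<-(X/E)} Y :: ennreal)" for Y
    proof -
      have "(X, Y) \<in> hyp_region E 1 \<longleftrightarrow> X / E < \<bar>Y\<bar> \<and> \<bar>Y\<bar> \<le> m"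
      proof -
        have "\<bar>X * Y\<bar> \<le> 1 \<longleftrightarrow> \<bar>Y\<bar> \<le> 1 / X" using True by (simp add: abs_mult field_simps)
        moreover have "X < E * \<bar>Y\<bar> \<longleftrightarrow> X / E < \<bar>Y\<bar>" using E by (simp add: field_simps)
        ultimately show ?thesis unfolding hyp_region_def m_def using True by auto
      qed
      moreover have "X / E > 0" using True E by simp
      ultimately show ?thesis by (auto simp: indicator_def)
    qed
    have "(\<integral>\<^sup>+Y. indicator (hyp_region E 1) (X, Y) \<partial>lborel) = emeasure lborel {X/E<..m} + emeasure lborel {-m..<-(X/E)}"
      unfolding eq by (subst nn_integral_add) auto
    also have "\<dots> = ennreal (2 * max 0 (m - X / E))"
    proof (cases "X / E \<le> m")
      case True
      thus ?thesis by (simp add: ennreal_plus[symmetric] del: ennreal_plus)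
    next
      case False
      thus ?thesis by (simp add: max_def)
    qed
    also have "\<dots> = h1 X + h2 X"
    proof (cases "X < 1")
      case True
      have "X * X \<le> 1 * 1" using True \<open>X > 0\<close> by (intro mult_mono) auto
      hence "m = X" unfolding m_def using \<open>X > 0\<close> by (simp add: min_def field_simps)
      moreover have "X / E \<le> X" using \<open>X > 0\<close> E by (simp add: field_simps)
      ultimately show ?thesis using True \<open>X > 0\<close> unfolding h1_def h2_def by (simp add: max_def)
    next
      case False
      hence X1: "X > 1" using X by simp
      have "1 * 1 \<le> X * X" using X1 by (intro mult_mono) auto
      hence m: "m = 1 / X" unfolding m_def using X1 by (simp add: min_def field_simps)
      have "X \<le> sqrt E \<longleftrightarrow> X / E \<le> 1 / X"
      proof -
        have "X \<le> sqrt E \<longleftrightarrow> X ^ 2 \<le> E" using X1 E by (metis real_le_rsqrt real_sqrt_pow2 power_mono less_imp_le order_trans zero_le_one)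
        also have "\<dots> \<longleftrightarrow> X / E \<le> 1 / X" using X1 E by (simp add: field_simps power2_eq_square)
        finally show ?thesis .
      qed
      thus ?thesis using X1 m unfolding h1_def h2_def by (auto simp: max_def indicator_def)
    qed
    finally show ?thesis .
  qed
  have "(\<integral>\<^sup>+X. \<integral>\<^sup>+Y. indicator (hyp_region E 1) (X, Y) \<partial>lborel \<partial>lborel) = (\<integral>\<^sup>+X. h1 X + h2 X \<partial>lborel)"
  proof (rule nn_integral_cong_AE)
    have "AE X in lborel. X \<noteq> (1::real)" "AE X in lborel. X \<noteq> (0::real)" by (rule AE_lborel_singleton)+
    thus "AE X in lborel. (\<integral>\<^sup>+Y. indicator (hyp_region E 1) (X, Y) \<partial>lborel) = h1 X + h2 X"
      by eventually_elim (rule inner)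
  qed
  also have "\<dots> = (\<integral>\<^sup>+X. h1 X \<partial>lborel) + (\<integral>\<^sup>+X. h2 X \<partial>lborel)"
    unfolding h1_def h2_def by (intro nn_integral_add) auto
  also have "(\<integral>\<^sup>+X. h1 X \<partial>lborel) = ennreal ((1 - 1 / E) * 1 ^ 2 - (1 - 1 / E) * 0 ^ 2)"
    unfolding h1_def
  proof (rule nn_integral_FTC_Icc)
    fix x :: real assume "x \<in> {0..1}"
    hence x: "0 \<le> x" "x \<le> 1" by auto
    show "((\<lambda>x. (1 - 1 / E) * x ^ 2) has_real_derivative 2 * (x - x / E)) (at x)"
      using E by (auto intro!: derivative_eq_intros simp: field_simps)
    have "x * 1 \<le> x * E" using x E by (intro mult_left_mono) auto
    hence "x / E \<le> x" using E by (simp add: divide_le_eq)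
    thus "0 \<le> 2 * (x - x / E)" by simp
  qed auto
  also have "(\<integral>\<^sup>+X. h2 X \<partial>lborel) = ennreal ((2 * ln (sqrt E) - (sqrt E) ^ 2 / E) - (2 * ln 1 - 1 ^ 2 / E))"
    unfolding h2_def
  proof (rule nn_integral_FTC_Icc)
    fix x :: real assume "x \<in> {1..sqrt E}"
    hence x: "1 \<le> x" "x \<le> sqrt E" by auto
    have "((\<lambda>x. 2 * ln x - x ^ 2 / E) has_real_derivative 2 * (1 / x) - 2 * x / E) (at x)"
      using x by (auto intro!: derivative_eq_intros)
    thus "((\<lambda>x. 2 * ln x - x ^ 2 / E) has_real_derivative 2 * (1 / x - x / E)) (at x)"
      by (simp add: right_diff_distrib)
    have "x ^ 2 \<le> (sqrt E) ^ 2" using x by (intro power_mono) auto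
    hence "x * x \<le> E" using E by (simp add: power2_eq_square)
    thus "0 \<le> 2 * (1 / x - x / E)" using x E by (simp add: field_simps)
  qed (use sE in auto)
  also have "ennreal ((1 - 1 / E) * 1 ^ 2 - (1 - 1 / E) * 0 ^ 2) + ennreal ((2 * ln (sqrt E) - (sqrt E) ^ 2 / E) - (2 * ln 1 - 1 ^ 2 / E)) = ennreal (ln E)"
  proof -
    have 1: "(1 - 1 / E) * 1 ^ 2 - (1 - 1 / E) * 0 ^ 2 = 1 - 1 / E" by simp
    have 2: "(2 * ln (sqrt E) - (sqrt E) ^ 2 / E) - (2 * ln 1 - 1 ^ 2 / E) = ln E - (1 - 1 / E)"
      using E by (simp add: ln_sqrt)
    have "ln (1 / E) \<le> 1 / E - 1" using E by (intro ln_le_minus_one) simp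
    hence "1 - 1 / E \<le> ln E" using E by (simp add: ln_div)
    moreover have "0 \<le> 1 - 1 / E" using E by simp
    ultimately show ?thesis unfolding 1 2 by (subst ennreal_plus[symmetric]) auto
  qed
  finally show ?thesis .
qed

text \<open>A linear change of variables of determinant \<open>a * (\<beta> - \<beta>')\<close> up
  to sign, carried out as two one-dimensional substitutions with Fubini in between.\<close>

lemma emeasure_hyp_region_affine:
  fixes a \<beta> \<beta>' E :: real
  assumes a: "a > 0" and d: "\<beta> \<noteq> \<beta>'" and E: "E > 1"
  shows "emeasure (lborel \<Otimes>\<^sub>M lborel) {(s, r). (a * r + \<beta> * s, a * r + \<beta>' * s) \<in> hyp_region E 1} = ennreal (ln E / (a * \<bar>\<beta> - \<beta>'\<bar>))"
proof -
  define \<delta> where "\<delta> = \<beta> - \<beta>'"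
  have \<delta>: "\<delta> \<noteq> 0" using d unfolding \<delta>_def by simp
  define I where "I = (indicator (hyp_region E 1) :: real \<times> real \<Rightarrow> ennreal)"
  have [measurable]: "I \<in> borel_measurable (borel \<Otimes>\<^sub>M borel)" unfolding I_def by measurable
  define B where "B = {(s, r). (a * r + \<beta> * s, a * r + \<beta>' * s) \<in> hyp_region E 1}"
  have BI: "indicator B (s, r) = I (\<beta> * s + a * r, (\<beta> * s + a * r) - \<delta> * s)" for s r
    unfolding B_def I_def \<delta>_def by (simp add: indicator_def algebra_simps)
  have Bm [measurable]: "B \<in> sets (borel \<Otimes>\<^sub>M borel)"
  proof -
    have "B = (\<lambda>z. (a * snd z + \<beta> * fst z, a * snd z + \<beta>' * fst z)) -` hyp_region E 1 \<inter> space (borel \<Otimes>\<^sub>M borel)"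
      unfolding B_def by (auto simp: space_pair_measure)
    also have "\<dots> \<in> sets (borel \<Otimes>\<^sub>M borel)" by measurable
    finally show ?thesis .
  qed
  have "emeasure (lborel \<Otimes>\<^sub>M lborel) B = (\<integral>\<^sup>+s. \<integral>\<^sup>+r. indicator B (s, r) \<partial>lborel \<partial>lborel)"
    by (subst lborel.emeasure_pair_measure) auto
  also have "\<dots> = (\<integral>\<^sup>+s. ennreal (1 / a) * (\<integral>\<^sup>+X. I (X, X - \<delta> * s) \<partial>lborel) \<partial>lborel)"
  proof (intro nn_integral_cong)
    fix s
    have "(\<integral>\<^sup>+X. I (X, X - \<delta> * s) \<partial>lborel) = \<bar>a\<bar> * (\<integral>\<^sup>+r. I (\<beta> * s + a * r, (\<beta> * s + a * r) - \<delta> * s) \<partial>lborel)"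
      using a by (intro nn_integral_real_affine[where c = a and t = "\<beta> * s"]) auto
    hence "ennreal (1 / a) * (\<integral>\<^sup>+X. I (X, X - \<delta> * s) \<partial>lborel) = (ennreal (1 / a) * ennreal a) * (\<integral>\<^sup>+r. I (\<beta> * s + a * r, (\<beta> * s + a * r) - \<delta> * s) \<partial>lborel)"
      using a by (simp add: mult.assoc)
    also have "ennreal (1 / a) * ennreal a = 1" using a by (simp add: ennreal_mult[symmetric])
    finally show "(\<integral>\<^sup>+r. indicator B (s, r) \<partial>lborel) = ennreal (1 / a) * (\<integral>\<^sup>+X. I (X, X - \<delta> * s) \<partial>lborel)"
      unfolding BI by simp
  qed
  also have "\<dots> = ennreal (1 / a) * (\<integral>\<^sup>+s. (\<integral>\<^sup>+X. I (X, X - \<delta> * s) \<partial>lborel) \<partial>lborel)"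
    by (intro nn_integral_cmult) measurable
  also have "(\<integral>\<^sup>+s. (\<integral>\<^sup>+X. I (X, X - \<delta> * s) \<partial>lborel) \<partial>lborel) = (\<integral>\<^sup>+X. (\<integral>\<^sup>+s. I (X, X - \<delta> * s) \<partial>lborel) \<partial>lborel)"
    by (rule lborel_pair.Fubini'[of "\<lambda>X s. I (X, X - \<delta> * s)"]) measurable
  also have "\<dots> = (\<integral>\<^sup>+X. ennreal (1 / \<bar>\<delta>\<bar>) * (\<integral>\<^sup>+Y. I (X, Y) \<partial>lborel) \<partial>lborel)"
  proof (intro nn_integral_cong)
    fix X
    have "(\<integral>\<^sup>+Y. I (X, Y) \<partial>lborel) = \<bar>- \<delta>\<bar> * (\<integral>\<^sup>+s. I (X, X + (- \<delta>) * s) \<partial>lborel)"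
      using \<delta> by (intro nn_integral_real_affine[where c = "- \<delta>" and t = X]) auto
    hence "ennreal (1 / \<bar>\<delta>\<bar>) * (\<integral>\<^sup>+Y. I (X, Y) \<partial>lborel) = (ennreal (1 / \<bar>\<delta>\<bar>) * ennreal \<bar>\<delta>\<bar>) * (\<integral>\<^sup>+s. I (X, X - \<delta> * s) \<partial>lborel)"
      by (simp add: mult.assoc)
    also have "ennreal (1 / \<bar>\<delta>\<bar>) * ennreal \<bar>\<delta>\<bar> = 1" using \<delta> by (simp add: ennreal_mult[symmetric])
    finally show "(\<integral>\<^sup>+s. I (X, X - \<delta> * s) \<partial>lborel) = ennreal (1 / \<bar>\<delta>\<bar>) * (\<integral>\<^sup>+Y. I (X, Y) \<partial>lborel)" by simp
  qed
  also have "\<dots> = ennreal (1 / \<bar>\<delta>\<bar>) * (\<integral>\<^sup>+X. (\<integral>\<^sup>+Y. I (X, Y) \<partial>lborel) \<partial>lborel)"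
    by (intro nn_integral_cmult) measurable
  also have "(\<integral>\<^sup>+X. (\<integral>\<^sup>+Y. I (X, Y) \<partial>lborel) \<partial>lborel) = ennreal (ln E)"
    unfolding I_def by (rule nn_integral_hyp_region[OF E])
  also have "ennreal (1 / a) * (ennreal (1 / \<bar>\<delta>\<bar>) * ennreal (ln E)) = ennreal (ln E / (a * \<bar>\<delta>\<bar>))"
    using a E by (simp add: ennreal_mult[symmetric])
  finally show ?thesis unfolding B_def \<delta>_def .
qed

text \<open>Off the boundary curves each defining inequality holds strictly or fails strictly at the
  limit point, so its truth value is eventually constant.\<close>

lemma hyp_region_interior_tendsto:
  assumes lim: "(f \<longlongrightarrow> X) F" "(g \<longlongrightarrow> Y) F"
    and nb: "X \<noteq> 0" "\<bar>X * Y\<bar> \<noteq> 1" "\<bar>Y\<bar> \<noteq> X" "X \<noteq> E * \<bar>Y\<bar>"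
  shows "((\<lambda>T. indicator (hyp_region E 1) (f T, g T) :: real) \<longlongrightarrow> indicator (hyp_region E 1) (X, Y)) F"
proof -
  have 1: "eventually (\<lambda>T. 0 < f T \<longleftrightarrow> 0 < X) F"
  proof (cases "X > 0")
    case True
    thus ?thesis using order_tendstoD(1)[OF lim(1), of 0] by (auto elim: eventually_mono)
  next
    case False
    hence "X < 0" using nb by simp
    thus ?thesis using order_tendstoD(2)[OF lim(1), of 0] by (auto elim: eventually_mono)
  qed
  have gen: "eventually (\<lambda>T. u T \<le> v T \<longleftrightarrow> U \<le> V) F" if "(u \<longlongrightarrow> U) F" "(v \<longlongrightarrow> V) F" "U \<noteq> V" for u v :: "_ \<Rightarrow> real" and U V
  proof -
    have d: "((\<lambda>T. v T - u T) \<longlongrightarrow> V - U) F" using that by (intro tendsto_diff)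
    show ?thesis
    proof (cases "U < V")
      case True
      hence "eventually (\<lambda>T. 0 < v T - u T) F" by (intro order_tendstoD(1)[OF d]) simp
      thus ?thesis using True by (auto elim: eventually_mono)
    next
      case False
      hence "eventually (\<lambda>T. v T - u T < 0) F" using that by (intro order_tendstoD(2)[OF d]) simp
      thus ?thesis using False that by (auto elim: eventually_mono)
    qed
  qed
  have 2: "eventually (\<lambda>T. \<bar>f T * g T\<bar> \<le> 1 \<longleftrightarrow> \<bar>X * Y\<bar> \<le> 1) F"
    using nb by (intro gen tendsto_intros lim)
  have 3: "eventually (\<lambda>T. \<bar>g T\<bar> \<le> f T \<longleftrightarrow> \<bar>Y\<bar> \<le> X) F"
    using nb by (intro gen tendsto_intros lim)
  have 4: "eventually (\<lambda>T. E * \<bar>g T\<bar> \<le> f T \<longleftrightarrow> E * \<bar>Y\<bar> \<le> X) F"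
    using nb by (intro gen tendsto_intros lim) auto
  have "eventually (\<lambda>T. indicator (hyp_region E 1) (X, Y) = (indicator (hyp_region E 1) (f T, g T) :: real)) F"
    using 1 2 3 4
  proof eventually_elim
    case (elim T)
    have "f T < E * \<bar>g T\<bar> \<longleftrightarrow> X < E * \<bar>Y\<bar>" using elim(4) by linarith
    hence "(f T, g T) \<in> hyp_region E 1 \<longleftrightarrow> (X, Y) \<in> hyp_region E 1" using elim unfolding hyp_region_def by simp
    thus ?case by (simp add: indicator_def)
  qed
  thus ?thesis by (rule Lim_transform_eventually[OF tendsto_const])
qed

lemma finite_quadratic_real: "finite {x::real. x * (x - c) = e}"
proof -
  have "{x. x * (x - c) = e} = {x. poly [:- e, - c, 1:] x = 0}" by (auto simp: algebra_simps)
  thus ?thesis using poly_roots_finite[of "[:- e, - c, 1:]"] by simp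
qed

lemma finite_linear_real: "c \<noteq> 0 \<Longrightarrow> finite {x::real. c * x = e}"
proof -
  assume "c \<noteq> 0"
  hence "{x. c * x = e} \<subseteq> {e / c}" by (auto simp: field_simps)
  thus ?thesis using finite_subset by blast
qed

text \<open>For fixed \<open>s \<noteq> 0\<close> the difference \<open>X - Y\<close> is a nonzero
  constant \<open>c\<close>, so each boundary condition becomes a nontrivial linear or quadratic
  equation in \<open>X\<close> and excludes finitely many \<open>r\<close>.\<close>

lemma AE_hyp_region_boundary:
  fixes a \<beta> \<beta>' E :: real
  assumes a: "a > 0" and d: "\<beta> \<noteq> \<beta>'" and E: "E > 1"
  shows "AE z in lborel \<Otimes>\<^sub>M lborel. case z of (s, r) \<Rightarrow> let X = a * r + \<beta> * s; Y = a * r + \<beta>' * s in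
     X \<noteq> 0 \<and> \<bar>X * Y\<bar> \<noteq> 1 \<and> \<bar>Y\<bar> \<noteq> X \<and> X \<noteq> E * \<bar>Y\<bar>"
proof -
  define P where "P = (\<lambda>z. case z of (s, r) \<Rightarrow> let X = a * r + \<beta> * s; Y = a * r + \<beta>' * s in
     X \<noteq> 0 \<and> \<bar>X * Y\<bar> \<noteq> 1 \<and> \<bar>Y\<bar> \<noteq> X \<and> X \<noteq> E * \<bar>Y\<bar>)"
  have "AE z in lborel \<Otimes>\<^sub>M lborel. P z"
  proof (rule lborel_pair.AE_pair_measure)
    show "{x \<in> space (lborel \<Otimes>\<^sub>M lborel). P x} \<in> sets (lborel \<Otimes>\<^sub>M lborel)"
      unfolding P_def case_prod_unfold Let_def by measurable
    have "AE s in lborel. s \<noteq> (0::real)" by (rule AE_lborel_singleton)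
    thus "AE s in lborel. AE r in lborel. P (s, r)"
    proof eventually_elim
      case (elim s)
      define c where "c = (\<beta> - \<beta>') * s"
      have c: "c \<noteq> 0" using d elim unfolding c_def by simp
      define Bad where "Bad = {X. X = 0} \<union> {X. X * (X - c) = 1} \<union> {X. X * (X - c) = -1} \<union> {X. 2 * X = c} 
        \<union> {X. (E - 1) * X = E * c} \<union> {X. (E + 1) * X = E * c}"
      have "finite Bad" unfolding Bad_def using E by (intro finite_UnI finite_quadratic_real finite_linear_real) auto
      hence "finite ((\<lambda>X. (X - \<beta> * s) / a) ` Bad)" by simp
      hence "AE r in lborel. r \<notin> (\<lambda>X. (X - \<beta> * s) / a) ` Bad"
        by (intro AE_not_in countable_imp_null_set_lborel countable_finite) 
      thus ?case
      proof eventually_elim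
        case (elim r)
        define X where "X = a * r + \<beta> * s"
        have Y: "a * r + \<beta>' * s = X - c" unfolding X_def c_def by (simp add: algebra_simps)
        have "r = (X - \<beta> * s) / a" unfolding X_def using a by simp
        hence nb: "X \<notin> Bad" using elim by blast
        hence n: "X \<noteq> 0" "X * (X - c) \<noteq> 1" "X * (X - c) \<noteq> -1" "2 * X \<noteq> c" "(E - 1) * X \<noteq> E * c" "(E + 1) * X \<noteq> E * c"
          unfolding Bad_def by auto
        have "\<bar>X * (X - c)\<bar> \<noteq> 1" using n by linarith
        moreover have "\<bar>X - c\<bar> \<noteq> X" using n c by linarith
        moreover have "X \<noteq> E * \<bar>X - c\<bar>"
        proof (cases "X - c \<ge> 0")
          case True
          thus ?thesis using n(5) by (auto simp: algebra_simps)
        next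
          case False
          thus ?thesis using n(6) by (auto simp: algebra_simps)
        qed
        ultimately show ?case unfolding P_def using n(1) by (simp add: Let_def Y X_def[symmetric])
      qed
    qed
  qed
  thus ?thesis unfolding P_def .
qed

lemma finite_hyp_region_lattice:
  fixes a \<beta> \<beta>' E :: real
  assumes a: "a > 0" and d: "\<beta> \<noteq> \<beta>'" and E: "E > 1" and T: "T > 0"
  shows "finite {(j::int, i::int). (a * i + \<beta> * j, a * i + \<beta>' * j) \<in> hyp_region E (T ^ 2)}"
proof -
  define k1 where "k1 = (E + 1) * T / \<bar>\<beta> - \<beta>'\<bar>"
  define k2 where "k2 = (E * T + \<bar>\<beta>\<bar> * k1) / a"
  have "{(j::int, i::int). (a * i + \<beta> * j, a * i + \<beta>' * j) \<in> hyp_region E (T ^ 2)} \<subseteq> {-\<lceil>k1\<rceil>..\<lceil>k1\<rceil>} \<times> {-\<lceil>k2\<rceil>..\<lceil>k2\<rceil>}"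
  proof
    fix z assume "z \<in> {(j::int, i::int). (a * i + \<beta> * j, a * i + \<beta>' * j) \<in> hyp_region E (T ^ 2)}"
    then obtain j i :: int where z: "z = (j, i)" and h: "(a * i + \<beta> * j, a * i + \<beta>' * j) \<in> hyp_region E (T ^ 2)"
      by auto
    define X Y where "X = a * i + \<beta> * j" and "Y = a * i + \<beta>' * j"
    have "(X / T, Y / T) \<in> hyp_region E 1" using h hyp_region_scale[OF T] unfolding X_def Y_def by simp
    from hyp_region_bounds[OF this E] have b: "\<bar>X\<bar> \<le> E * T" "\<bar>Y\<bar> \<le> T" using T by (auto simp: field_simps)
    have "(\<beta> - \<beta>') * j = X - Y" unfolding X_def Y_def by (simp add: algebra_simps)
    hence "\<bar>\<beta> - \<beta>'\<bar> * \<bar>real_of_int j\<bar> = \<bar>X - Y\<bar>" by (metis abs_mult)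
    also have "\<dots> \<le> (E + 1) * T" using b by (simp add: algebra_simps)
    finally have j: "\<bar>real_of_int j\<bar> \<le> k1" unfolding k1_def using d by (simp add: field_simps)
    have "a * \<bar>real_of_int i\<bar> = \<bar>X - \<beta> * j\<bar>" unfolding X_def using a by (simp add: abs_mult)
    also have "\<dots> \<le> \<bar>X\<bar> + \<bar>\<beta>\<bar> * \<bar>real_of_int j\<bar>" using abs_triangle_ineq4[of X "\<beta> * j"] by (simp add: abs_mult)
    also have "\<dots> \<le> E * T + \<bar>\<beta>\<bar> * k1" using b j by (intro add_mono mult_left_mono) auto
    finally have i: "\<bar>real_of_int i\<bar> \<le> k2" unfolding k2_def using a by (simp add: field_simps)
    show "z \<in> {-\<lceil>k1\<rceil>..\<lceil>k1\<rceil>} \<times> {-\<lceil>k2\<rceil>..\<lceil>k2\<rceil>}"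
    proof -
      have "\<bar>j\<bar> \<le> \<lceil>k1\<rceil>" "\<bar>i\<bar> \<le> \<lceil>k2\<rceil>" using i j by linarith+
      thus ?thesis unfolding z by auto
    qed
  qed
  thus ?thesis by (rule finite_subset) simp
qed

lemma floor_scale_tendsto: "((\<lambda>T. of_int \<lfloor>T * x\<rfloor> / T) \<longlongrightarrow> x) at_top" for x :: real
proof -
  have "((\<lambda>T. of_int \<lfloor>T * x\<rfloor> / T - x) \<longlongrightarrow> 0) at_top"
  proof (rule Lim_null_comparison)
    show "((\<lambda>T::real. 1 / T) \<longlongrightarrow> 0) at_top" by real_asymp
    show "eventually (\<lambda>T. norm (of_int \<lfloor>T * x\<rfloor> / T - x) \<le> 1 / T) at_top"
      using eventually_gt_at_top[of 0]
    proof eventually_elim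
      case (elim T)
      have "of_int \<lfloor>T * x\<rfloor> / T - x = (of_int \<lfloor>T * x\<rfloor> - T * x) / T" using elim by (simp add: field_simps)
      moreover have "\<bar>of_int \<lfloor>T * x\<rfloor> - T * x\<bar> \<le> 1" by linarith
      ultimately show ?case using elim by (simp add: divide_right_mono)
    qed
  qed
  from tendsto_add[OF this tendsto_const[of x]] show ?thesis by simp
qed

text \<open>With \<open>t = T^2\<close>, the count divided by \<open>T^2\<close> is the integral of
  the indicator evaluated at the point rounded down to the grid of mesh \<open>1 / T\<close>, in
  which each lattice point owns a square of area \<open>1 / T^2\<close>. The rounded indicator
  converges almost everywhere, and dominated convergence yields the area.\<close>

lemma lattice_points_hyp_region:
  fixes a \<beta> \<beta>' E :: real
  assumes a: "a > 0" and d: "\<beta> \<noteq> \<beta>'" and E: "E > 1"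
  shows "((\<lambda>t. card {(j::int, i::int). (a * i + \<beta> * j, a * i + \<beta>' * j) \<in> hyp_region E t} / t)
     \<longlongrightarrow> ln E / (a * \<bar>\<beta> - \<beta>'\<bar>)) at_top"
proof -
  define S where "S = (\<lambda>T. {(j::int, i::int). (a * i + \<beta> * j, a * i + \<beta>' * j) \<in> hyp_region E (T ^ 2)})"
  define f where "f = (\<lambda>T (s, r). indicator (hyp_region E 1)
     (a * (of_int \<lfloor>T * r\<rfloor> / T) + \<beta> * (of_int \<lfloor>T * s\<rfloor> / T), a * (of_int \<lfloor>T * r\<rfloor> / T) + \<beta>' * (of_int \<lfloor>T * s\<rfloor> / T)) :: real)"
  define g where "g = (\<lambda>(s, r). indicator (hyp_region E 1) (a * r + \<beta> * s, a * r + \<beta>' * s) :: real)"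
  have meas: "f T \<in> borel_measurable (lborel \<Otimes>\<^sub>M lborel)" for T
    unfolding f_def case_prod_unfold by measurable
  have measg: "g \<in> borel_measurable (lborel \<Otimes>\<^sub>M lborel)"
    unfolding g_def case_prod_unfold by measurable
  define k1 where "k1 = (E + 1) / \<bar>\<beta> - \<beta>'\<bar>"
  define k2 where "k2 = (E + \<bar>\<beta>\<bar> * k1) / a"
  \<comment> \<open>The region is bounded, and for \<open>T \<ge> 1\<close> rounding moves each
    coordinate by at most 1; hence the margins.\<close>
  define Box where "Box = {-(k1 + 1)..k1 + 1} \<times> {-(k2 + 1)..k2 + 1}"
  have bound: "norm (f T z) \<le> indicator Box z" if T: "T \<ge> 1" for T z
  proof -
    obtain s r where z: "z = (s, r)" by (cases z)
    define s' r' where "s' = of_int \<lfloor>T * s\<rfloor> / T" and "r' = of_int \<lfloor>T * r\<rfloor> / T"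
    have close: "\<bar>of_int \<lfloor>T * x\<rfloor> / T - x\<bar> \<le> 1" for x :: real
    proof -
      have "of_int \<lfloor>T * x\<rfloor> / T - x = (of_int \<lfloor>T * x\<rfloor> - T * x) / T" using T by (simp add: field_simps)
      moreover have "\<bar>of_int \<lfloor>T * x\<rfloor> - T * x\<bar> \<le> 1" by linarith
      ultimately show ?thesis using T by (simp add: divide_le_eq)
    qed
    have "(s, r) \<in> Box" if h: "(a * r' + \<beta> * s', a * r' + \<beta>' * s') \<in> hyp_region E 1"
    proof -
      define X Y where "X = a * r' + \<beta> * s'" and "Y = a * r' + \<beta>' * s'"
      from hyp_region_bounds[OF h E] have b: "\<bar>X\<bar> \<le> E" "\<bar>Y\<bar> \<le> 1" unfolding X_def Y_def by auto
      have "(\<beta> - \<beta>') * s' = X - Y" unfolding X_def Y_def by (simp add: algebra_simps)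
      hence "\<bar>\<beta> - \<beta>'\<bar> * \<bar>s'\<bar> = \<bar>X - Y\<bar>" by (metis abs_mult)
      also have "\<dots> \<le> E + 1" using b by linarith
      finally have s': "\<bar>s'\<bar> \<le> k1" unfolding k1_def using d by (simp add: field_simps)
      have "a * \<bar>r'\<bar> = \<bar>X - \<beta> * s'\<bar>" unfolding X_def using a by (simp add: abs_mult)
      also have "\<dots> \<le> \<bar>X\<bar> + \<bar>\<beta>\<bar> * \<bar>s'\<bar>" using abs_triangle_ineq4[of X "\<beta> * s'"] by (simp add: abs_mult)
      also have "\<dots> \<le> E + \<bar>\<beta>\<bar> * k1" using b s' by (intro add_mono mult_left_mono) auto
      finally have r': "\<bar>r'\<bar> \<le> k2" unfolding k2_def using a by (simp add: field_simps)
      have "\<bar>s\<bar> \<le> k1 + 1" "\<bar>r\<bar> \<le> k2 + 1"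
        using s' r' close[of s] close[of r] unfolding s'_def[symmetric] r'_def[symmetric] by linarith+
      thus ?thesis unfolding Box_def by auto
    qed
    thus ?thesis unfolding z f_def prod.case s'_def[symmetric] r'_def[symmetric] by (auto simp: indicator_def)
  qed
  have Boxint: "integrable (lborel \<Otimes>\<^sub>M lborel) (indicator Box :: real \<times> real \<Rightarrow> real)"
  proof (rule integrable_real_indicator)
    show "Box \<in> sets (lborel \<Otimes>\<^sub>M lborel)" unfolding Box_def by (intro pair_measureI) auto
    have "emeasure (lborel \<Otimes>\<^sub>M lborel) Box = emeasure lborel {-(k1 + 1)..k1 + 1} * emeasure lborel {-(k2 + 1)..k2 + 1}"
      unfolding Box_def by (intro lborel.emeasure_pair_measure_Times) auto
    also have "\<dots> < \<infinity>" by (auto simp: ennreal_mult_less_top emeasure_lborel_Icc_eq)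
    finally show "emeasure (lborel \<Otimes>\<^sub>M lborel) Box < \<infinity>" .
  qed
  have lim: "((\<lambda>T. integral\<^sup>L (lborel \<Otimes>\<^sub>M lborel) (f T)) \<longlongrightarrow> integral\<^sup>L (lborel \<Otimes>\<^sub>M lborel) g) at_top"
  proof (rule integral_dominated_convergence_at_top[where w = "indicator Box"])
    show "AE x in lborel \<Otimes>\<^sub>M lborel. ((\<lambda>T. f T x) \<longlongrightarrow> g x) at_top"
      using AE_hyp_region_boundary[OF a d E]
    proof eventually_elim
      case (elim z)
      obtain s r where z: "z = (s, r)" by (cases z)
      show ?case unfolding z f_def g_def prod.case
        using elim unfolding z by (intro hyp_region_interior_tendsto tendsto_intros floor_scale_tendsto) (auto simp: Let_def)
    qed
    show "eventually (\<lambda>T. AE x in lborel \<Otimes>\<^sub>M lborel. norm (f T x) \<le> indicator Box x) at_top"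
      using eventually_ge_at_top[of 1] by eventually_elim (use bound in auto)
  qed (use meas measg Boxint in auto)
  have "integral\<^sup>L (lborel \<Otimes>\<^sub>M lborel) g = ln E / (a * \<bar>\<beta> - \<beta>'\<bar>)"
  proof -
    have "g = indicator {(s, r). (a * r + \<beta> * s, a * r + \<beta>' * s) \<in> hyp_region E 1}"
      unfolding g_def by (auto simp: indicator_def)
    hence "integral\<^sup>L (lborel \<Otimes>\<^sub>M lborel) g = measure (lborel \<Otimes>\<^sub>M lborel) {(s, r). (a * r + \<beta> * s, a * r + \<beta>' * s) \<in> hyp_region E 1}"
      by (simp add: space_pair_measure)
    also have "\<dots> = ln E / (a * \<bar>\<beta> - \<beta>'\<bar>)"
      using emeasure_hyp_region_affine[OF a d E] a E by (simp add: measure_def)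
    finally show ?thesis .
  qed
  moreover
  have "integral\<^sup>L (lborel \<Otimes>\<^sub>M lborel) (f T) = card (S T) / T ^ 2" if T: "T > 0" for T
  proof -
    define C where "C = (\<lambda>j::int. {of_int j / T..<(of_int j + 1) / T})"
    have C: "x \<in> C j \<longleftrightarrow> \<lfloor>T * x\<rfloor> = j" for x j
      unfolding C_def using T by (auto simp: floor_eq_iff field_simps)
    have fin: "finite (S T)" unfolding S_def by (rule finite_hyp_region_lattice[OF a d E T])
    have "f T = (\<lambda>z. \<Sum>(j, i)\<in>S T. indicator (C j \<times> C i) z)"
    proof
      fix z :: "real \<times> real"
      obtain s r where z: "z = (s, r)" by (cases z)
      have "f T z = (if (\<lfloor>T * s\<rfloor>, \<lfloor>T * r\<rfloor>) \<in> S T then 1 else 0)"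
        using hyp_region_scale[OF T, of "a * of_int \<lfloor>T * r\<rfloor> + \<beta> * of_int \<lfloor>T * s\<rfloor>" "a * of_int \<lfloor>T * r\<rfloor> + \<beta>' * of_int \<lfloor>T * s\<rfloor>" E]
        unfolding f_def z S_def by (simp add: indicator_def add_divide_distrib)
      also have "\<dots> = (\<Sum>x\<in>S T. if x = (\<lfloor>T * s\<rfloor>, \<lfloor>T * r\<rfloor>) then 1 else 0)" using fin by simp
      also have "\<dots> = (\<Sum>(j, i)\<in>S T. indicator (C j \<times> C i) z)"
        unfolding z by (intro sum.cong refl) (auto simp: indicator_def C)
      finally show "f T z = (\<Sum>(j, i)\<in>S T. indicator (C j \<times> C i) z)" .
    qed
    moreover have "integral\<^sup>L (lborel \<Otimes>\<^sub>M lborel) (\<lambda>z. \<Sum>(j, i)\<in>S T. indicator (C j \<times> C i) z :: real) = (\<Sum>(j, i)\<in>S T. 1 / T ^ 2)"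
    proof -
      have eC: "emeasure lborel (C j) = ennreal (1 / T)" for j
        unfolding C_def using T by (simp add: diff_divide_distrib[symmetric] divide_right_mono)
      have em: "emeasure (lborel \<Otimes>\<^sub>M lborel) (C j \<times> C i) = ennreal (1 / T ^ 2)" for j i
      proof -
        have "emeasure (lborel \<Otimes>\<^sub>M lborel) (C j \<times> C i) = emeasure lborel (C j) * emeasure lborel (C i)"
          by (intro lborel.emeasure_pair_measure_Times) (auto simp: C_def)
        also have "\<dots> = ennreal (1 / T * (1 / T))" unfolding eC using T by (simp add: ennreal_mult[symmetric])
        finally show ?thesis by (simp add: power2_eq_square)
      qed
      have sets: "C j \<times> C i \<in> sets (lborel \<Otimes>\<^sub>M lborel)" for j i unfolding C_def by (intro pair_measureI) auto
      have int: "integrable (lborel \<Otimes>\<^sub>M lborel) (indicator (C j \<times> C i) :: _ \<Rightarrow> real)" for j i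
        using sets by (intro integrable_real_indicator) (auto simp: em)
      have I: "integral\<^sup>L (lborel \<Otimes>\<^sub>M lborel) (indicator (C j \<times> C i) :: _ \<Rightarrow> real) = 1 / T ^ 2" for j i
      proof -
        have "C j \<times> C i \<inter> space (lborel \<Otimes>\<^sub>M lborel) = C j \<times> C i" by (auto simp: space_pair_measure)
        thus ?thesis using T by (simp add: measure_def em)
      qed
      have "integral\<^sup>L (lborel \<Otimes>\<^sub>M lborel) (\<lambda>z. \<Sum>x\<in>S T. indicator (C (fst x) \<times> C (snd x)) z :: real)
          = (\<Sum>x\<in>S T. integral\<^sup>L (lborel \<Otimes>\<^sub>M lborel) (indicator (C (fst x) \<times> C (snd x)) :: _ \<Rightarrow> real))"
        by (rule Bochner_Integration.integral_sum) (rule int)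
      thus ?thesis unfolding case_prod_unfold I .
    qed
    ultimately show ?thesis by (simp add: case_prod_unfold)
  qed
  hence ev: "eventually (\<lambda>T. integral\<^sup>L (lborel \<Otimes>\<^sub>M lborel) (f T) = card (S T) / T ^ 2) at_top"
    by (intro eventually_mono[OF eventually_gt_at_top[of "0::real"]])
  ultimately have L: "((\<lambda>T. card (S T) / T ^ 2) \<longlongrightarrow> ln E / (a * \<bar>\<beta> - \<beta>'\<bar>)) at_top"
    using Lim_transform_eventually[OF lim ev] by (simp only:)
  have "((\<lambda>t. card (S (sqrt t)) / (sqrt t) ^ 2) \<longlongrightarrow> ln E / (a * \<bar>\<beta> - \<beta>'\<bar>)) at_top"
    by (rule filterlim_compose[OF L sqrt_at_top])
  thus ?thesis
  proof (rule Lim_transform_eventually)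
    show "eventually (\<lambda>t. card (S (sqrt t)) / (sqrt t) ^ 2 =
        card {(j::int, i::int). (a * i + \<beta> * j, a * i + \<beta>' * j) \<in> hyp_region E t} / t) at_top"
      using eventually_gt_at_top[of "0::real"] by eventually_elim (simp add: S_def)
  qed
qed

section \<open>Ideals and their norms\<close>

text \<open>Division with remainder by the least positive element of \<open>S\<close>.\<close>

lemma int_subgroup_principal:
  fixes S :: "int set"
  assumes add: "\<And>x y. x \<in> S \<Longrightarrow> y \<in> S \<Longrightarrow> x + y \<in> S" and mult: "\<And>x c. x \<in> S \<Longrightarrow> c * x \<in> S"
    and k: "k \<in> S" "k \<noteq> 0"
  shows "\<exists>g>0. S = {x. g dvd x}"
proof -
  have "nat \<bar>k\<bar> > 0 \<and> int (nat \<bar>k\<bar>) \<in> S" using k mult[of k "-1"] by (auto simp: abs_if)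
  hence ex: "\<exists>n::nat. n > 0 \<and> int n \<in> S" by blast
  define n where "n = (LEAST n::nat. n > 0 \<and> int n \<in> S)"
  have n: "n > 0" "int n \<in> S" using LeastI_ex[OF ex] unfolding n_def by auto
  have least: "m = 0" if "m < n" "int m \<in> S" for m
    using not_less_Least[of m "\<lambda>n. n > 0 \<and> int n \<in> S"] that unfolding n_def by auto
  have "int n dvd x" if x: "x \<in> S" for x
  proof -
    have "x mod int n = x + (- (x div int n)) * int n" by (simp add: minus_div_mult_eq_mod[symmetric])
    hence "x mod int n \<in> S" using add[OF x mult[OF n(2)]] by (simp only:)
    moreover have "0 \<le> x mod int n" "x mod int n < int n" using n by auto
    ultimately have "nat (x mod int n) = 0" by (intro least) auto
    hence "x mod int n = 0" using \<open>0 \<le> x mod int n\<close> by simp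
    thus ?thesis by presburger
  qed
  moreover have "x \<in> S" if "int n dvd x" for x
    using that mult[OF n(2)] by (metis dvdE mult.commute)
  ultimately show ?thesis using n by (intro exI[of _ "int n"]) auto
qed

context real_quadratic
begin

text \<open>\<open>m\<close> times the lattice spanned by \<open>a\<close> and
  \<open>b + om\<close>. Membership is expressed by divisibility of coordinates, so that equal
  lattices can be compared by testing single elements.\<close>

definition Lat :: "int \<Rightarrow> int \<Rightarrow> int \<Rightarrow> real set" where
  "Lat m a b = {of_int x + of_int y * om | x y. m dvd y \<and> m * a dvd x - b * y}"

lemma Lat_mem: "of_int x + of_int y * om \<in> Lat m a b \<longleftrightarrow> m dvd y \<and> m * a dvd x - b * y"
  unfolding Lat_def using OK_coords_unique by blast

lemma Lat_altdef:
  "Lat m a b = {of_int i * (of_int m * of_int a) + of_int j * (of_int m * (of_int b + om)) | i j. True}"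
proof (intro equalityI subsetI)
  fix z assume "z \<in> Lat m a b"
  then obtain x y where z: "z = of_int x + of_int y * om" "m dvd y" "m * a dvd x - b * y" unfolding Lat_def by blast
  from z(2) obtain j where j: "y = m * j" ..
  from z(3) obtain i where i: "x - b * y = m * a * i" ..
  hence x: "x = m * a * i + b * (m * j)" unfolding j by simp
  have "z = of_int i * (of_int m * of_int a) + of_int j * (of_int m * (of_int b + om))"
    unfolding z(1) x j by (simp add: algebra_simps)
  thus "z \<in> {of_int i * (of_int m * of_int a) + of_int j * (of_int m * (of_int b + om)) | i j. True}" by blast
next
  fix z assume "z \<in> {of_int i * (of_int m * of_int a) + of_int j * (of_int m * (of_int b + om)) | i j. True}"
  then obtain i j where z: "z = of_int i * (of_int m * of_int a) + of_int j * (of_int m * (of_int b + om))" by blast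
  have "z = of_int (m * a * i + b * (m * j)) + of_int (m * j) * om" unfolding z by (simp add: algebra_simps)
  thus "z \<in> Lat m a b" by (simp only: Lat_mem) simp
qed

lemma OK_mult_coords:
  "(of_int u + of_int v * om) * (of_int x + of_int y * om) = of_int (u * x + v * y * int q) + of_int (u * y + v * x + v * y) * om"
proof -
  have "(of_int u + of_int v * om) * (of_int x + of_int y * om) =
    of_int u * of_int x + (of_int u * of_int y + of_int v * of_int x) * om + of_int v * of_int y * (om * om)"
    by (simp add: algebra_simps)
  thus ?thesis unfolding om_square by (simp add: algebra_simps)
qed

lemma Lat_ideal:
  assumes "m > 0" "a > 0" "a dvd root_poly b"
  shows "Lat m a b \<in> nonzero_ideals R"
proof -
  have "ideal (Lat m a b) R" unfolding R_ideal_iff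
  proof (intro conjI ballI)
    show "Lat m a b \<subseteq> OK" unfolding Lat_def by auto
    show "0 \<in> Lat m a b" using Lat_mem[of 0 0 m a b] by simp
    fix z assume "z \<in> Lat m a b"
    then obtain x y where z: "z = of_int x + of_int y * om" "m dvd y" "m * a dvd x - b * y" unfolding Lat_def by blast
    show "z + w \<in> Lat m a b" if "w \<in> Lat m a b" for w
    proof -
      obtain x' y' where w: "w = of_int x' + of_int y' * om" "m dvd y'" "m * a dvd x' - b * y'" using \<open>w \<in> Lat m a b\<close> unfolding Lat_def by blast
      have e: "z + w = of_int (x + x') + of_int (y + y') * om" unfolding z w by (simp add: algebra_simps)
      have "x + x' - b * (y + y') = (x - b * y) + (x' - b * y')" by (simp add: algebra_simps)
      thus ?thesis unfolding e Lat_mem using z w by (metis dvd_add)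
    qed
    show "r * z \<in> Lat m a b" if "r \<in> OK" for r
    proof -
      obtain u v where r: "r = of_int u + of_int v * om" using \<open>r \<in> OK\<close> by (rule OKE)
      have "m dvd x - b * y" using z(3) dvd_mult_left by blast
      hence mx: "m dvd x" using z(2) by (metis diff_add_cancel dvd_add dvd_mult)
      \<comment> \<open>The second membership condition for the product differs from a multiple of
        the one for \<open>z\<close> by \<open>v * y * root_poly b\<close>; here \<open>m\<close>
        divides \<open>y\<close> and \<open>a\<close> divides \<open>root_poly b\<close>.\<close>
      have "m * a dvd y * root_poly b" using z(2) assms(3) by (rule mult_dvd_mono)
      hence "m * a dvd (u - v * b) * (x - b * y) - v * (y * root_poly b)" using dvd_diff[OF dvd_mult[OF z(3)] dvd_mult] by blast
      also have "(u - v * b) * (x - b * y) - v * (y * root_poly b) = (u * x + v * y * int q) - b * (u * y + v * x + v * y)"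
        unfolding root_poly_def by (simp add: algebra_simps power2_eq_square)
      finally show ?thesis unfolding r z(1) OK_mult_coords Lat_mem using z(2) mx by (intro conjI dvd_add dvd_mult)
    qed
  qed
  moreover have "Lat m a b \<noteq> {0}"
  proof
    assume "Lat m a b = {0}"
    moreover have "of_int (m * a) + of_int 0 * om \<in> Lat m a b" unfolding Lat_mem by simp
    ultimately have "real_of_int (m * a) = 0" by simp
    thus False using assms by simp
  qed
  ultimately show ?thesis unfolding nonzero_ideals_def by simp
qed

text \<open>Testing the membership conditions at suitable integer coordinates recovers
  \<open>m\<close>, then \<open>a\<close>, then \<open>b\<close> modulo \<open>a\<close>; the range
  of \<open>b\<close> does the rest.\<close>

lemma Lat_unique:
  assumes eq: "Lat m a b = Lat m' a' b'" and pos: "m > 0" "a > 0" "m' > 0" "a' > 0"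
    and b: "0 \<le> b" "b < a" "0 \<le> b'" "b' < a'"
  shows "m = m' \<and> a = a' \<and> b = b'"
proof -
  have iff: "(m dvd y \<and> m * a dvd x - b * y) = (m' dvd y \<and> m' * a' dvd x - b' * y)" for x y
    using eq Lat_mem by metis
  have "m' dvd m" "m dvd m'" using iff[of m "b * m"] iff[of m' "b' * m'"] by simp_all
  hence m: "m = m'" using pos by (meson zdvd_antisym_nonneg less_imp_le)
  have "m * a' dvd m * a" "m * a dvd m * a'" using iff[of 0 "m * a"] iff[of 0 "m' * a'"] unfolding m by simp_all
  hence "a' dvd a" "a dvd a'" using pos by simp_all
  hence a: "a = a'" using pos by (meson zdvd_antisym_nonneg less_imp_le)
  have "m * a dvd b * m - b' * m" using iff[of m "b * m"] unfolding m a by simp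
  also have "b * m - b' * m = m * (b - b')" by (simp add: algebra_simps)
  finally have "a dvd b - b'" using pos by simp
  hence "b = b'" using b unfolding a[symmetric] by (metis mod_eq_dvd_iff mod_pos_pos_trivial)
  thus ?thesis using m a by simp
qed

lemma om'_eq: "om' = 1 - om" using om_add by simp

lemma root_poly_factor: "(of_int b + om) * (of_int b + om') = of_int (root_poly b)"
proof -
  have "(of_int b + om) * (of_int b + om') = of_int b * of_int b + of_int b * (om + om') + om * om'" by (simp add: algebra_simps)
  thus ?thesis unfolding om_add om_mult root_poly_def by (simp add: power2_eq_square)
qed

text \<open>Hermite normal form adapted to ideals: \<open>m\<close> generates the group of second
  coordinates, and \<open>n = m * a\<close> generates the rational integers in \<open>I\<close>.
  Multiplication by \<open>om\<close> turns a first coordinate into part of a second one, whence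
  \<open>m\<close> divides \<open>c\<close>; multiplication by the conjugate of
  \<open>b + om\<close> puts \<open>m * root_poly b\<close> into \<open>I\<close> and gives
  \<open>a dvd root_poly b\<close>.\<close>

lemma ideal_eq_Lat:
  assumes "I \<in> nonzero_ideals R"
  obtains m a :: nat and b :: int where "m > 0" "a > 0" "b \<in> roots_mod a" "I = Lat (int m) (int a) b"
proof -
  have id: "I \<subseteq> OK" "0 \<in> I" "\<And>x y. x \<in> I \<Longrightarrow> y \<in> I \<Longrightarrow> x + y \<in> I" "\<And>r x. r \<in> OK \<Longrightarrow> x \<in> I \<Longrightarrow> r * x \<in> I"
    and "I \<noteq> {0}"
    using assms unfolding nonzero_ideals_def R_ideal_iff by auto
  then obtain z where z: "z \<in> I" "z \<noteq> 0" by blast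
  obtain x0 y0 where z0: "z = of_int x0 + of_int y0 * om" using z id(1) by (blast elim: OKE)
  have sc: "of_int c * w \<in> I" if "w \<in> I" for c w using id(4)[OF OK_of_int that] .
  define S1 where "S1 = {y. \<exists>x. of_int x + of_int y * om \<in> I}"
  define S2 where "S2 = {x. of_int x \<in> I}"
  have "\<exists>k\<in>S1. k \<noteq> 0"
  proof (cases "y0 = 0")
    case True
    have "om * z \<in> I" using id(4) z by simp
    hence "of_int 0 + of_int x0 * om \<in> I" unfolding z0 True by (simp add: mult.commute)
    hence "x0 \<in> S1" unfolding S1_def by blast
    moreover have "x0 \<noteq> 0" using z z0 True by auto
    ultimately show ?thesis by blast
  next
    case False
    thus ?thesis using z unfolding z0 S1_def by blast
  qed
  moreover have "y + y' \<in> S1" if yS: "y \<in> S1" "y' \<in> S1" for y y'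
  proof -
    obtain x x' where "of_int x + of_int y * om \<in> I" "of_int x' + of_int y' * om \<in> I" using yS unfolding S1_def by blast
    from id(3)[OF this] have "of_int (x + x') + of_int (y + y') * om \<in> I" by (simp add: algebra_simps)
    thus ?thesis unfolding S1_def by blast
  qed
  moreover have "c * y \<in> S1" if yS: "y \<in> S1" for c y
  proof -
    obtain x where "of_int x + of_int y * om \<in> I" using yS unfolding S1_def by blast
    from sc[OF this, of c] have "of_int (c * x) + of_int (c * y) * om \<in> I" by (simp add: algebra_simps)
    thus ?thesis unfolding S1_def by blast
  qed
  ultimately obtain m where m: "m > 0" "S1 = {x. m dvd x}" using int_subgroup_principal[of S1] by metis
  have "z * cj z \<in> I" using id(1,4) z OK_cj by (subst mult.commute) blast
  moreover obtain n0 :: int where n0: "z * cj z = of_int n0" using norm_int z id(1) by blast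
  moreover have "n0 \<noteq> 0" using n0 z cj_eq_0_iff[OF OK_K] id(1) by fastforce
  ultimately have "n0 \<in> S2" "n0 \<noteq> 0" unfolding S2_def by auto
  moreover have "x + x' \<in> S2" if "x \<in> S2" "x' \<in> S2" for x x' using that id(3) unfolding S2_def by auto
  moreover have "c * x \<in> S2" if "x \<in> S2" for c x using that sc unfolding S2_def by auto
  ultimately obtain n where n: "n > 0" "S2 = {x. n dvd x}" using int_subgroup_principal[of S2] by metis
  have "n \<in> S2" unfolding n(2) by simp
  hence "of_int n \<in> I" unfolding S2_def by simp
  hence "om * of_int n \<in> I" using id(4) by simp
  hence "of_int 0 + of_int n * om \<in> I" by (simp add: mult.commute)
  hence "n \<in> S1" unfolding S1_def by blast
  then obtain a where a: "n = m * a" using m by auto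
  have a0: "a > 0" using a n m by (simp add: zero_less_mult_iff)
  have "m \<in> S1" using m by auto
  then obtain c where c: "of_int c + of_int m * om \<in> I" unfolding S1_def by blast
  have "(of_int 0 + of_int 1 * om) * (of_int c + of_int m * om) \<in> I" using id(4)[OF _ c] by simp
  hence "of_int (m * int q) + of_int (c + m) * om \<in> I" unfolding OK_mult_coords by simp
  hence "c + m \<in> S1" unfolding S1_def by blast
  hence "m dvd c" using m by simp
  then obtain b0 where b0: "c = m * b0" ..
  define b where "b = b0 mod a"
  have bb: "0 \<le> b" "b < a" unfolding b_def using a0 by auto
  have mb: "m * b = c + n * (- (b0 div a))" unfolding b_def b0 a by (simp add: minus_div_mult_eq_mod[symmetric] algebra_simps)
  have "(of_int c + of_int m * om) + of_int (- (b0 div a)) * of_int n \<in> I" by (intro id(3) c sc) fact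
  also have "(of_int c + of_int m * om) + of_int (- (b0 div a)) * of_int n = of_int (c + n * (- (b0 div a))) + of_int m * om"
    by (simp add: mult.commute)
  also have "\<dots> = of_int m * (of_int b + om)" unfolding mb[symmetric] by (simp add: distrib_left)
  finally have w: "of_int m * (of_int b + om) \<in> I" .
  have "(of_int b + om') \<in> OK" unfolding om'_eq using OKI[of "b + 1" "-1"] by (simp add: algebra_simps)
  from id(4)[OF this w] have "of_int m * ((of_int b + om) * (of_int b + om')) \<in> I" by (simp add: mult_ac)
  hence "m * root_poly b \<in> S2" unfolding S2_def root_poly_factor by simp
  hence "m * a dvd m * root_poly b" using n a by simp
  hence rb: "a dvd root_poly b" using m by simp
  have "I = Lat m a b"
  proof (intro equalityI subsetI)
    fix t assume "t \<in> Lat m a b"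
    then obtain i j where "t = of_int i * (of_int m * of_int a) + of_int j * (of_int m * (of_int b + om))"
      unfolding Lat_altdef by blast
    moreover have "of_int i * (of_int m * of_int a) \<in> I" using sc[OF \<open>of_int n \<in> I\<close>, of i] unfolding a by simp
    ultimately show "t \<in> I" using id(3) sc[OF w, of j] by blast
  next
    fix t assume t: "t \<in> I"
    then obtain x y where xy: "t = of_int x + of_int y * om" using id(1) by (blast elim: OKE)
    have "y \<in> S1" using t unfolding xy S1_def by blast
    then obtain j where j: "y = m * j" using m by auto
    have "t + of_int (- j) * (of_int m * (of_int b + om)) \<in> I" by (intro id(3) t sc w)
    also have "t + of_int (- j) * (of_int m * (of_int b + om)) = of_int (x - b * y)" unfolding xy j by (simp add: algebra_simps)
    finally have "x - b * y \<in> S2" unfolding S2_def by simp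
    hence "m * a dvd x - b * y" using n a by simp
    thus "t \<in> Lat m a b" unfolding xy Lat_mem j by simp
  qed
  hence "I = Lat (int (nat m)) (int (nat a)) b" using m a0 by simp
  moreover have "b \<in> roots_mod (nat a)" unfolding roots_mod_def using bb rb a0 by simp
  moreover have "nat m > 0" "nat a > 0" using m a0 by auto
  ultimately show thesis using that by blast
qed

text \<open>The index of \<open>I\<close> in the ring of integers, read off from the normal form;
  uniqueness of that form makes \<open>THE\<close> meaningful for nonzero ideals.\<close>

definition nrm :: "real set \<Rightarrow> nat" where
  "nrm I = (THE n. \<exists>m a b. m > 0 \<and> a > 0 \<and> b \<in> roots_mod a \<and> I = Lat (int m) (int a) b \<and> n = m ^ 2 * a)"

lemma Lat_unique_nat:
  assumes "Lat (int m) (int a) b = Lat (int m') (int a') b'" "m > 0" "a > 0" "m' > 0" "a' > 0" "b \<in> roots_mod a" "b' \<in> roots_mod a'"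
  shows "m = m' \<and> a = a' \<and> b = b'"
  using Lat_unique[OF assms(1)] assms(2-) unfolding roots_mod_def by auto

lemma nrm_Lat:
  assumes "m > 0" "a > 0" "b \<in> roots_mod a"
  shows "nrm (Lat (int m) (int a) b) = m ^ 2 * a"
  unfolding nrm_def
proof (rule the_equality)
  show "\<exists>m' a' b'. m' > 0 \<and> a' > 0 \<and> b' \<in> roots_mod a' \<and> Lat (int m) (int a) b = Lat (int m') (int a') b' \<and> m ^ 2 * a = m' ^ 2 * a'"
    using assms by blast
  fix n assume "\<exists>m' a' b'. m' > 0 \<and> a' > 0 \<and> b' \<in> roots_mod a' \<and> Lat (int m) (int a) b = Lat (int m') (int a') b' \<and> n = m' ^ 2 * a'"
  thus "n = m ^ 2 * a" using Lat_unique_nat assms by metis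
qed

lemma nrm_pos: "I \<in> nonzero_ideals R \<Longrightarrow> nrm I > 0"
  by (erule ideal_eq_Lat) (simp add: nrm_Lat)

lemma Lat_ideal_nat: "m > 0 \<Longrightarrow> a > 0 \<Longrightarrow> b \<in> roots_mod a \<Longrightarrow> Lat (int m) (int a) b \<in> nonzero_ideals R"
  by (rule Lat_ideal) (auto simp: roots_mod_def)

definition span2 :: "real \<Rightarrow> real \<Rightarrow> real set" where
  "span2 \<alpha> \<beta> = {of_int i * \<alpha> + of_int j * \<beta> | i j. True}"

text \<open>Each basis is an integer combination of the other, so either determinant is an integer
  multiple of the other one.\<close>

lemma span2_det:
  assumes "\<alpha> \<in> K" "\<beta> \<in> K" "\<alpha>' \<in> K" "\<beta>' \<in> K" and eq: "span2 \<alpha> \<beta> = span2 \<alpha>' \<beta>'"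
  shows "\<bar>\<alpha> * cj \<beta> - cj \<alpha> * \<beta>\<bar> = \<bar>\<alpha>' * cj \<beta>' - cj \<alpha>' * \<beta>'\<bar>"
proof -
  have half: "\<exists>k::int. \<gamma> * cj \<delta> - cj \<gamma> * \<delta> = of_int k * (\<alpha> * cj \<beta> - cj \<alpha> * \<beta>)"
    if h: "\<alpha> \<in> K" "\<beta> \<in> K" and m: "\<gamma> \<in> span2 \<alpha> \<beta>" "\<delta> \<in> span2 \<alpha> \<beta>" for \<alpha> \<beta> \<gamma> \<delta>
  proof -
    obtain i j k l where g: "\<gamma> = of_int i * \<alpha> + of_int j * \<beta>" and d: "\<delta> = of_int k * \<alpha> + of_int l * \<beta>"
      using m unfolding span2_def by blast
    have cg: "cj \<gamma> = of_int i * cj \<alpha> + of_int j * cj \<beta>" and cd: "cj \<delta> = of_int k * cj \<alpha> + of_int l * cj \<beta>"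
      unfolding g d using h by (simp_all add: K_add K_mult)
    have "\<gamma> * cj \<delta> - cj \<gamma> * \<delta> = of_int (i * l - j * k) * (\<alpha> * cj \<beta> - cj \<alpha> * \<beta>)"
      unfolding cg cd unfolding g d by (simp add: algebra_simps)
    thus ?thesis ..
  qed
  have mem: "x \<in> span2 x y" "y \<in> span2 x y" for x y
  proof -
    have "x = of_int 1 * x + of_int 0 * y" "y = of_int 0 * x + of_int 1 * y" by simp_all
    thus "x \<in> span2 x y" "y \<in> span2 x y" unfolding span2_def by blast+
  qed
  define d where "d = \<alpha> * cj \<beta> - cj \<alpha> * \<beta>"
  define d' where "d' = \<alpha>' * cj \<beta>' - cj \<alpha>' * \<beta>'"
  obtain k :: int where k: "d' = of_int k * d"
    using half[of \<alpha> \<beta> \<alpha>' \<beta>'] assms mem unfolding d_def d'_def by metis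
  obtain k' :: int where k': "d = of_int k' * d'"
    using half[of \<alpha>' \<beta>' \<alpha> \<beta>] assms mem unfolding d_def d'_def by metis
  have "\<bar>d\<bar> = \<bar>d'\<bar>"
  proof (cases "d = 0")
    case False
    have "d = of_int (k' * k) * d" using k'[unfolded k] by (simp only: of_int_mult mult.assoc)
    hence "real_of_int (k' * k) = of_int 1" using False by simp
    hence "k' * k = 1" by (simp only: of_int_eq_iff)
    hence "\<bar>k\<bar> = 1" using abs_zmult_eq_1[of k k'] by (simp add: mult.commute)
    hence "\<bar>real_of_int k\<bar> = 1" by linarith
    thus ?thesis unfolding k abs_mult by simp
  qed (use k in simp)
  thus ?thesis unfolding d_def d'_def .
qed

text \<open>The normal form has determinant \<open>- (m^2 * a * rt)\<close>. By invariance of the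
  determinant, the norm can be computed from any basis.\<close>

lemma nrm_span2:
  assumes I: "span2 \<alpha> \<beta> \<in> nonzero_ideals R" and K: "\<alpha> \<in> K" "\<beta> \<in> K"
  shows "\<bar>\<alpha> * cj \<beta> - cj \<alpha> * \<beta>\<bar> = real (nrm (span2 \<alpha> \<beta>)) * rt"
proof -
  obtain m a b where L: "m > 0" "a > 0" "b \<in> roots_mod a" "span2 \<alpha> \<beta> = Lat (int m) (int a) b"
    using ideal_eq_Lat[OF I] by metis
  define \<gamma> where "\<gamma> = real_of_int (int m * int a)"
  define \<delta> where "\<delta> = of_int (int m) * (of_int b + om)"
  have \<delta>K: "\<delta> \<in> K" and c\<delta>: "cj \<delta> = of_int (int m) * (of_int b + om')"
    unfolding \<delta>_def by (simp_all only: K_mult K_add K_of_int om_K cj_om)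
  have "span2 \<alpha> \<beta> = span2 \<gamma> \<delta>"
    unfolding L(4) Lat_altdef unfolding span2_def \<gamma>_def \<delta>_def by (simp only: of_int_mult)
  hence "\<bar>\<alpha> * cj \<beta> - cj \<alpha> * \<beta>\<bar> = \<bar>\<gamma> * cj \<delta> - cj \<gamma> * \<delta>\<bar>"
    by (intro span2_det K \<delta>K) (auto simp: \<gamma>_def simp del: of_int_mult)
  also have "\<gamma> * cj \<delta> - cj \<gamma> * \<delta> = - (real (m ^ 2 * a) * (om - om'))"
    unfolding c\<delta> unfolding \<gamma>_def \<delta>_def K_of_int by (simp add: algebra_simps power2_eq_square)
  finally show ?thesis unfolding om_diff L(4) nrm_Lat[OF L(1-3)] by (simp add: abs_mult)
qed

lemma ideals_of_norm:
  assumes n: "n > 0"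
  shows "finite {I \<in> nonzero_ideals R. nrm I = n}" "card {I \<in> nonzero_ideals R. nrm I = n} = ideal_count n"
proof -
  define S where "S = (SIGMA m:{m. m ^ 2 dvd n}. roots_mod (n div m ^ 2))"
  have fS: "finite S" unfolding S_def using finite_square_divisors[OF n] by (intro finite_SigmaI) auto
  have pos: "m > 0 \<and> n div m ^ 2 > 0 \<and> m ^ 2 * (n div m ^ 2) = n" if "m ^ 2 dvd n" for m
  proof -
    have e: "m ^ 2 * (n div m ^ 2) = n" using that by simp
    moreover have "m > 0" "n div m ^ 2 > 0" using e n by (auto intro!: gr0I)
    ultimately show ?thesis by blast
  qed
  have "bij_betw (\<lambda>(m, b). Lat (int m) (int (n div m ^ 2)) b) S {I \<in> nonzero_ideals R. nrm I = n}"
  proof (rule bij_betw_imageI)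
    show "inj_on (\<lambda>(m, b). Lat (int m) (int (n div m ^ 2)) b) S"
    proof (rule inj_onI, clarify)
      fix m b m' b' assume "(m, b) \<in> S" "(m', b') \<in> S" and eq: "Lat (int m) (int (n div m ^ 2)) b = Lat (int m') (int (n div m' ^ 2)) b'"
      thus "m = m' \<and> b = b'" using Lat_unique_nat[OF eq] pos[of m] pos[of m'] unfolding S_def by auto
    qed
    show "(\<lambda>(m, b). Lat (int m) (int (n div m ^ 2)) b) ` S = {I \<in> nonzero_ideals R. nrm I = n}"
    proof (intro equalityI subsetI)
      fix I assume "I \<in> (\<lambda>(m, b). Lat (int m) (int (n div m ^ 2)) b) ` S"
      then obtain m b where mb: "m ^ 2 dvd n" "b \<in> roots_mod (n div m ^ 2)" "I = Lat (int m) (int (n div m ^ 2)) b"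
        unfolding S_def by auto
      thus "I \<in> {I \<in> nonzero_ideals R. nrm I = n}" using pos[OF mb(1)] Lat_ideal_nat nrm_Lat by simp
    next
      fix I assume I: "I \<in> {I \<in> nonzero_ideals R. nrm I = n}"
      then obtain m a b where L: "m > 0" "a > 0" "b \<in> roots_mod a" "I = Lat (int m) (int a) b" using ideal_eq_Lat by blast
      have "m ^ 2 * a = n" using I nrm_Lat[OF L(1-3)] L(4) by simp
      hence "m ^ 2 dvd n" "a = n div m ^ 2" using L by auto
      hence "(m, b) \<in> S" "I = (\<lambda>(m, b). Lat (int m) (int (n div m ^ 2)) b) (m, b)" using L unfolding S_def by auto
      thus "I \<in> (\<lambda>(m, b). Lat (int m) (int (n div m ^ 2)) b) ` S" by blast
    qed
  qed
  note bij = this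
  show "finite {I \<in> nonzero_ideals R. nrm I = n}" using bij_betw_finite[OF bij] fS by simp
  have "card S = ideal_count n"
    unfolding S_def ideal_count_def num_roots_def using finite_square_divisors[OF n] by (intro card_SigmaI) auto
  thus "card {I \<in> nonzero_ideals R. nrm I = n} = ideal_count n" using bij_betw_same_card[OF bij] by simp
qed

lemma ideals_up_to_norm:
  "finite {I \<in> nonzero_ideals R. nrm I \<le> N}" "card {I \<in> nonzero_ideals R. nrm I \<le> N} = (\<Sum>n=1..N. ideal_count n)"
proof -
  have eq: "{I \<in> nonzero_ideals R. nrm I \<le> N} = (\<Union>n\<in>{1..N}. {I \<in> nonzero_ideals R. nrm I = n})"
    using nrm_pos by (auto simp: Suc_le_eq)
  show "finite {I \<in> nonzero_ideals R. nrm I \<le> N}" unfolding eq using ideals_of_norm(1) by (intro finite_UN_I) auto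
  have "card (\<Union>n\<in>{1..N}. {I \<in> nonzero_ideals R. nrm I = n}) = (\<Sum>n\<in>{1..N}. card {I \<in> nonzero_ideals R. nrm I = n})"
    using ideals_of_norm(1) by (intro card_UN_disjoint) auto
  also have "\<dots> = (\<Sum>n=1..N. ideal_count n)" using ideals_of_norm(2) by (intro sum.cong) auto
  finally show "card {I \<in> nonzero_ideals R. nrm I \<le> N} = (\<Sum>n=1..N. ideal_count n)" unfolding eq .
qed

end

section \<open>Units and ideal classes\<close>

lemma powi_bracket:
  fixes E \<rho> :: real
  assumes "E > 1" "\<rho> > 0"
  obtains k :: int where "E powi k \<le> \<rho>" "\<rho> < E powi k * E"
proof -
  define k where "k = \<lfloor>log E \<rho>\<rfloor>"
  have e: "E powi n = E powr of_int n" for n using assms by (simp add: powr_real_of_int')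
  have r: "\<rho> = E powr (log E \<rho>)" using assms by simp
  have "E powr of_int k \<le> E powr (log E \<rho>)" unfolding k_def using assms by (intro powr_mono) auto
  moreover have "E powr (log E \<rho>) < E powr (of_int k + 1)" unfolding k_def using assms by (intro powr_less_mono) auto
  moreover have "E powr (of_int k + 1) = E powr of_int k * E" using assms by (simp add: powr_add)
  ultimately show thesis using that[of k] unfolding e using r by simp
qed

context real_quadratic
begin

section \<open>Units and the parametrisation of an ideal class\<close>

definition units :: "real set" where "units = {u \<in> OK. \<exists>v\<in>OK. u * v = 1}"

lemma Units_R: "Units R = units"
  unfolding Units_def units_def by (auto simp: mult.commute)

lemma units_OK: "u \<in> units \<Longrightarrow> u \<in> OK" unfolding units_def by blast

lemma units_K: "u \<in> units \<Longrightarrow> u \<in> K" using units_OK OK_K by blast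

lemma units_nonzero: "u \<in> units \<Longrightarrow> u \<noteq> 0" unfolding units_def by auto

lemma units_1: "1 \<in> units" unfolding units_def by auto

lemma units_mult: "u \<in> units \<Longrightarrow> w \<in> units \<Longrightarrow> u * w \<in> units"
proof -
  assume u: "u \<in> units" and w: "w \<in> units"
  obtain v v' where v: "v \<in> OK" "u * v = 1" "v' \<in> OK" "w * v' = 1" using u w unfolding units_def by blast
  have "(u * w) * (v * v') = (u * v) * (w * v')" by (simp only: mult_ac)
  hence "(u * w) * (v * v') = 1" using v by simp
  thus ?thesis using OK_mult v u w unfolding units_def by blast
qed

lemma units_inverse: "u \<in> units \<Longrightarrow> inverse u \<in> units"
proof -
  assume u: "u \<in> units"
  obtain v where v: "v \<in> OK" "u * v = 1" using u unfolding units_def by blast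
  have "inverse u = v" using v(2) by (rule inverse_unique)
  thus ?thesis using v u unfolding units_def by (auto intro!: bexI[of _ u] simp: mult.commute)
qed

lemma units_minus: "u \<in> units \<Longrightarrow> - u \<in> units"
proof -
  assume u: "u \<in> units"
  obtain v where v: "v \<in> OK" "u * v = 1" using u unfolding units_def by blast
  have "(- u) * (- v) = 1" using v by simp
  thus ?thesis using OK_minus u v unfolding units_def by blast
qed

lemma units_power: "u \<in> units \<Longrightarrow> u ^ n \<in> units"
  by (induction n) (auto intro: units_1 units_mult)

lemma units_powi: "u \<in> units \<Longrightarrow> u powi k \<in> units"
  unfolding power_int_def by (auto intro: units_power units_inverse)

text \<open>The norm of a unit is an integer with integral inverse, hence 1 or -1.\<close>

lemma units_abs_cj:
  assumes "u \<in> units" shows "\<bar>cj u\<bar> = 1 / \<bar>u\<bar>"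
proof -
  obtain v where v: "v \<in> OK" "u * v = 1" using assms unfolding units_def by blast
  have u: "u \<in> OK" using assms by (rule units_OK)
  obtain n m :: int where n: "u * cj u = of_int n" and m: "v * cj v = of_int m" using norm_int u v by blast
  have "cj u * cj v = 1" using K_mult(2)[OF OK_K[OF u] OK_K[OF v(1)]] v(2) by simp
  hence "(u * cj u) * (v * cj v) = 1" using v(2) by (metis mult.assoc mult.commute mult_1)
  hence "n * m = 1" unfolding n m by (metis of_int_1 of_int_eq_iff of_int_mult)
  hence "\<bar>n * m\<bar> = 1" by simp
  hence "\<bar>n\<bar> = 1" by (rule abs_zmult_eq_1)
  hence "\<bar>u\<bar> * \<bar>cj u\<bar> = 1" unfolding abs_mult[symmetric] n by linarith
  thus ?thesis using units_nonzero[OF assms] by (simp add: field_simps)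
qed

lemma units_stable:
  assumes "u \<in> units" "I \<in> nonzero_ideals R" shows "(*) u ` I = I"
proof -
  have sub: "(*) w ` I \<subseteq> I" if "w \<in> units" for w
    using assms(2) units_OK[OF that] unfolding nonzero_ideals_def R_ideal_iff by auto
  have "x \<in> (*) u ` I" if x: "x \<in> I" for x
  proof -
    have "inverse u * x \<in> I" using sub[OF units_inverse[OF assms(1)]] x by blast
    moreover have "x = u * (inverse u * x)" using units_nonzero[OF assms(1)] by simp
    ultimately show ?thesis by blast
  qed
  thus ?thesis using sub[OF assms(1)] by blast
qed

text \<open>Every ideal in the class of \<open>J = Lat 1 a b\<close> is \<open>\<delta> / a\<close>
  times \<open>J\<close> for some \<open>\<delta>\<close> in the field. As \<open>J\<close> times
  its conjugate is the ideal generated by \<open>a\<close>, such a multiple lies in the ring of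
  integers exactly when \<open>\<delta>\<close> lies in the conjugate of \<open>J\<close>. The class
  is thus parametrised, up to units, by the points of a lattice.\<close>

definition scaled_Lat :: "nat \<Rightarrow> int \<Rightarrow> real \<Rightarrow> real set" where
  "scaled_Lat a b \<delta> = (*) (\<delta> / real a) ` Lat 1 (int a) b"

text \<open>A point of the conjugate lattice, which has the basis \<open>a\<close>,
  \<open>b + om'\<close>.\<close>

definition dual_point :: "nat \<Rightarrow> int \<Rightarrow> int \<Rightarrow> int \<Rightarrow> real" where
  "dual_point a b j i = real a * of_int i + (of_int b + om') * of_int j"

lemma Lat_1: "Lat 1 (int a) b = {of_int i * real a + of_int j * (of_int b + om) | i j. True}"
  unfolding Lat_altdef by simp

lemma Lat_scale: "Lat (int m) (int a) b = (*) (real m) ` Lat 1 (int a) b"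
proof -
  have "of_int i * (of_int (int m) * of_int (int a)) + of_int j * (of_int (int m) * (of_int b + om))
    = real m * (of_int i * real a + of_int j * (of_int b + om))" for i j by (simp add: algebra_simps)
  thus ?thesis unfolding Lat_1 unfolding Lat_altdef by (auto simp: image_def)
qed

lemma dual_point_coords: "dual_point a b j i = of_int (int a * i + b * j + j) + of_int (- j) * om"
  unfolding dual_point_def om'_eq by (simp add: algebra_simps)

lemma dual_point_OK: "dual_point a b j i \<in> OK" unfolding dual_point_coords by blast

lemma cj_dual_point: "cj (dual_point a b j i) = real a * of_int i + (of_int b + om) * of_int j"
  unfolding dual_point_coords cj_OK unfolding om'_eq by (simp add: algebra_simps)

lemma dual_point_unique:
  assumes "a > 0" "dual_point a b j i = dual_point a b j' i'" shows "j = j' \<and> i = i'"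
  using OK_coords_unique[OF assms(2)[unfolded dual_point_coords]] assms(1) by auto

text \<open>The only product of basis elements without a visible factor \<open>a\<close> is
  \<open>(b + om') * (b + om)\<close>; this is the norm \<open>root_poly b\<close>, divisible by
  \<open>a\<close>.\<close>

lemma scaled_Lat_subset_OK:
  assumes a: "a > 0" "b \<in> roots_mod a"
  shows "scaled_Lat a b (dual_point a b j i) \<subseteq> OK"
proof
  fix z assume "z \<in> scaled_Lat a b (dual_point a b j i)"
  then obtain k l where z: "z = dual_point a b j i / real a * (of_int k * real a + of_int l * (of_int b + om))"
    unfolding scaled_Lat_def Lat_1 by auto
  obtain r where r: "root_poly b = int a * r" using a unfolding roots_mod_def by auto
  have bO: "of_int b + om \<in> OK" using OKI[of b 1] by simp
  have "dual_point a b j i * (of_int k * real a + of_int l * (of_int b + om)) =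
    real a * (dual_point a b j i * of_int k + of_int (i * l) * (of_int b + om)) + of_int (j * l) * ((of_int b + om) * (of_int b + om'))"
    unfolding dual_point_def by (simp add: algebra_simps)
  also have "\<dots> = real a * (dual_point a b j i * of_int k + of_int (i * l) * (of_int b + om) + of_int (j * l * r))"
    unfolding root_poly_factor r by (simp add: algebra_simps)
  finally have "z = dual_point a b j i * of_int k + of_int (i * l) * (of_int b + om) + of_int (j * l * r)"
    unfolding z using a by simp
  thus "z \<in> OK" using dual_point_OK bO by (auto intro!: OK_add OK_mult simp del: of_int_mult)
qed

lemma scaled_Lat_ideal:
  assumes a: "a > 0" "b \<in> roots_mod a" and nz: "\<delta> \<noteq> 0" and sub: "scaled_Lat a b \<delta> \<subseteq> OK"
  shows "scaled_Lat a b \<delta> \<in> nonzero_ideals R"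
proof -
  define J where "J = Lat 1 (int a) b"
  have J: "J \<in> nonzero_ideals R" unfolding J_def using Lat_ideal_nat[of 1 a b] a by simp
  hence id: "0 \<in> J" "\<And>x y. x \<in> J \<Longrightarrow> y \<in> J \<Longrightarrow> x + y \<in> J" "\<And>r x. r \<in> OK \<Longrightarrow> x \<in> J \<Longrightarrow> r * x \<in> J" and "J \<noteq> {0}"
    unfolding nonzero_ideals_def R_ideal_iff by auto
  then obtain w where w: "w \<in> J" "w \<noteq> 0" by blast
  have "ideal (scaled_Lat a b \<delta>) R" unfolding R_ideal_iff
  proof (intro conjI ballI sub)
    show "0 \<in> scaled_Lat a b \<delta>" using id(1) unfolding scaled_Lat_def J_def by force
    fix x assume "x \<in> scaled_Lat a b \<delta>"
    then obtain x' where x': "x' \<in> J" "x = \<delta> / real a * x'" unfolding scaled_Lat_def J_def by blast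
    show "x + y \<in> scaled_Lat a b \<delta>" if y: "y \<in> scaled_Lat a b \<delta>" for y
    proof -
      obtain y' where y': "y' \<in> J" "y = \<delta> / real a * y'" using y unfolding scaled_Lat_def J_def by blast
      have "x + y = \<delta> / real a * (x' + y')" unfolding x' y' by (simp only: distrib_left)
      thus ?thesis using id(2)[OF x'(1) y'(1)] unfolding scaled_Lat_def J_def by blast
    qed
    show "r * x \<in> scaled_Lat a b \<delta>" if r: "r \<in> OK" for r
    proof -
      have "r * x = \<delta> / real a * (r * x')" unfolding x' by (simp only: mult_ac)
      thus ?thesis using id(3)[OF r x'(1)] unfolding scaled_Lat_def J_def by blast
    qed
  qed
  moreover have "\<delta> / real a * w \<in> scaled_Lat a b \<delta>" "\<delta> / real a * w \<noteq> 0" using w nz a unfolding scaled_Lat_def J_def by auto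
  hence "scaled_Lat a b \<delta> \<noteq> {0}" by (metis singletonD)
  ultimately show ?thesis unfolding nonzero_ideals_def by simp
qed

lemma scaled_Lat_span2: "a > 0 \<Longrightarrow> scaled_Lat a b \<delta> = span2 \<delta> (\<delta> * (of_int b + om) / real a)"
proof -
  assume a: "a > 0"
  have e: "\<delta> / real a * (of_int i * real a + of_int j * (of_int b + om)) = of_int i * \<delta> + of_int j * (\<delta> * (of_int b + om) / real a)" for i j
    using a by (simp add: field_simps)
  have "scaled_Lat a b \<delta> = {\<delta> / real a * (of_int i * real a + of_int j * (of_int b + om)) | i j. True}"
    unfolding scaled_Lat_def Lat_1 by blast
  thus ?thesis unfolding span2_def e .
qed

text \<open>The basis \<open>\<delta>\<close>, \<open>\<delta> * (b + om) / a\<close> has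
  determinant \<open>\<delta> * cj \<delta> * rt / a\<close> up to sign.\<close>

lemma nrm_scaled_Lat:
  assumes a: "a > 0" and I: "scaled_Lat a b \<delta> \<in> nonzero_ideals R" and d: "\<delta> \<in> K"
  shows "real (nrm (scaled_Lat a b \<delta>)) = \<bar>\<delta> * cj \<delta>\<bar> / real a"
proof -
  define \<beta> where "\<beta> = \<delta> * (of_int b + om) / real a"
  have bK: "of_int b + om \<in> K" "cj (of_int b + om) = of_int b + om'"
    by (simp_all only: K_add K_of_int om_K cj_om)
  have "\<beta> \<in> K" unfolding \<beta>_def by (intro K_divide K_mult d bK K_of_nat)
  moreover have "cj \<beta> = cj \<delta> * (of_int b + om') / real a"
    unfolding \<beta>_def using a by (simp add: cj_divide K_mult d bK)
  moreover note nrm_span2[OF I[unfolded scaled_Lat_span2[OF a]] d]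
  ultimately have "\<bar>\<delta> * (cj \<delta> * (of_int b + om') / real a) - cj \<delta> * (\<delta> * (of_int b + om) / real a)\<bar> = real (nrm (scaled_Lat a b \<delta>)) * rt"
    unfolding scaled_Lat_span2[OF a] \<beta>_def by simp
  moreover have "\<delta> * (cj \<delta> * (of_int b + om') / real a) - cj \<delta> * (\<delta> * (of_int b + om) / real a) = - (\<delta> * cj \<delta> / real a * (om - om'))"
    by (simp add: algebra_simps diff_divide_distrib add_divide_distrib)
  ultimately have "real (nrm (scaled_Lat a b \<delta>)) * rt = \<bar>\<delta> * cj \<delta>\<bar> / real a * rt"
    unfolding om_diff by (simp add: abs_mult)
  moreover have "rt \<noteq> 0" using p_gt5 by simp
  ultimately show ?thesis using mult_right_cancel by blast
qed

lemma l_coset_R: "x <#\<^bsub>R\<^esub> I = (*) x ` I"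
  unfolding l_coset_def by auto

lemma scaled_Lat_rel:
  assumes m: "m > 0" and a: "a > 0" "b \<in> roots_mod a" and I: "scaled_Lat a b \<delta> \<in> nonzero_ideals R" and d: "\<delta> \<in> OK" "\<delta> \<noteq> 0"
  shows "(Lat (int m) (int a) b, scaled_Lat a b \<delta>) \<in> ideal_class_rel R"
proof -
  have "\<delta> * (real m * z) = real (m * a) * (\<delta> / real a * z)" for z using a by simp
  hence "(*) \<delta> ` Lat (int m) (int a) b = (*) (real (m * a)) ` scaled_Lat a b \<delta>"
    unfolding Lat_scale scaled_Lat_def image_image by simp
  moreover have "real (m * a) \<in> OK - {0}" by (rule DiffI[OF OK_of_nat]) (use m a in simp)
  ultimately show ?thesis
    unfolding ideal_class_rel_def l_coset_R R_simps using d I Lat_ideal_nat[OF m a] by blast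
qed

text \<open>Integrality of \<open>\<delta> * (b + om) / a\<close> says that \<open>a\<close> divides
  both coordinates of \<open>\<delta> * (b + om)\<close>. For the coordinate at \<open>om\<close>
  this is precisely the condition that \<open>\<delta>\<close> belongs to the conjugate
  lattice.\<close>

lemma scaled_Lat_lattice:
  assumes a: "a > 0" and d: "scaled_Lat a b \<delta> \<subseteq> OK"
  obtains j i where "\<delta> = dual_point a b j i"
proof -
  have "\<delta> \<in> scaled_Lat a b \<delta>" "\<delta> * (of_int b + om) / real a \<in> scaled_Lat a b \<delta>"
  proof -
    have "\<delta> = of_int 1 * \<delta> + of_int 0 * (\<delta> * (of_int b + om) / real a)"
      "\<delta> * (of_int b + om) / real a = of_int 0 * \<delta> + of_int 1 * (\<delta> * (of_int b + om) / real a)" by simp_all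
    thus "\<delta> \<in> scaled_Lat a b \<delta>" "\<delta> * (of_int b + om) / real a \<in> scaled_Lat a b \<delta>" unfolding scaled_Lat_span2[OF a] span2_def by blast+
  qed
  hence "\<delta> \<in> OK" "\<delta> * (of_int b + om) / real a \<in> OK" using d by auto
  then obtain x y u v where xy: "\<delta> = of_int x + of_int y * om" and uv: "\<delta> * (of_int b + om) / real a = of_int u + of_int v * om"
    by (elim OKE)
  have "\<delta> * (of_int b + of_int 1 * om) = of_int (int a * u) + of_int (int a * v) * om"
    using uv a by (simp add: field_simps)
  hence "x * 1 + y * b + y * 1 = int a * v"
    unfolding xy OK_mult_coords using OK_coords_unique by blast
  hence e: "int a * v + b * - y + - y = x" by (simp add: algebra_simps)
  have "\<delta> = dual_point a b (- y) v" unfolding dual_point_coords xy e by simp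
  thus thesis by (rule that)
qed

lemma rel_scaled_Lat:
  assumes m: "m > 0" and a: "a > 0" "b \<in> roots_mod a" and rel: "(Lat (int m) (int a) b, I) \<in> ideal_class_rel R"
  obtains \<delta> where "\<delta> \<in> K" "\<delta> \<noteq> 0" "I = scaled_Lat a b \<delta>"
proof -
  obtain x y where xy: "x \<in> OK" "x \<noteq> 0" "y \<in> OK" "y \<noteq> 0" "(*) x ` Lat (int m) (int a) b = (*) y ` I"
    using rel unfolding ideal_class_rel_def l_coset_R by auto
  define \<delta> where "\<delta> = x * real m * real a / y"
  have "(*) (1 / y) ` (*) y ` I = I" unfolding image_image using xy by simp
  hence "I = (*) (1 / y) ` (*) x ` (*) (real m) ` Lat 1 (int a) b" unfolding xy(5)[symmetric] Lat_scale by simp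
  moreover have "1 / y * (x * (real m * z)) = \<delta> / real a * z" for z unfolding \<delta>_def using a by simp
  ultimately have "I = scaled_Lat a b \<delta>" unfolding scaled_Lat_def image_image by simp
  moreover have "\<delta> \<in> K" unfolding \<delta>_def using xy by (intro K_divide K_mult OK_K K_of_nat)
  moreover have "\<delta> \<noteq> 0" unfolding \<delta>_def using xy m a by simp
  ultimately show thesis using that by blast
qed

text \<open>Multiplication by \<open>u\<close> has an integer matrix in the basis \<open>a\<close>,
  \<open>b + om\<close>, and its characteristic polynomial gives a monic equation for
  \<open>u\<close>.\<close>

lemma multiplier_OK:
  assumes a: "a > 0" and u: "u \<in> K" and st: "(*) u ` Lat 1 (int a) b \<subseteq> Lat 1 (int a) b"
  shows "u \<in> OK"
proof -
  define w where "w = of_int b + om"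
  have "real a = of_int 1 * real a + of_int 0 * w" "w = of_int 0 * real a + of_int 1 * w" by simp_all
  hence "real a \<in> Lat 1 (int a) b" "w \<in> Lat 1 (int a) b" unfolding Lat_1 w_def[symmetric] by blast+
  hence "u * real a \<in> Lat 1 (int a) b" "u * w \<in> Lat 1 (int a) b" using st by auto
  then obtain k l r s where 1: "u * real a = of_int k * real a + of_int l * w" and 2: "u * w = of_int r * real a + of_int s * w"
    unfolding Lat_1 w_def[symmetric] by blast
  have 3: "(u - of_int k) * real a = of_int l * w" using 1 by (simp add: algebra_simps)
  have 4: "(u - of_int s) * w = of_int r * real a" using 2 by (simp add: algebra_simps)
  have "(u - of_int s) * ((u - of_int k) * real a) = of_int l * ((u - of_int s) * w)" unfolding 3 by simp
  hence "(u - of_int s) * (u - of_int k) * real a = (of_int l * of_int r) * real a" unfolding 4 by simp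
  hence "(u - of_int s) * (u - of_int k) = of_int l * of_int r" using a by simp
  hence "u * u - of_int (k + s) * u + of_int (k * s - l * r) = 0" by (simp add: algebra_simps)
  hence "algebraic_int u" by (rule algebraic_int_quadratic)
  thus ?thesis using algebraic_int_OK u by blast
qed

text \<open>The quotient and its inverse both map the lattice into itself, so both are
  integral.\<close>

lemma scaled_Lat_eq_unit:
  assumes a: "a > 0" and eq: "scaled_Lat a b \<delta> = scaled_Lat a b \<delta>'" and d: "\<delta> \<in> K" "\<delta>' \<in> K" "\<delta> \<noteq> 0" "\<delta>' \<noteq> 0"
  shows "\<delta> / \<delta>' \<in> units"
proof -
  have half: "\<delta> / \<delta>' \<in> OK" if eq: "scaled_Lat a b \<delta> = scaled_Lat a b \<delta>'" and d: "\<delta> \<in> K" "\<delta>' \<in> K" "\<delta> \<noteq> 0" "\<delta>' \<noteq> 0" for \<delta> \<delta>'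
  proof (rule multiplier_OK[OF a])
    show "\<delta> / \<delta>' \<in> K" using d by (intro K_divide)
    have "\<delta> / \<delta>' * z = real a / \<delta>' * (\<delta> / real a * z)" for z using a d by simp
    hence "(*) (\<delta> / \<delta>') ` Lat 1 (int a) b = (*) (real a / \<delta>') ` scaled_Lat a b \<delta>" unfolding scaled_Lat_def image_image by simp
    also have "\<dots> = Lat 1 (int a) b"
    proof -
      have e: "real a / \<delta>' * (\<delta>' / real a * z) = z" for z using a d by simp
      show ?thesis unfolding eq unfolding scaled_Lat_def image_image by (simp only: e image_ident)
    qed
    finally show "(*) (\<delta> / \<delta>') ` Lat 1 (int a) b \<subseteq> Lat 1 (int a) b" by simp
  qed
  have "\<delta> / \<delta>' * (\<delta>' / \<delta>) = 1" using d by simp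
  thus ?thesis using half[OF eq d] half[OF eq[symmetric] d(2,1,4,3)] unfolding units_def by blast
qed

lemma scaled_Lat_unit:
  assumes a: "a > 0" "b \<in> roots_mod a" and u: "u \<in> units"
  shows "scaled_Lat a b (u * \<delta>) = scaled_Lat a b \<delta>"
proof -
  have "scaled_Lat a b (u * \<delta>) = (*) (\<delta> / real a) ` (*) u ` Lat 1 (int a) b"
    unfolding scaled_Lat_def image_image by (rule image_cong[OF refl]) simp
  also have "(*) u ` Lat 1 (int a) b = Lat 1 (int a) b" using units_stable[OF u] Lat_ideal_nat[of 1 a b] a by simp
  finally show ?thesis unfolding scaled_Lat_def .
qed

text \<open>The conjugate \<open>om'\<close> occurs in the first coordinate because
  \<open>\<delta>\<close> itself runs over the conjugate lattice; \<open>region_altdef\<close> gives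
  the intended reading.\<close>

definition region :: "nat \<Rightarrow> int \<Rightarrow> real \<Rightarrow> real \<Rightarrow> (int \<times> int) set" where
  "region a b E t = {(j, i). (real a * of_int i + (of_int b + om') * of_int j, real a * of_int i + (of_int b + om) * of_int j) \<in> hyp_region E t}"

lemma region_altdef: "(j, i) \<in> region a b E t \<longleftrightarrow> (dual_point a b j i, cj (dual_point a b j i)) \<in> hyp_region E t"
  unfolding region_def cj_dual_point unfolding dual_point_def by simp

lemma finite_region: "a > 0 \<Longrightarrow> E > 1 \<Longrightarrow> t > 0 \<Longrightarrow> finite (region a b E t)"
proof -
  assume h: "a > 0" "E > 1" "t > 0"
  have "of_int b + om' \<noteq> of_int b + om" using om_diff p_gt5 by auto
  from finite_hyp_region_lattice[OF _ this h(2), of "real a" "sqrt t"] h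
  show ?thesis unfolding region_def by simp
qed

text \<open>An ideal of norm at most \<open>N\<close> corresponds to
  \<open>\<bar>\<delta> * cj \<delta>\<bar> \<le> a * N\<close>, while the lattice has determinant
  \<open>a * rt\<close>. The factor \<open>a\<close> cancels, so the density is the same for every
  class.\<close>

lemma region_count:
  assumes "a > 0" "E > 1"
  shows "(\<lambda>N. real (card (region a b E (real a * real N))) / real N) \<longlonglongrightarrow> ln E / rt"
proof -
  have ne: "of_int b + om' \<noteq> of_int b + om" using om_diff p_gt5 by auto
  have a0: "real a > 0" using assms by simp
  have "\<bar>of_int b + om' - (of_int b + om)\<bar> = \<bar>om - om'\<bar>" by simp
  hence d: "\<bar>of_int b + om' - (of_int b + om)\<bar> = rt" unfolding om_diff by simp
  have "((\<lambda>t. card (region a b E t) / t) \<longlongrightarrow> ln E / (real a * rt)) at_top"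
    using lattice_points_hyp_region[OF a0 ne assms(2)] unfolding d region_def[symmetric] .
  moreover have "filterlim (\<lambda>N. real a * real N) at_top sequentially"
    using a0 by (intro filterlim_tendsto_pos_mult_at_top[OF tendsto_const _ filterlim_real_sequentially])
  ultimately have "(\<lambda>N. card (region a b E (real a * real N)) / (real a * real N)) \<longlonglongrightarrow> ln E / (real a * rt)"
    by (rule filterlim_compose)
  hence "(\<lambda>N. real a * (card (region a b E (real a * real N)) / (real a * real N))) \<longlonglongrightarrow> real a * (ln E / (real a * rt))"
    by (rule tendsto_mult_left)
  thus ?thesis using a0 by simp
qed

text \<open>Two points with the same ideal differ by a positive unit. If that unit were some
  \<open>u > 1\<close>, it would raise \<open>X / \<bar>Y\<bar>\<close> by
  \<open>u^2 \<ge> E\<close> and leave the sector. The assumption \<open>gap\<close> is vacuous if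
  there is no unit above 1, which is the situation to be refuted.\<close>

lemma region_inj:
  assumes a: "a > 0" and gap: "\<forall>u\<in>units. u > 1 \<longrightarrow> E \<le> u ^ 2"
  shows "inj_on (\<lambda>(j, i). scaled_Lat a b (dual_point a b j i)) (region a b E t)"
proof -
  have key: "\<not> \<delta> / \<delta>' > 1" if h: "(\<delta>, cj \<delta>) \<in> hyp_region E t" "(\<delta>', cj \<delta>') \<in> hyp_region E t" "\<delta> \<in> K" "\<delta>' \<in> K" "\<delta> / \<delta>' \<in> units" for \<delta> \<delta>'
  proof
    define u where "u = \<delta> / \<delta>'"
    assume "\<delta> / \<delta>' > 1"
    hence u1: "u > 1" unfolding u_def .
    have pos: "\<delta> > 0" "\<delta>' > 0" "\<delta> < E * \<bar>cj \<delta>\<bar>" "\<bar>cj \<delta>'\<bar> \<le> \<delta>'" using h unfolding hyp_region_def by auto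
    have \<delta>: "\<delta> = u * \<delta>'" unfolding u_def using pos by simp
    have uu: "u \<in> units" using h unfolding u_def by simp
    have cu: "\<bar>cj \<delta>\<bar> = \<bar>cj \<delta>'\<bar> / u"
      unfolding \<delta> K_mult(2)[OF units_K[OF uu] h(4)] abs_mult units_abs_cj[OF uu] using u1 by simp
    have "E \<ge> 0"
    proof (rule ccontr)
      assume "\<not> E \<ge> 0"
      hence "E * \<bar>cj \<delta>\<bar> \<le> 0" by (intro mult_nonpos_nonneg) auto
      thus False using pos by simp
    qed
    have "u * \<delta>' < E * (\<bar>cj \<delta>'\<bar> / u)" using pos(3) unfolding cu unfolding \<delta> .
    also have "\<dots> \<le> E * (\<delta>' / u)" using pos u1 \<open>E \<ge> 0\<close> by (intro mult_left_mono divide_right_mono) auto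
    finally have "u ^ 2 < E" using pos u1 by (simp add: field_simps power2_eq_square)
    thus False using gap uu u1 by force
  qed
  show ?thesis
  proof (rule inj_onI, clarify)
    fix j i j' i' assume h: "(j, i) \<in> region a b E t" "(j', i') \<in> region a b E t" "scaled_Lat a b (dual_point a b j i) = scaled_Lat a b (dual_point a b j' i')"
    define \<delta> \<delta>' where "\<delta> = dual_point a b j i" and "\<delta>' = dual_point a b j' i'"
    have r: "(\<delta>, cj \<delta>) \<in> hyp_region E t" "(\<delta>', cj \<delta>') \<in> hyp_region E t" using h unfolding region_altdef \<delta>_def \<delta>'_def by auto
    hence pos: "\<delta> > 0" "\<delta>' > 0" unfolding hyp_region_def by auto
    have k: "\<delta> \<in> K" "\<delta>' \<in> K" unfolding \<delta>_def \<delta>'_def using dual_point_OK OK_K by auto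
    have u: "\<delta> / \<delta>' \<in> units" "\<delta>' / \<delta> \<in> units"
      using scaled_Lat_eq_unit[OF a h(3)[folded \<delta>_def \<delta>'_def] k] scaled_Lat_eq_unit[OF a h(3)[folded \<delta>_def \<delta>'_def, symmetric] k(2,1)] pos by auto
    have "\<not> \<delta> / \<delta>' > 1" "\<not> \<delta>' / \<delta> > 1" using key[OF r k u(1)] key[OF r(2,1) k(2,1) u(2)] by auto
    hence "\<delta> = \<delta>'" using pos by simp
    thus "j = j' \<and> i = i'" using dual_point_unique[OF a] unfolding \<delta>_def \<delta>'_def by blast
  qed
qed

lemma region_scaled_Lat:
  assumes m: "m > 0" and a: "a > 0" "b \<in> roots_mod a" and ji: "(j, i) \<in> region a b E (real a * real N)"
  shows "scaled_Lat a b (dual_point a b j i) \<in> nonzero_ideals R" "nrm (scaled_Lat a b (dual_point a b j i)) \<le> N"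
    "(Lat (int m) (int a) b, scaled_Lat a b (dual_point a b j i)) \<in> ideal_class_rel R"
proof -
  define \<delta> where "\<delta> = dual_point a b j i"
  have h: "\<delta> > 0" "\<bar>\<delta> * cj \<delta>\<bar> \<le> real a * real N" using ji unfolding region_altdef \<delta>_def hyp_region_def by auto
  have \<delta>: "\<delta> \<in> OK" "\<delta> \<noteq> 0" unfolding \<delta>_def using dual_point_OK h \<delta>_def by auto
  show I: "scaled_Lat a b (dual_point a b j i) \<in> nonzero_ideals R"
    using scaled_Lat_ideal[OF a \<delta>(2)] scaled_Lat_subset_OK[OF a] unfolding \<delta>_def by blast
  have "real (nrm (scaled_Lat a b \<delta>)) \<le> real N"
    unfolding nrm_scaled_Lat[OF a(1) I[folded \<delta>_def] OK_K[OF \<delta>(1)]] using h a by (simp add: field_simps)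
  thus "nrm (scaled_Lat a b (dual_point a b j i)) \<le> N" unfolding \<delta>_def by simp
  show "(Lat (int m) (int a) b, scaled_Lat a b (dual_point a b j i)) \<in> ideal_class_rel R"
    using scaled_Lat_rel[OF m a I[folded \<delta>_def] \<delta>] unfolding \<delta>_def .
qed

text \<open>The value \<open>L(1, chi)\<close>, as computed by \<open>L_value\<close>.\<close>

definition L_one :: real where "L_one = 2 * log_ratio_limit / rt"

lemma ideal_total: "(\<lambda>N. real (card {I \<in> nonzero_ideals R. nrm I \<le> N}) / real N) \<longlonglongrightarrow> L_one"
  using sum_ideal_count_asymp[OF L_value] unfolding ideals_up_to_norm L_one_def by simp

text \<open>Points of the region for the unit ideal give distinct ideals, so their density cannot
  exceed that of all ideals.\<close>

lemma unit_gap_bound: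
  assumes E: "E > 1" and gap: "\<forall>u\<in>units. u > 1 \<longrightarrow> E \<le> u ^ 2"
  shows "ln E / rt \<le> L_one"
proof (rule LIMSEQ_le)
  have b: "0 \<in> roots_mod 1" unfolding roots_mod_def by simp
  show "(\<lambda>N. real (card (region 1 0 E (real 1 * real N))) / real N) \<longlonglongrightarrow> ln E / rt" by (rule region_count) (use E in auto)
  show "(\<lambda>N. real (card {I \<in> nonzero_ideals R. nrm I \<le> N}) / real N) \<longlonglongrightarrow> L_one" by (rule ideal_total)
  have "card (region 1 0 E (real 1 * real N)) \<le> card {I \<in> nonzero_ideals R. nrm I \<le> N}" for N
  proof (rule card_inj_on_le[OF region_inj[OF _ gap]])
    show "(\<lambda>(j, i). scaled_Lat 1 0 (dual_point 1 0 j i)) ` region 1 0 E (real 1 * real N) \<subseteq> {I \<in> nonzero_ideals R. nrm I \<le> N}"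
      using region_scaled_Lat[OF zero_less_one zero_less_one b] by auto
  qed (use ideals_up_to_norm in auto)
  thus "\<exists>M. \<forall>N\<ge>M. real (card (region 1 0 E (real 1 * real N))) / real N \<le> real (card {I \<in> nonzero_ideals R. nrm I \<le> N}) / real N"
    by (intro exI allI impI divide_right_mono) auto
qed

text \<open>Without such a unit the density bound would hold for every \<open>E > 1\<close>, but
  \<open>ln E\<close> is unbounded.\<close>

lemma exists_unit: "\<exists>u\<in>units. u > 1"
proof (rule ccontr)
  assume no: "\<not> ?thesis"
  define E where "E = exp (rt * (\<bar>L_one\<bar> + 1))"
  have rt: "rt > 0" using p_gt5 by simp
  hence "rt * (\<bar>L_one\<bar> + 1) > 0" by (intro mult_pos_pos) auto
  hence "E > 1" unfolding E_def by simp
  hence "ln E / rt \<le> L_one" using no by (intro unit_gap_bound) auto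
  hence "\<bar>L_one\<bar> + 1 \<le> L_one" unfolding E_def using rt by simp
  thus False by simp
qed

text \<open>Units in the interval from 1 to \<open>u0\<close> have norm of modulus 1, so they are
  lattice points of a bounded hyperbolic region, and there are finitely many. The summand 1 in
  \<open>E\<close> gives the strict inequality at \<open>u0\<close> itself.\<close>

lemma least_unit:
  obtains \<epsilon> where "\<epsilon> \<in> units" "\<epsilon> > 1" "\<And>u. u \<in> units \<Longrightarrow> u > 1 \<Longrightarrow> \<epsilon> \<le> u"
proof -
  obtain u0 where u0: "u0 \<in> units" "u0 > 1" using exists_unit by blast
  define S where "S = {u \<in> units. 1 < u \<and> u \<le> u0}"
  define E where "E = u0 ^ 2 + 1"
  have "u0 ^ 2 > 0" using u0 by simp
  hence E: "E > 1" unfolding E_def by simp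
  have "S \<subseteq> (\<lambda>(j, i). dual_point 1 0 j i) ` region 1 0 E 1"
  proof
    fix u assume "u \<in> S"
    hence u: "u \<in> units" "1 < u" "u \<le> u0" unfolding S_def by auto
    obtain x y where xy: "u = of_int x + of_int y * om" using units_OK[OF u(1)] by (rule OKE)
    have d: "u = dual_point 1 0 (- y) (x + y)" unfolding dual_point_coords xy by simp
    have c: "\<bar>cj u\<bar> = 1 / u" using units_abs_cj[OF u(1)] u by simp
    have "(u, cj u) \<in> hyp_region E 1"
    proof -
      have "1 / u \<le> 1" using u by simp
      hence "\<bar>cj u\<bar> \<le> u" unfolding c using u by linarith
      moreover have "\<bar>u * cj u\<bar> \<le> 1" unfolding abs_mult c using u by simp
      moreover have "u < E * \<bar>cj u\<bar>"
      proof -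
        have "u * u \<le> u0 * u0" using u by (intro mult_mono) auto
        hence "u * u < E" unfolding E_def by (simp add: power2_eq_square)
        thus ?thesis unfolding c using u by (simp add: field_simps)
      qed
      ultimately show ?thesis unfolding hyp_region_def using u by auto
    qed
    hence "(- y, x + y) \<in> region 1 0 E 1" unfolding region_altdef using d by simp
    thus "u \<in> (\<lambda>(j, i). dual_point 1 0 j i) ` region 1 0 E 1" using d by force
  qed
  moreover have "finite (region 1 0 E 1)" using E by (intro finite_region) auto
  ultimately have fS: "finite S" by (rule finite_subset[OF _ finite_imageI])
  have u0S: "u0 \<in> S" unfolding S_def using u0 by simp
  define \<epsilon> where "\<epsilon> = Min S"
  have "\<epsilon> \<in> S" unfolding \<epsilon>_def using fS u0S by (intro Min_in) auto
  moreover have "\<epsilon> \<le> u" if "u \<in> units" "u > 1" for u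
  proof (cases "u \<le> u0")
    case True
    thus ?thesis unfolding \<epsilon>_def using fS that by (intro Min_le) (auto simp: S_def)
  next
    case False
    moreover have "\<epsilon> \<le> u0" unfolding \<epsilon>_def using fS u0S by (intro Min_le)
    ultimately show ?thesis by simp
  qed
  ultimately show thesis using that unfolding S_def by blast
qed

text \<open>Dividing \<open>\<bar>u\<bar>\<close> by the largest power of \<open>\<epsilon>\<close>
  not exceeding it leaves a unit in \<open>[1, \<epsilon>)\<close>, which is 1 by
  minimality.\<close>

lemma units_powers:
  assumes \<epsilon>: "\<epsilon> \<in> units" "\<epsilon> > 1" and least: "\<And>u. u \<in> units \<Longrightarrow> u > 1 \<Longrightarrow> \<epsilon> \<le> u" and u: "u \<in> units"
  shows "\<exists>k::int. u = \<epsilon> powi k \<or> u = - (\<epsilon> powi k)"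
proof -
  define w where "w = \<bar>u\<bar>"
  have w: "w \<in> units" "w > 0" unfolding w_def using u units_minus[OF u] units_nonzero[OF u] by (auto simp: abs_if)
  obtain k where k: "\<epsilon> powi k \<le> w" "w < \<epsilon> powi k * \<epsilon>" using powi_bracket[OF \<epsilon>(2) w(2)] by blast
  have pos: "\<epsilon> powi k > 0" using \<epsilon> by (intro zero_less_power_int) auto
  define v where "v = w * inverse (\<epsilon> powi k)"
  have "v \<in> units" unfolding v_def by (intro units_mult w units_inverse units_powi \<epsilon>)
  moreover have v: "v = w / \<epsilon> powi k" unfolding v_def by (simp add: divide_inverse)
  have "v < \<epsilon>" "v \<ge> 1" unfolding v using k pos by (simp_all add: field_simps)
  ultimately have "v = 1" using least[of v] by force
  hence "w = \<epsilon> powi k" unfolding v using pos by simp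
  thus ?thesis unfolding w_def by (metis abs_if minus_minus)
qed

text \<open>For the uniqueness demanded by \<open>THE\<close>: another generator
  \<open>\<eta> > 1\<close> satisfies \<open>\<epsilon> = \<eta> powi k\<close> with
  \<open>k \<ge> 1\<close>, so \<open>\<eta> \<le> \<epsilon>\<close>, and minimality gives
  equality.\<close>

lemma fundamental_unit_eq:
  assumes \<epsilon>: "\<epsilon> \<in> units" "\<epsilon> > 1" and least: "\<And>u. u \<in> units \<Longrightarrow> u > 1 \<Longrightarrow> \<epsilon> \<le> u"
  shows "fundamental_unit K = \<epsilon>"
  unfolding fundamental_unit_def R_def[symmetric] Units_R
proof (rule the_equality)
  show "\<epsilon> \<in> units \<and> 1 < \<epsilon> \<and> (\<forall>u\<in>units. \<exists>k. u = \<epsilon> powi k \<or> u = - (\<epsilon> powi k))"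
    using \<epsilon> units_powers[OF \<epsilon> least] by blast
  fix \<eta> assume \<eta>: "\<eta> \<in> units \<and> 1 < \<eta> \<and> (\<forall>u\<in>units. \<exists>k. u = \<eta> powi k \<or> u = - (\<eta> powi k))"
  then obtain k where k: "\<epsilon> = \<eta> powi k \<or> \<epsilon> = - (\<eta> powi k)" using \<epsilon> by blast
  have "\<eta> powi k > 0" using \<eta> by (intro zero_less_power_int) auto
  hence k: "\<epsilon> = \<eta> powi k" using k \<epsilon> by auto
  have "k \<ge> 1"
  proof (rule ccontr)
    assume "\<not> k \<ge> 1"
    hence "\<eta> powi k \<le> \<eta> powi 0" using \<eta> by (intro power_int_increasing) auto
    thus False using k \<epsilon> by simp
  qed
  hence "\<eta> powi 1 \<le> \<eta> powi k" using \<eta> by (intro power_int_increasing) auto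
  hence "\<eta> \<le> \<epsilon>" unfolding k by simp
  thus "\<eta> = \<epsilon>" using least[of \<eta>] \<eta> by force
qed

text \<open>A parameter \<open>\<delta>\<close> of the ideal may be multiplied by any unit. The
  exponent \<open>k\<close> with \<open>\<bar>\<delta>\<bar> / \<bar>cj \<delta>\<bar>\<close>
  between \<open>(\<epsilon>^2) powi k\<close> and the next power tells which power of
  \<open>\<epsilon>\<close> to remove, and the sign of \<open>u\<close> makes the result
  positive.\<close>

lemma region_surj:
  assumes \<epsilon>: "\<epsilon> \<in> units" "\<epsilon> > 1" and m: "m > 0" and a: "a > 0" "b \<in> roots_mod a"
    and I: "(Lat (int m) (int a) b, I) \<in> ideal_class_rel R" "nrm I \<le> N"
  shows "I \<in> (\<lambda>(j, i). scaled_Lat a b (dual_point a b j i)) ` region a b (\<epsilon> ^ 2) (real a * real N)"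
proof -
  have II: "I \<in> nonzero_ideals R" using I unfolding ideal_class_rel_def by blast
  obtain \<delta> where \<delta>: "\<delta> \<in> K" "\<delta> \<noteq> 0" "I = scaled_Lat a b \<delta>" using rel_scaled_Lat[OF m a I(1)] by blast
  have c0: "cj \<delta> \<noteq> 0" using cj_eq_0_iff \<delta> by blast
  have E: "\<epsilon> ^ 2 > 1" using \<epsilon> by simp
  define \<rho> where "\<rho> = \<bar>\<delta>\<bar> / \<bar>cj \<delta>\<bar>"
  have "\<rho> > 0" unfolding \<rho>_def using \<delta> c0 by simp
  then obtain k where k: "(\<epsilon> ^ 2) powi k \<le> \<rho>" "\<rho> < (\<epsilon> ^ 2) powi k * \<epsilon> ^ 2" using powi_bracket[OF E] by blast
  define w where "w = \<epsilon> powi k"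
  have w: "w \<in> units" "w > 0" unfolding w_def using \<epsilon> by (auto intro: units_powi zero_less_power_int)
  have w2: "(\<epsilon> ^ 2) powi k = w * w" unfolding w_def by (simp add: power2_eq_square power_int_mult_distrib)
  define u where "u = (if \<delta> > 0 then inverse w else - inverse w)"
  have u: "u \<in> units" unfolding u_def using units_inverse[OF w(1)] units_minus by auto
  have au: "\<bar>u\<bar> = 1 / w" unfolding u_def using w by (simp add: inverse_eq_divide)
  define \<delta>' where "\<delta>' = u * \<delta>"
  have fr: "scaled_Lat a b \<delta>' = I" unfolding \<delta>'_def \<delta>(3) by (rule scaled_Lat_unit[OF a u])
  have "I \<subseteq> OK" using II unfolding nonzero_ideals_def R_ideal_iff by auto
  then obtain j i where ji: "\<delta>' = dual_point a b j i" using scaled_Lat_lattice[OF a(1), of b \<delta>'] fr by metis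
  have \<delta>'K: "\<delta>' \<in> K" unfolding \<delta>'_def by (intro K_mult units_K u \<delta>)
  have X: "\<delta>' > 0" unfolding \<delta>'_def u_def using \<delta> w by (auto simp: mult_neg_neg zero_less_mult_iff)
  have X': "\<delta>' = \<bar>\<delta>\<bar> / w" using X au unfolding \<delta>'_def by (metis abs_mult abs_of_pos mult.commute times_divide_eq_right mult_1_right)
  have Y: "\<bar>cj \<delta>'\<bar> = \<bar>cj \<delta>\<bar> * w"
    unfolding \<delta>'_def K_mult(2)[OF units_K[OF u] \<delta>(1)] abs_mult units_abs_cj[OF u] au using w by simp
  have "w * w * \<bar>cj \<delta>\<bar> \<le> \<bar>\<delta>\<bar>" using k(1) c0 unfolding w2 \<rho>_def by (simp add: pos_le_divide_eq)
  hence "\<bar>cj \<delta>'\<bar> \<le> \<bar>\<delta>\<bar> / w" unfolding Y using w by (simp add: pos_le_divide_eq mult_ac)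
  hence 1: "\<bar>cj \<delta>'\<bar> \<le> \<delta>'" by (simp only: X'[symmetric])
  have "\<bar>\<delta>\<bar> < w * w * \<epsilon> ^ 2 * \<bar>cj \<delta>\<bar>" using k(2) c0 unfolding w2 \<rho>_def by (simp add: pos_divide_less_eq)
  hence "\<bar>\<delta>\<bar> / w < \<epsilon> ^ 2 * \<bar>cj \<delta>'\<bar>" unfolding Y using w by (simp add: pos_divide_less_eq mult_ac)
  hence 2: "\<delta>' < \<epsilon> ^ 2 * \<bar>cj \<delta>'\<bar>" by (simp only: X'[symmetric])
  have "real (nrm I) = \<bar>\<delta>' * cj \<delta>'\<bar> / real a" using nrm_scaled_Lat[OF a(1) _ \<delta>'K, of b] II unfolding fr by simp
  moreover have "real (nrm I) \<le> real N" using I by simp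
  ultimately have "\<bar>\<delta>' * cj \<delta>'\<bar> / real a \<le> real N" by linarith
  hence "\<bar>\<delta>' * cj \<delta>'\<bar> \<le> real a * real N" using a by (simp add: pos_divide_le_eq mult.commute)
  hence "(\<delta>', cj \<delta>') \<in> hyp_region (\<epsilon> ^ 2) (real a * real N)" unfolding hyp_region_def using X 1 2 by auto
  hence "(j, i) \<in> region a b (\<epsilon> ^ 2) (real a * real N)" unfolding region_altdef ji .
  thus ?thesis using fr ji by force
qed

text \<open>For \<open>E = \<epsilon>^2\<close> the points of the region correspond bijectively to
  the ideals of the class with bounded norm; the factor 2 is the exponent of
  \<open>\<epsilon>\<close>.\<close>

lemma class_count:
  assumes \<epsilon>: "\<epsilon> \<in> units" "\<epsilon> > 1" and least: "\<And>u. u \<in> units \<Longrightarrow> u > 1 \<Longrightarrow> \<epsilon> \<le> u" and J: "J \<in> nonzero_ideals R"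
  shows "(\<lambda>N. real (card {I. (J, I) \<in> ideal_class_rel R \<and> nrm I \<le> N}) / real N) \<longlonglongrightarrow> 2 * ln \<epsilon> / rt"
proof -
  obtain m a b where L: "m > 0" "a > 0" "b \<in> roots_mod a" "J = Lat (int m) (int a) b" using ideal_eq_Lat[OF J] by metis
  have E: "\<epsilon> ^ 2 > 1" using \<epsilon> by simp
  have gap: "\<forall>u\<in>units. u > 1 \<longrightarrow> \<epsilon> ^ 2 \<le> u ^ 2" using least \<epsilon> by (auto intro: power_mono)
  have "card {I. (J, I) \<in> ideal_class_rel R \<and> nrm I \<le> N} = card (region a b (\<epsilon> ^ 2) (real a * real N))" for N
  proof -
    have "(\<lambda>(j, i). scaled_Lat a b (dual_point a b j i)) ` region a b (\<epsilon> ^ 2) (real a * real N) = {I. (J, I) \<in> ideal_class_rel R \<and> nrm I \<le> N}"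
      using region_scaled_Lat[OF L(1-3)] region_surj[OF \<epsilon> L(1-3)] unfolding L(4) by auto
    thus ?thesis using card_image[OF region_inj[OF L(2) gap]] by metis
  qed
  moreover have "(\<lambda>N. real (card (region a b (\<epsilon> ^ 2) (real a * real N))) / real N) \<longlonglongrightarrow> ln (\<epsilon> ^ 2) / rt"
    by (rule region_count[OF L(2) E])
  moreover have "ln (\<epsilon> ^ 2) = 2 * ln \<epsilon>" using \<epsilon> by (simp add: ln_realpow)
  ultimately show ?thesis by simp
qed

lemma ideal_class_equiv: "equiv (nonzero_ideals R) (ideal_class_rel R)"
proof (rule equivI)
  show "ideal_class_rel R \<subseteq> nonzero_ideals R \<times> nonzero_ideals R" unfolding ideal_class_rel_def by auto
  show "refl_on (nonzero_ideals R) (ideal_class_rel R)"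
    unfolding refl_on_def ideal_class_rel_def by (auto intro!: bexI[of _ 1])
  show "sym (ideal_class_rel R)" unfolding sym_def ideal_class_rel_def by (auto; metis)
  show "trans (ideal_class_rel R)"
  proof (rule transI)
    fix I J M assume "(I, J) \<in> ideal_class_rel R" "(J, M) \<in> ideal_class_rel R"
    then obtain a b c d where h: "I \<in> nonzero_ideals R" "M \<in> nonzero_ideals R" "a \<in> OK" "a \<noteq> 0" "b \<in> OK" "b \<noteq> 0" "(*) a ` I = (*) b ` J"
      "c \<in> OK" "c \<noteq> 0" "d \<in> OK" "d \<noteq> 0" "(*) c ` J = (*) d ` M"
      unfolding ideal_class_rel_def l_coset_R by auto
    have "(*) (c * a) ` I = (*) c ` (*) a ` I" by (simp add: image_image mult.assoc)
    also have "\<dots> = (*) b ` (*) c ` J" unfolding h(7) by (simp add: image_image mult_ac)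
    also have "\<dots> = (*) (b * d) ` M" unfolding h(12) by (simp add: image_image mult.assoc)
    finally have "(*) (c * a) ` I = (*) (b * d) ` M" .
    moreover have "c * a \<in> OK - {0}" "b * d \<in> OK - {0}" using h OK_mult by auto
    ultimately show "(I, M) \<in> ideal_class_rel R" unfolding ideal_class_rel_def l_coset_R R_simps using h(1,2) by blast
  qed
qed

theorem class_number_formula: "fundamental_unit K ^ class_number K = exp log_ratio_limit"
proof -
  obtain \<epsilon> where \<epsilon>: "\<epsilon> \<in> units" "\<epsilon> > 1" and least: "\<And>u. u \<in> units \<Longrightarrow> u > 1 \<Longrightarrow> \<epsilon> \<le> u" using least_unit by blast
  have fu: "fundamental_unit K = \<epsilon>" by (rule fundamental_unit_eq[OF \<epsilon> least])
  define Q where "Q = nonzero_ideals R // ideal_class_rel R"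
  define \<kappa> where "\<kappa> = 2 * ln \<epsilon> / rt"
  have rt: "rt > 0" using p_gt5 by simp
  have \<kappa>0: "\<kappa> > 0" unfolding \<kappa>_def using \<epsilon> rt by simp
  define cnt where "cnt = (\<lambda>c N. card {I \<in> c. nrm I \<le> N})"
  have cnt: "(\<lambda>N. real (cnt c N) / real N) \<longlonglongrightarrow> \<kappa>" if c: "c \<in> Q" for c
  proof -
    obtain J where J: "J \<in> nonzero_ideals R" "c = ideal_class_rel R `` {J}" using c unfolding Q_def by (auto elim: quotientE)
    show ?thesis using class_count[OF \<epsilon> least J(1)] unfolding cnt_def J(2) \<kappa>_def by simp
  qed
  have sub: "c \<subseteq> nonzero_ideals R" if "c \<in> Q" for c
    using that in_quotient_imp_subset[OF ideal_class_equiv] unfolding Q_def by blast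
  have sumcnt: "(\<lambda>N. (\<Sum>c\<in>F. real (cnt c N) / real N)) \<longlonglongrightarrow> card F * \<kappa>" if F: "F \<subseteq> Q" for F
  proof -
    have "(\<lambda>N. (\<Sum>c\<in>F. real (cnt c N) / real N)) \<longlonglongrightarrow> (\<Sum>c\<in>F. \<kappa>)" using cnt F by (intro tendsto_sum) auto
    thus ?thesis by simp
  qed
  have un: "(\<Sum>c\<in>F. cnt c N) = card {I \<in> \<Union>F. nrm I \<le> N}" if F: "F \<subseteq> Q" "finite F" for F N
  proof -
    have fin: "finite {I \<in> c. nrm I \<le> N}" if c: "c \<in> F" for c
    proof (rule finite_subset[OF _ ideals_up_to_norm(1)[of N]])
      show "{I \<in> c. nrm I \<le> N} \<subseteq> {I \<in> nonzero_ideals R. nrm I \<le> N}" using sub[of c] F c by auto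
    qed
    have dis: "{I \<in> c. nrm I \<le> N} \<inter> {I \<in> c'. nrm I \<le> N} = {}" if cc: "c \<in> F" "c' \<in> F" "c \<noteq> c'" for c c'
    proof -
      have "c \<in> Q" "c' \<in> Q" using F(1) cc by auto
      hence "c \<inter> c' = {}" using quotient_disj[OF ideal_class_equiv, of c c'] cc(3) unfolding Q_def by simp
      thus ?thesis by auto
    qed
    have "{I \<in> \<Union>F. nrm I \<le> N} = (\<Union>c\<in>F. {I \<in> c. nrm I \<le> N})" by blast
    thus ?thesis unfolding cnt_def using F(2) fin dis by (simp add: card_UN_disjoint)
  qed
  have quot: "(\<Sum>c\<in>F. real (cnt c N) / real N) = real (\<Sum>c\<in>F. cnt c N) / real N" for F N
    by (simp add: sum_divide_distrib)
  have bound: "card F * \<kappa> \<le> L_one" if F: "F \<subseteq> Q" "finite F" for F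
  proof (rule LIMSEQ_le[OF sumcnt[OF F(1)] ideal_total])
    have "(\<Sum>c\<in>F. real (cnt c N) / real N) \<le> real (card {I \<in> nonzero_ideals R. nrm I \<le> N}) / real N" for N
    proof -
      have "{I \<in> \<Union>F. nrm I \<le> N} \<subseteq> {I \<in> nonzero_ideals R. nrm I \<le> N}" using sub F by blast
      hence "(\<Sum>c\<in>F. cnt c N) \<le> card {I \<in> nonzero_ideals R. nrm I \<le> N}"
        unfolding un[OF F] by (rule card_mono[OF ideals_up_to_norm(1)])
      thus ?thesis unfolding quot by (intro divide_right_mono) linarith+
    qed
    thus "\<exists>M. \<forall>N\<ge>M. (\<Sum>c\<in>F. real (cnt c N) / real N) \<le> real (card {I \<in> nonzero_ideals R. nrm I \<le> N}) / real N" by blast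
  qed
  \<comment> \<open>More than \<open>L_one / \<kappa>\<close> classes would together have a larger
    density than all ideals. Finiteness is essential for the meaning of \<open>class_number\<close>,
    since \<open>card\<close> of an infinite set is 0.\<close>
  have finQ: "finite Q"
  proof (rule ccontr)
    assume inf: "infinite Q"
    obtain k :: nat where k: "L_one / \<kappa> < k" using reals_Archimedean2 by blast
    obtain F where F: "finite F" "card F = k" "F \<subseteq> Q" using infinite_arbitrarily_large[OF inf] by blast
    have "k * \<kappa> \<le> L_one" using bound[OF F(3,1)] F(2) by simp
    thus False using k \<kappa>0 by (simp add: field_simps)
  qed
  have tot: "(\<lambda>N. (\<Sum>c\<in>Q. real (cnt c N) / real N)) = (\<lambda>N. real (card {I \<in> nonzero_ideals R. nrm I \<le> N}) / real N)"
  proof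
    fix N
    have "\<Union>Q = nonzero_ideals R" unfolding Q_def by (rule Union_quotient[OF ideal_class_equiv])
    hence "(\<Sum>c\<in>Q. cnt c N) = card {I \<in> nonzero_ideals R. nrm I \<le> N}" using un[OF subset_refl finQ] by simp
    thus "(\<Sum>c\<in>Q. real (cnt c N) / real N) = real (card {I \<in> nonzero_ideals R. nrm I \<le> N}) / real N"
      unfolding quot by (simp only:)
  qed
  have "card Q * \<kappa> = L_one" by (rule LIMSEQ_unique[OF sumcnt[OF subset_refl, unfolded tot] ideal_total])
  hence "card Q * ln \<epsilon> = log_ratio_limit" unfolding \<kappa>_def L_one_def using rt by (simp add: field_simps)
  hence "exp log_ratio_limit = exp (card Q * ln \<epsilon>)" by simp
  also have "\<dots> = \<epsilon> ^ card Q" using \<epsilon> by (simp add: exp_of_nat_mult)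
  finally show ?thesis unfolding fu class_number_def R_def[symmetric] Q_def by simp
qed

end

theorem theorem1p1:
  fixes p :: nat
  assumes "Factorial_Ring.prime p" and "p > 5" and "[p = 1] (mod 4)"
  shows "(\<lambda>\<nu>. (\<Sum>n = 0..\<nu>. real (p_plus p n)) / (\<Sum>n = 0..\<nu>. real (p_minus p n)))
           \<longlonglongrightarrow> fundamental_unit (quadratic_field p) ^ class_number (quadratic_field p)"
proof -
  interpret real_quadratic p
    using assms by unfold_locales
  show ?thesis
    using partition_ratio_tendsto unfolding class_number_formula[symmetric] K_def .
qed

end
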